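(* Assume: (1) $\phi\in\mathcal C^2_b(\mathbb R^d)\cap\mathcal C^2_{lip}(\mathbb R^d)$, $G=\{\phi>0\}$, $\partial G=\{\phi=0\}$, $|\nabla\phi(x)|=1$ for all $x\in\partial G$; (2) $G$ is bounded and convex; (3) $|b(x)-b(y)|\le K_b|x-y|$ and $|\sigma(x)-\sigma(y)|\le K_\sigma|x-y|$ for all $x,y\in\mathbb R^d$; (4) $|\psi(x,z)-\psi(x',z')|\le K_{\psi,x}|x-x'|+K_{\psi,z}|z-z'|$ for all $x,x'\in\overline G$ and $z,z'\in\mathbb R^{1\times d}$; (5) $\eta+K_{\psi,z}K_\sigma<0$; (6) $g\in\mathcal C^2_{lip}(\overline G)$. Suppose that either (a) $\mu\in\mathbb R$ is given and $\lambda\in\mathbb R$, $v\in\mathcal C^0_{lip}(\overline G)$, $\zeta:\mathbb R^d\to\mathbb R^{1\times d}$ measurable are associated with it, or (b) in addition $|\psi|$ is bounded and $\mathbb E^\nu[\mathcal L\phi]<0$ for the invariant measure $\nu$ of $(X_t)_{t\ge0}$, $\lambda\in\mathbb R$ is given and $\mu\in\mathbb R$, $v\in\mathcal C^0_{lip}(\overline G)$, $\zeta:\mathbb R^d\to\mathbb R^{1\times d}$ measurable are associated with it, in such a way that (such objects exist), with $Y^x_t:=v(X^x_t)$ and $Z^x_t:=\zeta(X^x_t)$, one has $Z^x\in\mathcal M^2(\mathbb R^+,\mathbb R^{1\times d})$ and, $\mathbb P$-a.s., for all $x\in\overline G$ and $0\le t\le T<+\infty$, $$Y^x_t=Y^x_T+\int_t^T[\psi(X^x_s,Z^x_s)-\lambda]ds+\int_t^T[g(X^x_s)-\mu]dK^x_s-\int_t^TZ^x_sdW_s.$$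 Then $v$ is a viscosity solution of the elliptic PDE $$\begin{cases}\mathcal Lv(x)+\psi(x,{}^t\nabla v(x)\sigma(x))=\lambda,&x\in G,\\ \dfrac{\partial v}{\partial n}(x)+g(x)=\mu,&x\in\partial G.\end{cases}$$
   Context: $(W_t)_{t\ge0}$ is a $d$-dimensional Brownian motion on $(\Omega,\mathcal F,\mathbb P)$ with augmented natural filtration $(\mathcal F_t)$. $\mathcal M^2(\mathbb R^+,E)$ is the set of progressively measurable $E$-valued processes $X$ with $\mathbb E\int_0^T|X_s|^2ds<\infty$ for all $T>0$. $\mathcal C^k_b$: class $\mathcal C^k$, bounded with bounded partial derivatives up to order $k$. $\mathcal C^k_{lip}$: class $\mathcal C^k$ with Lipschitz partial derivatives of order $k$. Functions $b:\mathbb R^d\to\mathbb R^d$, $\sigma:\mathbb R^d\to\mathbb R^{d\times d}$, $\psi:\overline G\times\mathbb R^{1\times d}\to\mathbb R$, $g:\overline G\to\mathbb R$ are given. For $x\in\overline G$, $(X^x,K^x)$ is the unique adapted continuous pair with values in $\overline G\times\mathbb R^+$ such that $X^x_t=x+\int_0^tb(X^x_s)ds+\int_0^t\sigma(X^x_s)dW_s+\int_0^t\nabla\phi(X^x_s)dK^x_s$, $K^x_t=\int_0^t\mathbf 1_{X^x_s\in\partial G}dK^x_s$, $K^x$ nondecreasing. Under these assumptions $X$ has a unique invariant probability measure $\nu$. $$\eta:=\sup_{x,y\in\overline G,\,x\ne y}\left\{\frac{{}^t(x-y)(b(x)-b(y))}{|x-y|^2}+\frac{\mathrm{Tr}[(\sigma(x)-\sigma(y))\,{}^t(\sigma(x)-\sigma(y))]}{2|x-y|^2}\right\},$$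 $$\mathcal Lf(x)=\tfrac12\mathrm{Tr}(\sigma(x)\,{}^t\sigma(x)\nabla^2f(x))+{}^tb(x)\nabla f(x),\qquad\frac{\partial f}{\partial n}(x)={}^t\nabla\phi(x)\nabla f(x)\ (x\in\partial G).$$ Viscosity solution: a continuous $v$ on $\overline G$ is a viscosity subsolution if for every $\varphi\in\mathcal C^2(\mathbb R^d)$ and every $x\in\overline G$ at which $v-\varphi$ has a local maximum (relative to $\overline G$), one has $F(x):=-\mathcal L\varphi(x)-\psi(x,{}^t\nabla\varphi(x)\sigma(x))+\lambda\le0$ if $x\in G$, and $\min\big(F(x),\,-\frac{\partial\varphi}{\partial n}(x)-g(x)+\mu\big)\le0$ if $x\in\partial G$. It is a viscosity supersolution if for every $\varphi\in\mathcal C^2(\mathbb R^d)$ and every local minimum $x\in\overline G$ of $v-\varphi$, $F(x)\ge0$ if $x\in G$ and $\max\big(F(x),\,-\frac{\partial\varphi}{\partial n}(x)-g(x)+\mu\big)\ge0$ if $x\in\partial G$. A viscosity solution is both. *)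

theory Defs
  imports "HOL-Probability.Probability"
begin

section \<open>Differential calculus\<close>

definition partial :: "'d \<Rightarrow> (real^'d \<Rightarrow> real) \<Rightarrow> real^'d::finite \<Rightarrow> real" where
  "partial i f x = frechet_derivative f (at x) (axis i 1)"

primrec partials :: "'d list \<Rightarrow> (real^'d \<Rightarrow> real) \<Rightarrow> real^'d::finite \<Rightarrow> real" where
  "partials [] f = f"
| "partials (i # is) f = partial i (partials is f)"

definition grad :: "(real^'d \<Rightarrow> real) \<Rightarrow> real^'d::finite \<Rightarrow> real^'d" where
  "grad f x = (\<chi> i. partial i f x)"

definition hessian :: "(real^'d \<Rightarrow> real) \<Rightarrow> real^'d::finite \<Rightarrow> real^'d^'d" where
  "hessian f x = (\<chi> i j. partials [i, j] f x)"

text \<open>Class \<open>C\<^sup>k\<close> on \<open>S\<close>, where \<open>S\<close> is the whole space or the closure of a convex open set: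
  \<open>f\<close> is \<open>C\<^sup>k\<close> in the interior, and all partial derivatives up to order \<open>k\<close> extend
  continuously to \<open>S\<close>. For \<open>S = UNIV\<close> this is the usual class \<open>C\<^sup>k\<close>.\<close>

definition C_k :: "nat \<Rightarrow> (real^'d) set \<Rightarrow> (real^'d::finite \<Rightarrow> real) \<Rightarrow> bool" where
  "C_k k S f \<longleftrightarrow> continuous_on S f \<and>
     (\<forall>is. length is < k \<longrightarrow> partials is f differentiable_on interior S) \<and>
     (\<forall>is. length is \<le> k \<longrightarrow>
        (\<exists>h. continuous_on S h \<and> (\<forall>x\<in>interior S. h x = partials is f x)))"

definition C_k_bounded :: "nat \<Rightarrow> (real^'d) set \<Rightarrow> (real^'d::finite \<Rightarrow> real) \<Rightarrow> bool" where
  "C_k_bounded k S f \<longleftrightarrow> C_k k S f \<and>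
     (\<forall>is. length is \<le> k \<longrightarrow> bounded (partials is f ` interior S))"

definition C_k_lip :: "nat \<Rightarrow> (real^'d) set \<Rightarrow> (real^'d::finite \<Rightarrow> real) \<Rightarrow> bool" where
  "C_k_lip k S f \<longleftrightarrow> C_k k S f \<and>
     (\<forall>is. length is = k \<longrightarrow> (\<exists>L. L-lipschitz_on (interior S) (partials is f)))"

section \<open>Processes, Brownian motion and stochastic integrals\<close>

text \<open>Time is \<open>[0,\<infinity>)\<close>; processes are indexed by \<open>real\<close> and their values at
  negative times are never used.\<close>

definition natural_filtration ::
  "'a measure \<Rightarrow> (real \<Rightarrow> 'a \<Rightarrow> real^'d::finite) \<Rightarrow> real \<Rightarrow> 'a measure" where
  "natural_filtration M W t =
     sigma (space M) {W s -` A \<inter> space M | s A. 0 \<le> s \<and> s \<le> t \<and> A \<in> sets borel}"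

text \<open>The null sets added are the measurable ones; if \<open>M\<close> is complete, these are all
  negligible sets.\<close>

definition augmented_filtration ::
  "'a measure \<Rightarrow> (real \<Rightarrow> 'a \<Rightarrow> real^'d::finite) \<Rightarrow> real \<Rightarrow> 'a measure" where
  "augmented_filtration M W t =
     sigma (space M) (sets (natural_filtration M W t) \<union> null_sets M)"

definition brownian_motion :: "'a measure \<Rightarrow> (real \<Rightarrow> 'a \<Rightarrow> real^'d::finite) \<Rightarrow> bool" where
  "brownian_motion M W \<longleftrightarrow>
     (\<forall>t\<ge>0. W t \<in> borel_measurable M) \<and>
     (AE \<omega> in M. W 0 \<omega> = 0) \<and>
     (AE \<omega> in M. continuous_on {0..} (\<lambda>t. W t \<omega>)) \<and>
     (\<forall>s t. 0 \<le> s \<and> s < t \<longrightarrow>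
        prob_space.indep_set M (sets (natural_filtration M W s))
          {(\<lambda>\<omega>. W t \<omega> - W s \<omega>) -` A \<inter> space M | A. A \<in> sets borel} \<and>
        prob_space.indep_vars M (\<lambda>_. borel) (\<lambda>i \<omega>. (W t \<omega> - W s \<omega>) $ i) UNIV \<and>
        (\<forall>i. distributed M lborel (\<lambda>\<omega>. (W t \<omega> - W s \<omega>) $ i)
               (\<lambda>y. ennreal (normal_density 0 (sqrt (t - s)) y))))"

definition adapted ::
  "(real \<Rightarrow> 'a measure) \<Rightarrow> (real \<Rightarrow> 'a \<Rightarrow> 'b::topological_space) \<Rightarrow> bool" where
  "adapted F X \<longleftrightarrow> (\<forall>t\<ge>0. X t \<in> borel_measurable (F t))"

definition progressively_measurable ::
  "(real \<Rightarrow> 'a measure) \<Rightarrow> (real \<Rightarrow> 'a \<Rightarrow> 'b::topological_space) \<Rightarrow> bool" where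
  "progressively_measurable F X \<longleftrightarrow>
     (\<forall>T\<ge>0. (\<lambda>(s, \<omega>). X s \<omega>) \<in> borel_measurable (restrict_space borel {0..T} \<Otimes>\<^sub>M F T))"

definition sq_norm_upto ::
  "'a measure \<Rightarrow> real \<Rightarrow> (real \<Rightarrow> 'a \<Rightarrow> 'b::real_normed_vector) \<Rightarrow> ennreal" where
  "sq_norm_upto M T X =
     (\<integral>\<^sup>+ \<omega>. (\<integral>\<^sup>+ s\<in>{0..T}. ennreal ((norm (X s \<omega>))\<^sup>2) \<partial>lborel) \<partial>M)"

definition M2_process ::
  "'a measure \<Rightarrow> (real \<Rightarrow> 'a measure) \<Rightarrow> (real \<Rightarrow> 'a \<Rightarrow> 'b::real_normed_vector) \<Rightarrow> bool" where
  "M2_process M F X \<longleftrightarrow> progressively_measurable F X \<and> (\<forall>T>0. sq_norm_upto M T X < \<infinity>)"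

text \<open>Simple integrands \<open>\<Sum>i<n. \<xi>\<^sub>i 1\<^bsub>(\<tau>\<^sub>i, \<tau>\<^sub>i\<^sub>+\<^sub>1]\<^esub>\<close>. Here and below, row vectors in
  \<open>\<real>\<^bsup>1\<times>d\<^esup>\<close> are represented by \<open>real^'d\<close>, so that \<open>z w\<close> for a row \<open>z\<close> and a
  column \<open>w\<close> is \<open>z \<bullet> w\<close>.\<close>

definition simple_integrand ::
  "(real \<Rightarrow> 'a measure) \<Rightarrow> nat \<Rightarrow> (nat \<Rightarrow> real) \<Rightarrow> (nat \<Rightarrow> 'a \<Rightarrow> real^'d::finite) \<Rightarrow> bool" where
  "simple_integrand F n \<tau> \<xi> \<longleftrightarrow> 0 \<le> \<tau> 0 \<and>
     (\<forall>i<n. \<tau> i \<le> \<tau> (Suc i) \<and> \<xi> i \<in> borel_measurable (F (\<tau> i)) \<and>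
            bounded (\<xi> i ` space (F (\<tau> i))))"

definition simple_process ::
  "nat \<Rightarrow> (nat \<Rightarrow> real) \<Rightarrow> (nat \<Rightarrow> 'a \<Rightarrow> real^'d::finite) \<Rightarrow> real \<Rightarrow> 'a \<Rightarrow> real^'d" where
  "simple_process n \<tau> \<xi> s \<omega> = (\<Sum>i<n. indicator {\<tau> i<..\<tau> (Suc i)} s *\<^sub>R \<xi> i \<omega>)"

definition simple_integral ::
  "(real \<Rightarrow> 'a \<Rightarrow> real^'d) \<Rightarrow> nat \<Rightarrow> (nat \<Rightarrow> real) \<Rightarrow> (nat \<Rightarrow> 'a \<Rightarrow> real^'d::finite)
     \<Rightarrow> real \<Rightarrow> 'a \<Rightarrow> real" where
  "simple_integral W n \<tau> \<xi> t \<omega> =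
     (\<Sum>i<n. \<xi> i \<omega> \<bullet> (W (min t (\<tau> (Suc i))) \<omega> - W (min t (\<tau> i)) \<omega>))"

text \<open>\<open>I\<close> is a continuous version of the Ito integral process of \<open>H \<in> M\<^sup>2\<close>: the
  \<open>L\<^sup>2\<close>-limit of integrals of simple integrands converging to \<open>H\<close>. This determines \<open>I\<close> up to
  indistinguishability.\<close>

definition ito_integral ::
  "'a measure \<Rightarrow> (real \<Rightarrow> 'a measure) \<Rightarrow> (real \<Rightarrow> 'a \<Rightarrow> real^'d::finite)
     \<Rightarrow> (real \<Rightarrow> 'a \<Rightarrow> real^'d) \<Rightarrow> (real \<Rightarrow> 'a \<Rightarrow> real) \<Rightarrow> bool" where
  "ito_integral M F W H I \<longleftrightarrow>
     M2_process M F H \<and> adapted F I \<and>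
     (AE \<omega> in M. continuous_on {0..} (\<lambda>t. I t \<omega>)) \<and>
     (\<exists>n \<tau> \<xi>. (\<forall>k. simple_integrand F (n k) (\<tau> k) (\<xi> k)) \<and>
        (\<forall>T\<ge>0.
           (\<lambda>k. sq_norm_upto M T (\<lambda>s \<omega>. simple_process (n k) (\<tau> k) (\<xi> k) s \<omega> - H s \<omega>))
              \<longlonglongrightarrow> 0 \<and>
           (\<lambda>k. \<integral>\<^sup>+ \<omega>. ennreal ((simple_integral W (n k) (\<tau> k) (\<xi> k) T \<omega> - I T \<omega>)\<^sup>2) \<partial>M)
              \<longlonglongrightarrow> 0))"

text \<open>The measure \<open>dK\<close> of a continuous nondecreasing \<open>K : [0,\<infinity>) \<Rightarrow> \<real>\<close>, which is extended
  to negative times by the constant \<open>K 0\<close>.\<close>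

definition stieltjes :: "(real \<Rightarrow> real) \<Rightarrow> real measure" where
  "stieltjes K = interval_measure (\<lambda>t. K (max 0 t))"

section \<open>Reflected diffusion\<close>

definition reflected_sde_solution ::
  "'a measure \<Rightarrow> (real \<Rightarrow> 'a measure) \<Rightarrow> (real \<Rightarrow> 'a \<Rightarrow> real^'d::finite)
     \<Rightarrow> (real^'d \<Rightarrow> real^'d) \<Rightarrow> (real^'d \<Rightarrow> real^'d^'d) \<Rightarrow> (real^'d \<Rightarrow> real) \<Rightarrow> (real^'d) set
     \<Rightarrow> real^'d \<Rightarrow> (real \<Rightarrow> 'a \<Rightarrow> real^'d) \<Rightarrow> (real \<Rightarrow> 'a \<Rightarrow> real) \<Rightarrow> bool" where
  "reflected_sde_solution M F W b \<sigma> \<phi> G x X K \<longleftrightarrow>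
     adapted F X \<and> adapted F K \<and>
     (\<exists>I :: 'd \<Rightarrow> real \<Rightarrow> 'a \<Rightarrow> real.
        (\<forall>i. ito_integral M F W (\<lambda>s \<omega>. row i (\<sigma> (X s \<omega>))) (I i)) \<and>
        (AE \<omega> in M.
           continuous_on {0..} (\<lambda>t. X t \<omega>) \<and> continuous_on {0..} (\<lambda>t. K t \<omega>) \<and>
           mono_on {0..} (\<lambda>t. K t \<omega>) \<and>
           (\<forall>t\<ge>0. X t \<omega> \<in> closure G \<and> 0 \<le> K t \<omega> \<and>
              X t \<omega> = x + (LINT s:{0..t}|lborel. b (X s \<omega>)) + (\<chi> i. I i t \<omega>)
                        + (LINT s:{0..t}|stieltjes (\<lambda>r. K r \<omega>). grad \<phi> (X s \<omega>)) \<and>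
              K t \<omega> = (LINT s:{0..t}|stieltjes (\<lambda>r. K r \<omega>).
                          indicator (frontier G) (X s \<omega>)))))"

definition invariant_measure ::
  "'a measure \<Rightarrow> (real^'d::finite) set \<Rightarrow> (real^'d \<Rightarrow> real \<Rightarrow> 'a \<Rightarrow> real^'d)
     \<Rightarrow> (real^'d) measure \<Rightarrow> bool" where
  "invariant_measure M D X \<nu> \<longleftrightarrow>
     prob_space \<nu> \<and> sets \<nu> = sets (restrict_space borel D) \<and>
     (\<forall>t\<ge>0. \<forall>A\<in>sets \<nu>.
        (\<integral>\<^sup>+ x. emeasure M {\<omega> \<in> space M. X x t \<omega> \<in> A} \<partial>\<nu>) = emeasure \<nu> A)"

definition dissipativity ::
  "(real^'d) set \<Rightarrow> (real^'d \<Rightarrow> real^'d) \<Rightarrow> (real^'d::finite \<Rightarrow> real^'d^'d) \<Rightarrow> real" where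
  "dissipativity D b \<sigma> =
     (SUP (x, y)\<in>{(x, y). x \<in> D \<and> y \<in> D \<and> x \<noteq> y}.
        ((x - y) \<bullet> (b x - b y)) / (norm (x - y))\<^sup>2 +
        trace ((\<sigma> x - \<sigma> y) ** transpose (\<sigma> x - \<sigma> y)) / (2 * (norm (x - y))\<^sup>2))"

definition generator ::
  "(real^'d \<Rightarrow> real^'d) \<Rightarrow> (real^'d \<Rightarrow> real^'d^'d) \<Rightarrow> (real^'d \<Rightarrow> real)
     \<Rightarrow> real^'d::finite \<Rightarrow> real" where
  "generator b \<sigma> f x =
     (1/2) * trace (\<sigma> x ** transpose (\<sigma> x) ** hessian f x) + b x \<bullet> grad f x"

definition normal_deriv ::
  "(real^'d \<Rightarrow> real) \<Rightarrow> (real^'d \<Rightarrow> real) \<Rightarrow> real^'d::finite \<Rightarrow> real" where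
  "normal_deriv \<phi> f x = grad \<phi> x \<bullet> grad f x"

section \<open>The ergodic BSDE in Markovian form\<close>

definition ebsde_solution ::
  "'a measure \<Rightarrow> (real \<Rightarrow> 'a measure) \<Rightarrow> (real \<Rightarrow> 'a \<Rightarrow> real^'d::finite) \<Rightarrow> (real^'d) set
     \<Rightarrow> (real^'d \<Rightarrow> real \<Rightarrow> 'a \<Rightarrow> real^'d) \<Rightarrow> (real^'d \<Rightarrow> real \<Rightarrow> 'a \<Rightarrow> real)
     \<Rightarrow> (real^'d \<Rightarrow> real^'d \<Rightarrow> real) \<Rightarrow> (real^'d \<Rightarrow> real) \<Rightarrow> real \<Rightarrow> real
     \<Rightarrow> (real^'d \<Rightarrow> real) \<Rightarrow> (real^'d \<Rightarrow> real^'d) \<Rightarrow> bool" where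
  "ebsde_solution M F W D X K \<psi> g lam \<mu> v \<zeta> \<longleftrightarrow>
     (\<exists>L. L-lipschitz_on D v) \<and> \<zeta> \<in> borel_measurable borel \<and>
     (\<forall>x\<in>D. M2_process M F (\<lambda>t \<omega>. \<zeta> (X x t \<omega>))) \<and>
     (\<exists>I. (\<forall>x\<in>D. ito_integral M F W (\<lambda>t \<omega>. \<zeta> (X x t \<omega>)) (I x)) \<and>
        (AE \<omega> in M. \<forall>x\<in>D. \<forall>t T. 0 \<le> t \<and> t \<le> T \<longrightarrow>
           v (X x t \<omega>) = v (X x T \<omega>)
             + (LINT s:{t..T}|lborel. \<psi> (X x s \<omega>) (\<zeta> (X x s \<omega>)) - lam)
             + (LINT s:{t..T}|stieltjes (\<lambda>r. K x r \<omega>). g (X x s \<omega>) - \<mu>)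
             - (I x T \<omega> - I x t \<omega>)))"

section \<open>Viscosity solutions of the Neumann problem\<close>

definition local_max_on :: "'b::metric_space set \<Rightarrow> ('b \<Rightarrow> real) \<Rightarrow> 'b \<Rightarrow> bool" where
  "local_max_on D f x \<longleftrightarrow> x \<in> D \<and> (\<exists>e>0. \<forall>y\<in>D \<inter> ball x e. f y \<le> f x)"

definition local_min_on :: "'b::metric_space set \<Rightarrow> ('b \<Rightarrow> real) \<Rightarrow> 'b \<Rightarrow> bool" where
  "local_min_on D f x \<longleftrightarrow> x \<in> D \<and> (\<exists>e>0. \<forall>y\<in>D \<inter> ball x e. f x \<le> f y)"

definition pde_interior ::
  "(real^'d \<Rightarrow> real^'d) \<Rightarrow> (real^'d \<Rightarrow> real^'d^'d) \<Rightarrow> (real^'d \<Rightarrow> real^'d \<Rightarrow> real) \<Rightarrow> real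
     \<Rightarrow> (real^'d \<Rightarrow> real) \<Rightarrow> real^'d::finite \<Rightarrow> real" where
  "pde_interior b \<sigma> \<psi> lam f x = - generator b \<sigma> f x - \<psi> x (grad f x v* \<sigma> x) + lam"

definition pde_boundary ::
  "(real^'d \<Rightarrow> real) \<Rightarrow> (real^'d \<Rightarrow> real) \<Rightarrow> real
     \<Rightarrow> (real^'d \<Rightarrow> real) \<Rightarrow> real^'d::finite \<Rightarrow> real" where
  "pde_boundary \<phi> g \<mu> f x = - normal_deriv \<phi> f x - g x + \<mu>"

definition viscosity_subsolution ::
  "(real^'d) set \<Rightarrow> (real^'d \<Rightarrow> real) \<Rightarrow> (real^'d \<Rightarrow> real^'d) \<Rightarrow> (real^'d \<Rightarrow> real^'d^'d)
     \<Rightarrow> (real^'d \<Rightarrow> real^'d \<Rightarrow> real) \<Rightarrow> (real^'d \<Rightarrow> real) \<Rightarrow> real \<Rightarrow> real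
     \<Rightarrow> (real^'d::finite \<Rightarrow> real) \<Rightarrow> bool" where
  "viscosity_subsolution G \<phi> b \<sigma> \<psi> g lam \<mu> v \<longleftrightarrow>
     continuous_on (closure G) v \<and>
     (\<forall>f x. C_k 2 UNIV f \<and> local_max_on (closure G) (\<lambda>y. v y - f y) x \<longrightarrow>
        (x \<in> G \<longrightarrow> pde_interior b \<sigma> \<psi> lam f x \<le> 0) \<and>
        (x \<in> frontier G \<longrightarrow> min (pde_interior b \<sigma> \<psi> lam f x) (pde_boundary \<phi> g \<mu> f x) \<le> 0))"

definition viscosity_supersolution ::
  "(real^'d) set \<Rightarrow> (real^'d \<Rightarrow> real) \<Rightarrow> (real^'d \<Rightarrow> real^'d) \<Rightarrow> (real^'d \<Rightarrow> real^'d^'d)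
     \<Rightarrow> (real^'d \<Rightarrow> real^'d \<Rightarrow> real) \<Rightarrow> (real^'d \<Rightarrow> real) \<Rightarrow> real \<Rightarrow> real
     \<Rightarrow> (real^'d::finite \<Rightarrow> real) \<Rightarrow> bool" where
  "viscosity_supersolution G \<phi> b \<sigma> \<psi> g lam \<mu> v \<longleftrightarrow>
     continuous_on (closure G) v \<and>
     (\<forall>f x. C_k 2 UNIV f \<and> local_min_on (closure G) (\<lambda>y. v y - f y) x \<longrightarrow>
        (x \<in> G \<longrightarrow> pde_interior b \<sigma> \<psi> lam f x \<ge> 0) \<and>
        (x \<in> frontier G \<longrightarrow> max (pde_interior b \<sigma> \<psi> lam f x) (pde_boundary \<phi> g \<mu> f x) \<ge> 0))"

definition viscosity_solution ::
  "(real^'d) set \<Rightarrow> (real^'d \<Rightarrow> real) \<Rightarrow> (real^'d \<Rightarrow> real^'d) \<Rightarrow> (real^'d \<Rightarrow> real^'d^'d)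
     \<Rightarrow> (real^'d \<Rightarrow> real^'d \<Rightarrow> real) \<Rightarrow> (real^'d \<Rightarrow> real) \<Rightarrow> real \<Rightarrow> real
     \<Rightarrow> (real^'d::finite \<Rightarrow> real) \<Rightarrow> bool" where
  "viscosity_solution G \<phi> b \<sigma> \<psi> g lam \<mu> v \<longleftrightarrow>
     viscosity_subsolution G \<phi> b \<sigma> \<psi> g lam \<mu> v \<and>
     viscosity_supersolution G \<phi> b \<sigma> \<psi> g lam \<mu> v"

end

theory Submission
  imports Defs
begin

text \<open>Suppose that a test function \<open>f\<close> touches \<open>v\<close> from above at \<open>x\<^sub>0\<close> and violates the
  subsolution inequality strictly. Start the diffusion at \<open>x\<^sub>0\<close> and write \<open>h = X - x\<^sub>0\<close>,
  \<open>E = v(X) - v(x\<^sub>0) - \<nabla>f(x\<^sub>0) h\<close> and \<open>q(h)\<close> for a quadratic form slightly larger than half the Hessian of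
  \<open>f\<close>. By the two equations \<open>E\<close>, \<open>E\<^sup>2\<close> and \<open>q(h)\<close> are semimartingales, and
  \<open>\<Phi> = E + C E\<^sup>2 - q(h)\<close> is nonpositive near \<open>x\<^sub>0\<close>. Its drift is bounded below by a
  positive constant near \<open>x\<^sub>0\<close>: the error \<open>L |\<zeta> - \<nabla>f(x\<^sub>0) \<sigma>|\<close> of the generator is absorbed by the
  bracket \<open>C |\<zeta> - \<nabla>f(x\<^sub>0) \<sigma>|\<^sup>2\<close> of \<open>E\<close>, which replaces Girsanov's theorem. At the first point of a grid at which
  \<open>X\<close> has left a small ball or \<open>dK\<close> has charged too much, the expectation of \<open>\<Phi>\<close> would thus
  be positive. The integrals of the squares are only needed as \<open>L\<^sup>1\<close> limits of sums over the grid, so that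
  neither the Ito formula nor continuous-time stopping enters. The supersolution property follows by changing the
  signs of \<open>v\<close>, \<open>\<zeta>\<close> and of the data.\<close>

section \<open>Brownian motion and its augmented filtration\<close>

text \<open>Two gaps in integrability shape the proof. No moment of the boundary measure
  \<open>dK\<close> is at hand, so the path is also stopped once \<open>K\<close> exceeds 1. And
  \<open>\<zeta>\<close> is only square integrable along the path, so the bracket of
  \<open>E\<close> is merely integrable; therefore the errors of the discrete Ito formulas are
  written as terms of zero mean plus overshoots, the contributions of the single step in which the
  path leaves. Overshoots of the stochastic integrals vanish in the limit because elementary
  integrals, which are dense, have fourth moments of order \<open>(t - s)^2\<close>. Only functions
  that are linear in \<open>X\<close> and \<open>v(X)\<close>, and their squares, are ever expanded:
  by polarization \<open>q(h)\<close> is a combination of squares of linear forms. The square of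
  \<open>E\<close> multiplies its drift by \<open>1 + 2 C E\<close>, which is close to 1 near the
  starting point, and the excess of \<open>q\<close> over half the Hessian pays for
  \<open>C E^2\<close>. The contradiction is drawn on the elapsed time: its expectation must tend to
  zero along the grids, while continuity of \<open>X\<close> and \<open>K\<close> keeps it away from
  zero on every path.\<close>

locale brownian = prob_space M for M :: "'a measure" +
  fixes W :: "real \<Rightarrow> 'a \<Rightarrow> real^'d::finite"
  assumes bm: "brownian_motion M W"
begin

abbreviation F where "F \<equiv> augmented_filtration M W"

lemma W_measurable: "0 \<le> t \<Longrightarrow> W t \<in> borel_measurable M"
  using bm unfolding brownian_motion_def by blast

lemma sets_natural:
  "sets (natural_filtration M W t) =
     sigma_sets (space M) {W s -` A \<inter> space M | s A. 0 \<le> s \<and> s \<le> t \<and> A \<in> sets borel}"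
  unfolding natural_filtration_def by (rule sets_measure_of) auto

lemma natural_subset: "sets (natural_filtration M W t) \<subseteq> sets M"
  unfolding sets_natural by (rule sets.sigma_sets_subset) (auto intro: measurable_sets W_measurable)

lemma space_F [simp]: "space (F t) = space M"
  unfolding augmented_filtration_def by (rule space_measure_of_conv)

lemma sets_F: "sets (F t) = sigma_sets (space M) (sets (natural_filtration M W t) \<union> null_sets M)"
  unfolding augmented_filtration_def
  using natural_subset[of t] sets.sets_into_space by (intro sets_measure_of) (auto simp: null_sets_def)

lemma F_subset: "sets (F t) \<subseteq> sets M"
  unfolding sets_F using natural_subset[of t] by (intro sets.sigma_sets_subset) auto

lemma F_mono: assumes "s \<le> t" shows "sets (F s) \<subseteq> sets (F t)"
proof -
  have "sets (natural_filtration M W s) \<subseteq> sets (natural_filtration M W t)"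
    unfolding sets_natural using assms by (intro sigma_sets_mono') fastforce
  then show ?thesis unfolding sets_F by (intro sigma_sets_mono') auto
qed

lemma measurable_F_mono:
  assumes "f \<in> borel_measurable (F s)" "s \<le> t" shows "f \<in> borel_measurable (F t)"
  by (rule measurable_from_subalg[OF _ assms(1)]) (simp add: subalgebra_def F_mono assms(2))

lemma measurable_F_M: "f \<in> borel_measurable (F s) \<Longrightarrow> f \<in> borel_measurable M"
  by (rule measurable_from_subalg[of M "F s"]) (simp_all add: subalgebra_def F_subset)

lemma W_F: assumes "0 \<le> s" "s \<le> t" shows "W s \<in> borel_measurable (F t)"
proof (rule measurableI)
  fix A :: "(real^'d) set" assume "A \<in> sets borel"
  then have "W s -` A \<inter> space M \<in> sets (natural_filtration M W t)"
    unfolding sets_natural using assms by (intro sigma_sets.Basic) auto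
  then show "W s -` A \<inter> space (F t) \<in> sets (F t)"
    unfolding sets_F space_F by (intro sigma_sets.Basic) auto
qed auto

text \<open>Null sets among the generators cannot change an event by more than a null set: a null
  set is matched with the empty set, and the relation survives complements and countable unions.
  This carries independence over to the augmented filtration.\<close>

lemma F_approx: assumes "A \<in> sets (F s)"
  shows "\<exists>A'\<in>sets (natural_filtration M W s). AE \<omega> in M. \<omega> \<in> A \<longleftrightarrow> \<omega> \<in> A'"
  using assms unfolding sets_F
proof (induction rule: sigma_sets.induct)
  case (Basic a)
  then show ?case
  proof
    assume "a \<in> null_sets M"
    then have "AE \<omega> in M. \<omega> \<in> a \<longleftrightarrow> \<omega> \<in> {}" using AE_not_in by fastforce
    then show ?thesis by (meson sets.empty_sets)
  qed auto
next
  case (Compl a)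
  then obtain A' where "A' \<in> sets (natural_filtration M W s)" "AE \<omega> in M. \<omega> \<in> a \<longleftrightarrow> \<omega> \<in> A'" by auto
  moreover have "space M - A' \<in> sets (natural_filtration M W s)"
    using calculation(1) sets.compl_sets[of A' "natural_filtration M W s"]
    by (simp add: natural_filtration_def space_measure_of_conv)
  ultimately show ?case by (intro bexI[of _ "space M - A'"]) auto
next
  case (Union a)
  then obtain A' where A': "\<And>i. A' i \<in> sets (natural_filtration M W s)" "\<And>i. AE \<omega> in M. \<omega> \<in> a i \<longleftrightarrow> \<omega> \<in> A' i"
    by metis
  have "AE \<omega> in M. \<forall>i. \<omega> \<in> a i \<longleftrightarrow> \<omega> \<in> A' i"
    unfolding AE_all_countable using A'(2) by blast
  then have "AE \<omega> in M. \<omega> \<in> (\<Union>i. a i) \<longleftrightarrow> \<omega> \<in> (\<Union>i. A' i)" by eventually_elim auto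
  then show ?case using A'(1) by (intro bexI[of _ "\<Union>i::nat. A' i"]) auto
qed auto

text \<open>Both sides of the product formula ignore null sets, so an event of \<open>F s\<close>
  may be replaced by its approximant in the natural filtration, where independence is part of the
  definition of Brownian motion.\<close>

lemma indep_F:
  assumes "0 \<le> s" "s < t"
  shows "indep_set (sets (F s)) {(\<lambda>\<omega>. W t \<omega> - W s \<omega>) -` A \<inter> space M | A. A \<in> sets borel}"
proof (rule indep_setI)
  have ind: "indep_set (sets (natural_filtration M W s))
      {(\<lambda>\<omega>. W t \<omega> - W s \<omega>) -` A \<inter> space M | A. A \<in> sets borel}"
    using bm assms unfolding brownian_motion_def by blast
  have m: "(\<lambda>\<omega>. W t \<omega> - W s \<omega>) \<in> borel_measurable M" using W_measurable assms by auto
  show "sets (F s) \<subseteq> events" by (rule F_subset)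
  show "{(\<lambda>\<omega>. W t \<omega> - W s \<omega>) -` A \<inter> space M |A. A \<in> sets borel} \<subseteq> events"
    using m by (auto intro: measurable_sets)
  fix a b assume a: "a \<in> sets (F s)" and b: "b \<in> {(\<lambda>\<omega>. W t \<omega> - W s \<omega>) -` A \<inter> space M |A. A \<in> sets borel}"
  obtain A' where A': "A' \<in> sets (natural_filtration M W s)" "AE \<omega> in M. \<omega> \<in> a \<longleftrightarrow> \<omega> \<in> A'"
    using F_approx[OF a] by auto
  have ev: "a \<in> events" "A' \<in> events" "b \<in> events"
    using a A' F_subset natural_subset b m by (auto intro: measurable_sets)
  have "prob (a \<inter> b) = prob (A' \<inter> b)"
    by (rule finite_measure_eq_AE) (use A' ev in auto)
  also have "\<dots> = prob A' * prob b" by (rule indep_setD[OF ind A'(1) b])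
  also have "prob A' = prob a" by (rule finite_measure_eq_AE) (use A' ev in auto)
  finally show "prob (a \<inter> b) = prob a * prob b" .
qed

lemma indep_increment:
  fixes Z :: "'a \<Rightarrow> real" and g :: "real^'d \<Rightarrow> real"
  assumes st: "0 \<le> s" "s < t" and Z: "Z \<in> borel_measurable (F s)" and g: "g \<in> borel_measurable borel"
  shows "indep_var borel Z borel (\<lambda>\<omega>. g (W t \<omega> - W s \<omega>))"
proof -
  have m: "(\<lambda>\<omega>. g (W t \<omega> - W s \<omega>)) \<in> borel_measurable M"
    using W_measurable[of s] W_measurable[of t] st g by (intro measurable_compose[OF _ g]) auto
  \<comment> \<open>Systems of preimages are closed under intersections; this lifts independence
    from them to the sigma-algebras that they generate.\<close>
  have stable: "Int_stable {f -` A \<inter> space M | A. A \<in> sets borel}" for f :: "'a \<Rightarrow> real"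
  proof (rule Int_stableI, clarify)
    fix A B :: "real set" assume "A \<in> sets borel" "B \<in> sets borel"
    then show "\<exists>C. f -` A \<inter> space M \<inter> (f -` B \<inter> space M) = f -` C \<inter> space M \<and> C \<in> sets borel"
      by (intro exI[of _ "A \<inter> B"]) auto
  qed
  have "indep_set {Z -` A \<inter> space M | A. A \<in> sets borel} {(\<lambda>\<omega>. g (W t \<omega> - W s \<omega>)) -` A \<inter> space M | A. A \<in> sets borel}"
  proof -
    have sub: "{Z -` A \<inter> space M | A. A \<in> sets borel} \<subseteq> sets (F s)"
      using measurable_sets[OF Z] by auto
    have "\<exists>B. (\<lambda>\<omega>. g (W t \<omega> - W s \<omega>)) -` A \<inter> space M = (\<lambda>\<omega>. W t \<omega> - W s \<omega>) -` B \<inter> space M \<and> B \<in> sets borel"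
      if "A \<in> sets borel" for A
      using measurable_sets[OF g that] by (intro exI[of _ "g -` A"]) auto
    then have sub2: "{(\<lambda>\<omega>. g (W t \<omega> - W s \<omega>)) -` A \<inter> space M | A. A \<in> sets borel}
        \<subseteq> {(\<lambda>\<omega>. W t \<omega> - W s \<omega>) -` A \<inter> space M | A. A \<in> sets borel}" by blast
    show ?thesis using indep_F[OF st] sub sub2 unfolding indep_sets2_eq by (meson subset_iff)
  qed
  then show ?thesis
    unfolding indep_var_eq using measurable_F_M[OF Z] m stable by (simp add: indep_set_sigma_sets)
qed

lemma expectation_increment:
  fixes Z :: "'a \<Rightarrow> real" and g :: "real^'d \<Rightarrow> real"
  assumes st: "0 \<le> s" "s < t" and Z: "Z \<in> borel_measurable (F s)" "integrable M Z"
    and g: "g \<in> borel_measurable borel" "integrable M (\<lambda>\<omega>. g (W t \<omega> - W s \<omega>))"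
  shows "integrable M (\<lambda>\<omega>. Z \<omega> * g (W t \<omega> - W s \<omega>))"
    and "expectation (\<lambda>\<omega>. Z \<omega> * g (W t \<omega> - W s \<omega>)) = expectation Z * expectation (\<lambda>\<omega>. g (W t \<omega> - W s \<omega>))"
  using indep_var_integrable[OF indep_increment[OF st Z(1) g(1)] Z(2) g(2)]
    indep_var_lebesgue_integral[OF indep_increment[OF st Z(1) g(1)] Z(2) g(2)] by auto

section \<open>Gaussian moments of the increments\<close>

lemma increment_distributed:
  assumes "0 \<le> s" "s < t"
  shows "distributed M lborel (\<lambda>\<omega>. (W t \<omega> - W s \<omega>) $ i) (\<lambda>y. ennreal (normal_density 0 (sqrt (t - s)) y))"
  using bm assms unfolding brownian_motion_def by blast

text \<open>The second moments lead to the isometry; the fourth one will control the quadratic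
  variation over a single short step.\<close>

lemma increment_moments:
  assumes st: "0 \<le> s" "s < t"
  shows "integrable M (\<lambda>\<omega>. ((W t \<omega> - W s \<omega>) $ i) ^ k)"
    and "expectation (\<lambda>\<omega>. (W t \<omega> - W s \<omega>) $ i) = 0"
    and "expectation (\<lambda>\<omega>. ((W t \<omega> - W s \<omega>) $ i)^2) = t - s"
    and "expectation (\<lambda>\<omega>. ((W t \<omega> - W s \<omega>) $ i)^4) = 3 * (t - s)^2"
proof -
  have pos: "sqrt (t - s) > 0" using st by simp
  note d = increment_distributed[OF st, of i]
  have nn: "\<And>y. 0 \<le> normal_density 0 (sqrt (t - s)) y" by simp
  have int: "integrable M (\<lambda>\<omega>. ((W t \<omega> - W s \<omega>) $ i) ^ k)" for k
    using integrable_normal_moment[OF pos, of 0 k]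
    by (subst distributed_integrable[OF d, symmetric]) auto
  then show "integrable M (\<lambda>\<omega>. ((W t \<omega> - W s \<omega>) $ i) ^ k)" .
  have e: "expectation (\<lambda>\<omega>. ((W t \<omega> - W s \<omega>) $ i) ^ k)
      = (\<integral>y. normal_density 0 (sqrt (t - s)) y * (y - 0) ^ k \<partial>lborel)" for k
    using distributed_integral[OF d, of "\<lambda>y. y ^ k"] by simp
  show "expectation (\<lambda>\<omega>. (W t \<omega> - W s \<omega>) $ i) = 0"
    using e[of 1] integral_normal_moment_odd[OF pos, of 0 0] by simp
  show "expectation (\<lambda>\<omega>. ((W t \<omega> - W s \<omega>) $ i)^2) = t - s"
    using e[of 2] integral_normal_moment_even[OF pos, of 0 1] st by (simp add: numeral_eq_Suc)
  show "expectation (\<lambda>\<omega>. ((W t \<omega> - W s \<omega>) $ i)^4) = 3 * (t - s)^2"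
    using e[of 4] integral_normal_moment_even[OF pos, of 0 2] st
    by (simp add: power2_eq_square fact_numeral field_simps)
qed

lemma increment_covariance:
  assumes st: "0 \<le> s" "s < t"
  shows "integrable M (\<lambda>\<omega>. (W t \<omega> - W s \<omega>) $ i * (W t \<omega> - W s \<omega>) $ j)"
    and "expectation (\<lambda>\<omega>. (W t \<omega> - W s \<omega>) $ i * (W t \<omega> - W s \<omega>) $ j) = (if i = j then t - s else 0)"
proof -
  have 1: "integrable M (\<lambda>\<omega>. (W t \<omega> - W s \<omega>) $ i)" for i
    using increment_moments(1)[OF st, of i 1] by simp
  have "integrable M (\<lambda>\<omega>. (W t \<omega> - W s \<omega>) $ i * (W t \<omega> - W s \<omega>) $ j) \<and>
    expectation (\<lambda>\<omega>. (W t \<omega> - W s \<omega>) $ i * (W t \<omega> - W s \<omega>) $ j) = (if i = j then t - s else 0)"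
  proof (cases "i = j")
    case True
    then show ?thesis using increment_moments(1)[OF st, of i 2] increment_moments(3)[OF st, of i]
      by (simp add: power2_eq_square)
  next
    case False
    have "indep_vars (\<lambda>_. borel) (\<lambda>i \<omega>. (W t \<omega> - W s \<omega>) $ i) UNIV"
      using bm st unfolding brownian_motion_def by blast
    \<comment> \<open>Independence of the whole family of components is restricted to two
      singletons, and the resulting one-point functions are then evaluated.\<close>
    from indep_var_restrict[OF this, of "{i}" "{j}"] False
    have "indep_var (Pi\<^sub>M {i} (\<lambda>_. borel)) (\<lambda>\<omega>. \<lambda>i\<in>{i}. (W t \<omega> - W s \<omega>) $ i)
        (Pi\<^sub>M {j} (\<lambda>_. borel)) (\<lambda>\<omega>. \<lambda>i\<in>{j}. (W t \<omega> - W s \<omega>) $ i)" by auto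
    from indep_var_compose[OF this, of "\<lambda>f. f i" borel "\<lambda>f. f j" borel]
    have "indep_var borel (\<lambda>\<omega>. (W t \<omega> - W s \<omega>) $ i) borel (\<lambda>\<omega>. (W t \<omega> - W s \<omega>) $ j)"
      by (simp add: comp_def)
    from indep_var_integrable[OF this 1 1] indep_var_lebesgue_integral[OF this 1 1] False
    show ?thesis using increment_moments(2)[OF st] by auto
  qed
  then show "integrable M (\<lambda>\<omega>. (W t \<omega> - W s \<omega>) $ i * (W t \<omega> - W s \<omega>) $ j)"
    and "expectation (\<lambda>\<omega>. (W t \<omega> - W s \<omega>) $ i * (W t \<omega> - W s \<omega>) $ j) = (if i = j then t - s else 0)"
    by auto
qed

end

section \<open>Integrals of piecewise constant integrands\<close>

lemma borel_measurable_component [measurable]: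
  "(\<lambda>x::real^'d::finite. x $ i) \<in> borel_measurable borel"
  by (intro borel_measurable_continuous_onI continuous_intros)

lemma integrable_L2_mult:
  fixes f g :: "'a \<Rightarrow> real"
  assumes "f \<in> borel_measurable M" "g \<in> borel_measurable M"
    and "integrable M (\<lambda>x. (f x)^2)" "integrable M (\<lambda>x. (g x)^2)"
  shows "integrable M (\<lambda>x. f x * g x)"
proof (rule Bochner_Integration.integrable_bound)
  show "integrable M (\<lambda>x. (f x)^2 + (g x)^2)" using assms by simp
  show "AE x in M. norm (f x * g x) \<le> norm ((f x)^2 + (g x)^2)"
  proof (rule AE_I2)
    fix x
    have "0 \<le> (\<bar>f x\<bar> - \<bar>g x\<bar>)^2" by simp
    then have "2 * (\<bar>f x\<bar> * \<bar>g x\<bar>) \<le> (f x)^2 + (g x)^2" by (simp add: power2_diff)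
    then show "norm (f x * g x) \<le> norm ((f x)^2 + (g x)^2)"
      by (simp add: abs_mult) (smt (verit) mult_nonneg_nonneg abs_ge_zero)
  qed
qed (use assms in measurable)

text \<open>The number of points of \<open>S\<close> strictly inside the interval drops when it is
  cut at one of them. With \<open>S\<close> the jump times of a piecewise constant integrand, a
  claim about its integral has to be checked only where the integrand is constant, and then to be
  additive.\<close>

lemma gap_induct [consumes 3, case_names gap join]:
  fixes S :: "real set"
  assumes "finite S" "0 \<le> s" "s < t"
    and gap: "\<And>s t. 0 \<le> s \<Longrightarrow> s < t \<Longrightarrow> S \<inter> {s<..<t} = {} \<Longrightarrow> P s t"
    and join: "\<And>s m t. 0 \<le> s \<Longrightarrow> s < m \<Longrightarrow> m < t \<Longrightarrow> m \<in> S \<Longrightarrow> P s m \<Longrightarrow> P m t \<Longrightarrow> P s t"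
  shows "P s t"
  using assms(2,3)
proof (induction "card (S \<inter> {s<..<t})" arbitrary: s t rule: less_induct)
  case less
  show ?case
  proof (cases "S \<inter> {s<..<t} = {}")
    case True then show ?thesis using gap less.prems by blast
  next
    case False
    then obtain m where m: "m \<in> S" "s < m" "m < t" by auto
    have "card (S \<inter> {s<..<m}) < card (S \<inter> {s<..<t})" "card (S \<inter> {m<..<t}) < card (S \<inter> {s<..<t})"
      using m \<open>finite S\<close> by (intro psubset_card_mono; force)+
    then show ?thesis using less m by (intro join[of s m t]) auto
  qed
qed

lemma set_integral_const_on_open:
  fixes f :: "real \<Rightarrow> real"
  assumes "f \<in> borel_measurable borel" "s < t" "\<And>r. s < r \<Longrightarrow> r < t \<Longrightarrow> f r = c"
  shows "(LINT r:{s..t}|lborel. f r) = c * (t - s)"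
proof -
  have "(LINT r:{s..t}|lborel. f r) = (LINT r:{s..t}|lborel. c)"
    unfolding set_lebesgue_integral_def
  proof (rule integral_cong_AE)
    show "AE x in lborel. indicat_real {s..t} x *\<^sub>R f x = indicat_real {s..t} x *\<^sub>R c"
      using AE_lborel_singleton[of s] AE_lborel_singleton[of t]
      by eventually_elim (use assms in \<open>auto simp: indicator_def\<close>)
  qed (use assms in auto)
  also have "\<dots> = c * (t - s)" using assms by (simp add: set_integral_const)
  finally show ?thesis .
qed

text \<open>The two closed intervals overlap in \<open>m\<close>, which the measure must not charge.
  The measure is left general because the lemma serves both Lebesgue measure and the measure of a
  continuous \<open>K\<close>.\<close>

lemma set_integral_Icc_split:
  fixes f :: "real \<Rightarrow> 'b::euclidean_space"
  assumes M: "AE r in M. r \<noteq> m" and f: "set_integrable M {s..t} f" and m: "s \<le> m" "m \<le> t"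
    and sets: "sets M = sets borel"
  shows "(LINT r:{s..t}|M. f r) = (LINT r:{s..m}|M. f r) + (LINT r:{m..t}|M. f r)"
proof -
  have "{s..t} = {s..m} \<union> {m..t}" using m by auto
  moreover have "AE r in M. \<not> (r \<in> {s..m} \<and> r \<in> {m..t})"
    using M by eventually_elim auto
  ultimately show ?thesis
    using set_integral_Un_AE[of "{s..m}" "{m..t}" M f] sets
      set_integrable_subset[OF f, of "{s..m}"] set_integrable_subset[OF f, of "{m..t}"] m
    by auto
qed

lemma set_integral_split:
  fixes f :: "real \<Rightarrow> 'b::euclidean_space"
  assumes "set_integrable lborel {s..t} f" "s \<le> m" "m \<le> t"
  shows "(LINT r:{s..t}|lborel. f r) = (LINT r:{s..m}|lborel. f r) + (LINT r:{m..t}|lborel. f r)"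
  by (rule set_integral_Icc_split[OF AE_lborel_singleton assms]) simp

section \<open>Moments and isometry of elementary integrals\<close>

context brownian
begin

text \<open>In coordinates every term is a product of a factor known at time \<open>s\<close> and a
  function of the increment, so expectations factor; the covariance is diagonal, which leaves only
  the squares of the components of \<open>\<eta>\<close>. For the fourth power a bound is
  enough.\<close>

lemma increment_inner:
  fixes \<eta> :: "'a \<Rightarrow> real^'d"
  assumes st: "0 \<le> s" "s < t" and \<eta>: "\<eta> \<in> borel_measurable (F s)" "\<forall>\<omega>\<in>space M. norm (\<eta> \<omega>) \<le> C"
  shows "Z \<in> borel_measurable (F s) \<Longrightarrow> integrable M Z \<Longrightarrow>
      integrable M (\<lambda>\<omega>. Z \<omega> * (\<eta> \<omega> \<bullet> (W t \<omega> - W s \<omega>))) \<and>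
      expectation (\<lambda>\<omega>. Z \<omega> * (\<eta> \<omega> \<bullet> (W t \<omega> - W s \<omega>))) = 0"
    and "Y \<in> borel_measurable (F s) \<Longrightarrow> \<forall>\<omega>\<in>space M. \<bar>Y \<omega>\<bar> \<le> B \<Longrightarrow>
      integrable M (\<lambda>\<omega>. Y \<omega> * (\<eta> \<omega> \<bullet> (W t \<omega> - W s \<omega>))^2) \<and>
      expectation (\<lambda>\<omega>. Y \<omega> * (\<eta> \<omega> \<bullet> (W t \<omega> - W s \<omega>))^2) = expectation (\<lambda>\<omega>. Y \<omega> * (norm (\<eta> \<omega>))^2) * (t - s)"
    and "integrable M (\<lambda>\<omega>. (\<eta> \<omega> \<bullet> (W t \<omega> - W s \<omega>))^4) \<and>
      expectation (\<lambda>\<omega>. (\<eta> \<omega> \<bullet> (W t \<omega> - W s \<omega>))^4) \<le> (3 * C^4 * real CARD('d)^2) * (t - s)^2"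
proof -
  let ?D = "\<lambda>\<omega>. W t \<omega> - W s \<omega>"
  have Dm: "?D \<in> borel_measurable M" using W_measurable[of s] W_measurable[of t] st by auto
  have \<eta>M: "\<eta> \<in> borel_measurable M" by (rule measurable_F_M[OF \<eta>(1)])
  have comp: "\<bar>\<eta> \<omega> $ i\<bar> \<le> C" if "\<omega> \<in> space M" for \<omega> i
    using component_le_norm_cart[of "\<eta> \<omega>" i] \<eta>(2)[rule_format, OF that] by simp
  {
    assume Z: "Z \<in> borel_measurable (F s)" "integrable M Z"
    have 1: "integrable M (\<lambda>\<omega>. Z \<omega> * \<eta> \<omega> $ i)" for i
    proof (rule Bochner_Integration.integrable_bound)
      show "integrable M (\<lambda>\<omega>. C * Z \<omega>)" using Z by simp
      show "AE \<omega> in M. norm (Z \<omega> * \<eta> \<omega> $ i) \<le> norm (C * Z \<omega>)"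
        using comp by (intro AE_I2) (auto simp: abs_mult mult.commute[of "\<bar>Z _\<bar>"] intro!: mult_right_mono intro: order_trans[OF _ abs_ge_self])
      show "(\<lambda>\<omega>. Z \<omega> * \<eta> \<omega> $ i) \<in> borel_measurable M"
        using measurable_F_M[OF Z(1)] \<eta>M by measurable
    qed
    have 2: "(\<lambda>\<omega>. Z \<omega> * \<eta> \<omega> $ i) \<in> borel_measurable (F s)" for i using Z \<eta> by measurable
    have 3: "integrable M (\<lambda>\<omega>. ?D \<omega> $ i)" for i using increment_moments(1)[OF st, of i 1] by simp
    have eq: "(\<lambda>\<omega>. Z \<omega> * (\<eta> \<omega> \<bullet> ?D \<omega>)) = (\<lambda>\<omega>. \<Sum>i\<in>UNIV. (Z \<omega> * \<eta> \<omega> $ i) * (?D \<omega> $ i))"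
      by (auto simp: inner_vec_def sum_distrib_left mult.assoc)
    note E = expectation_increment[OF st 2 1, of "\<lambda>x. x $ i" for i]
    show "integrable M (\<lambda>\<omega>. Z \<omega> * (\<eta> \<omega> \<bullet> ?D \<omega>)) \<and> expectation (\<lambda>\<omega>. Z \<omega> * (\<eta> \<omega> \<bullet> ?D \<omega>)) = 0"
      unfolding eq using E 3 increment_moments(2)[OF st] by (simp add: integral_sum)
  }
  {
    assume Y: "Y \<in> borel_measurable (F s)" "\<forall>\<omega>\<in>space M. \<bar>Y \<omega>\<bar> \<le> B"
    have 1: "integrable M (\<lambda>\<omega>. Y \<omega> * \<eta> \<omega> $ i * \<eta> \<omega> $ j)" for i j
    proof (rule Bochner_Integration.integrable_bound)
      show "integrable M (\<lambda>\<omega>. B * C * C)" by simp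
      show "AE \<omega> in M. norm (Y \<omega> * \<eta> \<omega> $ i * \<eta> \<omega> $ j) \<le> norm (B * C * C)"
      proof (rule AE_I2)
        fix \<omega> assume w: "\<omega> \<in> space M"
        have "\<bar>Y \<omega> * \<eta> \<omega> $ i * \<eta> \<omega> $ j\<bar> \<le> B * C * C"
          unfolding abs_mult using comp[OF w] Y(2)[rule_format, OF w]
          by (intro mult_mono mult_nonneg_nonneg) (auto intro: order_trans[OF abs_ge_zero])
        then show "norm (Y \<omega> * \<eta> \<omega> $ i * \<eta> \<omega> $ j) \<le> norm (B * C * C)" by simp
      qed
    qed (use measurable_F_M[OF Y(1)] \<eta>M in measurable)
    have 2: "(\<lambda>\<omega>. Y \<omega> * \<eta> \<omega> $ i * \<eta> \<omega> $ j) \<in> borel_measurable (F s)" for i j using Y \<eta> by measurable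
    have eq: "(\<lambda>\<omega>. Y \<omega> * (\<eta> \<omega> \<bullet> ?D \<omega>)^2)
        = (\<lambda>\<omega>. \<Sum>i\<in>UNIV. \<Sum>j\<in>UNIV. (Y \<omega> * \<eta> \<omega> $ i * \<eta> \<omega> $ j) * (?D \<omega> $ i * ?D \<omega> $ j))"
      by (auto simp: inner_vec_def power2_eq_square sum_product sum_distrib_left mult_ac intro!: ext sum.cong)
    note E = expectation_increment[OF st 2 1, of "\<lambda>x. x $ i * x $ j" for i j]
    have "(\<Sum>i\<in>UNIV. \<Sum>j\<in>UNIV. expectation (\<lambda>\<omega>. Y \<omega> * \<eta> \<omega> $ i * \<eta> \<omega> $ j) * (if i = j then t - s else 0))
        = (\<Sum>i\<in>UNIV. expectation (\<lambda>\<omega>. Y \<omega> * \<eta> \<omega> $ i * \<eta> \<omega> $ i) * (t - s))"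
      by (intro sum.cong refl) (simp add: sum.delta if_distrib cong: if_cong)
    also have "\<dots> = expectation (\<lambda>\<omega>. \<Sum>i\<in>UNIV. Y \<omega> * \<eta> \<omega> $ i * \<eta> \<omega> $ i) * (t - s)"
      using 1 by (simp add: integral_sum sum_distrib_right)
    also have "(\<lambda>\<omega>. \<Sum>i\<in>UNIV. Y \<omega> * \<eta> \<omega> $ i * \<eta> \<omega> $ i) = (\<lambda>\<omega>. Y \<omega> * (norm (\<eta> \<omega>))^2)"
      by (auto simp: power2_norm_eq_inner inner_vec_def sum_distrib_left mult.assoc)
    finally show "integrable M (\<lambda>\<omega>. Y \<omega> * (\<eta> \<omega> \<bullet> ?D \<omega>)^2) \<and>
      expectation (\<lambda>\<omega>. Y \<omega> * (\<eta> \<omega> \<bullet> ?D \<omega>)^2) = expectation (\<lambda>\<omega>. Y \<omega> * (norm (\<eta> \<omega>))^2) * (t - s)"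
      unfolding eq using E increment_covariance[OF st] by (simp add: integral_sum)
  }
  \<comment> \<open>Cauchy-Schwarz twice, once in the inner product and once for the square of a sum
    of squares. The latter produces one factor \<open>CARD('d)\<close>; the other one in the final
    constant comes from summing the moments \<open>3 * (t - s)^2\<close> over the
    components.\<close>
  have bd: "(\<eta> \<omega> \<bullet> ?D \<omega>)^4 \<le> C^4 * real CARD('d) * (\<Sum>i\<in>UNIV. (?D \<omega> $ i)^4)" if w: "\<omega> \<in> space M" for \<omega>
  proof -
    have "(\<eta> \<omega> \<bullet> ?D \<omega>)^2 \<le> (C * norm (?D \<omega>))^2"
    proof (rule abs_le_square_iff[THEN iffD1])
      have "\<bar>\<eta> \<omega> \<bullet> ?D \<omega>\<bar> \<le> norm (\<eta> \<omega>) * norm (?D \<omega>)" by (rule Cauchy_Schwarz_ineq2)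
      also have "\<dots> \<le> C * norm (?D \<omega>)" using \<eta>(2)[rule_format, OF w] by (intro mult_right_mono) auto
      finally show "\<bar>\<eta> \<omega> \<bullet> ?D \<omega>\<bar> \<le> \<bar>C * norm (?D \<omega>)\<bar>"
        by (rule order_trans[OF _ abs_ge_self])
    qed
    then have "((\<eta> \<omega> \<bullet> ?D \<omega>)^2)^2 \<le> ((C * norm (?D \<omega>))^2)^2" by (rule power_mono) simp
    also have "\<dots> = C^4 * ((norm (?D \<omega>))^2)^2" by (simp add: power_mult_distrib)
    also have "(norm (?D \<omega>))^2 = (\<Sum>i\<in>UNIV. (?D \<omega> $ i)^2)"
      by (simp add: power2_norm_eq_inner inner_vec_def power2_eq_square[symmetric])
    also have "(\<Sum>i\<in>UNIV. (?D \<omega> $ i)^2)^2 \<le> real CARD('d) * (\<Sum>i\<in>UNIV. (?D \<omega> $ i)^4)"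
      using sum_squared_le_sum_of_squares[of "\<lambda>i. (?D \<omega> $ i)^2" UNIV] by (simp add: mult.commute)
    finally show ?thesis by (simp add: mult_left_mono mult.assoc)
  qed
  have int: "integrable M (\<lambda>\<omega>. C^4 * real CARD('d) * (\<Sum>i\<in>UNIV. (?D \<omega> $ i)^4))"
    using increment_moments(1)[OF st] by simp
  have i4: "integrable M (\<lambda>\<omega>. (\<eta> \<omega> \<bullet> ?D \<omega>)^4)"
    by (rule Bochner_Integration.integrable_bound[OF int]) (use bd \<eta>M Dm in \<open>auto simp: order_trans[OF _ abs_ge_self]\<close>)
  have "expectation (\<lambda>\<omega>. (\<eta> \<omega> \<bullet> ?D \<omega>)^4) \<le> expectation (\<lambda>\<omega>. C^4 * real CARD('d) * (\<Sum>i\<in>UNIV. (?D \<omega> $ i)^4))"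
    by (rule integral_mono[OF i4 int bd])
  also have "\<dots> = (3 * C^4 * real CARD('d)^2) * (t - s)^2"
    using increment_moments[OF st] by (simp add: integral_sum power2_eq_square)
  finally show "integrable M (\<lambda>\<omega>. (\<eta> \<omega> \<bullet> ?D \<omega>)^4) \<and>
      expectation (\<lambda>\<omega>. (\<eta> \<omega> \<bullet> ?D \<omega>)^4) \<le> (3 * C^4 * real CARD('d)^2) * (t - s)^2" using i4 by simp
qed

text \<open>The integral \<open>J\<close> of a piecewise constant \<open>H\<close> is described by
  its behaviour between the jump times \<open>S\<close> and not by a sum. Two such integrals are
  then added by uniting their jump times, without refining partitions. Open intervals leave the
  value of \<open>H\<close> at a jump time free, where Lebesgue measure does not see it.\<close>

definition elementary :: "real set \<Rightarrow> (real \<Rightarrow> 'a \<Rightarrow> real) \<Rightarrow> (real \<Rightarrow> 'a \<Rightarrow> real^'d) \<Rightarrow> bool" where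
  "elementary S J H \<longleftrightarrow> finite S \<and> (\<forall>t\<ge>0. J t \<in> borel_measurable (F t)) \<and> (\<forall>\<omega>\<in>space M. J 0 \<omega> = 0) \<and>
     (\<lambda>(s, \<omega>). H s \<omega>) \<in> borel_measurable (borel \<Otimes>\<^sub>M M) \<and>
     (\<exists>C. \<forall>s. \<forall>\<omega>\<in>space M. norm (H s \<omega>) \<le> C) \<and>
     (\<forall>s t. 0 \<le> s \<longrightarrow> s < t \<longrightarrow> S \<inter> {s<..<t} = {} \<longrightarrow>
        (\<exists>\<eta>\<in>borel_measurable (F s). \<forall>\<omega>\<in>space M.
           J t \<omega> - J s \<omega> = \<eta> \<omega> \<bullet> (W t \<omega> - W s \<omega>) \<and> (\<forall>r\<in>{s<..<t}. H r \<omega> = \<eta> \<omega>)))"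

lemma elementary_simps:
  assumes "elementary S J H"
  shows "finite S" and "(\<lambda>x. H (fst x) (snd x)) \<in> borel_measurable (borel \<Otimes>\<^sub>M M)"
    and "\<exists>C. \<forall>s. \<forall>\<omega>\<in>space M. norm (H s \<omega>) \<le> C"
    and "0 \<le> s \<Longrightarrow> s < t \<Longrightarrow> S \<inter> {s<..<t} = {} \<Longrightarrow>
        \<exists>\<eta>\<in>borel_measurable (F s). \<forall>\<omega>\<in>space M.
           J t \<omega> - J s \<omega> = \<eta> \<omega> \<bullet> (W t \<omega> - W s \<omega>) \<and> (\<forall>r\<in>{s<..<t}. H r \<omega> = \<eta> \<omega>)"
  using assms unfolding elementary_def split_beta by blast+

lemma elementary_gap:
  assumes "elementary S J H"
  obtains C where "\<And>s \<omega>. \<omega> \<in> space M \<Longrightarrow> norm (H s \<omega>) \<le> C"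
    and "\<And>s t. 0 \<le> s \<Longrightarrow> s < t \<Longrightarrow> S \<inter> {s<..<t} = {} \<Longrightarrow>
        \<exists>\<eta>\<in>borel_measurable (F s). (\<forall>\<omega>\<in>space M. norm (\<eta> \<omega>) \<le> C) \<and> (\<forall>\<omega>\<in>space M.
           J t \<omega> - J s \<omega> = \<eta> \<omega> \<bullet> (W t \<omega> - W s \<omega>) \<and> (\<forall>r\<in>{s<..<t}. H r \<omega> = \<eta> \<omega>))"
proof -
  obtain C where C: "\<forall>s. \<forall>\<omega>\<in>space M. norm (H s \<omega>) \<le> C" using assms by (auto simp: elementary_def)
  have "\<exists>\<eta>\<in>borel_measurable (F s). (\<forall>\<omega>\<in>space M. norm (\<eta> \<omega>) \<le> C) \<and> (\<forall>\<omega>\<in>space M.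
           J t \<omega> - J s \<omega> = \<eta> \<omega> \<bullet> (W t \<omega> - W s \<omega>) \<and> (\<forall>r\<in>{s<..<t}. H r \<omega> = \<eta> \<omega>))"
    if st: "0 \<le> s" "s < t" and gp: "S \<inter> {s<..<t} = {}" for s t
  proof -
    obtain \<eta> where e: "\<eta>\<in>borel_measurable (F s)" "\<forall>\<omega>\<in>space M.
           J t \<omega> - J s \<omega> = \<eta> \<omega> \<bullet> (W t \<omega> - W s \<omega>) \<and> (\<forall>r\<in>{s<..<t}. H r \<omega> = \<eta> \<omega>)"
      using elementary_simps(4)[OF assms st gp] by blast
    \<comment> \<open>\<open>H\<close> equals \<open>\<eta>\<close> at the midpoint of the gap, so
      the bound of \<open>H\<close> passes to \<open>\<eta>\<close>.\<close>
    have "(s+t)/2 \<in> {s<..<t}" using st by auto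
    then have "\<forall>\<omega>\<in>space M. norm (\<eta> \<omega>) \<le> C" using e(2) C by metis
    then show ?thesis using e by blast
  qed
  with C that show ?thesis by blast
qed

lemma elementary_measurable:
  assumes "elementary S J H" shows "0 \<le> t \<Longrightarrow> J t \<in> borel_measurable (F t)" "0 \<le> t \<Longrightarrow> J t \<in> borel_measurable M"
  using assms measurable_F_M by (auto simp: elementary_def)

text \<open>The three claims are proved together, by cutting at jump times. When two pieces are
  joined, the second moments make the cross term integrable and the martingale property of the later
  piece makes it vanish. The bounded weight \<open>Y\<close>, known at time \<open>s\<close>, turns
  the isometry into a conditional one.\<close>

lemma elementary_L2:
  assumes el: "elementary S J H" and st: "0 \<le> s" "s < t"
  shows "integrable M (\<lambda>\<omega>. (J t \<omega> - J s \<omega>)^2) \<and>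
    (\<forall>Z. Z \<in> borel_measurable (F s) \<longrightarrow> integrable M (\<lambda>\<omega>. (Z \<omega>)^2) \<longrightarrow>
        expectation (\<lambda>\<omega>. Z \<omega> * (J t \<omega> - J s \<omega>)) = 0) \<and>
    (\<forall>Y B. Y \<in> borel_measurable (F s) \<longrightarrow> (\<forall>\<omega>\<in>space M. \<bar>Y \<omega>\<bar> \<le> B) \<longrightarrow>
        expectation (\<lambda>\<omega>. Y \<omega> * (J t \<omega> - J s \<omega>)^2)
          = expectation (\<lambda>\<omega>. Y \<omega> * (LINT r:{s..t}|lborel. (norm (H r \<omega>))^2)))"
  (is "?P s t")
proof -
  obtain C where C: "\<And>s \<omega>. \<omega> \<in> space M \<Longrightarrow> norm (H s \<omega>) \<le> C"
    and g: "\<And>s t. 0 \<le> s \<Longrightarrow> s < t \<Longrightarrow> S \<inter> {s<..<t} = {} \<Longrightarrow>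
        \<exists>\<eta>\<in>borel_measurable (F s). (\<forall>\<omega>\<in>space M. norm (\<eta> \<omega>) \<le> C) \<and> (\<forall>\<omega>\<in>space M.
           J t \<omega> - J s \<omega> = \<eta> \<omega> \<bullet> (W t \<omega> - W s \<omega>) \<and> (\<forall>r\<in>{s<..<t}. H r \<omega> = \<eta> \<omega>))"
    using elementary_gap[OF el] by blast
  have finS: "finite S" using el by (simp add: elementary_def)
  have Hm: "(\<lambda>(s, \<omega>). H s \<omega>) \<in> borel_measurable (borel \<Otimes>\<^sub>M M)" using el by (simp add: elementary_def)
  have Hs: "(\<lambda>r. H r \<omega>) \<in> borel_measurable borel" if "\<omega> \<in> space M" for \<omega>
    using measurable_compose[OF measurable_Pair2'[OF that] Hm] by simp
  have C0: "0 \<le> C" using C not_empty by (metis norm_ge_zero order_trans ex_in_conv)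
  have Hint: "set_integrable lborel {s..t} (\<lambda>r. (norm (H r \<omega>))^2)" if "\<omega> \<in> space M" for \<omega> s t
    unfolding set_integrable_def
  proof (rule Bochner_Integration.integrable_bound)
    have "integrable lborel (indicat_real {s..t})" by (rule integrable_real_indicator) (auto simp: emeasure_lborel_Icc_eq)
    then show "integrable lborel (\<lambda>r. indicator {s..t} r *\<^sub>R (C^2))" by simp
    show "AE r in lborel. norm (indicat_real {s..t} r *\<^sub>R (norm (H r \<omega>))\<^sup>2) \<le> norm (indicator {s..t} r *\<^sub>R (C^2))"
      using C[OF that] by (intro AE_I2) (auto simp: indicator_def intro!: power_mono)
  qed (use Hs[OF that] in measurable)
  have Im: "(\<lambda>\<omega>. LINT r:{s..t}|lborel. (norm (H r \<omega>))^2) \<in> borel_measurable M" for s t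
    unfolding set_lebesgue_integral_def
    by (rule lborel.borel_measurable_lebesgue_integral)
       (use measurable_compose[OF measurable_pair_swap' Hm] in \<open>simp add: split_beta\<close>)
  have Ib: "(LINT r:{s..t}|lborel. (norm (H r \<omega>))^2) \<le> C^2 * (t - s)" "0 \<le> (LINT r:{s..t}|lborel. (norm (H r \<omega>))^2)"
    if "\<omega> \<in> space M" "s \<le> t" for \<omega> s t
  proof -
    have "(LINT r:{s..t}|lborel. (norm (H r \<omega>))^2) \<le> (LINT r:{s..t}|lborel. C^2)"
      by (rule set_integral_mono[OF Hint[OF that(1)]])
         (use C[OF that(1)] in \<open>auto simp: set_integrable_def integrable_indicator_iff emeasure_lborel_Icc_eq intro!: power_mono integrable_scaleR_left\<close>)
    then show "(LINT r:{s..t}|lborel. (norm (H r \<omega>))^2) \<le> C^2 * (t - s)"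
      using that by (simp add: set_integral_const mult.commute)
    show "0 \<le> (LINT r:{s..t}|lborel. (norm (H r \<omega>))^2)"
      unfolding set_lebesgue_integral_def by (rule Bochner_Integration.integral_nonneg) auto
  qed
  have YI: "integrable M (\<lambda>\<omega>. Y \<omega> * (LINT r:{s..t}|lborel. (norm (H r \<omega>))^2))"
    if "Y \<in> borel_measurable M" "\<forall>\<omega>\<in>space M. \<bar>Y \<omega>\<bar> \<le> B" "s \<le> t" for Y B s t
  proof (rule integrable_const_bound)
    show "AE \<omega> in M. norm (Y \<omega> * (LINT r:{s..t}|lborel. (norm (H r \<omega>))\<^sup>2)) \<le> B * (C^2 * (t - s))"
      using Ib that by (intro AE_I2) (auto simp: abs_mult intro!: mult_mono intro: order_trans[OF abs_ge_zero])
    show "(\<lambda>\<omega>. Y \<omega> * (LINT r:{s..t}|lborel. (norm (H r \<omega>))\<^sup>2)) \<in> borel_measurable M"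
      using that(1) Im[of s t] by measurable
  qed
  have YJ: "integrable M (\<lambda>\<omega>. Y \<omega> * (J t \<omega> - J s \<omega>)^2)"
    if "integrable M (\<lambda>\<omega>. (J t \<omega> - J s \<omega>)^2)" "Y \<in> borel_measurable M" "\<forall>\<omega>\<in>space M. \<bar>Y \<omega>\<bar> \<le> B" for Y B s t
  proof (rule Bochner_Integration.integrable_bound)
    show "integrable M (\<lambda>\<omega>. B * (J t \<omega> - J s \<omega>)^2)" using that by simp
    show "AE \<omega> in M. norm (Y \<omega> * (J t \<omega> - J s \<omega>)^2) \<le> norm (B * (J t \<omega> - J s \<omega>)^2)"
      using that(3) by (intro AE_I2) (auto simp: abs_mult intro!: mult_right_mono intro: order_trans[OF _ abs_ge_self])
    show "(\<lambda>\<omega>. Y \<omega> * (J t \<omega> - J s \<omega>)^2) \<in> borel_measurable M"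
      using that(2) borel_measurable_integrable[OF that(1)] by measurable
  qed
  show ?thesis
    using finS st
  proof (induction rule: gap_induct)
    case (gap s t)
    obtain \<eta> where e: "\<eta>\<in>borel_measurable (F s)" "\<forall>\<omega>\<in>space M. norm (\<eta> \<omega>) \<le> C"
       "\<And>\<omega>. \<omega>\<in>space M \<Longrightarrow> J t \<omega> - J s \<omega> = \<eta> \<omega> \<bullet> (W t \<omega> - W s \<omega>) \<and> (\<forall>r\<in>{s<..<t}. H r \<omega> = \<eta> \<omega>)"
      using g[OF gap] by blast
    note inc = increment_inner[OF gap(1,2) e(1,2)]
    have cg: "expectation (\<lambda>\<omega>. f \<omega> (J t \<omega> - J s \<omega>)) = expectation (\<lambda>\<omega>. f \<omega> (\<eta> \<omega> \<bullet> (W t \<omega> - W s \<omega>)))" for f :: "'a \<Rightarrow> real \<Rightarrow> real"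
      by (rule Bochner_Integration.integral_cong) (use e(3) in auto)
    have "integrable M (\<lambda>\<omega>. (J t \<omega> - J s \<omega>)^2) \<longleftrightarrow> integrable M (\<lambda>\<omega>. (\<eta> \<omega> \<bullet> (W t \<omega> - W s \<omega>))^2)"
      by (rule Bochner_Integration.integrable_cong) (use e(3) in auto)
    moreover have "integrable M (\<lambda>\<omega>. (\<eta> \<omega> \<bullet> (W t \<omega> - W s \<omega>))^2)"
      using inc(2)[of "\<lambda>_. 1" 1] by simp
    moreover have "expectation (\<lambda>\<omega>. Z \<omega> * (J t \<omega> - J s \<omega>)) = 0"
      if "Z \<in> borel_measurable (F s)" "integrable M (\<lambda>\<omega>. (Z \<omega>)^2)" for Z
      using inc(1)[OF that(1) square_integrable_imp_integrable[OF measurable_F_M[OF that(1)] that(2)]] cg[of "\<lambda>\<omega> x. Z \<omega> * x"] by simp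
    moreover have "expectation (\<lambda>\<omega>. Y \<omega> * (J t \<omega> - J s \<omega>)^2)
          = expectation (\<lambda>\<omega>. Y \<omega> * (LINT r:{s..t}|lborel. (norm (H r \<omega>))^2))"
      if "Y \<in> borel_measurable (F s)" "\<forall>\<omega>\<in>space M. \<bar>Y \<omega>\<bar> \<le> B" for Y B
    proof -
      have "expectation (\<lambda>\<omega>. Y \<omega> * (J t \<omega> - J s \<omega>)^2) = expectation (\<lambda>\<omega>. Y \<omega> * (norm (\<eta> \<omega>))^2) * (t - s)"
        using inc(2)[of Y B] that cg[of "\<lambda>\<omega> x. Y \<omega> * x^2"] by simp
      also have "\<dots> = expectation (\<lambda>\<omega>. Y \<omega> * (norm (\<eta> \<omega>))^2 * (t - s))" by simp
      also have "\<dots> = expectation (\<lambda>\<omega>. Y \<omega> * (LINT r:{s..t}|lborel. (norm (H r \<omega>))^2))"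
      proof (rule Bochner_Integration.integral_cong[OF refl])
        fix \<omega> assume w: "\<omega> \<in> space M"
        have "(LINT r:{s..t}|lborel. (norm (H r \<omega>))^2) = (norm (\<eta> \<omega>))^2 * (t - s)"
          by (rule set_integral_const_on_open) (use Hs[OF w] e(3)[OF w] gap in auto)
        then show "Y \<omega> * (norm (\<eta> \<omega>))^2 * (t - s) = Y \<omega> * (LINT r:{s..t}|lborel. (norm (H r \<omega>))^2)" by simp
      qed
      finally show ?thesis .
    qed
    ultimately show ?case by blast
  next
    case (join s m t)
    have ms: "J s \<in> borel_measurable (F m)" "J m \<in> borel_measurable (F m)" "J t \<in> borel_measurable M"
      "J s \<in> borel_measurable M" "J m \<in> borel_measurable M"
      using elementary_measurable[OF el] join(1-3) measurable_F_mono by (auto intro: measurable_F_mono[of _ s])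
    have i1: "integrable M (\<lambda>\<omega>. (J m \<omega> - J s \<omega>)^2)" and i2: "integrable M (\<lambda>\<omega>. (J t \<omega> - J m \<omega>)^2)"
      using join by auto
    have i12: "integrable M (\<lambda>\<omega>. (J m \<omega> - J s \<omega>) * (J t \<omega> - J m \<omega>))"
      using integrable_L2_mult[OF _ _ i1 i2] ms by auto
    have sq: "(J t \<omega> - J s \<omega>)^2 = (J m \<omega> - J s \<omega>)^2 + (J t \<omega> - J m \<omega>)^2 + 2 * ((J m \<omega> - J s \<omega>) * (J t \<omega> - J m \<omega>))" for \<omega>
      by (simp add: power2_eq_square algebra_simps)
    have r1: "integrable M (\<lambda>\<omega>. (J t \<omega> - J s \<omega>)^2)" unfolding sq using i1 i2 i12 by auto
    have r2: "expectation (\<lambda>\<omega>. Z \<omega> * (J t \<omega> - J s \<omega>)) = 0"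
      if Z: "Z \<in> borel_measurable (F s)" "integrable M (\<lambda>\<omega>. (Z \<omega>)^2)" for Z
    proof -
      have Zm: "Z \<in> borel_measurable (F m)" "Z \<in> borel_measurable M"
        using measurable_F_mono[OF Z(1)] measurable_F_M[OF Z(1)] join(2) by simp_all
      have "integrable M (\<lambda>\<omega>. Z \<omega> * (J m \<omega> - J s \<omega>))" "integrable M (\<lambda>\<omega>. Z \<omega> * (J t \<omega> - J m \<omega>))"
        using integrable_L2_mult[OF _ _ Z(2) i1] integrable_L2_mult[OF _ _ Z(2) i2] Zm ms by auto
      then have "expectation (\<lambda>\<omega>. Z \<omega> * (J m \<omega> - J s \<omega>) + Z \<omega> * (J t \<omega> - J m \<omega>)) = 0"
        using join.IH Z Zm by simp
      then show ?thesis by (simp add: algebra_simps)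
    qed
    have r3: "expectation (\<lambda>\<omega>. Y \<omega> * (J t \<omega> - J s \<omega>)^2)
          = expectation (\<lambda>\<omega>. Y \<omega> * (LINT r:{s..t}|lborel. (norm (H r \<omega>))^2))"
      if Y: "Y \<in> borel_measurable (F s)" "\<forall>\<omega>\<in>space M. \<bar>Y \<omega>\<bar> \<le> B" for Y B
    proof -
      have Ym: "Y \<in> borel_measurable (F m)" "Y \<in> borel_measurable M"
        using measurable_F_mono[OF Y(1)] measurable_F_M[OF Y(1)] join(2) by simp_all
      \<comment> \<open>The earlier increment together with the weight is known at time
        \<open>m\<close> and square integrable, so it is an admissible factor for the martingale
        property on the later interval.\<close>
      let ?Z = "\<lambda>\<omega>. Y \<omega> * (J m \<omega> - J s \<omega>)"
      have Zm: "?Z \<in> borel_measurable (F m)" using Ym ms by measurable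
      have Z2: "integrable M (\<lambda>\<omega>. (?Z \<omega>)^2)"
        unfolding power_mult_distrib
        by (rule YJ[OF i1, of _ "B^2"]) (use Ym Y(2) power_mono[of "\<bar>Y _\<bar>" B 2] in auto)
      have cross: "expectation (\<lambda>\<omega>. ?Z \<omega> * (J t \<omega> - J m \<omega>)) = 0"
        using join.IH(2) Zm Z2 by blast
      have ic: "integrable M (\<lambda>\<omega>. ?Z \<omega> * (J t \<omega> - J m \<omega>))"
        using integrable_L2_mult[OF _ _ Z2 i2] measurable_F_M[OF Zm] ms by auto
      have "expectation (\<lambda>\<omega>. Y \<omega> * (J t \<omega> - J s \<omega>)^2) = expectation (\<lambda>\<omega>. Y \<omega> * (J m \<omega> - J s \<omega>)^2
           + Y \<omega> * (J t \<omega> - J m \<omega>)^2 + 2 * (?Z \<omega> * (J t \<omega> - J m \<omega>)))"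
        unfolding sq by (simp add: algebra_simps)
      also have "\<dots> = expectation (\<lambda>\<omega>. Y \<omega> * (J m \<omega> - J s \<omega>)^2) + expectation (\<lambda>\<omega>. Y \<omega> * (J t \<omega> - J m \<omega>)^2)"
        using YJ[OF i1 Ym(2) Y(2)] YJ[OF i2 Ym(2) Y(2)] ic cross by simp
      also have "\<dots> = expectation (\<lambda>\<omega>. Y \<omega> * (LINT r:{s..m}|lborel. (norm (H r \<omega>))^2))
           + expectation (\<lambda>\<omega>. Y \<omega> * (LINT r:{m..t}|lborel. (norm (H r \<omega>))^2))"
        using join.IH(1)[THEN conjunct2, THEN conjunct2, THEN spec, THEN spec, THEN mp, THEN mp, OF Y]
          join.IH(2)[THEN conjunct2, THEN conjunct2, THEN spec, THEN spec, THEN mp, THEN mp, OF Ym(1) Y(2)]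
        by (simp only:)
      also have "\<dots> = expectation (\<lambda>\<omega>. Y \<omega> * (LINT r:{s..m}|lborel. (norm (H r \<omega>))^2)
           + Y \<omega> * (LINT r:{m..t}|lborel. (norm (H r \<omega>))^2))"
        using YI[OF Ym(2) Y(2)] join(2,3) by simp
      also have "\<dots> = expectation (\<lambda>\<omega>. Y \<omega> * (LINT r:{s..t}|lborel. (norm (H r \<omega>))^2))"
      proof (rule Bochner_Integration.integral_cong[OF refl])
        fix \<omega> assume w: "\<omega> \<in> space M"
        have "(LINT r:{s..t}|lborel. (norm (H r \<omega>))^2) =
            (LINT r:{s..m}|lborel. (norm (H r \<omega>))^2) + (LINT r:{m..t}|lborel. (norm (H r \<omega>))^2)"
          by (rule set_integral_split[OF Hint[OF w]]) (use join(2,3) in auto)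
        then show "Y \<omega> * (LINT r:{s..m}|lborel. (norm (H r \<omega>))^2) + Y \<omega> * (LINT r:{m..t}|lborel. (norm (H r \<omega>))^2)
            = Y \<omega> * (LINT r:{s..t}|lborel. (norm (H r \<omega>))^2)" by (simp only: distrib_left)
      qed
      finally show ?thesis .
    qed
    show ?case
      by (intro conjI allI impI, rule r1, (rule r2; assumption), (rule r3; assumption))
  qed
qed

text \<open>Only the order \<open>(t - s)^2\<close> matters, the constant may depend on the
  integrand. Every cut at a jump time costs a factor 8 from
  \<open>(a + b)^4 \<le> 8 * a^4 + 8 * b^4\<close>, and there are at most \<open>card S\<close>
  cuts.\<close>

lemma elementary_fourth_moment:
  assumes el: "elementary S J H"
  obtains C where "\<And>s t. 0 \<le> s \<Longrightarrow> s < t \<Longrightarrow>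
    integrable M (\<lambda>\<omega>. (J t \<omega> - J s \<omega>)^4) \<and> expectation (\<lambda>\<omega>. (J t \<omega> - J s \<omega>)^4) \<le> C * (t - s)^2"
proof -
  obtain C where "\<And>s \<omega>. \<omega> \<in> space M \<Longrightarrow> norm (H s \<omega>) \<le> C"
    and g: "\<And>s t. 0 \<le> s \<Longrightarrow> s < t \<Longrightarrow> S \<inter> {s<..<t} = {} \<Longrightarrow>
        \<exists>\<eta>\<in>borel_measurable (F s). (\<forall>\<omega>\<in>space M. norm (\<eta> \<omega>) \<le> C) \<and> (\<forall>\<omega>\<in>space M.
           J t \<omega> - J s \<omega> = \<eta> \<omega> \<bullet> (W t \<omega> - W s \<omega>) \<and> (\<forall>r\<in>{s<..<t}. H r \<omega> = \<eta> \<omega>))"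
    using elementary_gap[OF el] by blast
  define K where "K = 3 * C^4 * real CARD('d)^2"
  have K0: "0 \<le> K" unfolding K_def by (intro mult_nonneg_nonneg) auto
  have finS: "finite S" using el by (simp add: elementary_def)
  have main: "integrable M (\<lambda>\<omega>. (J t \<omega> - J s \<omega>)^4) \<and>
     expectation (\<lambda>\<omega>. (J t \<omega> - J s \<omega>)^4) \<le> K * 8 ^ card (S \<inter> {s<..<t}) * (t - s)^2" if "0 \<le> s" "s < t" for s t
    using finS that
  proof (induction rule: gap_induct)
    case (gap s t)
    obtain \<eta> where e: "\<eta>\<in>borel_measurable (F s)" "\<forall>\<omega>\<in>space M. norm (\<eta> \<omega>) \<le> C"
       "\<And>\<omega>. \<omega>\<in>space M \<Longrightarrow> J t \<omega> - J s \<omega> = \<eta> \<omega> \<bullet> (W t \<omega> - W s \<omega>)"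
      using g[OF gap] by blast
    have "integrable M (\<lambda>\<omega>. (J t \<omega> - J s \<omega>)^4) \<longleftrightarrow> integrable M (\<lambda>\<omega>. (\<eta> \<omega> \<bullet> (W t \<omega> - W s \<omega>))^4)"
      by (rule Bochner_Integration.integrable_cong) (use e(3) in auto)
    moreover have "expectation (\<lambda>\<omega>. (J t \<omega> - J s \<omega>)^4) = expectation (\<lambda>\<omega>. (\<eta> \<omega> \<bullet> (W t \<omega> - W s \<omega>))^4)"
      by (rule Bochner_Integration.integral_cong) (use e(3) in auto)
    ultimately show ?case using increment_inner(3)[OF gap(1,2) e(1,2)] gap(3) by (simp add: K_def)
  next
    case (join s m t)
    have ms: "J t \<in> borel_measurable M" "J s \<in> borel_measurable M" "J m \<in> borel_measurable M"
      using elementary_measurable[OF el] join(1-3) by auto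
    have ineq: "(a + b)^4 \<le> 8 * a^4 + 8 * b^4" for a b :: real
    proof -
      have *: "(x + y)^2 \<le> 2 * x^2 + 2 * y^2" for x y :: real
        using zero_le_power2[of "x - y"] by (simp add: power2_eq_square algebra_simps)
      have "((a + b)^2)^2 \<le> (2 * a^2 + 2 * b^2)^2" using * by (intro power_mono) auto
      also have "\<dots> \<le> 2 * (2 * a^2)^2 + 2 * (2 * b^2)^2" by (rule *)
      finally show ?thesis by (simp add: power_mult_distrib)
    qed
    let ?f = "\<lambda>\<omega>. 8 * (J m \<omega> - J s \<omega>)^4 + 8 * (J t \<omega> - J m \<omega>)^4"
    have bd: "(J t \<omega> - J s \<omega>)^4 \<le> ?f \<omega>" for \<omega> using ineq[of "J m \<omega> - J s \<omega>" "J t \<omega> - J m \<omega>"] by simp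
    have J4: "integrable M (\<lambda>\<omega>. (J m \<omega> - J s \<omega>)^4)" "integrable M (\<lambda>\<omega>. (J t \<omega> - J m \<omega>)^4)"
      using join.IH by blast+
    then have int: "integrable M ?f" by (intro Bochner_Integration.integrable_add integrable_mult_right)
    have i: "integrable M (\<lambda>\<omega>. (J t \<omega> - J s \<omega>)^4)"
      by (rule Bochner_Integration.integrable_bound[OF int])
         (use bd ms in \<open>auto intro!: order_trans[OF _ abs_ge_self]\<close>)
    have fin: "finite (S \<inter> {s<..<t})" using finS by auto
    let ?k = "card (S \<inter> {s<..<t})"
    have "card (S \<inter> {s<..<m}) < ?k" "card (S \<inter> {m<..<t}) < ?k"
      using join(2-4) fin by (intro psubset_card_mono; force)+
    \<comment> \<open>Each half has lost at least the jump time \<open>m\<close>, so the factor 8 of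
      the join fits into the exponent.\<close>
    then have p: "8 * 8 ^ card (S \<inter> {s<..<m}) \<le> (8::real) ^ ?k" "8 * 8 ^ card (S \<inter> {m<..<t}) \<le> (8::real) ^ ?k"
      unfolding power_Suc[symmetric] by (intro power_increasing; simp)+
    have "expectation (\<lambda>\<omega>. (J t \<omega> - J s \<omega>)^4) \<le> expectation ?f" by (rule integral_mono[OF i int bd])
    also have "\<dots> \<le> 8 * (K * 8 ^ card (S \<inter> {s<..<m}) * (m - s)^2) + 8 * (K * 8 ^ card (S \<inter> {m<..<t}) * (t - m)^2)"
      unfolding Bochner_Integration.integral_add[OF integrable_mult_right[OF J4(1)] integrable_mult_right[OF J4(2)]]
        integral_mult_right_zero
      by (intro add_mono mult_left_mono join.IH[THEN conjunct2]) simp_all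
    also have "\<dots> = K * ((8 * 8 ^ card (S \<inter> {s<..<m})) * (m - s)^2 + (8 * 8 ^ card (S \<inter> {m<..<t})) * (t - m)^2)"
      by (simp add: algebra_simps)
    also have "\<dots> \<le> K * (8 ^ ?k * (m - s)^2 + 8 ^ ?k * (t - m)^2)"
      using p K0 by (intro mult_left_mono add_mono mult_right_mono) auto
    also have "\<dots> = K * 8 ^ ?k * ((m - s)^2 + (t - m)^2)" by (simp add: algebra_simps)
    \<comment> \<open>Squared lengths of adjacent intervals add up to at most the square of the
      total length, so that joining costs no further constant.\<close>
    also have "\<dots> \<le> K * 8 ^ ?k * (t - s)^2"
    proof (rule mult_left_mono)
      have "0 \<le> (m - s) * (t - m)" using join by simp
      then show "(m - s)^2 + (t - m)^2 \<le> (t - s)^2" by (simp add: power2_eq_square algebra_simps)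
    qed (use K0 in simp)
    finally show ?case using i by simp
  qed
  show thesis
  proof (rule that[of "K * 8 ^ card S"])
    fix s t :: real assume st: "0 \<le> s" "s < t"
    have "K * 8 ^ card (S \<inter> {s<..<t}) * (t - s)^2 \<le> K * 8 ^ card S * (t - s)^2"
      using K0 finS by (intro mult_right_mono mult_left_mono power_increasing card_mono) auto
    then show "integrable M (\<lambda>\<omega>. (J t \<omega> - J s \<omega>)^4) \<and> expectation (\<lambda>\<omega>. (J t \<omega> - J s \<omega>)^4) \<le> K * 8 ^ card S * (t - s)^2"
      using main[OF st] by linarith
  qed
qed

section \<open>Linear combinations, and simple integrands as elementary ones\<close>

lemma elementary_add:
  assumes "elementary S J H" "elementary S' J' H'"
  shows "elementary (S \<union> S') (\<lambda>t \<omega>. J t \<omega> + J' t \<omega>) (\<lambda>s \<omega>. H s \<omega> + H' s \<omega>)"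
  unfolding elementary_def
proof (intro conjI allI impI ballI)
  obtain C C' where C: "\<forall>s. \<forall>\<omega>\<in>space M. norm (H s \<omega>) \<le> C" "\<forall>s. \<forall>\<omega>\<in>space M. norm (H' s \<omega>) \<le> C'"
    using elementary_simps(3)[OF assms(1)] elementary_simps(3)[OF assms(2)] by blast
  then have "norm (H s \<omega> + H' s \<omega>) \<le> C + C'" if "\<omega> \<in> space M" for s \<omega>
    using norm_triangle_le[OF add_mono] that by blast
  then show "\<exists>C. \<forall>s. \<forall>\<omega>\<in>space M. norm (H s \<omega> + H' s \<omega>) \<le> C" by blast
  show "(\<lambda>(s, \<omega>). H s \<omega> + H' s \<omega>) \<in> borel_measurable (borel \<Otimes>\<^sub>M M)"
    using elementary_simps(2)[OF assms(1)] elementary_simps(2)[OF assms(2)] unfolding split_beta by measurable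
  fix s t :: real assume st: "0 \<le> s" "s < t" "(S \<union> S') \<inter> {s<..<t} = {}"
  then have gap: "S \<inter> {s<..<t} = {}" "S' \<inter> {s<..<t} = {}" by (simp_all only: Int_Un_distrib2 Un_empty)
  then obtain \<eta> \<eta>' where "\<eta>\<in>borel_measurable (F s)" "\<forall>\<omega>\<in>space M.
           J t \<omega> - J s \<omega> = \<eta> \<omega> \<bullet> (W t \<omega> - W s \<omega>) \<and> (\<forall>r\<in>{s<..<t}. H r \<omega> = \<eta> \<omega>)"
     "\<eta>'\<in>borel_measurable (F s)" "\<forall>\<omega>\<in>space M.
           J' t \<omega> - J' s \<omega> = \<eta>' \<omega> \<bullet> (W t \<omega> - W s \<omega>) \<and> (\<forall>r\<in>{s<..<t}. H' r \<omega> = \<eta>' \<omega>)"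
    using elementary_simps(4)[OF assms(1) st(1,2) gap(1)] elementary_simps(4)[OF assms(2) st(1,2) gap(2)] by meson
  then show "\<exists>\<eta>\<in>borel_measurable (F s). \<forall>\<omega>\<in>space M.
           J t \<omega> + J' t \<omega> - (J s \<omega> + J' s \<omega>) = \<eta> \<omega> \<bullet> (W t \<omega> - W s \<omega>) \<and> (\<forall>r\<in>{s<..<t}. H r \<omega> + H' r \<omega> = \<eta> \<omega>)"
    by (intro bexI[of _ "\<lambda>\<omega>. \<eta> \<omega> + \<eta>' \<omega>"]) (auto simp: inner_add_left add_diff_add)
next
  show "finite (S \<union> S')" using elementary_simps(1) assms by simp
  show "(\<lambda>\<omega>. J t \<omega> + J' t \<omega>) \<in> borel_measurable (F t)" if "0 \<le> t" for t
    using elementary_measurable(1)[OF assms(1) that] elementary_measurable(1)[OF assms(2) that] by measurable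
  show "J 0 \<omega> + J' 0 \<omega> = 0" if "\<omega> \<in> space M" for \<omega>
    using assms that by (simp add: elementary_def)
qed

lemma elementary_scale:
  assumes "elementary S J H"
  shows "elementary S (\<lambda>t \<omega>. c * J t \<omega>) (\<lambda>s \<omega>. c *\<^sub>R H s \<omega>)"
  unfolding elementary_def
proof (intro conjI allI impI ballI)
  obtain C where C: "\<forall>s. \<forall>\<omega>\<in>space M. norm (H s \<omega>) \<le> C"
    using elementary_simps(3)[OF assms(1)] by blast
  then show "\<exists>C. \<forall>s. \<forall>\<omega>\<in>space M. norm (c *\<^sub>R H s \<omega>) \<le> C"
    by (intro exI[of _ "\<bar>c\<bar> * C"]) (auto intro!: mult_left_mono)
  show "(\<lambda>(s, \<omega>). c *\<^sub>R H s \<omega>) \<in> borel_measurable (borel \<Otimes>\<^sub>M M)"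
    using elementary_simps(2)[OF assms(1)] unfolding split_beta by measurable
  fix s t :: real assume "0 \<le> s" "s < t" "S \<inter> {s<..<t} = {}"
  then obtain \<eta> where "\<eta>\<in>borel_measurable (F s)" "\<forall>\<omega>\<in>space M.
           J t \<omega> - J s \<omega> = \<eta> \<omega> \<bullet> (W t \<omega> - W s \<omega>) \<and> (\<forall>r\<in>{s<..<t}. H r \<omega> = \<eta> \<omega>)"
    using elementary_simps(4)[OF assms] by meson
  then show "\<exists>\<eta>\<in>borel_measurable (F s). \<forall>\<omega>\<in>space M.
           c * J t \<omega> - c * J s \<omega> = \<eta> \<omega> \<bullet> (W t \<omega> - W s \<omega>) \<and> (\<forall>r\<in>{s<..<t}. c *\<^sub>R H r \<omega> = \<eta> \<omega>)"
    by (intro bexI[of _ "\<lambda>\<omega>. c *\<^sub>R \<eta> \<omega>"]) (auto simp: right_diff_distrib[symmetric])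
next
  show "finite S" using elementary_simps(1) assms by simp
  show "(\<lambda>\<omega>. c * J t \<omega>) \<in> borel_measurable (F t)" if "0 \<le> t" for t
    using elementary_measurable(1)[OF assms(1) that] by measurable
  show "c * J 0 \<omega> = 0" if "\<omega> \<in> space M" for \<omega>
    using assms that by (simp add: elementary_def)
qed

lemma elementary_simple:
  assumes si: "simple_integrand F n \<tau> \<xi>"
  shows "elementary (\<tau> ` {..n}) (simple_integral W n \<tau> \<xi>) (simple_process n \<tau> \<xi>)"
proof -
  have mono: "\<tau> i \<le> \<tau> j" if "i \<le> j" "j \<le> n" for i j
    using that
  proof (induction rule: dec_induct)
    case (step k) then show ?case using si unfolding simple_integrand_def by (meson Suc_le_lessD less_imp_le order_trans)
  qed simp
  have pos: "0 \<le> \<tau> i" if "i \<le> n" for i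
    using mono[of 0 i] that si unfolding simple_integrand_def by simp
  have \<xi>F: "\<xi> i \<in> borel_measurable (F (\<tau> i))" if "i < n" for i using si that by (simp add: simple_integrand_def)
  have \<xi>M: "\<xi> i \<in> borel_measurable M" if "i < n" for i using measurable_F_M[OF \<xi>F[OF that]] .
  have "\<forall>i<n. \<exists>c. \<forall>\<omega>\<in>space M. norm (\<xi> i \<omega>) \<le> c"
    using si unfolding simple_integrand_def bounded_iff by auto
  then obtain c where c: "\<And>i \<omega>. i < n \<Longrightarrow> \<omega> \<in> space M \<Longrightarrow> norm (\<xi> i \<omega>) \<le> c i" by metis
  show ?thesis
    unfolding elementary_def
  proof (intro conjI allI impI ballI)
    fix t :: real assume t: "0 \<le> t"
    have "(\<lambda>\<omega>. \<xi> i \<omega> \<bullet> (W (min t (\<tau> (Suc i))) \<omega> - W (min t (\<tau> i)) \<omega>)) \<in> borel_measurable (F t)" if i: "i < n" for i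
    \<comment> \<open>If the interval begins after \<open>t\<close>, its coefficient need not be
      known at time \<open>t\<close>, but then both arguments of \<open>W\<close> equal
      \<open>t\<close> and the summand is zero.\<close>
    proof (cases "\<tau> i \<le> t")
      case True
      have "\<xi> i \<in> borel_measurable (F t)" using measurable_F_mono[OF \<xi>F[OF i] True] .
      moreover have "W (min t (\<tau> (Suc i))) \<in> borel_measurable (F t)" "W (min t (\<tau> i)) \<in> borel_measurable (F t)"
        using pos[of i] pos[of "Suc i"] i t by (auto intro!: W_F)
      ultimately show ?thesis by measurable
    next
      case False
      then have "min t (\<tau> (Suc i)) = t" "min t (\<tau> i) = t" using mono[of i "Suc i"] i by auto
      then show ?thesis by simp
    qed
    then show "simple_integral W n \<tau> \<xi> t \<in> borel_measurable (F t)"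
      unfolding simple_integral_def[abs_def] by (intro borel_measurable_sum) auto
  next
    fix \<omega> show "simple_integral W n \<tau> \<xi> 0 \<omega> = 0"
      unfolding simple_integral_def using pos by (intro sum.neutral) (auto simp: min_def)
  next
    show "(\<lambda>(s, \<omega>). simple_process n \<tau> \<xi> s \<omega>) \<in> borel_measurable (borel \<Otimes>\<^sub>M M)"
      unfolding simple_process_def split_beta
    proof (intro borel_measurable_sum borel_measurable_scaleR)
      fix i assume "i \<in> {..<n}"
      then show "(\<lambda>x. \<xi> i (snd x)) \<in> borel_measurable (borel \<Otimes>\<^sub>M M)"
        using measurable_compose[OF measurable_snd \<xi>M] by simp
    qed measurable
  next
    show "\<exists>C. \<forall>s. \<forall>\<omega>\<in>space M. norm (simple_process n \<tau> \<xi> s \<omega>) \<le> C"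
    proof (intro exI[of _ "\<Sum>i<n. c i"] allI ballI)
      fix s \<omega> assume w: "\<omega> \<in> space M"
      show "norm (simple_process n \<tau> \<xi> s \<omega>) \<le> (\<Sum>i<n. c i)"
        unfolding simple_process_def
      proof (rule sum_norm_le)
        fix i assume i: "i \<in> {..<n}"
        have "0 \<le> c i" using c[of i \<omega>] w i norm_ge_zero order_trans by (metis lessThan_iff)
        then show "norm (indicat_real {\<tau> i<..\<tau> (Suc i)} s *\<^sub>R \<xi> i \<omega>) \<le> c i" using c[of i \<omega>] w i by (auto simp: indicator_def)
      qed
    qed
  next
    fix s t :: real assume st: "0 \<le> s" "s < t" "\<tau> ` {..n} \<inter> {s<..<t} = {}"
    have dich: "\<tau> i \<le> s \<or> t \<le> \<tau> i" if "i \<le> n" for i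
    proof -
      have "\<tau> i \<notin> {s<..<t}" using st that by blast
      then show ?thesis by auto
    qed
    \<comment> \<open>A gap lies inside or outside of each interval of the partition.
      \<open>\<eta>\<close> collects the coefficients of the intervals that contain it; these begin
      no later than \<open>s\<close>, so \<open>\<eta>\<close> is known at time
      \<open>s\<close>.\<close>
    define \<eta> where "\<eta> \<omega> = (\<Sum>i<n. (if \<tau> i \<le> s \<and> t \<le> \<tau> (Suc i) then \<xi> i \<omega> else 0))" for \<omega>
    have "(\<lambda>\<omega>. if \<tau> i \<le> s \<and> t \<le> \<tau> (Suc i) then \<xi> i \<omega> else 0) \<in> borel_measurable (F s)" if "i < n" for i
      by (cases "\<tau> i \<le> s") (use measurable_F_mono[OF \<xi>F[OF that]] in \<open>auto split: if_splits\<close>)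
    then have f1: "\<eta> \<in> borel_measurable (F s)" unfolding \<eta>_def[abs_def] by (intro borel_measurable_sum) auto
    have f2: "simple_integral W n \<tau> \<xi> t \<omega> - simple_integral W n \<tau> \<xi> s \<omega> = \<eta> \<omega> \<bullet> (W t \<omega> - W s \<omega>)" for \<omega>
      unfolding simple_integral_def \<eta>_def sum_subtractf[symmetric] inner_sum_left
    proof (rule sum.cong[OF refl])
      fix i assume "i \<in> {..<n}"
      then show "\<xi> i \<omega> \<bullet> (W (min t (\<tau> (Suc i))) \<omega> - W (min t (\<tau> i)) \<omega>) -
          \<xi> i \<omega> \<bullet> (W (min s (\<tau> (Suc i))) \<omega> - W (min s (\<tau> i)) \<omega>) =
          (if \<tau> i \<le> s \<and> t \<le> \<tau> (Suc i) then \<xi> i \<omega> else 0) \<bullet> (W t \<omega> - W s \<omega>)"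
        using dich[of i] dich[of "Suc i"] mono[of i "Suc i"] st(2)
        by (auto simp: min_def inner_diff_right)
    qed
    have f3: "simple_process n \<tau> \<xi> r \<omega> = \<eta> \<omega>" if "r \<in> {s<..<t}" for r \<omega>
      unfolding simple_process_def \<eta>_def
    proof (rule sum.cong[OF refl])
      fix i assume "i \<in> {..<n}"
      then show "indicat_real {\<tau> i<..\<tau> (Suc i)} r *\<^sub>R \<xi> i \<omega> = (if \<tau> i \<le> s \<and> t \<le> \<tau> (Suc i) then \<xi> i \<omega> else 0)"
        using dich[of i] dich[of "Suc i"] that by (auto simp: indicator_def)
    qed
    show "\<exists>\<eta>\<in>borel_measurable (F s). \<forall>\<omega>\<in>space M.
           simple_integral W n \<tau> \<xi> t \<omega> - simple_integral W n \<tau> \<xi> s \<omega> = \<eta> \<omega> \<bullet> (W t \<omega> - W s \<omega>) \<and>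
           (\<forall>r\<in>{s<..<t}. simple_process n \<tau> \<xi> r \<omega> = \<eta> \<omega>)"
      by (intro bexI[of _ \<eta>, OF _ f1] ballI conjI f2 f3)
  qed simp
qed

end

section \<open>Square-integrable functions and their limits\<close>

definition L2 :: "'x measure \<Rightarrow> ('x \<Rightarrow> 'b::euclidean_space) \<Rightarrow> bool" where
  "L2 \<mu> f \<longleftrightarrow> f \<in> borel_measurable \<mu> \<and> integrable \<mu> (\<lambda>x. (norm (f x))^2)"

text \<open>The distance is an extended nonnegative integral, as in \<open>ito_integral\<close>, so
  that square integrability of the limit is a conclusion and not a premise.\<close>

definition L2_lim :: "'x measure \<Rightarrow> (nat \<Rightarrow> 'x \<Rightarrow> 'b::euclidean_space) \<Rightarrow> ('x \<Rightarrow> 'b) \<Rightarrow> bool" where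
  "L2_lim \<mu> f g \<longleftrightarrow> (\<forall>k. L2 \<mu> (f k)) \<and> g \<in> borel_measurable \<mu> \<and>
     (\<lambda>k. \<integral>\<^sup>+ x. ennreal ((norm (f k x - g x))^2) \<partial>\<mu>) \<longlonglongrightarrow> 0"

lemma norm_add_squared_le: "(norm (a + b :: 'b::real_normed_vector))^2 \<le> 2 * (norm a)^2 + 2 * (norm b)^2"
proof -
  have "(norm (a + b))^2 \<le> (norm a + norm b)^2" by (rule power_mono[OF norm_triangle_ineq]) simp
  also have "\<dots> \<le> 2 * (norm a)^2 + 2 * (norm b)^2"
    using zero_le_power2[of "norm a - norm b"] by (simp add: power2_diff power2_sum)
  finally show ?thesis .
qed

lemma L2_add: assumes "L2 \<mu> f" "L2 \<mu> g" shows "L2 \<mu> (\<lambda>x. f x + g x)"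
  unfolding L2_def
proof
  show m: "(\<lambda>x. f x + g x) \<in> borel_measurable \<mu>" using assms unfolding L2_def by (intro borel_measurable_add) auto
  show "integrable \<mu> (\<lambda>x. (norm (f x + g x))^2)"
  proof (rule Bochner_Integration.integrable_bound)
    show "integrable \<mu> (\<lambda>x. 2 * (norm (f x))^2 + 2 * (norm (g x))^2)" using assms unfolding L2_def by simp
    show "AE x in \<mu>. norm ((norm (f x + g x))^2) \<le> norm (2 * (norm (f x))^2 + 2 * (norm (g x))^2)"
      by (rule AE_I2) (simp add: norm_add_squared_le)
  qed (use m in measurable)
qed

lemma L2_scaleR: assumes "L2 \<mu> f" shows "L2 \<mu> (\<lambda>x. c *\<^sub>R f x)"
  using assms unfolding L2_def by (auto simp: power_mult_distrib)

lemma L2_diff: "L2 \<mu> f \<Longrightarrow> L2 \<mu> g \<Longrightarrow> L2 \<mu> (\<lambda>x. f x - g x)"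
  using L2_add[of \<mu> f "\<lambda>x. (-1) *\<^sub>R g x"] L2_scaleR[of \<mu> g "-1"] by simp

lemma L2_I: assumes "f \<in> borel_measurable \<mu>" "(\<integral>\<^sup>+ x. ennreal ((norm (f x))^2) \<partial>\<mu>) < \<infinity>" shows "L2 \<mu> f"
  unfolding L2_def using assms by (auto intro!: integrableI_bounded)

lemma nn_norm_add_le:
  assumes "f \<in> borel_measurable \<mu>" "g \<in> borel_measurable \<mu>"
  shows "(\<integral>\<^sup>+ x. ennreal ((norm (f x + g x :: 'b::euclidean_space))^2) \<partial>\<mu>)
     \<le> 2 * (\<integral>\<^sup>+ x. ennreal ((norm (f x))^2) \<partial>\<mu>) + 2 * (\<integral>\<^sup>+ x. ennreal ((norm (g x))^2) \<partial>\<mu>)"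
proof -
  have "(\<integral>\<^sup>+ x. ennreal ((norm (f x + g x))^2) \<partial>\<mu>) \<le> (\<integral>\<^sup>+ x. 2 * ennreal ((norm (f x))^2) + 2 * ennreal ((norm (g x))^2) \<partial>\<mu>)"
  proof (rule nn_integral_mono)
    fix x
    have "ennreal ((norm (f x + g x))^2) \<le> ennreal (2 * (norm (f x))^2 + 2 * (norm (g x))^2)"
      by (rule ennreal_leI[OF norm_add_squared_le])
    also have "\<dots> = 2 * ennreal ((norm (f x))^2) + 2 * ennreal ((norm (g x))^2)"
      by (simp add: ennreal_mult ennreal_plus)
    finally show "ennreal ((norm (f x + g x))^2) \<le> 2 * ennreal ((norm (f x))^2) + 2 * ennreal ((norm (g x))^2)" .
  qed
  also have "\<dots> = 2 * (\<integral>\<^sup>+ x. ennreal ((norm (f x))^2) \<partial>\<mu>) + 2 * (\<integral>\<^sup>+ x. ennreal ((norm (g x))^2) \<partial>\<mu>)"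
    using assms by (simp add: nn_integral_add nn_integral_cmult)
  finally show ?thesis .
qed

text \<open>One approximant at finite distance suffices: the limit differs from it by a
  square-integrable function.\<close>

lemma L2_lim_L2: assumes "L2_lim \<mu> f g" shows "L2 \<mu> g"
proof -
  have gm: "g \<in> borel_measurable \<mu>" and fm: "\<And>k. f k \<in> borel_measurable \<mu>"
    using assms by (auto simp: L2_lim_def L2_def)
  have "eventually (\<lambda>k. (\<integral>\<^sup>+ x. ennreal ((norm (f k x - g x))^2) \<partial>\<mu>) < 1) sequentially"
    using assms unfolding L2_lim_def by (intro order_tendstoD) auto
  then obtain k where k: "(\<integral>\<^sup>+ x. ennreal ((norm (f k x - g x))^2) \<partial>\<mu>) < 1"
    using eventually_happens trivial_limit_sequentially by blast
  have "(\<integral>\<^sup>+ x. ennreal ((norm (f k x - g x))^2) \<partial>\<mu>) < \<infinity>" by (rule less_trans[OF k]) simp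
  then have "L2 \<mu> (\<lambda>x. f k x - g x)" by (intro L2_I) (use gm fm in auto)
  moreover have "L2 \<mu> (f k)" using assms by (auto simp: L2_lim_def)
  ultimately show ?thesis using L2_diff[of \<mu> "f k" "\<lambda>x. f k x - g x"] by simp
qed

lemma L2_lim_real:
  assumes "L2_lim \<mu> f g"
  shows "integrable \<mu> (\<lambda>x. (norm (f k x - g x))^2)" and "(\<lambda>k. \<integral>x. (norm (f k x - g x))^2 \<partial>\<mu>) \<longlonglongrightarrow> 0"
proof -
  have L: "L2 \<mu> (\<lambda>x. f k x - g x)" for k
    using assms L2_lim_L2[OF assms] by (intro L2_diff) (auto simp: L2_lim_def)
  then show "integrable \<mu> (\<lambda>x. (norm (f k x - g x))^2)" by (simp add: L2_def)
  have eq: "(\<integral>x. (norm (f k x - g x))^2 \<partial>\<mu>) = enn2real (\<integral>\<^sup>+ x. ennreal ((norm (f k x - g x))^2) \<partial>\<mu>)" for k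
    using L[of k] unfolding L2_def by (intro integral_eq_nn_integral) auto
  have "(\<lambda>k. enn2real (\<integral>\<^sup>+ x. ennreal ((norm (f k x - g x))^2) \<partial>\<mu>)) \<longlonglongrightarrow> enn2real 0"
    using assms unfolding L2_lim_def by (intro tendsto_enn2real) auto
  then show "(\<lambda>k. \<integral>x. (norm (f k x - g x))^2 \<partial>\<mu>) \<longlonglongrightarrow> 0" unfolding eq by simp
qed

lemma L2_limD:
  assumes "L2_lim \<mu> f g"
  shows "L2 \<mu> (f k)" "g \<in> borel_measurable \<mu>" "f k \<in> borel_measurable \<mu>"
    "(\<lambda>k. \<integral>\<^sup>+ x. ennreal ((norm (f k x - g x))^2) \<partial>\<mu>) \<longlonglongrightarrow> 0"
  using assms unfolding L2_lim_def L2_def by blast+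

lemma L2_limI:
  assumes "\<And>k. L2 \<mu> (f k)" "g \<in> borel_measurable \<mu>"
    and "\<And>k. (\<integral>\<^sup>+ x. ennreal ((norm (f k x - g x))^2) \<partial>\<mu>) \<le> u k" "u \<longlonglongrightarrow> (0::ennreal)"
  shows "L2_lim \<mu> f g"
  unfolding L2_lim_def
proof (intro conjI allI assms(1,2))
  show "(\<lambda>k. \<integral>\<^sup>+ x. ennreal ((norm (f k x - g x))^2) \<partial>\<mu>) \<longlonglongrightarrow> 0"
    by (rule tendsto_sandwich[OF _ _ tendsto_const assms(4)]) (use assms(3) in auto)
qed

lemma L2_lim_add:
  assumes "L2_lim \<mu> f g" "L2_lim \<mu> f' g'"
  shows "L2_lim \<mu> (\<lambda>k x. f k x + f' k x) (\<lambda>x. g x + g' x)"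
proof -
  have m: "g \<in> borel_measurable \<mu>" "\<And>k. f k \<in> borel_measurable \<mu>" "g' \<in> borel_measurable \<mu>" "\<And>k. f' k \<in> borel_measurable \<mu>"
    using L2_limD(2,3)[OF assms(1)] L2_limD(2,3)[OF assms(2)] by blast+
  show ?thesis
  proof (rule L2_limI)
    show "(\<integral>\<^sup>+ x. ennreal ((norm (f k x + f' k x - (g x + g' x)))^2) \<partial>\<mu>)
      \<le> 2 * (\<integral>\<^sup>+ x. ennreal ((norm (f k x - g x))^2) \<partial>\<mu>) + 2 * (\<integral>\<^sup>+ x. ennreal ((norm (f' k x - g' x))^2) \<partial>\<mu>)" for k
      using nn_norm_add_le[of "\<lambda>x. f k x - g x" \<mu> "\<lambda>x. f' k x - g' x"] m by (simp add: add_diff_add)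
    have "(\<lambda>k. 2 * (\<integral>\<^sup>+ x. ennreal ((norm (f k x - g x))^2) \<partial>\<mu>) + 2 * (\<integral>\<^sup>+ x. ennreal ((norm (f' k x - g' x))^2) \<partial>\<mu>)) \<longlonglongrightarrow> 2 * 0 + 2 * 0"
      by (intro tendsto_add ennreal_tendsto_cmult L2_limD(4)[OF assms(1)] L2_limD(4)[OF assms(2)]) simp_all
    then show "(\<lambda>k. 2 * (\<integral>\<^sup>+ x. ennreal ((norm (f k x - g x))^2) \<partial>\<mu>) + 2 * (\<integral>\<^sup>+ x. ennreal ((norm (f' k x - g' x))^2) \<partial>\<mu>)) \<longlonglongrightarrow> 0" by simp
  qed (use m in \<open>simp_all add: L2_add L2_limD(1)[OF assms(1)] L2_limD(1)[OF assms(2)]\<close>)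
qed

lemma L2_lim_scaleR:
  assumes "L2_lim \<mu> f g"
  shows "L2_lim \<mu> (\<lambda>k x. c *\<^sub>R f k x) (\<lambda>x. c *\<^sub>R g x)"
proof (rule L2_limI)
  have m: "g \<in> borel_measurable \<mu>" "\<And>k. f k \<in> borel_measurable \<mu>"
    using L2_limD(2,3)[OF assms] by blast+
  show "(\<integral>\<^sup>+ x. ennreal ((norm (c *\<^sub>R f k x - c *\<^sub>R g x))^2) \<partial>\<mu>)
      \<le> ennreal (c^2) * (\<integral>\<^sup>+ x. ennreal ((norm (f k x - g x))^2) \<partial>\<mu>)" for k
  proof -
    have "(norm (c *\<^sub>R f k x - c *\<^sub>R g x))^2 = c^2 * (norm (f k x - g x))^2" for x
      unfolding scaleR_diff_right[symmetric] norm_scaleR power_mult_distrib by simp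
    then have "(\<integral>\<^sup>+ x. ennreal ((norm (c *\<^sub>R f k x - c *\<^sub>R g x))^2) \<partial>\<mu>) = (\<integral>\<^sup>+ x. ennreal (c^2) * ennreal ((norm (f k x - g x))^2) \<partial>\<mu>)"
      by (simp add: ennreal_mult)
    also have "\<dots> = ennreal (c^2) * (\<integral>\<^sup>+ x. ennreal ((norm (f k x - g x))^2) \<partial>\<mu>)"
      using m by (intro nn_integral_cmult) auto
    finally show ?thesis by simp
  qed
  have "(\<lambda>k. ennreal (c^2) * (\<integral>\<^sup>+ x. ennreal ((norm (f k x - g x))^2) \<partial>\<mu>)) \<longlonglongrightarrow> ennreal (c^2) * 0"
    by (intro ennreal_tendsto_cmult L2_limD(4)[OF assms]) simp
  then show "(\<lambda>k. ennreal (c^2) * (\<integral>\<^sup>+ x. ennreal ((norm (f k x - g x))^2) \<partial>\<mu>)) \<longlonglongrightarrow> 0" by simp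
qed (use L2_limD[OF assms] in \<open>simp_all add: L2_scaleR\<close>)

lemma L2_lim_const: "L2 \<mu> g \<Longrightarrow> L2_lim \<mu> (\<lambda>k. g) g"
  by (simp add: L2_lim_def L2_def)

lemma L2_lim_diff:
  "L2_lim \<mu> f g \<Longrightarrow> L2_lim \<mu> f' g' \<Longrightarrow> L2_lim \<mu> (\<lambda>k x. f k x - f' k x) (\<lambda>x. g x - g' x)"
  using L2_lim_add[of \<mu> f g "\<lambda>k x. (-1) *\<^sub>R f' k x" "\<lambda>x. (-1) *\<^sub>R g' x"] L2_lim_scaleR[of \<mu> f' g' "-1"] by simp

lemma L2_weighted_integrable:
  assumes "L2 \<mu> f" "y \<in> borel_measurable \<mu>" "\<forall>x\<in>space \<mu>. \<bar>y x\<bar> \<le> B"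
  shows "integrable \<mu> (\<lambda>x. y x * (norm (f x))^2)"
proof (rule Bochner_Integration.integrable_bound)
  show "integrable \<mu> (\<lambda>x. B * (norm (f x))^2)" using assms by (simp add: L2_def)
  show "AE x in \<mu>. norm (y x * (norm (f x))^2) \<le> norm (B * (norm (f x))^2)"
  proof (rule AE_I2)
    fix x assume "x \<in> space \<mu>"
    then have "\<bar>y x\<bar> * (norm (f x))^2 \<le> \<bar>B\<bar> * (norm (f x))^2" using assms(3) by (intro mult_right_mono) auto
    then show "norm (y x * (norm (f x))^2) \<le> norm (B * (norm (f x))^2)"
      unfolding real_norm_def abs_mult by simp
  qed
next
  have "f \<in> borel_measurable \<mu>" using assms by (simp add: L2_def)
  then show "(\<lambda>x. y x * (norm (f x))^2) \<in> borel_measurable \<mu>" using assms(2) by measurable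
qed

text \<open>With \<open>h = norm (f k - g)\<close>, the difference of the squared norms is at most
  \<open>h^2 + 2 * h * norm g\<close>. Young's inequality with a parameter \<open>e k\<close> splits
  the product into \<open>h^2 / e k\<close> and \<open>e k * (norm g)^2\<close>, and both integrals
  vanish if \<open>e k\<close> tends to zero more slowly than the integral of
  \<open>h^2\<close>.\<close>

lemma L2_lim_weighted:
  assumes lim: "L2_lim \<mu> f g" and y: "y \<in> borel_measurable \<mu>" "\<forall>x\<in>space \<mu>. \<bar>y x\<bar> \<le> B"
  shows "(\<lambda>k. \<integral>x. y x * (norm (f k x))^2 \<partial>\<mu>) \<longlonglongrightarrow> (\<integral>x. y x * (norm (g x))^2 \<partial>\<mu>)"
proof -
  have gL: "L2 \<mu> g" and fL: "\<And>k. L2 \<mu> (f k)" using L2_lim_L2[OF lim] L2_limD(1)[OF lim] by blast+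
  define d where "d k = (\<integral>x. (norm (f k x - g x))^2 \<partial>\<mu>)" for k
  have d0: "d \<longlonglongrightarrow> 0" unfolding d_def by (rule L2_lim_real[OF lim])
  have dnn: "0 \<le> d k" for k unfolding d_def by simp
  define a where "a = (\<integral>x. (norm (g x))^2 \<partial>\<mu>)"
  \<comment> \<open>The square root of the distance gives \<open>d k / e k \<le> sqrt (d k)\<close>;
    the added \<open>1 / (real k + 1)\<close> keeps \<open>e k\<close> positive when
    \<open>d k\<close> is zero.\<close>
  define e where "e k = sqrt (d k) + 1 / (real k + 1)" for k
  have epos: "0 < e k" for k unfolding e_def using dnn by (simp add: add_nonneg_pos)
  have e0: "e \<longlonglongrightarrow> 0"
  proof -
    have "e \<longlonglongrightarrow> sqrt 0 + 0" unfolding e_def[abs_def]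
      using LIMSEQ_inverse_real_of_nat d0 by (intro tendsto_add tendsto_real_sqrt) (auto simp: inverse_eq_divide add.commute)
    then show ?thesis by simp
  qed
  have bnd: "\<bar>(\<integral>x. y x * (norm (f k x))^2 \<partial>\<mu>) - (\<integral>x. y x * (norm (g x))^2 \<partial>\<mu>)\<bar> \<le> \<bar>B\<bar> * (d k + sqrt (d k) + e k * a)" for k
  proof -
    let ?h = "\<lambda>x. norm (f k x - g x)"
    have pt: "\<bar>y x * (norm (f k x))^2 - y x * (norm (g x))^2\<bar> \<le> \<bar>B\<bar> * ((1 + 1 / e k) * (?h x)^2 + e k * (norm (g x))^2)"
      if "x \<in> space \<mu>" for x
    proof -
      have h: "\<bar>norm (f k x) - norm (g x)\<bar> \<le> ?h x" by (rule norm_triangle_ineq3)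
      have "\<bar>(norm (f k x))^2 - (norm (g x))^2\<bar> = \<bar>norm (f k x) - norm (g x)\<bar> * (norm (f k x) + norm (g x))"
        by (simp add: power2_eq_square square_diff_square_factored abs_mult)
      also have "\<dots> \<le> ?h x * (?h x + 2 * norm (g x))" using h by (intro mult_mono) auto
      also have "\<dots> = (?h x)^2 + 2 * (?h x * norm (g x))" by (simp add: power2_eq_square algebra_simps)
      also have "2 * (?h x * norm (g x)) \<le> (?h x)^2 / e k + e k * (norm (g x))^2"
      proof -
        have *: "2 * (u * w) \<le> u^2 / c + c * w^2" if "0 < c" for u w c :: real
        proof -
          have "0 \<le> (u - c * w)^2 / c" using that by simp
          also have "\<dots> = u^2 / c + c * w^2 - 2 * (u * w)" using that by (simp add: power2_eq_square field_simps)
          finally show ?thesis by simp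
        qed
        show ?thesis by (rule *[OF epos])
      qed
      finally have 1: "\<bar>(norm (f k x))^2 - (norm (g x))^2\<bar> \<le> (1 + 1 / e k) * (?h x)^2 + e k * (norm (g x))^2"
        by (simp add: algebra_simps)
      have "\<bar>y x * (norm (f k x))^2 - y x * (norm (g x))^2\<bar> = \<bar>y x\<bar> * \<bar>(norm (f k x))^2 - (norm (g x))^2\<bar>"
        by (simp only: right_diff_distrib[symmetric] abs_mult)
      also have "\<dots> \<le> \<bar>B\<bar> * ((1 + 1 / e k) * (?h x)^2 + e k * (norm (g x))^2)"
        using 1 y(2)[rule_format, OF that] by (intro mult_mono) auto
      finally show ?thesis .
    qed
    have i1: "integrable \<mu> (\<lambda>x. y x * (norm (f k x))^2)" "integrable \<mu> (\<lambda>x. y x * (norm (g x))^2)"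
      using L2_weighted_integrable[OF fL y] L2_weighted_integrable[OF gL y] .
    have i2: "integrable \<mu> (\<lambda>x. (?h x)^2)" by (rule L2_lim_real(1)[OF lim])
    have i3: "integrable \<mu> (\<lambda>x. (norm (g x))^2)" using gL by (simp add: L2_def)
    have "\<bar>(\<integral>x. y x * (norm (f k x))^2 \<partial>\<mu>) - (\<integral>x. y x * (norm (g x))^2 \<partial>\<mu>)\<bar>
        = \<bar>\<integral>x. y x * (norm (f k x))^2 - y x * (norm (g x))^2 \<partial>\<mu>\<bar>" using i1 by simp
    also have "\<dots> \<le> (\<integral>x. \<bar>y x * (norm (f k x))^2 - y x * (norm (g x))^2\<bar> \<partial>\<mu>)" by (rule integral_abs_bound)
    also have "\<dots> \<le> (\<integral>x. \<bar>B\<bar> * ((1 + 1 / e k) * (?h x)^2 + e k * (norm (g x))^2) \<partial>\<mu>)"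
      using i1 i2 i3 pt by (intro integral_mono) auto
    also have "\<dots> = \<bar>B\<bar> * ((1 + 1 / e k) * d k + e k * a)" using i2 i3 by (simp add: d_def a_def)
    also have "\<dots> \<le> \<bar>B\<bar> * (d k + sqrt (d k) + e k * a)"
    proof (rule mult_left_mono)
      have "d k / e k \<le> sqrt (d k)"
      proof -
        have "d k = sqrt (d k) * sqrt (d k)" using dnn by simp
        also have "\<dots> \<le> sqrt (d k) * e k" unfolding e_def using dnn by (intro mult_left_mono) auto
        finally show ?thesis using epos[of k] by (simp add: divide_le_eq)
      qed
      then show "(1 + 1 / e k) * d k + e k * a \<le> d k + sqrt (d k) + e k * a" by (simp add: algebra_simps)
    qed simp
    finally show ?thesis .
  qed
  define U where "U k = \<bar>B\<bar> * (d k + sqrt (d k) + e k * a)" for k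
  have "(\<lambda>k. sqrt (d k)) \<longlonglongrightarrow> 0" using tendsto_real_sqrt[OF d0] by simp
  then have "(\<lambda>k. d k + sqrt (d k) + e k * a) \<longlonglongrightarrow> 0 + 0 + 0 * a"
    by (rule tendsto_add[OF tendsto_add[OF d0] tendsto_mult_right[OF e0]])
  then have "U \<longlonglongrightarrow> \<bar>B\<bar> * (0 + 0 + 0 * a)"
    unfolding U_def[abs_def] by (rule tendsto_mult_left)
  then have U0: "U \<longlonglongrightarrow> 0" by simp
  have "\<forall>k. norm ((\<integral>x. y x * (norm (f k x))^2 \<partial>\<mu>) - (\<integral>x. y x * (norm (g x))^2 \<partial>\<mu>)) \<le> U k"
    unfolding U_def real_norm_def using bnd by blast
  from Lim_null_comparison[OF always_eventually[OF this] U0] have "(\<lambda>k. (\<integral>x. y x * (norm (f k x))^2 \<partial>\<mu>) - (\<integral>x. y x * (norm (g x))^2 \<partial>\<mu>)) \<longlonglongrightarrow> 0"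
    .
  then show ?thesis by (rule LIM_zero_cancel)
qed

lemma L2_mult_integrable:
  fixes f g :: "'x \<Rightarrow> real"
  shows "L2 \<mu> f \<Longrightarrow> L2 \<mu> g \<Longrightarrow> integrable \<mu> (\<lambda>x. f x * g x)"
  by (auto simp: L2_def intro: integrable_L2_mult)

text \<open>By polarization the integral of a product is a difference of two squared norms, and
  \<open>L2_lim_weighted\<close> applies to each with weight one.\<close>

lemma L2_lim_mult:
  fixes Z :: "'x \<Rightarrow> real"
  assumes lim: "L2_lim \<mu> f g" and Z: "L2 \<mu> Z"
  shows "(\<lambda>k. \<integral>x. Z x * f k x \<partial>\<mu>) \<longlonglongrightarrow> (\<integral>x. Z x * g x \<partial>\<mu>)"
proof -
  have eq: "(\<integral>x. Z x * h x \<partial>\<mu>) = ((\<integral>x. 1 * (norm (h x + Z x))^2 \<partial>\<mu>) - (\<integral>x. 1 * (norm (h x - Z x))^2 \<partial>\<mu>)) / 4"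
    if "L2 \<mu> h" for h
  proof -
    have "integrable \<mu> (\<lambda>x. (norm (h x + Z x))^2)" "integrable \<mu> (\<lambda>x. (norm (h x - Z x))^2)"
      using L2_add[OF that Z] L2_diff[OF that Z] by (auto simp: L2_def)
    then have "(\<integral>x. (norm (h x + Z x))^2 \<partial>\<mu>) - (\<integral>x. (norm (h x - Z x))^2 \<partial>\<mu>)
        = (\<integral>x. (norm (h x + Z x))^2 - (norm (h x - Z x))^2 \<partial>\<mu>)" by simp
    also have "(\<lambda>x. (norm (h x + Z x))^2 - (norm (h x - Z x))^2) = (\<lambda>x. 4 * (Z x * h x))"
      by (rule ext) (simp add: power2_sum power2_diff)
    finally show ?thesis by simp
  qed
  have fL: "L2 \<mu> (f k)" for k using lim unfolding L2_lim_def by blast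
  have one: "(\<lambda>_. 1::real) \<in> borel_measurable \<mu>" "\<forall>x\<in>space \<mu>. \<bar>1::real\<bar> \<le> 1" by auto
  note A1 = L2_lim_weighted[OF L2_lim_add[OF lim L2_lim_const[OF Z]] one]
  note A2 = L2_lim_weighted[OF L2_lim_diff[OF lim L2_lim_const[OF Z]] one]
  have "(\<lambda>k. ((\<integral>x. 1 * (norm (f k x + Z x))^2 \<partial>\<mu>) - (\<integral>x. 1 * (norm (f k x - Z x))^2 \<partial>\<mu>)) / 4)
     \<longlonglongrightarrow> ((\<integral>x. 1 * (norm (g x + Z x))^2 \<partial>\<mu>) - (\<integral>x. 1 * (norm (g x - Z x))^2 \<partial>\<mu>)) / 4"
    by (intro tendsto_divide tendsto_diff tendsto_const A1 A2) simp
  then show ?thesis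
    by (simp only: eq[OF L2_lim_L2[OF lim]] eq[OF fL])
qed

section \<open>Ito integrals as limits\<close>

text \<open>The integrand becomes a single function on the product of time and probability space, so
  that both convergences in the construction of the Ito integral are instances of
  \<open>L2_lim\<close>.\<close>

definition time_cut :: "real \<Rightarrow> (real \<Rightarrow> 'a \<Rightarrow> 'b::real_vector) \<Rightarrow> real \<times> 'a \<Rightarrow> 'b" where
  "time_cut T H x = indicator {0..T} (fst x) *\<^sub>R H (fst x) (snd x)"

definition grid :: "real \<Rightarrow> nat \<Rightarrow> nat \<Rightarrow> real" where
  "grid T n i = T * real i / real n"

lemma grid_mono: "0 \<le> T \<Longrightarrow> i \<le> j \<Longrightarrow> grid T n i \<le> grid T n j"
  unfolding grid_def by (intro divide_right_mono mult_left_mono) auto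

lemma grid_0 [simp]: "grid T n 0 = 0" by (simp add: grid_def)

lemma grid_end: "0 < n \<Longrightarrow> grid T n n = T" by (simp add: grid_def)

lemma grid_nonneg: "0 \<le> T \<Longrightarrow> 0 \<le> grid T n i" by (simp add: grid_def)

lemma grid_le: assumes "0 \<le> T" "i \<le> n" shows "grid T n i \<le> T"
proof (cases "n = 0")
  case False
  have "grid T n i \<le> grid T n n" by (rule grid_mono[OF assms])
  then show ?thesis using False by (simp add: grid_end)
qed (use assms in \<open>simp add: grid_def\<close>)

lemma grid_step: "grid T n (Suc i) - grid T n i = T / real n"
  by (simp add: grid_def add_divide_distrib distrib_left)

lemma grid_strict: "0 < T \<Longrightarrow> i < n \<Longrightarrow> grid T n i < grid T n (Suc i)"
  using grid_step[of T n i] by (smt (verit) divide_pos_pos of_nat_0_less_iff not_less_zero zero_less_iff_neq_zero)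

section \<open>Integrands on the product space and the closure of the elementary integrals\<close>

context brownian
begin

interpretation LP: pair_sigma_finite lborel M
  by unfold_locales

lemma sets_P: "sets (lborel \<Otimes>\<^sub>M M) = sets (borel \<Otimes>\<^sub>M M)"
  by (rule sets_pair_measure_cong) simp_all

lemma measurable_P: "borel_measurable (lborel \<Otimes>\<^sub>M M) = borel_measurable (borel \<Otimes>\<^sub>M M)"
  by (rule measurable_cong_sets[OF sets_P refl])

text \<open>Tonelli identifies the iterated integral with a squared norm on the product
  space.\<close>

lemma sq_norm_time_cut:
  fixes H :: "real \<Rightarrow> 'a \<Rightarrow> 'b::euclidean_space"
  assumes "time_cut T H \<in> borel_measurable (lborel \<Otimes>\<^sub>M M)"
  shows "sq_norm_upto M T H = (\<integral>\<^sup>+ x. ennreal ((norm (time_cut T H x))^2) \<partial>(lborel \<Otimes>\<^sub>M M))"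
proof -
  have "(\<integral>\<^sup>+ x. ennreal ((norm (time_cut T H x))^2) \<partial>(lborel \<Otimes>\<^sub>M M))
      = (\<integral>\<^sup>+ \<omega>. (\<integral>\<^sup>+ s. ennreal ((norm (time_cut T H (s, \<omega>)))^2) \<partial>lborel) \<partial>M)"
    by (intro LP.nn_integral_snd[symmetric] measurable_compose[OF assms, of "\<lambda>y. ennreal ((norm y)^2)"]) measurable
  also have "\<dots> = sq_norm_upto M T H"
    unfolding sq_norm_upto_def
    by (intro nn_integral_cong) (auto simp: time_cut_def indicator_def)
  finally show ?thesis by simp
qed

definition path_L2 :: "(real \<Rightarrow> 'a \<Rightarrow> 'b::euclidean_space) \<Rightarrow> bool" where
  "path_L2 H \<longleftrightarrow> (\<forall>T\<ge>0. L2 (lborel \<Otimes>\<^sub>M M) (time_cut T H))"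

lemma path_L2_I:
  assumes "\<And>T. 0 \<le> T \<Longrightarrow> time_cut T H \<in> borel_measurable (lborel \<Otimes>\<^sub>M M)" "\<And>T. 0 \<le> T \<Longrightarrow> sq_norm_upto M T H < \<infinity>"
  shows "path_L2 H"
  unfolding path_L2_def
proof (intro allI impI L2_I assms(1))
  fix T :: real assume T: "0 \<le> T"
  show "(\<integral>\<^sup>+ x. ennreal ((norm (time_cut T H x))^2) \<partial>(lborel \<Otimes>\<^sub>M M)) < \<infinity>"
    using assms(2)[OF T] sq_norm_time_cut[OF assms(1)[OF T]] by simp
qed

lemma time_cut_add: "time_cut T (\<lambda>s \<omega>. H s \<omega> + H' s \<omega>) = (\<lambda>x. time_cut T H x + time_cut T H' x)"
  by (auto simp: time_cut_def scaleR_add_right)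

lemma time_cut_diff: "time_cut T (\<lambda>s \<omega>. H s \<omega> - H' s \<omega>) = (\<lambda>x. time_cut T H x - time_cut T H' x)"
  by (auto simp: time_cut_def scaleR_diff_right)

lemma time_cut_scaleR: "time_cut T (\<lambda>s \<omega>. c *\<^sub>R H s \<omega>) = (\<lambda>x. c *\<^sub>R time_cut T H x)"
  by (auto simp: time_cut_def)

text \<open>Fubini with a weight. The weighted energy over a time interval becomes a weighted
  squared norm on the product space, the form in which it passes to the limit. If \<open>T\<close>
  is negative the interval is empty and all terms vanish.\<close>

lemma path_L2_integrals:
  fixes H :: "real \<Rightarrow> 'a \<Rightarrow> 'b::euclidean_space"
  assumes H: "path_L2 H" and st: "0 \<le> s" "t \<le> T" and Y: "Y \<in> borel_measurable M" "\<forall>\<omega>\<in>space M. \<bar>Y \<omega>\<bar> \<le> B"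
  shows "integrable (lborel \<Otimes>\<^sub>M M) (\<lambda>x. (Y (snd x) * indicator {s..t} (fst x)) * (norm (time_cut T H x))^2)"
    and "integrable M (\<lambda>\<omega>. Y \<omega> * (LINT r:{s..t}|lborel. (norm (H r \<omega>))^2))"
    and "expectation (\<lambda>\<omega>. Y \<omega> * (LINT r:{s..t}|lborel. (norm (H r \<omega>))^2))
       = (\<integral>x. (Y (snd x) * indicator {s..t} (fst x)) * (norm (time_cut T H x))^2 \<partial>(lborel \<Otimes>\<^sub>M M))"
proof -
  consider (neg) "T < 0" | (pos) "0 \<le> T" by linarith
  then have "integrable (lborel \<Otimes>\<^sub>M M) (\<lambda>x. (Y (snd x) * indicator {s..t} (fst x)) * (norm (time_cut T H x))^2) \<and>
    integrable M (\<lambda>\<omega>. Y \<omega> * (LINT r:{s..t}|lborel. (norm (H r \<omega>))^2)) \<and>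
    expectation (\<lambda>\<omega>. Y \<omega> * (LINT r:{s..t}|lborel. (norm (H r \<omega>))^2))
       = (\<integral>x. (Y (snd x) * indicator {s..t} (fst x)) * (norm (time_cut T H x))^2 \<partial>(lborel \<Otimes>\<^sub>M M))"
  proof cases
    case neg
    then have "indicator {s..t} r = (0::real)" for r using st by (auto simp: indicator_def)
    then show ?thesis by (simp add: set_lebesgue_integral_def)
  next
    case pos
    have L: "L2 (lborel \<Otimes>\<^sub>M M) (time_cut T H)" using H pos by (simp add: path_L2_def)
    have ym: "(\<lambda>x. Y (snd x) * indicator {s..t} (fst x)) \<in> borel_measurable (lborel \<Otimes>\<^sub>M M)"
      using Y(1) by measurable
    have yb: "\<forall>x\<in>space (lborel \<Otimes>\<^sub>M M). \<bar>Y (snd x) * indicator {s..t} (fst x)\<bar> \<le> B"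
      using Y(2) by (auto simp: space_pair_measure indicator_def intro: order_trans[OF abs_ge_zero])
    have int: "integrable (lborel \<Otimes>\<^sub>M M) (\<lambda>x. (Y (snd x) * indicator {s..t} (fst x)) * (norm (time_cut T H x))^2)"
      by (rule L2_weighted_integrable[OF L ym yb])
    have eq: "(\<integral>r. Y \<omega> * indicator {s..t} r * (norm (time_cut T H (r, \<omega>)))^2 \<partial>lborel)
        = Y \<omega> * (LINT r:{s..t}|lborel. (norm (H r \<omega>))^2)" for \<omega>
    proof -
      have "Y \<omega> * indicator {s..t} r * (norm (time_cut T H (r, \<omega>)))^2
          = Y \<omega> * (indicator {s..t} r *\<^sub>R (norm (H r \<omega>))^2)" for r
        using st by (auto simp: time_cut_def indicator_def)
      then show ?thesis by (simp only: set_lebesgue_integral_def integral_mult_right_zero)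
    qed
    have int': "integrable (lborel \<Otimes>\<^sub>M M) (case_prod (\<lambda>r \<omega>. Y \<omega> * indicator {s..t} r * (norm (time_cut T H (r, \<omega>)))^2))"
      using int by (simp add: case_prod_beta')
    show ?thesis
      using int LP.integrable_snd[OF int'] LP.integral_snd[OF int'] unfolding eq by (simp add: case_prod_beta')
  qed
  then show "integrable (lborel \<Otimes>\<^sub>M M) (\<lambda>x. (Y (snd x) * indicator {s..t} (fst x)) * (norm (time_cut T H x))^2)"
    and "integrable M (\<lambda>\<omega>. Y \<omega> * (LINT r:{s..t}|lborel. (norm (H r \<omega>))^2))"
    and "expectation (\<lambda>\<omega>. Y \<omega> * (LINT r:{s..t}|lborel. (norm (H r \<omega>))^2))
       = (\<integral>x. (Y (snd x) * indicator {s..t} (fst x)) * (norm (time_cut T H x))^2 \<partial>(lborel \<Otimes>\<^sub>M M))"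
    by blast+
qed

lemma path_L2_AE:
  fixes H :: "real \<Rightarrow> 'a \<Rightarrow> 'b::euclidean_space"
  assumes H: "path_L2 H" and T: "0 \<le> T"
  shows "AE \<omega> in M. set_integrable lborel {0..T} (\<lambda>r. (norm (H r \<omega>))^2)"
proof -
  have "integrable (lborel \<Otimes>\<^sub>M M) (\<lambda>x. (norm (time_cut T H x))^2)"
    using H T by (simp add: path_L2_def L2_def)
  then have int: "integrable (lborel \<Otimes>\<^sub>M M) (case_prod (\<lambda>r \<omega>. (norm (time_cut T H (r, \<omega>)))^2))"
    by (simp add: case_prod_beta')
  have eq: "(\<lambda>r. (norm (time_cut T H (r, \<omega>)))^2) = (\<lambda>r. indicator {0..T} r *\<^sub>R (norm (H r \<omega>))^2)" for \<omega>
    by (auto simp: time_cut_def indicator_def)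
  show ?thesis using LP.AE_integrable_snd[OF int] unfolding eq set_integrable_def .
qed

lemma elementary_path_L2:
  assumes "elementary S J H" shows "path_L2 H"
  unfolding path_L2_def
proof (intro allI impI)
  fix T :: real assume "0 \<le> T"
  obtain C where C: "\<forall>s. \<forall>\<omega>\<in>space M. norm (H s \<omega>) \<le> C" using elementary_simps(3)[OF assms] by blast
  have Hm: "(\<lambda>x::real \<times> 'a. H (fst x) (snd x)) \<in> borel_measurable ((lborel :: real measure) \<Otimes>\<^sub>M M)"
    using elementary_simps(2)[OF assms] unfolding measurable_P .
  have m: "time_cut T H \<in> borel_measurable ((lborel :: real measure) \<Otimes>\<^sub>M M)"
    unfolding time_cut_def[abs_def] using Hm by measurable
  show "L2 ((lborel :: real measure) \<Otimes>\<^sub>M M) (time_cut T H)"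
    unfolding L2_def
  proof
    show "integrable ((lborel :: real measure) \<Otimes>\<^sub>M M) (\<lambda>x. (norm (time_cut T H x))^2)"
    proof (rule Bochner_Integration.integrable_bound)
      have "{0..T} \<times> space M \<in> sets ((lborel :: real measure) \<Otimes>\<^sub>M M)" by (intro pair_measureI) auto
      moreover have "emeasure ((lborel :: real measure) \<Otimes>\<^sub>M M) ({0..T} \<times> space M) < \<infinity>"
        using \<open>0 \<le> T\<close> by (subst emeasure_pair_measure_Times) (auto simp: emeasure_space_1)
      ultimately have "integrable ((lborel :: real measure) \<Otimes>\<^sub>M M) (indicat_real ({0..T} \<times> space M))"
        by (rule integrable_real_indicator)
      then show "integrable ((lborel :: real measure) \<Otimes>\<^sub>M M) (\<lambda>x. C^2 * indicat_real ({0..T} \<times> space M) x)" by simp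
      show "AE x in (lborel :: real measure) \<Otimes>\<^sub>M M. norm ((norm (time_cut T H x))^2) \<le> norm (C^2 * indicat_real ({0..T} \<times> space M) x)"
      proof (rule AE_I2)
        fix x assume "x \<in> space ((lborel :: real measure) \<Otimes>\<^sub>M M)"
        then have x: "snd x \<in> space M" by (auto simp: space_pair_measure)
        then have "(norm (H (fst x) (snd x)))^2 \<le> C^2" using C by (intro power_mono) auto
        then show "norm ((norm (time_cut T H x))^2) \<le> norm (C^2 * indicat_real ({0..T} \<times> space M) x)"
          using x by (cases x) (simp add: time_cut_def indicator_def)
      qed
    qed (use m in measurable)
  qed (rule m)
qed

lemma elementary_zero: assumes "elementary S J H" "\<omega> \<in> space M" shows "J 0 \<omega> = 0"
  using assms by (simp add: elementary_def)

lemma elementary_L2_values: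
  assumes el: "elementary S J H" and t: "0 \<le> t" shows "L2 M (J t)"
proof (cases "t = 0")
  case True
  have "integrable M (\<lambda>\<omega>. (norm (J 0 \<omega>))^2) \<longleftrightarrow> integrable M (\<lambda>\<omega>. 0::real)"
    by (rule Bochner_Integration.integrable_cong) (simp_all add: elementary_zero[OF el])
  then show ?thesis using True elementary_measurable(2)[OF el t] by (simp add: L2_def)
next
  case False
  then have "integrable M (\<lambda>\<omega>. (J t \<omega> - J 0 \<omega>)^2)" using elementary_L2[OF el, of 0 t] t by simp
  moreover have "integrable M (\<lambda>\<omega>. (J t \<omega> - J 0 \<omega>)^2) \<longleftrightarrow> integrable M (\<lambda>\<omega>. (norm (J t \<omega>))^2)"
    by (rule Bochner_Integration.integrable_cong) (simp_all add: elementary_zero[OF el])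
  ultimately show ?thesis using elementary_measurable(2)[OF el t] by (simp add: L2_def)
qed

text \<open>The closure of the elementary integrals: \<open>N\<close> is the integral of \<open>H\<close>. Unlike
  \<^const>\<open>ito_integral\<close>, this class is visibly closed under linear combinations.\<close>

definition ito_limit :: "(real \<Rightarrow> 'a \<Rightarrow> real) \<Rightarrow> (real \<Rightarrow> 'a \<Rightarrow> real^'d) \<Rightarrow> bool" where
  "ito_limit N H \<longleftrightarrow> (\<forall>t\<ge>0. N t \<in> borel_measurable (F t)) \<and>
     (\<exists>S J E. (\<forall>k. elementary (S k) (J k) (E k)) \<and>
        (\<forall>T\<ge>0. L2_lim (lborel \<Otimes>\<^sub>M M) (\<lambda>k. time_cut T (E k)) (time_cut T H) \<and> L2_lim M (\<lambda>k. J k T) (N T)))"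

lemma ito_limitE:
  assumes "ito_limit N H"
  obtains S J E where "\<And>k. elementary (S k) (J k) (E k)"
    "\<And>T. 0 \<le> T \<Longrightarrow> L2_lim (lborel \<Otimes>\<^sub>M M) (\<lambda>k. time_cut T (E k)) (time_cut T H)"
    "\<And>T. 0 \<le> T \<Longrightarrow> L2_lim M (\<lambda>k. J k T) (N T)"
  using assms unfolding ito_limit_def by blast

lemma ito_limit_measurable:
  assumes "ito_limit N H" "0 \<le> t" shows "N t \<in> borel_measurable (F t)" "N t \<in> borel_measurable M"
  using assms measurable_F_M unfolding ito_limit_def by blast+

lemma ito_limit_path_L2: assumes "ito_limit N H" shows "path_L2 H"
  by (rule ito_limitE[OF assms]) (auto simp: path_L2_def intro: L2_lim_L2)

lemma ito_limit_L2: assumes "ito_limit N H" "0 \<le> t" shows "L2 M (N t)"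
  by (rule ito_limitE[OF assms(1)]) (use assms(2) in \<open>auto intro: L2_lim_L2\<close>)

lemma ito_limit_elementary: assumes "elementary S J H" shows "ito_limit J H"
proof -
  have "L2_lim M (\<lambda>k. J T) (J T)" if "0 \<le> T" for T
    using elementary_L2_values[OF assms that] by (rule L2_lim_const)
  moreover have "L2_lim (lborel \<Otimes>\<^sub>M M) (\<lambda>k. time_cut T H) (time_cut T H)" if "0 \<le> T" for T
    using elementary_path_L2[OF assms] that unfolding path_L2_def by (intro L2_lim_const) blast
  ultimately show ?thesis
    unfolding ito_limit_def using elementary_measurable(1)[OF assms] assms
    by (intro conjI exI[of _ "\<lambda>_. S"] exI[of _ "\<lambda>_. J"] exI[of _ "\<lambda>_. H"] allI impI)
qed

lemma ito_limit_add:
  assumes "ito_limit N H" "ito_limit N' H'"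
  shows "ito_limit (\<lambda>t \<omega>. N t \<omega> + N' t \<omega>) (\<lambda>s \<omega>. H s \<omega> + H' s \<omega>)"
proof -
  obtain S J E where 1: "\<And>k. elementary (S k) (J k) (E k)"
    "\<And>T. 0 \<le> T \<Longrightarrow> L2_lim (lborel \<Otimes>\<^sub>M M) (\<lambda>k. time_cut T (E k)) (time_cut T H)"
    "\<And>T. 0 \<le> T \<Longrightarrow> L2_lim M (\<lambda>k. J k T) (N T)" by (rule ito_limitE[OF assms(1)]) (rule that)
  obtain S' J' E' where 2: "\<And>k. elementary (S' k) (J' k) (E' k)"
    "\<And>T. 0 \<le> T \<Longrightarrow> L2_lim (lborel \<Otimes>\<^sub>M M) (\<lambda>k. time_cut T (E' k)) (time_cut T H')"
    "\<And>T. 0 \<le> T \<Longrightarrow> L2_lim M (\<lambda>k. J' k T) (N' T)" by (rule ito_limitE[OF assms(2)]) (rule that)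
  have "\<forall>k. elementary (S k \<union> S' k) (\<lambda>t \<omega>. J k t \<omega> + J' k t \<omega>) (\<lambda>s \<omega>. E k s \<omega> + E' k s \<omega>)"
    using elementary_add[OF 1(1) 2(1)] by blast
  moreover have "\<forall>T\<ge>0. L2_lim (lborel \<Otimes>\<^sub>M M) (\<lambda>k. time_cut T (\<lambda>s \<omega>. E k s \<omega> + E' k s \<omega>)) (time_cut T (\<lambda>s \<omega>. H s \<omega> + H' s \<omega>)) \<and>
     L2_lim M (\<lambda>k \<omega>. J k T \<omega> + J' k T \<omega>) (\<lambda>\<omega>. N T \<omega> + N' T \<omega>)"
    unfolding time_cut_add using L2_lim_add[OF 1(2) 2(2)] L2_lim_add[OF 1(3) 2(3)] by blast
  moreover have "\<forall>t\<ge>0. (\<lambda>\<omega>. N t \<omega> + N' t \<omega>) \<in> borel_measurable (F t)"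
    using ito_limit_measurable(1)[OF assms(1)] ito_limit_measurable(1)[OF assms(2)] by (intro allI impI borel_measurable_add)
  ultimately show ?thesis unfolding ito_limit_def by (intro conjI exI) assumption+
qed

lemma ito_limit_scale:
  assumes "ito_limit N H"
  shows "ito_limit (\<lambda>t \<omega>. c * N t \<omega>) (\<lambda>s \<omega>. c *\<^sub>R H s \<omega>)"
proof -
  obtain S J E where 1: "\<And>k. elementary (S k) (J k) (E k)"
    "\<And>T. 0 \<le> T \<Longrightarrow> L2_lim (lborel \<Otimes>\<^sub>M M) (\<lambda>k. time_cut T (E k)) (time_cut T H)"
    "\<And>T. 0 \<le> T \<Longrightarrow> L2_lim M (\<lambda>k. J k T) (N T)" by (rule ito_limitE[OF assms(1)]) (rule that)
  have "\<forall>k. elementary (S k) (\<lambda>t \<omega>. c * J k t \<omega>) (\<lambda>s \<omega>. c *\<^sub>R E k s \<omega>)"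
    using elementary_scale[OF 1(1)] by blast
  moreover have "\<forall>T\<ge>0. L2_lim (lborel \<Otimes>\<^sub>M M) (\<lambda>k. time_cut T (\<lambda>s \<omega>. c *\<^sub>R E k s \<omega>)) (time_cut T (\<lambda>s \<omega>. c *\<^sub>R H s \<omega>)) \<and>
     L2_lim M (\<lambda>k \<omega>. c * J k T \<omega>) (\<lambda>\<omega>. c * N T \<omega>)"
    unfolding time_cut_scaleR using L2_lim_scaleR[OF 1(2)] L2_lim_scaleR[OF 1(3), where c = c] by simp
  moreover have "\<forall>t\<ge>0. (\<lambda>\<omega>. c * N t \<omega>) \<in> borel_measurable (F t)"
    using ito_limit_measurable(1)[OF assms(1)] by (intro allI impI borel_measurable_times) auto
  ultimately show ?thesis unfolding ito_limit_def by (intro conjI exI) assumption+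
qed

lemma ito_limit_increment_L2:
  assumes "ito_limit N H" "0 \<le> s" "s \<le> t" shows "L2 M (\<lambda>\<omega>. N t \<omega> - N s \<omega>)"
  using assms by (intro L2_diff ito_limit_L2) auto

text \<open>The identity holds for the approximating elementary integrals, and the expectation of a
  product with a fixed square-integrable \<open>Z\<close> is continuous for L2 convergence.\<close>

lemma ito_limit_martingale:
  assumes N: "ito_limit N H" and st: "0 \<le> s" "s < t" and Z: "Z \<in> borel_measurable (F s)" "L2 M Z"
  shows "expectation (\<lambda>\<omega>. Z \<omega> * (N t \<omega> - N s \<omega>)) = 0"
proof -
  obtain S J E where 1: "\<And>k. elementary (S k) (J k) (E k)"
    "\<And>T. 0 \<le> T \<Longrightarrow> L2_lim M (\<lambda>k. J k T) (N T)" by (rule ito_limitE[OF N]) (rule that)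
  have "(\<lambda>k. expectation (\<lambda>\<omega>. Z \<omega> * (J k t \<omega> - J k s \<omega>))) \<longlonglongrightarrow> expectation (\<lambda>\<omega>. Z \<omega> * (N t \<omega> - N s \<omega>))"
    using st by (intro L2_lim_mult[OF L2_lim_diff Z(2)] 1(2)) auto
  moreover have "expectation (\<lambda>\<omega>. Z \<omega> * (J k t \<omega> - J k s \<omega>)) = 0" for k
    using elementary_L2[OF 1(1) st, of k] Z unfolding L2_def by simp
  ultimately show ?thesis by (simp add: LIMSEQ_const_iff)
qed

text \<open>Both sides of the elementary isometry converge as weighted squared norms, the left one
  on the probability space, the right one on the product space after Fubini.\<close>

lemma ito_limit_isometry:
  assumes N: "ito_limit N H" and st: "0 \<le> s" "s < t"
    and Y: "Y \<in> borel_measurable (F s)" "\<forall>\<omega>\<in>space M. \<bar>Y \<omega>\<bar> \<le> B"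
  shows "expectation (\<lambda>\<omega>. Y \<omega> * (N t \<omega> - N s \<omega>)^2)
     = expectation (\<lambda>\<omega>. Y \<omega> * (LINT r:{s..t}|lborel. (norm (H r \<omega>))^2))"
proof -
  obtain S J E where 1: "\<And>k. elementary (S k) (J k) (E k)"
    "\<And>T. 0 \<le> T \<Longrightarrow> L2_lim (lborel \<Otimes>\<^sub>M M) (\<lambda>k. time_cut T (E k)) (time_cut T H)"
    "\<And>T. 0 \<le> T \<Longrightarrow> L2_lim M (\<lambda>k. J k T) (N T)" by (rule ito_limitE[OF N]) (rule that)
  have YM: "Y \<in> borel_measurable M" by (rule measurable_F_M[OF Y(1)])
  have t0: "0 \<le> t" using st by simp
  have A: "(\<lambda>k. expectation (\<lambda>\<omega>. Y \<omega> * (norm (J k t \<omega> - J k s \<omega>))^2)) \<longlonglongrightarrow> expectation (\<lambda>\<omega>. Y \<omega> * (norm (N t \<omega> - N s \<omega>))^2)"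
    by (rule L2_lim_weighted[OF L2_lim_diff[OF 1(3)[OF t0] 1(3)[OF st(1)]] YM Y(2)])
  let ?y = "\<lambda>x. Y (snd x) * indicator {s..t} (fst x)"
  have ym: "?y \<in> borel_measurable (lborel \<Otimes>\<^sub>M M)" using YM by measurable
  have yb: "\<forall>x\<in>space (lborel \<Otimes>\<^sub>M M). \<bar>?y x\<bar> \<le> B"
    using Y(2) by (auto simp: space_pair_measure indicator_def intro: order_trans[OF abs_ge_zero])
  have B: "(\<lambda>k. \<integral>x. ?y x * (norm (time_cut t (E k) x))^2 \<partial>(lborel \<Otimes>\<^sub>M M)) \<longlonglongrightarrow> (\<integral>x. ?y x * (norm (time_cut t H x))^2 \<partial>(lborel \<Otimes>\<^sub>M M))"
    by (rule L2_lim_weighted[OF 1(2)[OF t0] ym yb])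
  have "expectation (\<lambda>\<omega>. Y \<omega> * (norm (J k t \<omega> - J k s \<omega>))^2) = (\<integral>x. ?y x * (norm (time_cut t (E k) x))^2 \<partial>(lborel \<Otimes>\<^sub>M M))" for k
  proof -
    have "expectation (\<lambda>\<omega>. Y \<omega> * (J k t \<omega> - J k s \<omega>)^2)
        = expectation (\<lambda>\<omega>. Y \<omega> * (LINT r:{s..t}|lborel. (norm (E k r \<omega>))^2))"
      by (rule elementary_L2[OF 1(1) st, THEN conjunct2, THEN conjunct2, THEN spec, THEN spec, THEN mp, THEN mp, OF Y])
    also have "\<dots> = (\<integral>x. ?y x * (norm (time_cut t (E k) x))^2 \<partial>(lborel \<Otimes>\<^sub>M M))"
      by (rule path_L2_integrals(3)[OF elementary_path_L2[OF 1(1)] st(1) order_refl YM Y(2)])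
    finally show ?thesis by simp
  qed
  then have "expectation (\<lambda>\<omega>. Y \<omega> * (norm (N t \<omega> - N s \<omega>))^2) = (\<integral>x. ?y x * (norm (time_cut t H x))^2 \<partial>(lborel \<Otimes>\<^sub>M M))"
    using A B LIMSEQ_unique by simp
  also have "\<dots> = expectation (\<lambda>\<omega>. Y \<omega> * (LINT r:{s..t}|lborel. (norm (H r \<omega>))^2))"
    by (rule path_L2_integrals(3)[OF ito_limit_path_L2[OF N] st(1) order_refl YM Y(2), symmetric])
  finally show ?thesis by simp
qed

end

lemma set_integral_grid:
  fixes f :: "real \<Rightarrow> 'b::euclidean_space"
  assumes f: "set_integrable lborel {0..T} f" and T: "0 \<le> T" and m: "m \<le> n"
  shows "(\<Sum>i<m. LINT r:{grid T n i..grid T n (Suc i)}|lborel. f r) = (LINT r:{0..grid T n m}|lborel. f r)"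
  using m
proof (induction m)
  \<comment> \<open>The empty sum has to be matched with an integral over the single point
    0.\<close>
  case 0
  have "(LINT r:{0..grid T n 0}|lborel. f r) = (LINT r:{}|lborel. f r)"
    unfolding set_lebesgue_integral_def
  proof (rule integral_cong_AE)
    show "AE x in lborel. indicat_real {0..grid T n 0} x *\<^sub>R f x = indicat_real {} x *\<^sub>R f x"
      using AE_lborel_singleton[of 0] by eventually_elim (auto simp: indicator_def)
    have "set_integrable lborel {0..grid T n 0} f" by (rule set_integrable_subset[OF f]) (use T in auto)
    then show "(\<lambda>x. indicat_real {0..grid T n 0} x *\<^sub>R f x) \<in> borel_measurable lborel"
      unfolding set_integrable_def by (rule borel_measurable_integrable)
  qed simp
  then show ?case by (simp add: set_lebesgue_integral_def)
next
  case (Suc m)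
  have "set_integrable lborel {0..grid T n (Suc m)} f"
    by (rule set_integrable_subset[OF f]) (use grid_le[OF T Suc.prems] in auto)
  from set_integral_split[OF this, of "grid T n m"]
  have "(LINT r:{0..grid T n (Suc m)}|lborel. f r)
      = (LINT r:{0..grid T n m}|lborel. f r) + (LINT r:{grid T n m..grid T n (Suc m)}|lborel. f r)"
    using grid_nonneg[OF T] grid_mono[OF T] by simp
  then show ?case using Suc by simp
qed

section \<open>Ito integrals as limits of elementary ones, and their energy on a grid\<close>

context brownian
begin

text \<open>Clamping the time to \<open>{0..T}\<close> leads into the space on which progressive
  measurability is given, and changes nothing where the indicator is nonzero.\<close>

lemma progressive_time_cut:
  fixes H :: "real \<Rightarrow> 'a \<Rightarrow> 'b::euclidean_space"
  assumes H: "progressively_measurable F H" and T: "0 \<le> T"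
  shows "time_cut T H \<in> borel_measurable (lborel \<Otimes>\<^sub>M M)"
proof -
  let ?c = "\<lambda>x::real \<times> 'a. (min T (max 0 (fst x)), snd x)"
  have c1: "(\<lambda>x::real \<times> 'a. min T (max 0 (fst x))) \<in> measurable (borel \<Otimes>\<^sub>M M) (restrict_space borel {0..T})"
    by (rule measurable_restrict_space2) (use T in auto)
  have "id \<in> measurable M (F T)"
    by (rule measurableI) (use F_subset[of T] in auto)
  then have c2: "(\<lambda>x::real \<times> 'a. snd x) \<in> measurable (borel \<Otimes>\<^sub>M M) (F T)"
    using measurable_compose[OF measurable_snd, of id M "F T"] by simp
  have "?c \<in> measurable (borel \<Otimes>\<^sub>M M) (restrict_space borel {0..T} \<Otimes>\<^sub>M F T)"
    by (rule measurable_Pair[OF c1 c2])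
  from measurable_compose[OF this H[unfolded progressively_measurable_def, rule_format, OF T]]
  have *: "(\<lambda>x. H (min T (max 0 (fst x))) (snd x)) \<in> borel_measurable (borel \<Otimes>\<^sub>M M)" by simp
  have "time_cut T H = (\<lambda>x. indicator {0..T} (fst x) *\<^sub>R H (min T (max 0 (fst x))) (snd x))"
    by (auto simp: time_cut_def indicator_def fun_eq_iff)
  then show ?thesis using * unfolding measurable_P by simp
qed

lemma M2_process_path_L2:
  fixes H :: "real \<Rightarrow> 'a \<Rightarrow> 'b::euclidean_space"
  assumes "M2_process M F H" shows "path_L2 H"
proof (rule path_L2_I)
  show "time_cut T H \<in> borel_measurable (lborel \<Otimes>\<^sub>M M)" if "0 \<le> T" for T
    using progressive_time_cut that assms unfolding M2_process_def by blast
  show "sq_norm_upto M T H < \<infinity>" if "0 \<le> T" for T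
  proof -
    \<comment> \<open>\<open>M2_process\<close> speaks of positive horizons only; passing to
      \<open>T + 1\<close> covers \<open>T = 0\<close>.\<close>
    have "sq_norm_upto M T H \<le> sq_norm_upto M (T + 1) H"
      unfolding sq_norm_upto_def
      by (intro nn_integral_mono mult_left_mono) (auto simp: indicator_def)
    also have "\<dots> < \<infinity>" using assms that unfolding M2_process_def by auto
    finally show ?thesis .
  qed
qed

text \<open>The two convergences required by \<open>ito_integral\<close> are the two required here,
  once the one for the integrands is read on the product space.\<close>

lemma ito_limit_ito_integral:
  assumes I: "ito_integral M F W H I" shows "ito_limit I H"
proof -
  obtain n \<tau> \<xi> where si: "\<forall>k. simple_integrand F (n k) (\<tau> k) (\<xi> k)"
    and lim: "\<forall>T\<ge>0. (\<lambda>k. sq_norm_upto M T (\<lambda>s \<omega>. simple_process (n k) (\<tau> k) (\<xi> k) s \<omega> - H s \<omega>)) \<longlonglongrightarrow> 0 \<and>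
           (\<lambda>k. \<integral>\<^sup>+ \<omega>. ennreal ((simple_integral W (n k) (\<tau> k) (\<xi> k) T \<omega> - I T \<omega>)^2) \<partial>M) \<longlonglongrightarrow> 0"
    using I unfolding ito_integral_def by (elim conjE exE)
  have ad: "\<forall>t\<ge>0. I t \<in> borel_measurable (F t)" and M2: "M2_process M F H"
    using I unfolding ito_integral_def adapted_def by auto
  have el: "elementary (\<tau> k ` {..n k}) (simple_integral W (n k) (\<tau> k) (\<xi> k)) (simple_process (n k) (\<tau> k) (\<xi> k))" for k
    by (rule elementary_simple[OF si[rule_format]])
  have HL: "path_L2 H" by (rule M2_process_path_L2[OF M2])
  have "L2_lim (lborel \<Otimes>\<^sub>M M) (\<lambda>k. time_cut T (simple_process (n k) (\<tau> k) (\<xi> k))) (time_cut T H) \<and>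
      L2_lim M (\<lambda>k. simple_integral W (n k) (\<tau> k) (\<xi> k) T) (I T)" if T: "0 \<le> T" for T
  proof
    have L: "L2 (lborel \<Otimes>\<^sub>M M) (time_cut T (simple_process (n k) (\<tau> k) (\<xi> k)))" for k
      using elementary_path_L2[OF el] T unfolding path_L2_def by blast
    have LH: "L2 (lborel \<Otimes>\<^sub>M M) (time_cut T H)" using HL T unfolding path_L2_def by blast
    show "L2_lim (lborel \<Otimes>\<^sub>M M) (\<lambda>k. time_cut T (simple_process (n k) (\<tau> k) (\<xi> k))) (time_cut T H)"
    proof (rule L2_limI[OF L])
      show "time_cut T H \<in> borel_measurable (lborel \<Otimes>\<^sub>M M)" using LH unfolding L2_def by blast
      show "(\<lambda>k. sq_norm_upto M T (\<lambda>s \<omega>. simple_process (n k) (\<tau> k) (\<xi> k) s \<omega> - H s \<omega>)) \<longlonglongrightarrow> 0" using lim T by blast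
      fix k
      have "time_cut T (\<lambda>s \<omega>. simple_process (n k) (\<tau> k) (\<xi> k) s \<omega> - H s \<omega>) \<in> borel_measurable (lborel \<Otimes>\<^sub>M M)"
        unfolding time_cut_diff using L2_diff[OF L LH] unfolding L2_def by blast
      from sq_norm_time_cut[OF this]
      show "(\<integral>\<^sup>+ x. ennreal ((norm (time_cut T (simple_process (n k) (\<tau> k) (\<xi> k)) x - time_cut T H x))^2) \<partial>(lborel \<Otimes>\<^sub>M M))
          \<le> sq_norm_upto M T (\<lambda>s \<omega>. simple_process (n k) (\<tau> k) (\<xi> k) s \<omega> - H s \<omega>)"
        unfolding time_cut_diff by simp
    qed
    show "L2_lim M (\<lambda>k. simple_integral W (n k) (\<tau> k) (\<xi> k) T) (I T)"
    proof (rule L2_limI[OF elementary_L2_values[OF el T]])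
      show "I T \<in> borel_measurable M" using ad T measurable_F_M by blast
      show "(\<lambda>k. \<integral>\<^sup>+ \<omega>. ennreal ((simple_integral W (n k) (\<tau> k) (\<xi> k) T \<omega> - I T \<omega>)^2) \<partial>M) \<longlonglongrightarrow> 0" using lim T by blast
    qed simp
  qed
  then show ?thesis
    unfolding ito_limit_def using ad el
    by (intro conjI exI[of _ "\<lambda>k. \<tau> k ` {..n k}"] exI[of _ "\<lambda>k. simple_integral W (n k) (\<tau> k) (\<xi> k)"]
        exI[of _ "\<lambda>k. simple_process (n k) (\<tau> k) (\<xi> k)"] allI impI) auto
qed

text \<open>By the isometry the expected sum of squared increments does not depend on the grid. An
  integral with a small integrand therefore has small energy on all grids at once.\<close>

lemma ito_limit_grid_energy:
  assumes N: "ito_limit N H" and T: "0 < T" and n: "0 < n"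
  shows "(\<Sum>i<n. expectation (\<lambda>\<omega>. (N (grid T n (Suc i)) \<omega> - N (grid T n i) \<omega>)^2))
     = (\<integral>x. (norm (time_cut T H x))^2 \<partial>(lborel \<Otimes>\<^sub>M M))"
proof -
  have T0: "0 \<le> T" using T by simp
  note HL = ito_limit_path_L2[OF N]
  have one: "(\<lambda>_. 1::real) \<in> borel_measurable M" "\<forall>\<omega>\<in>space M. \<bar>1::real\<bar> \<le> 1" by auto
  have "expectation (\<lambda>\<omega>. (N (grid T n (Suc i)) \<omega> - N (grid T n i) \<omega>)^2)
      = expectation (\<lambda>\<omega>. 1 * (LINT r:{grid T n i..grid T n (Suc i)}|lborel. (norm (H r \<omega>))^2))" if "i < n" for i
    using ito_limit_isometry[OF N grid_nonneg[OF T0] grid_strict[OF T that], of "\<lambda>_. 1" 1] by simp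
  then have "(\<Sum>i<n. expectation (\<lambda>\<omega>. (N (grid T n (Suc i)) \<omega> - N (grid T n i) \<omega>)^2))
      = (\<Sum>i<n. expectation (\<lambda>\<omega>. 1 * (LINT r:{grid T n i..grid T n (Suc i)}|lborel. (norm (H r \<omega>))^2)))"
    by (intro sum.cong) auto
  also have "\<dots> = expectation (\<lambda>\<omega>. \<Sum>i<n. 1 * (LINT r:{grid T n i..grid T n (Suc i)}|lborel. (norm (H r \<omega>))^2))"
    by (intro Bochner_Integration.integral_sum[symmetric] path_L2_integrals(2)[OF HL grid_nonneg[OF T0] order_refl one])
  also have "\<dots> = expectation (\<lambda>\<omega>. 1 * (LINT r:{0..T}|lborel. (norm (H r \<omega>))^2))"
  proof (rule integral_cong_AE)
    show "AE \<omega> in M. (\<Sum>i<n. 1 * (LINT r:{grid T n i..grid T n (Suc i)}|lborel. (norm (H r \<omega>))^2))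
        = 1 * (LINT r:{0..T}|lborel. (norm (H r \<omega>))^2)"
      using path_L2_AE[OF HL T0]
      by eventually_elim (simp add: set_integral_grid[OF _ T0 order_refl] grid_end[OF n])
    show "(\<lambda>\<omega>. \<Sum>i<n. 1 * (LINT r:{grid T n i..grid T n (Suc i)}|lborel. (norm (H r \<omega>))^2)) \<in> borel_measurable M"
      by (intro borel_measurable_sum borel_measurable_integrable path_L2_integrals(2)[OF HL grid_nonneg[OF T0] order_refl one])
    show "(\<lambda>\<omega>. 1 * (LINT r:{0..T}|lborel. (norm (H r \<omega>))^2)) \<in> borel_measurable M"
      by (intro borel_measurable_integrable path_L2_integrals(2)[OF HL order_refl order_refl one])
  qed
  also have "\<dots> = (\<integral>x. (1 * indicator {0..T} (fst x)) * (norm (time_cut T H x))^2 \<partial>(lborel \<Otimes>\<^sub>M M))"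
    by (rule path_L2_integrals(3)[OF HL order_refl order_refl one])
  also have "\<dots> = (\<integral>x. (norm (time_cut T H x))^2 \<partial>(lborel \<Otimes>\<^sub>M M))"
    by (intro Bochner_Integration.integral_cong refl) (auto simp: time_cut_def indicator_def)
  finally show ?thesis .
qed

text \<open>A grid stopping time may overshoot. The weights \<open>D n i\<close> select a random single grid step; since
  the quadratic variation of \<open>N\<close> is uniformly integrable, one step carries no energy in the limit.\<close>

lemma ito_limit_overshoot:
  assumes N: "ito_limit N H" and T: "0 < T"
    and D: "\<And>n i. D n i \<in> borel_measurable M" "\<forall>n i. \<forall>\<omega>\<in>space M. 0 \<le> D n i \<omega>"
      "\<forall>n. \<forall>\<omega>\<in>space M. (\<Sum>i<n. D n i \<omega>) \<le> (1::real)"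
  shows "(\<lambda>n. expectation (\<lambda>\<omega>. \<Sum>i<n. D n i \<omega> * (N (grid T n (Suc i)) \<omega> - N (grid T n i) \<omega>)^2)) \<longlonglongrightarrow> 0"
proof (rule LIMSEQ_I)
  fix e :: real assume e: "0 < e"
  have T0: "0 \<le> T" using T by simp
  obtain S J E where 1: "\<And>k. elementary (S k) (J k) (E k)"
    "\<And>T. 0 \<le> T \<Longrightarrow> L2_lim (lborel \<Otimes>\<^sub>M M) (\<lambda>k. time_cut T (E k)) (time_cut T H)"
    "\<And>T. 0 \<le> T \<Longrightarrow> L2_lim M (\<lambda>k. J k T) (N T)" by (rule ito_limitE[OF N]) (rule that)
  have "eventually (\<lambda>k. (\<integral>x. (norm (time_cut T (E k) x - time_cut T H x))^2 \<partial>(lborel \<Otimes>\<^sub>M M)) < e / 8) sequentially"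
    using L2_lim_real(2)[OF 1(2)[OF T0]] e by (intro order_tendstoD) auto
  then obtain k where k: "(\<integral>x. (norm (time_cut T (E k) x - time_cut T H x))^2 \<partial>(lborel \<Otimes>\<^sub>M M)) < e / 8"
    using eventually_happens trivial_limit_sequentially by blast
  \<comment> \<open>The difference between an elementary approximant and \<open>N\<close>. Its
    energy is below \<open>e / 8\<close> on every grid, so its weights may be replaced by 1; only
    the elementary part has to make use of them.\<close>
  let ?N' = "\<lambda>t \<omega>. J k t \<omega> + (-1) * N t \<omega>" and ?H' = "\<lambda>s \<omega>. E k s \<omega> + (-1) *\<^sub>R H s \<omega>"
  have N': "ito_limit ?N' ?H'"
    by (rule ito_limit_add[OF ito_limit_elementary[OF 1(1)] ito_limit_scale[OF N]])
  have energy: "(\<Sum>i<n. expectation (\<lambda>\<omega>. (?N' (grid T n (Suc i)) \<omega> - ?N' (grid T n i) \<omega>)^2)) < e / 8" if "0 < n" for n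
    using k ito_limit_grid_energy[OF N' T that] by (simp add: time_cut_diff)
  obtain C where C: "\<And>s t. 0 \<le> s \<Longrightarrow> s < t \<Longrightarrow>
    integrable M (\<lambda>\<omega>. (J k t \<omega> - J k s \<omega>)^4) \<and> expectation (\<lambda>\<omega>. (J k t \<omega> - J k s \<omega>)^4) \<le> C * (t - s)^2"
    by (rule elementary_fourth_moment[OF 1(1)]) (rule that)
  have D1: "D n i \<omega> \<le> 1" if "i < n" "\<omega> \<in> space M" for n i \<omega>
  proof -
    have "D n i \<omega> \<le> (\<Sum>i<n. D n i \<omega>)" using D(2) that by (intro member_le_sum) auto
    then show ?thesis using D(3) that by (meson order_trans)
  qed
  \<comment> \<open>Chosen so that the fourth moments of all \<open>n\<close> steps, in total at
    most \<open>\<bar>C\<bar> * T^2 / n\<close>, contribute at most \<open>e / 4\<close> after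
    multiplication by \<open>4 / e\<close>.\<close>
  obtain n0 :: nat where n0: "16 * \<bar>C\<bar> * T^2 / e^2 < real n0" using reals_Archimedean2 by blast
  show "\<exists>no. \<forall>n\<ge>no. norm (expectation (\<lambda>\<omega>. \<Sum>i<n. D n i \<omega> * (N (grid T n (Suc i)) \<omega> - N (grid T n i) \<omega>)^2) - 0) < e"
  proof (intro exI[of _ "Suc n0"] allI impI)
    fix n assume n: "Suc n0 \<le> n"
    then have npos: "0 < n" by simp
    let ?dN = "\<lambda>i \<omega>. N (grid T n (Suc i)) \<omega> - N (grid T n i) \<omega>"
    let ?dN' = "\<lambda>i \<omega>. ?N' (grid T n (Suc i)) \<omega> - ?N' (grid T n i) \<omega>"
    let ?dJ = "\<lambda>i \<omega>. J k (grid T n (Suc i)) \<omega> - J k (grid T n i) \<omega>"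
    have g: "0 \<le> grid T n i" "grid T n i < grid T n (Suc i)" if "i < n" for i
      using grid_nonneg[OF T0] grid_strict[OF T that] by auto
    have J4: "integrable M (\<lambda>\<omega>. (?dJ i \<omega>)^4)" "expectation (\<lambda>\<omega>. (?dJ i \<omega>)^4) \<le> C * (T / real n)^2" if "i < n" for i
      using C[OF g[OF that]] by (simp_all add: grid_step)
    have iN': "integrable M (\<lambda>\<omega>. (?dN' i \<omega>)^2)" if "i < n" for i
      using ito_limit_increment_L2[OF N' g(1)[OF that] less_imp_le[OF g(2)[OF that]]] unfolding L2_def by simp
    have iN: "integrable M (\<lambda>\<omega>. D n i \<omega> * (?dN i \<omega>)^2)" if "i < n" for i
    proof -
      have "integrable M (\<lambda>\<omega>. D n i \<omega> * (norm (?dN i \<omega>))^2)"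
        by (rule L2_weighted_integrable[OF ito_limit_increment_L2[OF N g(1)[OF that] less_imp_le[OF g(2)[OF that]]] D(1)])
           (use D(2) D1[OF that] in auto)
      then show ?thesis by simp
    qed
    have iD: "integrable M (\<lambda>\<omega>. D n i \<omega> * (e / 4))" if "i < n" for i
      using integrable_const_bound[of "D n i" 1] D(1,2) D1[OF that] by (intro integrable_mult_left) auto
    \<comment> \<open>For the elementary part \<open>2 * x \<le> e / 4 + 4 / e * x^2\<close> is used
      with \<open>x\<close> the squared increment. The weights sum to at most 1, so
      \<open>e / 4\<close> is paid only once, and \<open>x^2\<close> is a fourth power of an
      increment.\<close>
    have pt: "D n i \<omega> * (?dN i \<omega>)^2 \<le> 2 * (?dN' i \<omega>)^2 + D n i \<omega> * (e / 4) + 4 / e * (?dJ i \<omega>)^4"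
      if i: "i < n" and w: "\<omega> \<in> space M" for i \<omega>
    proof -
      have d: "0 \<le> D n i \<omega>" "D n i \<omega> \<le> 1" using D(2) D1 i w by auto
      have "(?dN i \<omega>)^2 \<le> 2 * (?dN' i \<omega>)^2 + 2 * (?dJ i \<omega>)^2"
      proof -
        have eq: "- ?dN' i \<omega> + ?dJ i \<omega> = ?dN i \<omega>" by simp
        show ?thesis
          using norm_add_squared_le[of "- ?dN' i \<omega>" "?dJ i \<omega>"] unfolding eq real_norm_def power2_abs power2_minus .
      qed
      then have "D n i \<omega> * (?dN i \<omega>)^2 \<le> D n i \<omega> * (2 * (?dN' i \<omega>)^2 + 2 * (?dJ i \<omega>)^2)"
        using d by (intro mult_left_mono)
      also have "\<dots> = D n i \<omega> * (2 * (?dN' i \<omega>)^2) + D n i \<omega> * (2 * (?dJ i \<omega>)^2)" by (rule distrib_left)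
      also have "D n i \<omega> * (2 * (?dN' i \<omega>)^2) \<le> 1 * (2 * (?dN' i \<omega>)^2)" using d by (intro mult_right_mono) auto
      also have "D n i \<omega> * (2 * (?dJ i \<omega>)^2) \<le> D n i \<omega> * (e / 4 + 4 / e * (?dJ i \<omega>)^4)"
      proof (rule mult_left_mono[OF _ d(1)])
        have *: "2 * x \<le> e / 4 + 4 / e * x^2" for x :: real
        proof -
          have "0 \<le> (e / 2 - 2 * x)^2 / e" using e by simp
          also have "\<dots> = e / 4 + 4 / e * x^2 - 2 * x" using e by (simp add: power2_eq_square field_simps)
          finally show ?thesis by simp
        qed
        show "2 * (?dJ i \<omega>)^2 \<le> e / 4 + 4 / e * (?dJ i \<omega>)^4" using *[of "(?dJ i \<omega>)^2"] by simp
      qed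
      also have "\<dots> = D n i \<omega> * (e / 4) + D n i \<omega> * (4 / e * (?dJ i \<omega>)^4)" by (rule distrib_left)
      also have "D n i \<omega> * (4 / e * (?dJ i \<omega>)^4) \<le> 1 * (4 / e * (?dJ i \<omega>)^4)" using d e by (intro mult_right_mono) auto
      finally show ?thesis by simp
    qed
    have "expectation (\<lambda>\<omega>. \<Sum>i<n. D n i \<omega> * (?dN i \<omega>)^2)
        \<le> expectation (\<lambda>\<omega>. \<Sum>i<n. 2 * (?dN' i \<omega>)^2 + D n i \<omega> * (e / 4) + 4 / e * (?dJ i \<omega>)^4)"
      by (intro integral_mono sum_mono pt Bochner_Integration.integrable_sum Bochner_Integration.integrable_add
            integrable_mult_right iN iN' iD J4) auto
    also have "\<dots> = (\<Sum>i<n. 2 * expectation (\<lambda>\<omega>. (?dN' i \<omega>)^2) + expectation (\<lambda>\<omega>. D n i \<omega> * (e / 4)) + 4 / e * expectation (\<lambda>\<omega>. (?dJ i \<omega>)^4))"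
      using iN' iD J4 by (simp add: Bochner_Integration.integral_sum)
    also have "\<dots> = 2 * (\<Sum>i<n. expectation (\<lambda>\<omega>. (?dN' i \<omega>)^2)) + (\<Sum>i<n. expectation (\<lambda>\<omega>. D n i \<omega> * (e / 4)))
         + 4 / e * (\<Sum>i<n. expectation (\<lambda>\<omega>. (?dJ i \<omega>)^4))"
      by (simp only: sum.distrib sum_distrib_left)
    also have "\<dots> < 2 * (e / 8) + e / 4 + e / 4"
    proof (intro add_less_le_mono add_mono)
      show "2 * (\<Sum>i<n. expectation (\<lambda>\<omega>. (?dN' i \<omega>)^2)) < 2 * (e / 8)" using energy[OF npos] by simp
      have "(\<Sum>i<n. expectation (\<lambda>\<omega>. D n i \<omega> * (e / 4))) = expectation (\<lambda>\<omega>. \<Sum>i<n. D n i \<omega> * (e / 4))"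
        by (rule Bochner_Integration.integral_sum[symmetric]) (use iD in auto)
      also have "\<dots> = expectation (\<lambda>\<omega>. (\<Sum>i<n. D n i \<omega>) * (e / 4))" by (simp only: sum_distrib_right)
      also have "\<dots> \<le> expectation (\<lambda>\<omega>. e / 4)"
      proof (rule integral_mono)
        show "integrable M (\<lambda>\<omega>. (\<Sum>i<n. D n i \<omega>) * (e / 4))" unfolding sum_distrib_right using iD by (intro Bochner_Integration.integrable_sum) auto
        show "(\<Sum>i<n. D n i \<omega>) * (e / 4) \<le> e / 4" if "\<omega> \<in> space M" for \<omega>
          using mult_right_mono[of "\<Sum>i<n. D n i \<omega>" 1 "e / 4"] D(3) that e by auto
      qed simp
      finally show "(\<Sum>i<n. expectation (\<lambda>\<omega>. D n i \<omega> * (e / 4))) \<le> e / 4" by (simp add: prob_space)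
      have "(\<Sum>i<n. expectation (\<lambda>\<omega>. (?dJ i \<omega>)^4)) \<le> (\<Sum>i<n. C * (T / real n)^2)"
        using J4(2) by (intro sum_mono) auto
      also have "\<dots> = C * T^2 / real n" using npos by (simp add: power2_eq_square)
      also have "\<dots> \<le> \<bar>C\<bar> * T^2 / real n" by (intro divide_right_mono mult_right_mono) auto
      finally have "4 / e * (\<Sum>i<n. expectation (\<lambda>\<omega>. (?dJ i \<omega>)^4)) \<le> 4 / e * (\<bar>C\<bar> * T^2 / real n)"
        using e by (intro mult_left_mono) auto
      also have "\<dots> \<le> e / 4"
      proof -
        have "16 * \<bar>C\<bar> * T^2 < real n0 * e^2" using n0 e by (simp add: divide_less_eq)
        also have "\<dots> \<le> real n * e^2" using n by (intro mult_right_mono) auto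
        finally show ?thesis using e npos by (simp add: field_simps power2_eq_square)
      qed
      finally show "4 / e * (\<Sum>i<n. expectation (\<lambda>\<omega>. (?dJ i \<omega>)^4)) \<le> e / 4" .
    qed
    also have "\<dots> \<le> e" using e by simp
    finally have up: "expectation (\<lambda>\<omega>. \<Sum>i<n. D n i \<omega> * (?dN i \<omega>)^2) < e" .
    have "0 \<le> expectation (\<lambda>\<omega>. \<Sum>i<n. D n i \<omega> * (?dN i \<omega>)^2)"
      using D(2) by (intro Bochner_Integration.integral_nonneg sum_nonneg mult_nonneg_nonneg) auto
    then show "norm (expectation (\<lambda>\<omega>. \<Sum>i<n. D n i \<omega> * (?dN i \<omega>)^2) - 0) < e" using up by simp
  qed
qed

end

section \<open>Discrete Ito formulas with stopping on a grid\<close>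

lemma grid_modulus:
  fixes f :: "real \<Rightarrow> 'b::metric_space"
  assumes "continuous_on {0..} f" "0 < T" "0 < e"
  obtains n0 where "0 < n0"
    "\<And>n s t. n0 \<le> n \<Longrightarrow> s \<in> {0..T} \<Longrightarrow> t \<in> {0..T} \<Longrightarrow> \<bar>s - t\<bar> \<le> T / real n \<Longrightarrow> dist (f s) (f t) < e"
proof -
  have "uniformly_continuous_on {0..T} f"
    by (rule compact_uniformly_continuous) (use continuous_on_subset[OF assms(1)] in auto)
  then obtain d where d: "0 < d" "\<And>s t. s \<in> {0..T} \<Longrightarrow> t \<in> {0..T} \<Longrightarrow> dist s t < d \<Longrightarrow> dist (f s) (f t) < e"
    unfolding uniformly_continuous_on_def using assms(3) by metis
  obtain n0 :: nat where n0: "T / d < real n0" using reals_Archimedean2 by blast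
  have "0 < T / d" using assms(2) d(1) by simp
  then have pos: "0 < n0" using n0 by (cases n0) auto
  show thesis
  proof (rule that[OF pos])
    fix n s t assume n: "n0 \<le> n" and st: "s \<in> {0..T}" "t \<in> {0..T}" "\<bar>s - t\<bar> \<le> T / real n"
    have "T < d * real n0" using n0 d(1) by (simp add: divide_less_eq mult.commute)
    also have "\<dots> \<le> d * real n" using n d(1) by simp
    finally have "T / real n < d" using n pos by (simp add: divide_less_eq)
    then show "dist (f s) (f t) < e" using d(2)[OF st(1,2)] st(3) by (simp add: dist_real_def)
  qed
qed

lemma grid_mem: "0 \<le> T \<Longrightarrow> i \<le> n \<Longrightarrow> grid T n i \<in> {0..T}"
  using grid_nonneg grid_le by simp

lemma grid_step_abs: "0 \<le> T \<Longrightarrow> \<bar>grid T n (Suc i) - grid T n i\<bar> \<le> T / real n"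
  unfolding grid_step by simp

lemma weighted_sum_le:
  fixes D x :: "nat \<Rightarrow> real"
  assumes "\<And>i. i < n \<Longrightarrow> 0 \<le> D i" "(\<Sum>i<n. D i) \<le> 1" "\<And>i. i < n \<Longrightarrow> x i \<le> e" "0 \<le> e"
  shows "(\<Sum>i<n. D i * x i) \<le> e"
proof -
  have "(\<Sum>i<n. D i * x i) \<le> (\<Sum>i<n. D i * e)" using assms by (intro sum_mono mult_left_mono) auto
  also have "\<dots> = (\<Sum>i<n. D i) * e" by (rule sum_distrib_right[symmetric])
  also have "\<dots> \<le> 1 * e" using assms by (intro mult_right_mono) auto
  finally show ?thesis by simp
qed

text \<open>The primitive of an integrable function is continuous, hence uniformly so on
  \<open>{0..T}\<close>. Freezing it after \<open>T\<close> gives a function on all nonnegative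
  times, as \<open>grid_modulus\<close> expects.\<close>

lemma set_integral_increment_small:
  fixes f :: "real \<Rightarrow> real"
  assumes f: "set_integrable lborel {0..T} f" and T: "0 < T" and e: "0 < e"
  obtains n0 where "0 < n0" "\<And>n i. n0 \<le> n \<Longrightarrow> i < n \<Longrightarrow> \<bar>LINT r:{grid T n i..grid T n (Suc i)}|lborel. f r\<bar> < e"
proof -
  define Q where "Q t = (LINT r:{0..min t T}|lborel. f r)" for t
  have io: "f integrable_on {0..T}" by (rule set_borel_integral_eq_integral(1)[OF f])
  have Qeq: "(LINT r:{0..t}|lborel. f r) = integral {0..t} f" if "t \<in> {0..T}" for t
    by (rule set_borel_integral_eq_integral(2)[OF set_integrable_subset[OF f]]) (use that in auto)
  have "continuous_on {0..T} (\<lambda>t. integral {0..t} f)" by (rule indefinite_integral_continuous_1[OF io])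
  then have "continuous_on {0..} (\<lambda>t. integral {0..min t T} f)"
    by (rule continuous_on_compose2[of "{0..T}" _ _ "\<lambda>t. min t T"]) (use T in \<open>auto intro!: continuous_intros\<close>)
  then have "continuous_on {0..} Q" unfolding Q_def[abs_def]
    by (rule continuous_on_eq) (use T in \<open>auto simp: Qeq\<close>)
  then obtain n0 where n0: "0 < n0" "\<And>n s t. n0 \<le> n \<Longrightarrow> s \<in> {0..T} \<Longrightarrow> t \<in> {0..T} \<Longrightarrow> \<bar>s - t\<bar> \<le> T / real n \<Longrightarrow> dist (Q s) (Q t) < e"
    by (rule grid_modulus[OF _ T e]) (rule that)
  show thesis
  proof (rule that[OF n0(1)])
    fix n i assume n: "n0 \<le> n" and i: "i < n"
    have T0: "0 \<le> T" using T by simp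
    have m: "grid T n i \<in> {0..T}" "grid T n (Suc i) \<in> {0..T}" using i by (auto simp: grid_nonneg[OF T0] grid_le[OF T0])
    have "set_integrable lborel {0..grid T n (Suc i)} f"
      by (rule set_integrable_subset[OF f]) (use m in auto)
    from set_integral_split[OF this, of "grid T n i"]
    have "(LINT r:{grid T n i..grid T n (Suc i)}|lborel. f r) = Q (grid T n (Suc i)) - Q (grid T n i)"
      using m grid_mono[OF T0, of i "Suc i" n] unfolding Q_def by (simp add: min_def)
    then show "\<bar>LINT r:{grid T n i..grid T n (Suc i)}|lborel. f r\<bar> < e"
      using n0(2)[OF n m(2) m(1)] grid_step_abs[OF T0] by (simp add: dist_real_def)
  qed
qed

section \<open>Stopping weights, vanishing overshoots and the two discrete formulas\<close>

context brownian
begin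

lemma L2_integrable_real:
  fixes f :: "'a \<Rightarrow> real"
  assumes "L2 M f" shows "integrable M f"
  by (rule square_integrable_imp_integrable) (use assms in \<open>simp_all add: L2_def\<close>)

definition bounded_continuous_process :: "(real \<Rightarrow> 'a \<Rightarrow> real) \<Rightarrow> real \<Rightarrow> bool" where
  "bounded_continuous_process S C \<longleftrightarrow> (\<forall>t\<ge>0. S t \<in> borel_measurable (F t)) \<and>
     (AE \<omega> in M. continuous_on {0..} (\<lambda>t. S t \<omega>) \<and> (\<forall>t\<ge>0. \<bar>S t \<omega>\<bar> \<le> C))"

text \<open>\<open>Y n i\<close> decides, with the information at grid point \<open>i\<close>,
  whether the step to \<open>i + 1\<close> is still taken, and monotonicity forbids a restart. For
  weights with values 0 and 1, \<open>Y n i - Y n (Suc i)\<close> marks the last step taken; in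
  general these differences sum to at most 1.\<close>

definition stopping_weights :: "real \<Rightarrow> (nat \<Rightarrow> nat \<Rightarrow> 'a \<Rightarrow> real) \<Rightarrow> bool" where
  "stopping_weights T Y \<longleftrightarrow> (\<forall>n i. Y n i \<in> borel_measurable (F (grid T n i)) \<and>
     (\<forall>\<omega>\<in>space M. 0 \<le> Y n i \<omega> \<and> Y n i \<omega> \<le> 1 \<and> Y n (Suc i) \<omega> \<le> Y n i \<omega>))"

lemma stopping_weights_D:
  assumes "stopping_weights T Y"
  shows "Y n i \<in> borel_measurable (F (grid T n i))" "Y n i \<in> borel_measurable M"
    "\<omega> \<in> space M \<Longrightarrow> 0 \<le> Y n i \<omega>" "\<omega> \<in> space M \<Longrightarrow> Y n i \<omega> \<le> 1" "\<omega> \<in> space M \<Longrightarrow> Y n (Suc i) \<omega> \<le> Y n i \<omega>"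
    "\<omega> \<in> space M \<Longrightarrow> \<bar>Y n i \<omega>\<bar> \<le> 1" "\<omega> \<in> space M \<Longrightarrow> (\<Sum>i<n. Y n i \<omega> - Y n (Suc i) \<omega>) \<le> 1"
proof -
  show Y: "Y n i \<in> borel_measurable (F (grid T n i))" "\<omega> \<in> space M \<Longrightarrow> 0 \<le> Y n i \<omega>" "\<omega> \<in> space M \<Longrightarrow> Y n i \<omega> \<le> 1"
    "\<omega> \<in> space M \<Longrightarrow> Y n (Suc i) \<omega> \<le> Y n i \<omega>" for i
    using assms unfolding stopping_weights_def by blast+
  show "Y n i \<in> borel_measurable M" by (rule measurable_F_M[OF Y(1)])
  show "\<omega> \<in> space M \<Longrightarrow> \<bar>Y n i \<omega>\<bar> \<le> 1" using Y(2,3) by simp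
  assume "\<omega> \<in> space M"
  then show "(\<Sum>i<n. Y n i \<omega> - Y n (Suc i) \<omega>) \<le> 1"
    using Y(2)[of n] Y(3)[of 0] sum_lessThan_telescope'[of "\<lambda>i. Y n i \<omega>" n] by simp
qed

lemma bounded_continuous_process_L2:
  assumes S: "bounded_continuous_process S C" and t: "0 \<le> t"
  shows "S t \<in> borel_measurable M" "L2 M (S t)"
proof -
  show m: "S t \<in> borel_measurable M"
    using S t measurable_F_M unfolding bounded_continuous_process_def by blast
  have "AE \<omega> in M. norm ((norm (S t \<omega>))^2) \<le> C^2"
    using S unfolding bounded_continuous_process_def
  proof (elim conjE AE_mp, intro AE_I2 impI)
    fix \<omega> assume "continuous_on {0..} (\<lambda>t. S t \<omega>) \<and> (\<forall>t\<ge>0. \<bar>S t \<omega>\<bar> \<le> C)"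
    then have "\<bar>S t \<omega>\<bar> \<le> C" using t by blast
    then have "\<bar>S t \<omega>\<bar>^2 \<le> C^2" by (intro power_mono) auto
    then show "norm ((norm (S t \<omega>))^2) \<le> C^2" by simp
  qed
  then show "L2 M (S t)" unfolding L2_def using m by (intro conjI integrable_const_bound) auto
qed

lemma weight_integrable:
  assumes "stopping_weights T Y" "integrable M f"
  shows "integrable M (\<lambda>\<omega>. Y n i \<omega> * f \<omega>)"
proof (rule Bochner_Integration.integrable_bound[OF assms(2)])
  show "(\<lambda>\<omega>. Y n i \<omega> * f \<omega>) \<in> borel_measurable M"
    using stopping_weights_D(2)[OF assms(1)] borel_measurable_integrable[OF assms(2)] by (intro borel_measurable_times)
  show "AE \<omega> in M. norm (Y n i \<omega> * f \<omega>) \<le> norm (f \<omega>)"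
    using stopping_weights_D(6)[OF assms(1)] by (intro AE_I2) (simp add: abs_mult mult_left_le_one_le)
qed

text \<open>Because the weights sum to at most 1, the sum is bounded by the largest increment over
  one grid step. It vanishes on each path by uniform continuity and is dominated by
  \<open>2 * C\<close>.\<close>

lemma overshoot_process:
  assumes S: "bounded_continuous_process S C" and T: "0 < T" and Y: "stopping_weights T Y"
  shows "(\<lambda>n. expectation (\<lambda>\<omega>. \<Sum>i<n. (Y n i \<omega> - Y n (Suc i) \<omega>) * \<bar>S (grid T n (Suc i)) \<omega> - S (grid T n i) \<omega>\<bar>)) \<longlonglongrightarrow> 0"
proof -
  have T0: "0 \<le> T" using T by simp
  let ?f = "\<lambda>n \<omega>. \<Sum>i<n. (Y n i \<omega> - Y n (Suc i) \<omega>) * \<bar>S (grid T n (Suc i)) \<omega> - S (grid T n i) \<omega>\<bar>"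
  have C: "AE \<omega> in M. continuous_on {0..} (\<lambda>t. S t \<omega>) \<and> (\<forall>t\<ge>0. \<bar>S t \<omega>\<bar> \<le> C)"
    using S unfolding bounded_continuous_process_def by blast
  have nn: "0 \<le> ?f n \<omega>" if "\<omega> \<in> space M" for n \<omega>
    using stopping_weights_D(5)[OF Y that] by (intro sum_nonneg mult_nonneg_nonneg) auto
  have "(\<lambda>n. expectation (?f n)) \<longlonglongrightarrow> expectation (\<lambda>\<omega>. 0)"
  proof (rule integral_dominated_convergence)
    show "?f n \<in> borel_measurable M" for n
      using stopping_weights_D(2)[OF Y] bounded_continuous_process_L2(1)[OF S grid_nonneg[OF T0]]
      by (intro borel_measurable_sum borel_measurable_times borel_measurable_diff borel_measurable_abs)
    show "integrable M (\<lambda>_. 2 * C)" by simp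
    show "AE \<omega> in M. norm (?f n \<omega>) \<le> 2 * C" for n
      using C AE_space
    proof eventually_elim
      case (elim \<omega>)
      have b: "\<bar>S (grid T n i) \<omega>\<bar> \<le> C" for i using elim(1) grid_nonneg[OF T0] by blast
      have "?f n \<omega> \<le> 2 * C"
      proof (rule weighted_sum_le)
        show "\<bar>S (grid T n (Suc i)) \<omega> - S (grid T n i) \<omega>\<bar> \<le> 2 * C" for i
          using b[of i] b[of "Suc i"] by linarith
        show "0 \<le> 2 * C" using b[of 0] by linarith
      qed (use stopping_weights_D(5,7)[OF Y elim(2)] in auto)
      then show ?case using nn[OF elim(2), of n] by simp
    qed
    show "AE \<omega> in M. (\<lambda>n. ?f n \<omega>) \<longlonglongrightarrow> 0"
      using C AE_space
    proof eventually_elim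
      case (elim \<omega>)
      show ?case
      proof (rule LIMSEQ_I)
        fix e :: real assume e: "0 < e"
        obtain n0 where n0: "0 < n0" "\<And>n s t. n0 \<le> n \<Longrightarrow> s \<in> {0..T} \<Longrightarrow> t \<in> {0..T} \<Longrightarrow> \<bar>s - t\<bar> \<le> T / real n
            \<Longrightarrow> dist (S s \<omega>) (S t \<omega>) < e / 2"
          by (rule grid_modulus[OF elim(1)[THEN conjunct1] T, of "e / 2"]) (use e in simp, rule that)
        show "\<exists>no. \<forall>n\<ge>no. norm (?f n \<omega> - 0) < e"
        proof (intro exI[of _ n0] allI impI)
          fix n assume n: "n0 \<le> n"
          have "?f n \<omega> \<le> e / 2"
          proof (rule weighted_sum_le)
            show "\<bar>S (grid T n (Suc i)) \<omega> - S (grid T n i) \<omega>\<bar> \<le> e / 2" if "i < n" for i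
              using n0(2)[OF n grid_mem[OF T0, of "Suc i" n] grid_mem[OF T0, of i n] grid_step_abs[OF T0]] that
              by (simp add: dist_real_def)
          qed (use stopping_weights_D(5,7)[OF Y elim(2)] e in auto)
          then show "norm (?f n \<omega> - 0) < e" using nn[OF elim(2), of n] e by simp
        qed
      qed
    qed
  qed simp
  then show ?thesis by simp
qed

lemma overshoot_martingale_sq:
  assumes N: "ito_limit N H" and T: "0 < T" and Y: "stopping_weights T Y"
  shows "(\<lambda>n. expectation (\<lambda>\<omega>. \<Sum>i<n. (Y n i \<omega> - Y n (Suc i) \<omega>) * (N (grid T n (Suc i)) \<omega> - N (grid T n i) \<omega>)^2)) \<longlonglongrightarrow> 0"
  by (rule ito_limit_overshoot[OF N T]) (use stopping_weights_D(2,5,7)[OF Y] in auto)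

text \<open>The pathwise argument is that of \<open>overshoot_process\<close>, with the primitive of
  the squared integrand in place of the process; the total energy of the path is the dominating
  function.\<close>

lemma overshoot_energy:
  assumes N: "ito_limit N H" and T: "0 < T" and Y: "stopping_weights T Y"
  shows "(\<lambda>n. expectation (\<lambda>\<omega>. \<Sum>i<n. (Y n i \<omega> - Y n (Suc i) \<omega>) *
      (LINT r:{grid T n i..grid T n (Suc i)}|lborel. (norm (H r \<omega>))^2))) \<longlonglongrightarrow> 0"
proof -
  have T0: "0 \<le> T" using T by simp
  note HL = ito_limit_path_L2[OF N]
  let ?q = "\<lambda>n i \<omega>. LINT r:{grid T n i..grid T n (Suc i)}|lborel. (norm (H r \<omega>))^2"
  let ?f = "\<lambda>n \<omega>. \<Sum>i<n. (Y n i \<omega> - Y n (Suc i) \<omega>) * ?q n i \<omega>"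
  have one: "(\<lambda>_. 1::real) \<in> borel_measurable M" "\<forall>\<omega>\<in>space M. \<bar>1::real\<bar> \<le> 1" by auto
  have qi: "integrable M (?q n i)" for n i
    using path_L2_integrals(2)[OF HL grid_nonneg[OF T0] order_refl one] by simp
  have Qi: "integrable M (\<lambda>\<omega>. LINT r:{0..T}|lborel. (norm (H r \<omega>))^2)"
    using path_L2_integrals(2)[OF HL order_refl order_refl one] by simp
  have qnn: "0 \<le> ?q n i \<omega>" for n i \<omega>
    unfolding set_lebesgue_integral_def by (rule Bochner_Integration.integral_nonneg) auto
  have nn: "0 \<le> ?f n \<omega>" if "\<omega> \<in> space M" for n \<omega>
    using stopping_weights_D(5)[OF Y that] qnn by (intro sum_nonneg mult_nonneg_nonneg) auto
  have "(\<lambda>n. expectation (?f n)) \<longlonglongrightarrow> expectation (\<lambda>\<omega>. 0)"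
  proof (rule integral_dominated_convergence)
    show "?f n \<in> borel_measurable M" for n
      using stopping_weights_D(2)[OF Y] borel_measurable_integrable[OF qi]
      by (intro borel_measurable_sum borel_measurable_times borel_measurable_diff)
    show "integrable M (\<lambda>\<omega>. LINT r:{0..T}|lborel. (norm (H r \<omega>))^2)" by (rule Qi)
    show "AE \<omega> in M. norm (?f n \<omega>) \<le> (LINT r:{0..T}|lborel. (norm (H r \<omega>))^2)" for n
      using path_L2_AE[OF HL T0] AE_space
    proof eventually_elim
      case (elim \<omega>)
      have "?f n \<omega> \<le> (\<Sum>i<n. 1 * ?q n i \<omega>)"
      proof (intro sum_mono mult_right_mono)
        fix i show "Y n i \<omega> - Y n (Suc i) \<omega> \<le> 1"
          using stopping_weights_D(3)[OF Y elim(2), of n "Suc i"] stopping_weights_D(4)[OF Y elim(2), of n i] by linarith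
      qed (rule qnn)
      also have "\<dots> \<le> (LINT r:{0..T}|lborel. (norm (H r \<omega>))^2)"
      proof (cases "n = 0")
        case True then show ?thesis
          by (simp add: set_lebesgue_integral_def)
      next
        case False
        then show ?thesis using set_integral_grid[OF elim(1) T0, of n n] by (simp add: grid_end)
      qed
      finally show ?case using nn[OF elim(2), of n] by simp
    qed
    show "AE \<omega> in M. (\<lambda>n. ?f n \<omega>) \<longlonglongrightarrow> 0"
      using path_L2_AE[OF HL T0] AE_space
    proof eventually_elim
      case (elim \<omega>)
      show ?case
      proof (rule LIMSEQ_I)
        fix e :: real assume e: "0 < e"
        obtain n0 where n0: "0 < n0" "\<And>n i. n0 \<le> n \<Longrightarrow> i < n \<Longrightarrow> \<bar>?q n i \<omega>\<bar> < e / 2"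
          by (rule set_integral_increment_small[OF elim(1) T, of "e / 2"]) (use e in simp, rule that)
        show "\<exists>no. \<forall>n\<ge>no. norm (?f n \<omega> - 0) < e"
        proof (intro exI[of _ n0] allI impI)
          fix n assume n: "n0 \<le> n"
          have "?f n \<omega> \<le> e / 2"
          proof (rule weighted_sum_le)
            show "?q n i \<omega> \<le> e / 2" if "i < n" for i using n0(2)[OF n that] by linarith
          qed (use stopping_weights_D(5,7)[OF Y elim(2)] e in auto)
          then show "norm (?f n \<omega> - 0) < e" using nn[OF elim(2), of n] e by simp
        qed
      qed
    qed
  qed simp
  then show ?thesis by simp
qed

text \<open>An \<open>ito_limit\<close> carries no continuity of paths, so the squares are used
  instead: in \<open>x \<le> e / 2 + x^2 / (2 * e)\<close> the first term is paid once because of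
  the weights, and the second is an overshoot of squares.\<close>

lemma overshoot_martingale_abs:
  assumes N: "ito_limit N H" and T: "0 < T" and Y: "stopping_weights T Y"
  shows "(\<lambda>n. expectation (\<lambda>\<omega>. \<Sum>i<n. (Y n i \<omega> - Y n (Suc i) \<omega>) * \<bar>N (grid T n (Suc i)) \<omega> - N (grid T n i) \<omega>\<bar>)) \<longlonglongrightarrow> 0"
proof (rule LIMSEQ_I)
  fix e :: real assume e: "0 < e"
  have T0: "0 \<le> T" using T by simp
  let ?D = "\<lambda>n i \<omega>. Y n i \<omega> - Y n (Suc i) \<omega>" and ?d = "\<lambda>n i \<omega>. N (grid T n (Suc i)) \<omega> - N (grid T n i) \<omega>"
  have dL: "L2 M (?d n i)" for n i
    by (rule ito_limit_increment_L2[OF N grid_nonneg[OF T0] grid_mono[OF T0]]) simp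
  have i1: "integrable M (\<lambda>\<omega>. ?D n i \<omega> * \<bar>?d n i \<omega>\<bar>)" and i2: "integrable M (\<lambda>\<omega>. ?D n i \<omega> * (?d n i \<omega>)^2)" for n i
  proof -
    have a: "integrable M (\<lambda>\<omega>. \<bar>?d n i \<omega>\<bar>)" "integrable M (\<lambda>\<omega>. (?d n i \<omega>)^2)"
      using integrable_abs[OF L2_integrable_real[OF dL]] dL[of n i] unfolding L2_def by simp_all
    show "integrable M (\<lambda>\<omega>. ?D n i \<omega> * \<bar>?d n i \<omega>\<bar>)" "integrable M (\<lambda>\<omega>. ?D n i \<omega> * (?d n i \<omega>)^2)"
      unfolding left_diff_distrib
      by (intro Bochner_Integration.integrable_diff weight_integrable[OF Y] a)+
  qed
  have "eventually (\<lambda>n. expectation (\<lambda>\<omega>. \<Sum>i<n. ?D n i \<omega> * (?d n i \<omega>)^2) < e^2 / 2) sequentially"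
    using overshoot_martingale_sq[OF N T Y] e by (intro order_tendstoD) auto
  then obtain n0 where n0: "\<And>n. n0 \<le> n \<Longrightarrow> expectation (\<lambda>\<omega>. \<Sum>i<n. ?D n i \<omega> * (?d n i \<omega>)^2) < e^2 / 2"
    unfolding eventually_sequentially by blast
  show "\<exists>no. \<forall>n\<ge>no. norm (expectation (\<lambda>\<omega>. \<Sum>i<n. ?D n i \<omega> * \<bar>?d n i \<omega>\<bar>) - 0) < e"
  proof (intro exI[of _ n0] allI impI)
    fix n assume n: "n0 \<le> n"
    have "expectation (\<lambda>\<omega>. \<Sum>i<n. ?D n i \<omega> * \<bar>?d n i \<omega>\<bar>) \<le> expectation (\<lambda>\<omega>. e / 2 + (\<Sum>i<n. ?D n i \<omega> * (?d n i \<omega>)^2) / (2 * e))"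
    proof (rule integral_mono)
      show "integrable M (\<lambda>\<omega>. \<Sum>i<n. ?D n i \<omega> * \<bar>?d n i \<omega>\<bar>)" using i1 by (intro Bochner_Integration.integrable_sum)
      show "integrable M (\<lambda>\<omega>. e / 2 + (\<Sum>i<n. ?D n i \<omega> * (?d n i \<omega>)^2) / (2 * e))"
        using i2 by (intro Bochner_Integration.integrable_add integrable_divide Bochner_Integration.integrable_sum) auto
      fix \<omega> assume w: "\<omega> \<in> space M"
      have *: "x \<le> e / 2 + x^2 / (2 * e)" for x :: real
      proof -
        have "0 \<le> (x - e)^2 / (2 * e)" using e by simp
        also have "\<dots> = e / 2 + x^2 / (2 * e) - x" using e by (simp add: power2_eq_square field_simps)
        finally show ?thesis by simp
      qed
      have "(\<Sum>i<n. ?D n i \<omega> * \<bar>?d n i \<omega>\<bar>) \<le> (\<Sum>i<n. ?D n i \<omega> * (e / 2 + (?d n i \<omega>)^2 / (2 * e)))"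
        using stopping_weights_D(5)[OF Y w] *[of "\<bar>?d n _ \<omega>\<bar>"] by (intro sum_mono mult_left_mono) auto
      also have "\<dots> = (\<Sum>i<n. ?D n i \<omega> * (e / 2)) + (\<Sum>i<n. ?D n i \<omega> * (?d n i \<omega>)^2) / (2 * e)"
        by (simp only: distrib_left sum.distrib sum_divide_distrib times_divide_eq_right)
      also have "(\<Sum>i<n. ?D n i \<omega> * (e / 2)) \<le> e / 2"
        by (rule weighted_sum_le) (use stopping_weights_D(5,7)[OF Y w] e in auto)
      finally show "(\<Sum>i<n. ?D n i \<omega> * \<bar>?d n i \<omega>\<bar>) \<le> e / 2 + (\<Sum>i<n. ?D n i \<omega> * (?d n i \<omega>)^2) / (2 * e)" by simp
    qed
    also have "\<dots> = e / 2 + expectation (\<lambda>\<omega>. \<Sum>i<n. ?D n i \<omega> * (?d n i \<omega>)^2) / (2 * e)"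
      using i2 by (simp add: prob_space)
    also have "\<dots> < e / 2 + (e^2 / 2) / (2 * e)"
      using n0[OF n] e by (intro add_strict_left_mono divide_strict_right_mono) auto
    also have "\<dots> \<le> e" using e by (simp add: power2_eq_square)
    finally have "expectation (\<lambda>\<omega>. \<Sum>i<n. ?D n i \<omega> * \<bar>?d n i \<omega>\<bar>) < e" .
    moreover have "0 \<le> expectation (\<lambda>\<omega>. \<Sum>i<n. ?D n i \<omega> * \<bar>?d n i \<omega>\<bar>)"
      using stopping_weights_D(5)[OF Y]
      by (intro Bochner_Integration.integral_nonneg sum_nonneg mult_nonneg_nonneg) auto
    ultimately show "norm (expectation (\<lambda>\<omega>. \<Sum>i<n. ?D n i \<omega> * \<bar>?d n i \<omega>\<bar>) - 0) < e" by simp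
  qed
qed

text \<open>The increments of \<open>S\<close> carry the weight of the left endpoint, those of its
  compensator \<open>A\<close> that of the right endpoint, so that the compensator counts only steps
  with two good endpoints. The sum of \<open>Y n i\<close> times the martingale increments has zero
  mean, and the mismatch of the weights is an overshoot of \<open>S - N\<close>.\<close>

lemma discrete_ito_linear:
  assumes S: "bounded_continuous_process S C" and N: "ito_limit N H" and T: "0 < T" and Y: "stopping_weights T Y"
  defines "A \<equiv> \<lambda>t \<omega>. S t \<omega> - N t \<omega>"
  defines "R \<equiv> \<lambda>n \<omega>. \<Sum>i<n. Y n i \<omega> * (S (grid T n (Suc i)) \<omega> - S (grid T n i) \<omega>)
     - Y n (Suc i) \<omega> * (A (grid T n (Suc i)) \<omega> - A (grid T n i) \<omega>)"
  shows "integrable M (R n)" and "(\<lambda>n. expectation (R n)) \<longlonglongrightarrow> 0"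
proof -
  have T0: "0 \<le> T" using T by simp
  let ?D = "\<lambda>n i \<omega>. Y n i \<omega> - Y n (Suc i) \<omega>"
  let ?dS = "\<lambda>n i \<omega>. S (grid T n (Suc i)) \<omega> - S (grid T n i) \<omega>"
  let ?dN = "\<lambda>n i \<omega>. N (grid T n (Suc i)) \<omega> - N (grid T n i) \<omega>"
  have SL: "L2 M (S (grid T n i))" for n i by (rule bounded_continuous_process_L2(2)[OF S grid_nonneg[OF T0]])
  have NL: "L2 M (N (grid T n i))" for n i by (rule ito_limit_L2[OF N grid_nonneg[OF T0]])
  have int: "L2 M f \<Longrightarrow> integrable M f" for f :: "'a \<Rightarrow> real" by (rule L2_integrable_real)
  have iS: "integrable M (?dS n i)" and iN: "integrable M (?dN n i)" for n i
    by (intro int L2_diff SL NL)+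
  have iw: "integrable M (\<lambda>\<omega>. ?D n i \<omega> * f \<omega>)" if "integrable M f" for f n i
    unfolding left_diff_distrib by (intro Bochner_Integration.integrable_diff weight_integrable[OF Y] that)
  have Req: "R n \<omega> = (\<Sum>i<n. Y n i \<omega> * ?dN n i \<omega>) + (\<Sum>i<n. ?D n i \<omega> * (?dS n i \<omega> - ?dN n i \<omega>))" for n \<omega>
    unfolding R_def A_def sum.distrib[symmetric] by (intro sum.cong refl) (simp add: algebra_simps)
  have i1: "integrable M (\<lambda>\<omega>. Y n i \<omega> * ?dN n i \<omega>)" for n i by (rule weight_integrable[OF Y iN])
  have i2: "integrable M (\<lambda>\<omega>. ?D n i \<omega> * (?dS n i \<omega> - ?dN n i \<omega>))" for n i
    by (intro iw Bochner_Integration.integrable_diff iS iN)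
  show "integrable M (R n)"
    unfolding Req[abs_def] by (intro Bochner_Integration.integrable_add Bochner_Integration.integrable_sum i1 i2)
  have m0: "expectation (\<lambda>\<omega>. Y n i \<omega> * ?dN n i \<omega>) = 0" if "i < n" for n i
  proof (rule ito_limit_martingale[OF N grid_nonneg[OF T0] grid_strict[OF T that] stopping_weights_D(1)[OF Y]])
    show "L2 M (Y n i)" unfolding L2_def
    proof (intro conjI stopping_weights_D(2)[OF Y] integrable_const_bound)
      show "AE \<omega> in M. norm ((norm (Y n i \<omega>))^2) \<le> 1"
        using stopping_weights_D(6)[OF Y] by (intro AE_I2) (simp add: abs_square_le_1)
      show "(\<lambda>\<omega>. (norm (Y n i \<omega>))^2) \<in> borel_measurable M" using stopping_weights_D(2)[OF Y, of n i] by measurable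
    qed
  qed
  have ER: "expectation (R n) = expectation (\<lambda>\<omega>. \<Sum>i<n. ?D n i \<omega> * (?dS n i \<omega> - ?dN n i \<omega>))" for n
  proof -
    have "expectation (R n) = expectation (\<lambda>\<omega>. \<Sum>i<n. Y n i \<omega> * ?dN n i \<omega>) + expectation (\<lambda>\<omega>. \<Sum>i<n. ?D n i \<omega> * (?dS n i \<omega> - ?dN n i \<omega>))"
      unfolding Req[abs_def] by (intro Bochner_Integration.integral_add Bochner_Integration.integrable_sum i1 i2)
    also have "expectation (\<lambda>\<omega>. \<Sum>i<n. Y n i \<omega> * ?dN n i \<omega>) = (\<Sum>i<n. expectation (\<lambda>\<omega>. Y n i \<omega> * ?dN n i \<omega>))"
      by (rule Bochner_Integration.integral_sum) (rule i1)
    also have "\<dots> = 0" using m0 by simp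
    finally show ?thesis by simp
  qed
  have bd: "norm (expectation (R n)) \<le> expectation (\<lambda>\<omega>. \<Sum>i<n. ?D n i \<omega> * \<bar>?dS n i \<omega>\<bar>) + expectation (\<lambda>\<omega>. \<Sum>i<n. ?D n i \<omega> * \<bar>?dN n i \<omega>\<bar>)" for n
  proof -
    have j: "integrable M (\<lambda>\<omega>. ?D n i \<omega> * \<bar>?dS n i \<omega>\<bar>)" "integrable M (\<lambda>\<omega>. ?D n i \<omega> * \<bar>?dN n i \<omega>\<bar>)" for i
      by (intro iw integrable_abs iS iN)+
    have "norm (expectation (R n)) \<le> expectation (\<lambda>\<omega>. \<bar>\<Sum>i<n. ?D n i \<omega> * (?dS n i \<omega> - ?dN n i \<omega>)\<bar>)"
      unfolding ER real_norm_def by (rule integral_abs_bound)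
    also have "\<dots> \<le> expectation (\<lambda>\<omega>. (\<Sum>i<n. ?D n i \<omega> * \<bar>?dS n i \<omega>\<bar>) + (\<Sum>i<n. ?D n i \<omega> * \<bar>?dN n i \<omega>\<bar>))"
    proof (rule integral_mono)
      show "integrable M (\<lambda>\<omega>. \<bar>\<Sum>i<n. ?D n i \<omega> * (?dS n i \<omega> - ?dN n i \<omega>)\<bar>)"
        by (intro integrable_abs Bochner_Integration.integrable_sum i2)
      show "integrable M (\<lambda>\<omega>. (\<Sum>i<n. ?D n i \<omega> * \<bar>?dS n i \<omega>\<bar>) + (\<Sum>i<n. ?D n i \<omega> * \<bar>?dN n i \<omega>\<bar>))"
        by (intro Bochner_Integration.integrable_add Bochner_Integration.integrable_sum j)
      fix \<omega> assume w: "\<omega> \<in> space M"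
      have "\<bar>\<Sum>i<n. ?D n i \<omega> * (?dS n i \<omega> - ?dN n i \<omega>)\<bar> \<le> (\<Sum>i<n. \<bar>?D n i \<omega> * (?dS n i \<omega> - ?dN n i \<omega>)\<bar>)" by (rule sum_abs)
      also have "\<dots> \<le> (\<Sum>i<n. ?D n i \<omega> * \<bar>?dS n i \<omega>\<bar> + ?D n i \<omega> * \<bar>?dN n i \<omega>\<bar>)"
      proof (rule sum_mono)
        fix i
        have d: "0 \<le> ?D n i \<omega>" using stopping_weights_D(5)[OF Y w, of n i] by simp
        have "\<bar>?D n i \<omega> * (?dS n i \<omega> - ?dN n i \<omega>)\<bar> = ?D n i \<omega> * \<bar>?dS n i \<omega> - ?dN n i \<omega>\<bar>"
          unfolding abs_mult using d by simp
        also have "\<dots> \<le> ?D n i \<omega> * (\<bar>?dS n i \<omega>\<bar> + \<bar>?dN n i \<omega>\<bar>)" by (rule mult_left_mono[OF abs_triangle_ineq4 d])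
        finally show "\<bar>?D n i \<omega> * (?dS n i \<omega> - ?dN n i \<omega>)\<bar> \<le> ?D n i \<omega> * \<bar>?dS n i \<omega>\<bar> + ?D n i \<omega> * \<bar>?dN n i \<omega>\<bar>"
          unfolding distrib_left .
      qed
      finally show "\<bar>\<Sum>i<n. ?D n i \<omega> * (?dS n i \<omega> - ?dN n i \<omega>)\<bar> \<le> (\<Sum>i<n. ?D n i \<omega> * \<bar>?dS n i \<omega>\<bar>) + (\<Sum>i<n. ?D n i \<omega> * \<bar>?dN n i \<omega>\<bar>)"
        unfolding sum.distrib .
    qed
    also have "\<dots> = expectation (\<lambda>\<omega>. \<Sum>i<n. ?D n i \<omega> * \<bar>?dS n i \<omega>\<bar>) + expectation (\<lambda>\<omega>. \<Sum>i<n. ?D n i \<omega> * \<bar>?dN n i \<omega>\<bar>)"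
      by (intro Bochner_Integration.integral_add Bochner_Integration.integrable_sum j)
    finally show ?thesis .
  qed
  have lim: "(\<lambda>n. expectation (\<lambda>\<omega>. \<Sum>i<n. ?D n i \<omega> * \<bar>?dS n i \<omega>\<bar>) + expectation (\<lambda>\<omega>. \<Sum>i<n. ?D n i \<omega> * \<bar>?dN n i \<omega>\<bar>)) \<longlonglongrightarrow> 0"
    using tendsto_add[OF overshoot_process[OF S T Y] overshoot_martingale_abs[OF N T Y]] by simp
  show "(\<lambda>n. expectation (R n)) \<longlonglongrightarrow> 0"
    by (rule Lim_null_comparison[OF always_eventually lim]) (rule allI, rule bd)
qed

text \<open>With \<open>dS = dA + dN\<close> one has
  \<open>S1^2 - S0^2 = 2 * S0 * dN + dN^2 + dA * (2 * S1 - dA)\<close>. Taking \<open>S\<close> at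
  the right endpoint in the last term absorbs the mixed product \<open>dA * dN\<close>, so no
  covariation has to be estimated. The first term has zero mean, the square \<open>dN^2\<close> may
  be exchanged for the energy by the conditional isometry, and what remains are overshoots.\<close>

lemma discrete_ito_square:
  assumes S: "bounded_continuous_process S C" and N: "ito_limit N H" and T: "0 < T" and Y: "stopping_weights T Y"
  defines "A \<equiv> \<lambda>t \<omega>. S t \<omega> - N t \<omega>"
  defines "R \<equiv> \<lambda>n \<omega>. \<Sum>i<n. Y n i \<omega> * ((S (grid T n (Suc i)) \<omega>)^2 - (S (grid T n i) \<omega>)^2)
     - Y n (Suc i) \<omega> * ((LINT r:{grid T n i..grid T n (Suc i)}|lborel. (norm (H r \<omega>))^2)
        + (A (grid T n (Suc i)) \<omega> - A (grid T n i) \<omega>)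
          * (2 * S (grid T n (Suc i)) \<omega> - (A (grid T n (Suc i)) \<omega> - A (grid T n i) \<omega>)))"
  shows "integrable M (R n)" and "(\<lambda>n. expectation (R n)) \<longlonglongrightarrow> 0"
proof -
  have T0: "0 \<le> T" using T by simp
  let ?D = "\<lambda>n i \<omega>. Y n i \<omega> - Y n (Suc i) \<omega>"
  let ?S = "\<lambda>n i. S (grid T n i)"
  let ?dS = "\<lambda>n i \<omega>. S (grid T n (Suc i)) \<omega> - S (grid T n i) \<omega>"
  let ?dN = "\<lambda>n i \<omega>. N (grid T n (Suc i)) \<omega> - N (grid T n i) \<omega>"
  let ?q = "\<lambda>n i \<omega>. LINT r:{grid T n i..grid T n (Suc i)}|lborel. (norm (H r \<omega>))^2"
  let ?U = "\<lambda>n i \<omega>. (?dS n i \<omega> - ?dN n i \<omega>) * (2 * S (grid T n (Suc i)) \<omega> - (?dS n i \<omega> - ?dN n i \<omega>))"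
  have SL: "L2 M (?S n i)" for n i by (rule bounded_continuous_process_L2(2)[OF S grid_nonneg[OF T0]])
  have NL: "L2 M (N (grid T n i))" for n i by (rule ito_limit_L2[OF N grid_nonneg[OF T0]])
  have int: "L2 M f \<Longrightarrow> integrable M f" for f :: "'a \<Rightarrow> real" by (rule L2_integrable_real)
  have dSL: "L2 M (?dS n i)" and dNL: "L2 M (?dN n i)" for n i by (intro L2_diff SL NL)+
  have iU: "integrable M (?U n i)" for n i
  proof (intro L2_mult_integrable L2_diff SL NL)
    show "L2 M (\<lambda>x. 2 * ?S n (Suc i) x)" using L2_scaleR[OF SL[of n "Suc i"], of 2] by simp
  qed
  have iN2: "integrable M (\<lambda>\<omega>. (?dN n i \<omega>)^2)" for n i using dNL[of n i] unfolding L2_def by simp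
  have iSN: "integrable M (\<lambda>\<omega>. ?S n i \<omega> * ?dN n i \<omega>)" for n i by (rule L2_mult_integrable[OF SL dNL])
  have one: "(\<lambda>_. 1::real) \<in> borel_measurable M" "\<forall>\<omega>\<in>space M. \<bar>1::real\<bar> \<le> 1" by auto
  have iq: "integrable M (?q n i)" for n i
    using path_L2_integrals(2)[OF ito_limit_path_L2[OF N] grid_nonneg[OF T0] order_refl one] by simp
  have iw: "integrable M (\<lambda>\<omega>. ?D n i \<omega> * f \<omega>)" if "integrable M f" for f n i
    unfolding left_diff_distrib by (intro Bochner_Integration.integrable_diff weight_integrable[OF Y] that)
  note wi = weight_integrable[OF Y]
  have Req: "R n \<omega> = (\<Sum>i<n. 2 * (Y n i \<omega> * (?S n i \<omega> * ?dN n i \<omega>))) + (\<Sum>i<n. Y n i \<omega> * (?dN n i \<omega>)^2 - Y n i \<omega> * ?q n i \<omega>)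
       + ((\<Sum>i<n. ?D n i \<omega> * ?q n i \<omega>) + (\<Sum>i<n. ?D n i \<omega> * ?U n i \<omega>))" for n \<omega>
    unfolding R_def A_def sum.distrib[symmetric]
  proof (rule sum.cong[OF refl])
    fix i
    have alg: "y * (s1^2 - s0^2) - y' * (q + ((s1 - n1) - (s0 - n0)) * (2 * s1 - ((s1 - n1) - (s0 - n0))))
      = 2 * (y * (s0 * (n1 - n0))) + (y * (n1 - n0)^2 - y * q)
        + ((y - y') * q + (y - y') * (((s1 - s0) - (n1 - n0)) * (2 * s1 - ((s1 - s0) - (n1 - n0)))))"
      for y y' s0 s1 n0 n1 q :: real by algebra
    show "Y n i \<omega> * ((?S n (Suc i) \<omega>)^2 - (?S n i \<omega>)^2) - Y n (Suc i) \<omega> * (?q n i \<omega> +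
        (S (grid T n (Suc i)) \<omega> - N (grid T n (Suc i)) \<omega> - (S (grid T n i) \<omega> - N (grid T n i) \<omega>))
          * (2 * S (grid T n (Suc i)) \<omega> - (S (grid T n (Suc i)) \<omega> - N (grid T n (Suc i)) \<omega> - (S (grid T n i) \<omega> - N (grid T n i) \<omega>))))
      = 2 * (Y n i \<omega> * (?S n i \<omega> * ?dN n i \<omega>)) + (Y n i \<omega> * (?dN n i \<omega>)^2 - Y n i \<omega> * ?q n i \<omega>)
       + (?D n i \<omega> * ?q n i \<omega> + ?D n i \<omega> * ?U n i \<omega>)"
      by (rule alg)
  qed
  have i1: "integrable M (\<lambda>\<omega>. 2 * (Y n i \<omega> * (?S n i \<omega> * ?dN n i \<omega>)))" for n i
    by (intro integrable_mult_right wi iSN)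
  have i2: "integrable M (\<lambda>\<omega>. Y n i \<omega> * (?dN n i \<omega>)^2 - Y n i \<omega> * ?q n i \<omega>)" for n i
    by (intro Bochner_Integration.integrable_diff wi iN2 iq)
  have i3: "integrable M (\<lambda>\<omega>. ?D n i \<omega> * ?q n i \<omega>)" and i4: "integrable M (\<lambda>\<omega>. ?D n i \<omega> * ?U n i \<omega>)" for n i
    by (intro iw iq iU)+
  note isum = Bochner_Integration.integrable_add Bochner_Integration.integrable_sum
  show "integrable M (R n)"
    unfolding Req[abs_def] by (intro isum i1 i2 i3 i4)
  have e1: "expectation (\<lambda>\<omega>. 2 * (Y n i \<omega> * (?S n i \<omega> * ?dN n i \<omega>))) = 0" if i: "i < n" for n i
  proof -
    have "expectation (\<lambda>\<omega>. (Y n i \<omega> * ?S n i \<omega>) * ?dN n i \<omega>) = 0"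
    proof (rule ito_limit_martingale[OF N grid_nonneg[OF T0] grid_strict[OF T i]])
      have SF: "?S n i \<in> borel_measurable (F (grid T n i))"
        using S grid_nonneg[OF T0] unfolding bounded_continuous_process_def by blast
      show "(\<lambda>\<omega>. Y n i \<omega> * ?S n i \<omega>) \<in> borel_measurable (F (grid T n i))"
        using SF stopping_weights_D(1)[OF Y] by (intro borel_measurable_times)
      show "L2 M (\<lambda>\<omega>. Y n i \<omega> * ?S n i \<omega>)"
        unfolding L2_def
      proof
        show m: "(\<lambda>\<omega>. Y n i \<omega> * ?S n i \<omega>) \<in> borel_measurable M"
          using measurable_F_M[OF SF] stopping_weights_D(2)[OF Y] by (intro borel_measurable_times)
        show "integrable M (\<lambda>\<omega>. (norm (Y n i \<omega> * ?S n i \<omega>))^2)"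
        proof (rule Bochner_Integration.integrable_bound)
          show "integrable M (\<lambda>\<omega>. (norm (?S n i \<omega>))^2)" using SL unfolding L2_def by blast
          show "AE \<omega> in M. norm ((norm (Y n i \<omega> * ?S n i \<omega>))^2) \<le> norm ((norm (?S n i \<omega>))^2)"
          proof (rule AE_I2)
            fix \<omega> assume "\<omega> \<in> space M"
            then have "\<bar>Y n i \<omega>\<bar> * \<bar>?S n i \<omega>\<bar> \<le> 1 * \<bar>?S n i \<omega>\<bar>"
              using stopping_weights_D(6)[OF Y] by (intro mult_right_mono) auto
            then have "(\<bar>Y n i \<omega>\<bar> * \<bar>?S n i \<omega>\<bar>)^2 \<le> \<bar>?S n i \<omega>\<bar>^2" by (intro power_mono) auto
            then show "norm ((norm (Y n i \<omega> * ?S n i \<omega>))^2) \<le> norm ((norm (?S n i \<omega>))^2)"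
              by (simp add: power_mult_distrib)
          qed
        qed (use m in measurable)
      qed
    qed
    then show ?thesis by (simp add: mult.assoc)
  qed
  have e2: "expectation (\<lambda>\<omega>. Y n i \<omega> * (?dN n i \<omega>)^2 - Y n i \<omega> * ?q n i \<omega>) = 0" if i: "i < n" for n i
  proof -
    have "expectation (\<lambda>\<omega>. Y n i \<omega> * (?dN n i \<omega>)^2) = expectation (\<lambda>\<omega>. Y n i \<omega> * ?q n i \<omega>)"
      by (rule ito_limit_isometry[OF N grid_nonneg[OF T0] grid_strict[OF T i] stopping_weights_D(1)[OF Y], of 1])
         (use stopping_weights_D(6)[OF Y] in blast)
    then show ?thesis using Bochner_Integration.integral_diff[OF wi[OF iN2] wi[OF iq]] by simp
  qed
  have ER: "expectation (R n) = expectation (\<lambda>\<omega>. \<Sum>i<n. ?D n i \<omega> * ?q n i \<omega>) + expectation (\<lambda>\<omega>. \<Sum>i<n. ?D n i \<omega> * ?U n i \<omega>)" for n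
  proof -
    have "expectation (R n) = (expectation (\<lambda>\<omega>. \<Sum>i<n. 2 * (Y n i \<omega> * (?S n i \<omega> * ?dN n i \<omega>)))
        + expectation (\<lambda>\<omega>. \<Sum>i<n. Y n i \<omega> * (?dN n i \<omega>)^2 - Y n i \<omega> * ?q n i \<omega>))
        + (expectation (\<lambda>\<omega>. \<Sum>i<n. ?D n i \<omega> * ?q n i \<omega>) + expectation (\<lambda>\<omega>. \<Sum>i<n. ?D n i \<omega> * ?U n i \<omega>))"
      unfolding Req[abs_def]
      by (simp only: Bochner_Integration.integral_add isum i1 i2 i3 i4)
    also have "expectation (\<lambda>\<omega>. \<Sum>i<n. 2 * (Y n i \<omega> * (?S n i \<omega> * ?dN n i \<omega>))) = (\<Sum>i<n. expectation (\<lambda>\<omega>. 2 * (Y n i \<omega> * (?S n i \<omega> * ?dN n i \<omega>))))"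
      by (rule Bochner_Integration.integral_sum) (rule i1)
    also have "\<dots> = 0" using e1 by (intro sum.neutral) auto
    also have "expectation (\<lambda>\<omega>. \<Sum>i<n. Y n i \<omega> * (?dN n i \<omega>)^2 - Y n i \<omega> * ?q n i \<omega>) = (\<Sum>i<n. expectation (\<lambda>\<omega>. Y n i \<omega> * (?dN n i \<omega>)^2 - Y n i \<omega> * ?q n i \<omega>))"
      by (rule Bochner_Integration.integral_sum) (rule i2)
    also have "\<dots> = 0" using e2 by (intro sum.neutral) auto
    finally show ?thesis by simp
  qed
  have AEC: "AE \<omega> in M. \<forall>t\<ge>0. \<bar>S t \<omega>\<bar> \<le> C"
    using S unfolding bounded_continuous_process_def by (elim conjE AE_mp) auto
  have j: "integrable M (\<lambda>\<omega>. ?D n i \<omega> * \<bar>?dS n i \<omega>\<bar>)" "integrable M (\<lambda>\<omega>. ?D n i \<omega> * \<bar>?dN n i \<omega>\<bar>)"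
      "integrable M (\<lambda>\<omega>. ?D n i \<omega> * (?dN n i \<omega>)^2)" for n i
    by (intro iw integrable_abs int dSL dNL iN2)+
  let ?a = "\<lambda>n \<omega>. \<Sum>i<n. ?D n i \<omega> * \<bar>?dS n i \<omega>\<bar>" and ?b = "\<lambda>n \<omega>. \<Sum>i<n. ?D n i \<omega> * \<bar>?dN n i \<omega>\<bar>"
    and ?c = "\<lambda>n \<omega>. \<Sum>i<n. ?D n i \<omega> * (?dN n i \<omega>)^2"
  have ijs: "integrable M (?a n)" "integrable M (?b n)" "integrable M (?c n)" for n
    by (intro Bochner_Integration.integrable_sum j)+
  have bd: "norm (expectation (\<lambda>\<omega>. \<Sum>i<n. ?D n i \<omega> * ?U n i \<omega>)) \<le> 2 * C * expectation (?a n) + 4 * C * expectation (?b n) + expectation (?c n)" for n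
  proof -
    have "norm (expectation (\<lambda>\<omega>. \<Sum>i<n. ?D n i \<omega> * ?U n i \<omega>)) \<le> expectation (\<lambda>\<omega>. \<bar>\<Sum>i<n. ?D n i \<omega> * ?U n i \<omega>\<bar>)"
      unfolding real_norm_def by (rule integral_abs_bound)
    also have "\<dots> \<le> expectation (\<lambda>\<omega>. 2 * C * ?a n \<omega> + 4 * C * ?b n \<omega> + ?c n \<omega>)"
    proof (rule integral_mono_AE)
      show "integrable M (\<lambda>\<omega>. \<bar>\<Sum>i<n. ?D n i \<omega> * ?U n i \<omega>\<bar>)"
        by (intro integrable_abs Bochner_Integration.integrable_sum i4)
      show "integrable M (\<lambda>\<omega>. 2 * C * ?a n \<omega> + 4 * C * ?b n \<omega> + ?c n \<omega>)"
        by (intro Bochner_Integration.integrable_add integrable_mult_right ijs)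
      show "AE \<omega> in M. \<bar>\<Sum>i<n. ?D n i \<omega> * ?U n i \<omega>\<bar> \<le> 2 * C * ?a n \<omega> + 4 * C * ?b n \<omega> + ?c n \<omega>"
        using AEC AE_space
      proof eventually_elim
        case (elim \<omega>)
        have b: "\<bar>?S n i \<omega>\<bar> \<le> C" for i using elim(1) grid_nonneg[OF T0] by blast
        have "\<bar>\<Sum>i<n. ?D n i \<omega> * ?U n i \<omega>\<bar> \<le> (\<Sum>i<n. \<bar>?D n i \<omega> * ?U n i \<omega>\<bar>)" by (rule sum_abs)
        also have "\<dots> \<le> (\<Sum>i<n. 2 * C * (?D n i \<omega> * \<bar>?dS n i \<omega>\<bar>) + 4 * C * (?D n i \<omega> * \<bar>?dN n i \<omega>\<bar>) + ?D n i \<omega> * (?dN n i \<omega>)^2)"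
        proof (rule sum_mono)
          fix i
          have d: "0 \<le> ?D n i \<omega>" using stopping_weights_D(5)[OF Y elim(2), of n i] by simp
          have s2: "\<bar>?dS n i \<omega>\<bar> \<le> 2 * C" using b[of i] b[of "Suc i"] by linarith
          \<comment> \<open>In this form the second factor shows its bound
            \<open>2 * C + \<bar>dN\<bar>\<close>, so the product is controlled by the overshoots
            already treated.\<close>
          have "?U n i \<omega> = (?dS n i \<omega> - ?dN n i \<omega>) * (?S n i \<omega> + ?S n (Suc i) \<omega> + ?dN n i \<omega>)"
            by (simp add: algebra_simps)
          then have "\<bar>?U n i \<omega>\<bar> \<le> (\<bar>?dS n i \<omega>\<bar> + \<bar>?dN n i \<omega>\<bar>) * (2 * C + \<bar>?dN n i \<omega>\<bar>)"
            unfolding abs_mult[symmetric] using b[of i] b[of "Suc i"]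
            by (simp only: abs_mult) (intro mult_mono; linarith)
          also have "\<dots> = 2 * C * \<bar>?dS n i \<omega>\<bar> + 2 * C * \<bar>?dN n i \<omega>\<bar> + \<bar>?dS n i \<omega>\<bar> * \<bar>?dN n i \<omega>\<bar> + (?dN n i \<omega>)^2"
            unfolding power2_eq_square abs_mult_self_eq[symmetric, of "?dN n i \<omega>"] by (simp add: algebra_simps)
          also have "\<bar>?dS n i \<omega>\<bar> * \<bar>?dN n i \<omega>\<bar> \<le> 2 * C * \<bar>?dN n i \<omega>\<bar>" by (rule mult_right_mono[OF s2]) simp
          finally have u: "\<bar>?U n i \<omega>\<bar> \<le> 2 * C * \<bar>?dS n i \<omega>\<bar> + 4 * C * \<bar>?dN n i \<omega>\<bar> + (?dN n i \<omega>)^2" by simp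
          have "\<bar>?D n i \<omega> * ?U n i \<omega>\<bar> = ?D n i \<omega> * \<bar>?U n i \<omega>\<bar>" using d by (simp only: abs_mult abs_of_nonneg)
          also have "\<dots> \<le> ?D n i \<omega> * (2 * C * \<bar>?dS n i \<omega>\<bar> + 4 * C * \<bar>?dN n i \<omega>\<bar> + (?dN n i \<omega>)^2)" by (rule mult_left_mono[OF u d])
          also have "\<dots> = 2 * C * (?D n i \<omega> * \<bar>?dS n i \<omega>\<bar>) + 4 * C * (?D n i \<omega> * \<bar>?dN n i \<omega>\<bar>) + ?D n i \<omega> * (?dN n i \<omega>)^2"
            by (simp only: distrib_left mult.left_commute)
          finally show "\<bar>?D n i \<omega> * ?U n i \<omega>\<bar> \<le> 2 * C * (?D n i \<omega> * \<bar>?dS n i \<omega>\<bar>) + 4 * C * (?D n i \<omega> * \<bar>?dN n i \<omega>\<bar>) + ?D n i \<omega> * (?dN n i \<omega>)^2" .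
        qed
        finally show ?case by (simp only: sum.distrib sum_distrib_left)
      qed
    qed
    also have "\<dots> = 2 * C * expectation (?a n) + 4 * C * expectation (?b n) + expectation (?c n)"
      using ijs by simp
    finally show ?thesis .
  qed
  have "(\<lambda>n. 2 * C * expectation (?a n) + 4 * C * expectation (?b n) + expectation (?c n)) \<longlonglongrightarrow> 2 * C * 0 + 4 * C * 0 + 0"
    by (intro tendsto_add tendsto_mult tendsto_const overshoot_process[OF S T Y] overshoot_martingale_abs[OF N T Y] overshoot_martingale_sq[OF N T Y])
  then have lim: "(\<lambda>n. 2 * C * expectation (?a n) + 4 * C * expectation (?b n) + expectation (?c n)) \<longlonglongrightarrow> 0" by simp
  have "(\<lambda>n. expectation (\<lambda>\<omega>. \<Sum>i<n. ?D n i \<omega> * ?U n i \<omega>)) \<longlonglongrightarrow> 0"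
    by (rule Lim_null_comparison[OF always_eventually lim]) (rule allI, rule bd)
  from tendsto_add[OF overshoot_energy[OF N T Y] this]
  show "(\<lambda>n. expectation (R n)) \<longlonglongrightarrow> 0" unfolding ER by simp
qed

end

section \<open>Paths driven by a Stieltjes measure\<close>

lemma set_integral_abs_le:
  fixes f g :: "real \<Rightarrow> real"
  assumes "set_integrable M A f" "set_integrable M A g" "\<And>r. r \<in> A \<Longrightarrow> \<bar>f r\<bar> \<le> g r"
  shows "\<bar>LINT r:A|M. f r\<bar> \<le> (LINT r:A|M. g r)"
proof -
  have "\<bar>LINT r:A|M. f r\<bar> \<le> (\<integral>r. \<bar>indicator A r *\<^sub>R f r\<bar> \<partial>M)"
    unfolding set_lebesgue_integral_def by (rule integral_abs_bound)
  also have "\<dots> \<le> (LINT r:A|M. g r)"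
    unfolding set_lebesgue_integral_def
    using assms unfolding set_integrable_def by (intro integral_mono integrable_abs) (auto simp: indicator_def)
  finally show ?thesis .
qed

locale stieltjes_path =
  fixes K :: "real \<Rightarrow> real"
  assumes cont: "continuous_on {0..} K" and mono: "mono_on {0..} K"
begin

lemma K_mono: "0 \<le> s \<Longrightarrow> s \<le> t \<Longrightarrow> K s \<le> K t"
  using mono by (auto simp: mono_on_def)

lemma sets_K [simp, measurable_cong]: "sets (stieltjes K) = sets borel"
  by (simp add: stieltjes_def)

lemma emeasure_K: assumes "0 \<le> s" "s \<le> t" shows "emeasure (stieltjes K) {s..t} = K t - K s"
proof -
  have "continuous_on UNIV (\<lambda>t. K (max 0 t))"
    by (rule continuous_on_compose2[OF cont]) (auto intro!: continuous_intros)
  then show ?thesis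
    unfolding stieltjes_def using assms
    by (subst emeasure_interval_measure_Icc) (auto intro!: K_mono)
qed

lemma measure_K: "0 \<le> s \<Longrightarrow> s \<le> t \<Longrightarrow> measure (stieltjes K) {s..t} = K t - K s"
  using emeasure_K K_mono unfolding measure_def by simp

lemma AE_K: assumes "0 \<le> m" shows "AE r in stieltjes K. r \<noteq> m"
proof (rule AE_I')
  show "{m} \<in> null_sets (stieltjes K)" using emeasure_K[OF assms order_refl] by (simp add: null_sets_def)
qed auto

lemma integrable_indicator_K: assumes "0 \<le> s" shows "integrable (stieltjes K) (indicat_real {s..t})"
proof (cases "s \<le> t")
  case True show ?thesis by (rule integrable_real_indicator) (use emeasure_K[OF assms True] in simp_all)
qed simp

lemma integrable_K:
  fixes f :: "real \<Rightarrow> 'b::euclidean_space"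
  assumes f: "continuous_on {0..} f" and s: "0 \<le> s"
  shows "set_integrable (stieltjes K) {s..t} f"
proof -
  have sub: "continuous_on {s..t} f" by (rule continuous_on_subset[OF f]) (use s in auto)
  have "bounded (f ` {s..t})" by (intro compact_imp_bounded compact_continuous_image sub) simp
  then obtain B where B: "\<forall>r\<in>{s..t}. norm (f r) \<le> B" by (auto simp: bounded_iff)
  show ?thesis unfolding set_integrable_def
  proof (rule Bochner_Integration.integrable_bound)
    show "integrable (stieltjes K) (\<lambda>r. B * indicat_real {s..t} r)"
      using integrable_indicator_K[OF s] by simp
    show "(\<lambda>r. indicat_real {s..t} r *\<^sub>R f r) \<in> borel_measurable (stieltjes K)"
      using borel_measurable_continuous_on_indicator[OF _ sub]
      by (simp add: measurable_cong_sets[OF sets_K refl])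
    show "AE r in stieltjes K. norm (indicat_real {s..t} r *\<^sub>R f r) \<le> norm (B * indicat_real {s..t} r)"
      using B by (intro AE_I2) (auto simp: indicator_def intro: order_trans[OF _ abs_ge_self])
  qed
qed

lemma integral_K_split:
  fixes f :: "real \<Rightarrow> 'b::euclidean_space"
  assumes f: "continuous_on {0..} f" and "0 \<le> s" "s \<le> m" "m \<le> t"
  shows "(LINT r:{s..t}|stieltjes K. f r) = (LINT r:{s..m}|stieltjes K. f r) + (LINT r:{m..t}|stieltjes K. f r)"
  by (rule set_integral_Icc_split[OF AE_K integrable_K[OF f]]) (use assms in auto)

lemma integral_K_abs_le:
  fixes f :: "real \<Rightarrow> real"
  assumes f: "continuous_on {0..} f" and st: "0 \<le> s" "s \<le> t" and B: "\<And>r. r \<in> {s..t} \<Longrightarrow> \<bar>f r\<bar> \<le> B"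
  shows "\<bar>LINT r:{s..t}|stieltjes K. f r\<bar> \<le> B * (K t - K s)"
proof -
  have "\<bar>LINT r:{s..t}|stieltjes K. f r\<bar> \<le> (LINT r:{s..t}|stieltjes K. B)"
    using B st by (intro set_integral_abs_le integrable_K[OF f] integrable_K continuous_on_const) auto
  also have "\<dots> = B * (K t - K s)"
    using st emeasure_K[OF st] by (simp add: set_integral_const measure_K)
  finally show ?thesis .
qed

text \<open>If \<open>dK\<close> is carried by the times at which the path is on the boundary, only the values of the
  integrand at these times matter.\<close>

lemma integral_K_nonneg:
  fixes f :: "real \<Rightarrow> real" and P :: "real \<Rightarrow> bool"
  assumes f: "continuous_on {0..} f" and t: "0 \<le> t"
    and P: "K t = (LINT r:{0..t}|stieltjes K. indicator (Collect P) r)" "K 0 = 0"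
    and pos: "\<And>r. r \<in> {0..t} \<Longrightarrow> P r \<Longrightarrow> 0 \<le> f r"
    and Pm: "Collect P \<inter> {0..t} \<in> sets borel"
  shows "0 \<le> (LINT r:{0..t}|stieltjes K. f r)"
proof -
  have eq: "indicat_real {0..t} r *\<^sub>R indicator (Collect P) r = indicat_real (Collect P \<inter> {0..t}) r" for r
    by (auto simp: indicator_def)
  \<comment> \<open>As \<open>K 0 = 0\<close>, the formula for \<open>K t\<close> says that the
    times satisfying \<open>P\<close> carry the whole mass of the interval; the other times are then
    a null set.\<close>
  have m: "measure (stieltjes K) (Collect P \<inter> {0..t}) = measure (stieltjes K) {0..t}"
    using P measure_K[OF order_refl t] Pm unfolding set_lebesgue_integral_def eq by simp
  have fin: "emeasure (stieltjes K) {0..t} \<noteq> \<infinity>" using emeasure_K[OF order_refl t] by simp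
  have "emeasure (stieltjes K) (Collect P \<inter> {0..t}) \<le> emeasure (stieltjes K) {0..t}"
    by (rule emeasure_mono) auto
  then have fin2: "emeasure (stieltjes K) (Collect P \<inter> {0..t}) \<noteq> \<infinity>" using fin by (metis infinity_ennreal_def neq_top_trans)
  have "measure (stieltjes K) ({0..t} - (Collect P \<inter> {0..t})) = 0"
    using measure_Diff[OF fin _ _, of "Collect P \<inter> {0..t}"] m Pm by simp
  moreover have "emeasure (stieltjes K) ({0..t} - (Collect P \<inter> {0..t})) \<noteq> \<infinity>"
  proof -
    have "emeasure (stieltjes K) ({0..t} - (Collect P \<inter> {0..t})) \<le> emeasure (stieltjes K) {0..t}"
      by (rule emeasure_mono) auto
    then show ?thesis using fin by (metis infinity_ennreal_def neq_top_trans)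
  qed
  ultimately have "{0..t} - (Collect P \<inter> {0..t}) \<in> null_sets (stieltjes K)"
    using Pm by (auto simp: null_sets_def emeasure_eq_ennreal_measure)
  then have "AE r in stieltjes K. r \<notin> {0..t} - (Collect P \<inter> {0..t})" by (rule AE_not_in)
  then have "AE r in stieltjes K. 0 \<le> indicat_real {0..t} r *\<^sub>R f r"
    by eventually_elim (use pos in \<open>auto simp: indicator_def\<close>)
  then show ?thesis unfolding set_lebesgue_integral_def by (rule integral_nonneg_AE)
qed

end

text \<open>A single path, so that everything here is deterministic. \<open>A\<close> is the part of
  \<open>S\<close> of bounded variation, with density \<open>a\<close> in time, only integrable
  since \<open>\<zeta>\<close> will enter it, and bounded density \<open>\<beta>\<close> with
  respect to \<open>dK\<close>.\<close>

locale semimartingale_path = stieltjes_path +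
  fixes T C :: real and S A a \<beta> :: "real \<Rightarrow> real"
  assumes T: "0 < T" and K0: "K 0 = 0"
    and S_cont: "continuous_on {0..} S" and S_bd: "\<And>t. 0 \<le> t \<Longrightarrow> \<bar>S t\<bar> \<le> C"
    and a_int: "set_integrable lborel {0..T} a"
    and \<beta>_cont: "continuous_on {0..} \<beta>" and \<beta>_bd: "\<And>t. 0 \<le> t \<Longrightarrow> \<bar>\<beta> t\<bar> \<le> C"
    and A: "\<And>s t. 0 \<le> s \<Longrightarrow> s \<le> t \<Longrightarrow> t \<le> T \<Longrightarrow> A t - A s = (LINT r:{s..t}|lborel. a r) + (LINT r:{s..t}|stieltjes K. \<beta> r)"
begin

abbreviation "dA n i \<equiv> A (grid T n (Suc i)) - A (grid T n i)"

text \<open>A continuous nondecreasing majorant for the variation of \<open>A\<close>, more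
  convenient than the variation itself.\<close>

definition "V t = (LINT r:{0..t}|lborel. \<bar>a r\<bar>) + C * K t"

lemma T0: "0 \<le> T" using T by simp

lemma S2_bd: "0 \<le> t \<Longrightarrow> \<bar>2 * S t\<bar> \<le> 2 * C"
  using S_bd[of t] by (simp add: abs_mult)

lemma C0: "0 \<le> C" using S_bd[of 0] by linarith

lemma a_sub: "0 \<le> s \<Longrightarrow> t \<le> T \<Longrightarrow> set_integrable lborel {s..t} a"
  by (rule set_integrable_subset[OF a_int]) auto

lemma V_diff:
  assumes "0 \<le> s" "s \<le> t" "t \<le> T"
  shows "V t - V s = (LINT r:{s..t}|lborel. \<bar>a r\<bar>) + C * (K t - K s)"
  using set_integral_split[OF set_integrable_abs[OF a_sub[OF order_refl assms(3)]] assms(1,2)]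
  unfolding V_def by (simp add: algebra_simps)

lemma V_zero: "V 0 = 0"
proof -
  have "(LINT r:{0..0}|lborel. \<bar>a r\<bar>) = 0"
    using set_integral_split[OF set_integrable_abs[OF a_sub[of 0 0]], of 0] T0 by simp
  then show ?thesis unfolding V_def K0 by simp
qed

lemma V_mono: assumes "0 \<le> s" "s \<le> t" "t \<le> T" shows "V s \<le> V t"
proof -
  have "0 \<le> (LINT r:{s..t}|lborel. \<bar>a r\<bar>)"
    unfolding set_lebesgue_integral_def by (rule Bochner_Integration.integral_nonneg) auto
  moreover have "0 \<le> C * (K t - K s)" using C0 K_mono[OF assms(1,2)] by simp
  ultimately show ?thesis using V_diff[OF assms] by linarith
qed

lemma integral_bound:
  assumes st: "0 \<le> s" "s \<le> t" "t \<le> T" and f: "continuous_on {0..} f" and e: "\<And>r. r \<in> {s..t} \<Longrightarrow> \<bar>f r\<bar> \<le> e"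
  shows "set_integrable lborel {s..t} (\<lambda>r. f r * a r)"
    and "\<bar>(LINT r:{s..t}|lborel. f r * a r) + (LINT r:{s..t}|stieltjes K. f r * \<beta> r)\<bar> \<le> e * (V t - V s)"
proof -
  have e0: "0 \<le> e" using e[of s] st by (auto intro: order_trans[OF abs_ge_zero])
  have am: "(\<lambda>r. indicat_real {s..t} r *\<^sub>R a r) \<in> borel_measurable lborel"
    using a_sub[OF st(1,3)] unfolding set_integrable_def by (rule borel_measurable_integrable)
  have fm: "(\<lambda>r. indicat_real {s..t} r *\<^sub>R f r) \<in> borel_measurable lborel"
    using borel_measurable_continuous_on_indicator[of "{s..t}" f] continuous_on_subset[OF f, of "{s..t}"] st by auto
  have prod: "indicat_real {s..t} r *\<^sub>R (f r * a r) = (indicat_real {s..t} r *\<^sub>R f r) * (indicat_real {s..t} r *\<^sub>R a r)" for r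
    by (simp add: indicator_def)
  have ai: "set_integrable lborel {s..t} (\<lambda>r. e * \<bar>a r\<bar>)" using set_integrable_abs[OF a_sub[OF st(1,3)]] by simp
  show int: "set_integrable lborel {s..t} (\<lambda>r. f r * a r)"
    unfolding set_integrable_def
  proof (rule Bochner_Integration.integrable_bound)
    show "integrable lborel (\<lambda>r. indicat_real {s..t} r *\<^sub>R (e * \<bar>a r\<bar>))" using ai unfolding set_integrable_def .
    show "(\<lambda>r. indicat_real {s..t} r *\<^sub>R (f r * a r)) \<in> borel_measurable lborel"
      unfolding prod using am fm by (intro borel_measurable_times)
    show "AE r in lborel. norm (indicat_real {s..t} r *\<^sub>R (f r * a r)) \<le> norm (indicat_real {s..t} r *\<^sub>R (e * \<bar>a r\<bar>))"
    proof (rule AE_I2)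
      fix r
      show "norm (indicat_real {s..t} r *\<^sub>R (f r * a r)) \<le> norm (indicat_real {s..t} r *\<^sub>R (e * \<bar>a r\<bar>))"
      proof (cases "r \<in> {s..t}")
        case True
        then have "\<bar>f r\<bar> * \<bar>a r\<bar> \<le> e * \<bar>a r\<bar>" using e by (intro mult_right_mono) auto
        then show ?thesis using True e0 by (simp add: abs_mult)
      next
        case False
        then have z: "indicat_real {s..t} r = 0" by (rule indicator_simps(2))
        show ?thesis unfolding z by simp
      qed
    qed
  qed
  have 1: "\<bar>LINT r:{s..t}|lborel. f r * a r\<bar> \<le> e * (LINT r:{s..t}|lborel. \<bar>a r\<bar>)"
  proof -
    have "\<bar>LINT r:{s..t}|lborel. f r * a r\<bar> \<le> (LINT r:{s..t}|lborel. e * \<bar>a r\<bar>)"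
      by (rule set_integral_abs_le[OF int ai]) (use e in \<open>auto simp: abs_mult intro!: mult_right_mono\<close>)
    then show ?thesis by simp
  qed
  have 2: "\<bar>LINT r:{s..t}|stieltjes K. f r * \<beta> r\<bar> \<le> (e * C) * (K t - K s)"
    using e0 e \<beta>_bd st by (intro integral_K_abs_le continuous_on_mult f \<beta>_cont) (auto simp: abs_mult intro!: mult_mono)
  show "\<bar>(LINT r:{s..t}|lborel. f r * a r) + (LINT r:{s..t}|stieltjes K. f r * \<beta> r)\<bar> \<le> e * (V t - V s)"
    using 1 2 unfolding V_diff[OF st] by (simp add: distrib_left mult.assoc)
qed

lemma A_increment: assumes "0 \<le> s" "s \<le> t" "t \<le> T" shows "\<bar>A t - A s\<bar> \<le> V t - V s"
  using integral_bound(2)[OF assms continuous_on_const[of _ 1], of 1] A[OF assms] by simp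

text \<open>Freezing \<open>S\<close> at the right endpoint costs at most \<open>2 * e\<close> times
  the increment of \<open>V\<close>, and the square of the increment of \<open>A\<close> at most the
  square of that of \<open>V\<close>. Both errors contain a factor \<open>V t - V s\<close> and can
  be summed over a grid.\<close>

lemma step_error:
  assumes st: "0 \<le> s" "s \<le> t" "t \<le> T" and e: "\<And>r. r \<in> {s..t} \<Longrightarrow> \<bar>S t - S r\<bar> \<le> e"
  shows "\<bar>(A t - A s) * (2 * S t - (A t - A s))
     - ((LINT r:{s..t}|lborel. 2 * S r * a r) + (LINT r:{s..t}|stieltjes K. 2 * S r * \<beta> r))\<bar>
     \<le> (2 * e + (V t - V s)) * (V t - V s)"
proof -
  let ?L = "\<lambda>f. (LINT r:{s..t}|lborel. f r * a r) + (LINT r:{s..t}|stieltjes K. f r * \<beta> r)"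
  have c2: "continuous_on {0..} (\<lambda>r. 2 * S r)" "continuous_on {0..} (\<lambda>r. 2 * S t)" using S_cont by (auto intro!: continuous_intros)
  have c: "continuous_on {0..} (\<lambda>r. 2 * S t - 2 * S r)" using S_cont by (auto intro!: continuous_intros)
  have i1: "set_integrable lborel {s..t} (\<lambda>r. 2 * S r * a r)" "set_integrable lborel {s..t} (\<lambda>r. 2 * S t * a r)"
    by (rule integral_bound(1)[OF st c2(1), of "2 * C"], use S2_bd st in force)
       (rule integral_bound(1)[OF st c2(2), of "2 * C"], use S2_bd[of t] st in force)
  have i2: "set_integrable (stieltjes K) {s..t} (\<lambda>r. 2 * S r * \<beta> r)" "set_integrable (stieltjes K) {s..t} (\<lambda>r. 2 * S t * \<beta> r)"
    using S_cont \<beta>_cont by (auto intro!: integrable_K continuous_intros st)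
  have "?L (\<lambda>r. 2 * S t - 2 * S r) = 2 * S t * (A t - A s) - ?L (\<lambda>r. 2 * S r)"
    using i1 i2 unfolding left_diff_distrib A[OF st]
    by (simp add: set_integral_diff distrib_left)
  then have "(A t - A s) * (2 * S t - (A t - A s)) - ?L (\<lambda>r. 2 * S r) = ?L (\<lambda>r. 2 * S t - 2 * S r) - (A t - A s)^2"
    by (simp add: power2_eq_square algebra_simps)
  moreover have "\<bar>?L (\<lambda>r. 2 * S t - 2 * S r)\<bar> \<le> (2 * e) * (V t - V s)"
  proof (rule integral_bound(2)[OF st c])
    fix r assume "r \<in> {s..t}"
    then have "\<bar>S t - S r\<bar> \<le> e" by (rule e)
    then show "\<bar>2 * S t - 2 * S r\<bar> \<le> 2 * e" by linarith
  qed
  moreover have "(A t - A s)^2 \<le> (V t - V s)^2"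
    using power_mono[OF A_increment[OF st], of 2] by simp
  ultimately have "\<bar>(A t - A s) * (2 * S t - (A t - A s)) - ?L (\<lambda>r. 2 * S r)\<bar> \<le> (2 * e) * (V t - V s) + (V t - V s)^2"
    using zero_le_power2[of "A t - A s"] by linarith
  then show ?thesis by (simp add: power2_eq_square distrib_right)
qed

lemma V_grid_sum: "m \<le> n \<Longrightarrow> (\<Sum>i<m. V (grid T n (Suc i)) - V (grid T n i)) = V (grid T n m)"
  using sum_lessThan_telescope[of "\<lambda>i. V (grid T n i)" m] by (simp add: V_zero)

text \<open>This is where stopping at \<open>K \<le> 1\<close> pays: the variation up to the stopped
  grid point is bounded by a quantity in which \<open>K\<close> no longer occurs.\<close>

lemma V_grid_le:
  assumes m: "m \<le> n" and K1: "K (grid T n m) \<le> 1"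
  shows "V (grid T n m) \<le> (LINT r:{0..T}|lborel. \<bar>a r\<bar>) + C"
proof -
  have g: "0 \<le> grid T n m" "grid T n m \<le> T" using grid_nonneg[OF T0] grid_le[OF T0 m] by auto
  have "(LINT r:{0..T}|lborel. \<bar>a r\<bar>) = (LINT r:{0..grid T n m}|lborel. \<bar>a r\<bar>) + (LINT r:{grid T n m..T}|lborel. \<bar>a r\<bar>)"
    by (rule set_integral_split[OF set_integrable_abs[OF a_int]]) (use g in auto)
  moreover have "0 \<le> (LINT r:{grid T n m..T}|lborel. \<bar>a r\<bar>)"
    unfolding set_lebesgue_integral_def by (rule Bochner_Integration.integral_nonneg) auto
  moreover have "C * K (grid T n m) \<le> C * 1" using K1 C0 by (intro mult_left_mono)
  ultimately show ?thesis unfolding V_def by simp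
qed

lemma linear_sum:
  assumes m: "m \<le> n"
  shows "(\<Sum>i<m. dA n i) = (LINT r:{0..grid T n m}|lborel. a r) + (LINT r:{0..grid T n m}|stieltjes K. \<beta> r)"
  using sum_lessThan_telescope[of "\<lambda>i. A (grid T n i)" m] A[OF order_refl grid_nonneg[OF T0] grid_le[OF T0 m]] by simp

lemma linear_sum_bound:
  assumes m: "m \<le> n" and K1: "K (grid T n m) \<le> 1"
  shows "\<bar>\<Sum>i<m. dA n i\<bar> \<le> (LINT r:{0..T}|lborel. \<bar>a r\<bar>) + C"
proof -
  have "\<bar>A (grid T n m) - A 0\<bar> \<le> V (grid T n m) - V 0"
    by (rule A_increment[OF order_refl grid_nonneg[OF T0] grid_le[OF T0 m]])
  then show ?thesis using V_grid_le[OF m K1] V_zero sum_lessThan_telescope[of "\<lambda>i. A (grid T n i)" m] by simp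
qed

text \<open>The bound is quadratic in the integral of \<open>\<bar>a\<bar>\<close>. When
  \<open>a\<close> grows linearly in \<open>\<zeta>\<close>, it is dominated by the time integral of
  the squared norm of \<open>\<zeta>\<close>, which has finite expectation.\<close>

lemma square_sum_bound:
  assumes m: "m \<le> n" and K1: "K (grid T n m) \<le> 1"
  shows "\<bar>\<Sum>i<m. dA n i * (2 * S (grid T n (Suc i)) - dA n i)\<bar>
    \<le> ((LINT r:{0..T}|lborel. \<bar>a r\<bar>) + C) * (2 * C + ((LINT r:{0..T}|lborel. \<bar>a r\<bar>) + C))"
proof -
  let ?v = "\<lambda>i. V (grid T n (Suc i)) - V (grid T n i)"
  let ?B = "(LINT r:{0..T}|lborel. \<bar>a r\<bar>) + C"
  have B: "V (grid T n m) \<le> ?B" by (rule V_grid_le[OF m K1])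
  have step: "0 \<le> grid T n i" "grid T n i \<le> grid T n (Suc i)" "grid T n (Suc i) \<le> grid T n m" "grid T n (Suc i) \<le> T" if "i < m" for i
    using that m grid_nonneg[OF T0] grid_mono[OF T0] grid_le[OF T0] by auto
  have V0: "0 \<le> V (grid T n i)" if "i \<le> m" for i
    using V_mono[of 0 "grid T n i"] V_zero grid_nonneg[OF T0] grid_le[OF T0, of i n] that m by simp
  have v: "0 \<le> ?v i" "?v i \<le> ?B" if "i < m" for i
  proof -
    show "0 \<le> ?v i" using V_mono[OF step(1,2,4)[OF that]] by simp
    have "V (grid T n (Suc i)) \<le> V (grid T n m)"
      using step[OF that] grid_le[OF T0 m] by (intro V_mono) auto
    then show "?v i \<le> ?B" using V0[of i] that B by linarith
  qed
  have "\<bar>\<Sum>i<m. dA n i * (2 * S (grid T n (Suc i)) - dA n i)\<bar> \<le> (\<Sum>i<m. \<bar>dA n i * (2 * S (grid T n (Suc i)) - dA n i)\<bar>)"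
    by (rule sum_abs)
  also have "\<dots> \<le> (\<Sum>i<m. ?v i * (2 * C + ?B))"
  proof (rule sum_mono)
    fix i assume "i \<in> {..<m}"
    then have i: "i < m" by simp
    have d: "\<bar>dA n i\<bar> \<le> ?v i" by (rule A_increment[OF step(1,2,4)[OF i]])
    have "\<bar>2 * S (grid T n (Suc i)) - dA n i\<bar> \<le> 2 * C + ?B"
      using d v[OF i] S_bd[OF grid_nonneg[OF T0, of n "Suc i"]] by linarith
    then show "\<bar>dA n i * (2 * S (grid T n (Suc i)) - dA n i)\<bar> \<le> ?v i * (2 * C + ?B)"
      unfolding abs_mult using d v[OF i] by (intro mult_mono) auto
  qed
  also have "\<dots> = V (grid T n m) * (2 * C + ?B)" unfolding sum_distrib_right[symmetric] V_grid_sum[OF m] ..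
  also have "\<dots> \<le> ?B * (2 * C + ?B)" using B C0 V0[of m] by (intro mult_right_mono) auto
  finally show ?thesis .
qed

lemma V_cont: "continuous_on {0..T} V"
proof -
  have ai: "set_integrable lborel {0..T} (\<lambda>r. \<bar>a r\<bar>)" by (rule set_integrable_abs[OF a_int])
  have "continuous_on {0..T} (\<lambda>t. integral {0..t} (\<lambda>r. \<bar>a r\<bar>))"
    by (rule indefinite_integral_continuous_1[OF set_borel_integral_eq_integral(1)[OF ai]])
  then have "continuous_on {0..T} (\<lambda>t. integral {0..t} (\<lambda>r. \<bar>a r\<bar>) + C * K t)"
    using continuous_on_subset[OF cont, of "{0..T}"] by (intro continuous_intros) auto
  then show ?thesis
    by (rule continuous_on_eq)
       (auto simp: V_def intro!: set_borel_integral_eq_integral(2)[symmetric] set_integrable_subset[OF ai])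
qed

text \<open>The convergence of the sums has to be uniform in the upper index, because the stopping
  index depends on the path and on \<open>n\<close>. On fine grids each step error is at most
  \<open>3 * d\<close> times the increment of \<open>V\<close>, and \<open>V_grid_le\<close> bounds
  the sum of these increments.\<close>

lemma square_sum_limit:
  assumes e: "0 < e"
  obtains n0 where "0 < n0" "\<And>n m. n0 \<le> n \<Longrightarrow> m \<le> n \<Longrightarrow> K (grid T n m) \<le> 1 \<Longrightarrow>
     \<bar>(\<Sum>i<m. dA n i * (2 * S (grid T n (Suc i)) - dA n i))
       - ((LINT r:{0..grid T n m}|lborel. 2 * S r * a r) + (LINT r:{0..grid T n m}|stieltjes K. 2 * S r * \<beta> r))\<bar> \<le> e"
proof -
  let ?B = "(LINT r:{0..T}|lborel. \<bar>a r\<bar>) + C"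
  have Bpos: "0 \<le> ?B"
  proof -
    have "0 \<le> (LINT r:{0..T}|lborel. \<bar>a r\<bar>)"
      unfolding set_lebesgue_integral_def by (rule Bochner_Integration.integral_nonneg) auto
    then show ?thesis using C0 by simp
  qed
  \<comment> \<open>Makes \<open>3 * d * ?B \<le> e\<close>; the added 1 avoids a division by
    zero.\<close>
  define d where "d = e / (?B + 1) / 3"
  have d: "0 < d" unfolding d_def using e Bpos by simp
  obtain n1 where n1: "0 < n1" "\<And>n s t. n1 \<le> n \<Longrightarrow> s \<in> {0..T} \<Longrightarrow> t \<in> {0..T} \<Longrightarrow> \<bar>s - t\<bar> \<le> T / real n \<Longrightarrow> dist (S s) (S t) < d"
    by (rule grid_modulus[OF S_cont T d]) (rule that)
  have "continuous_on {0..} (\<lambda>t. V (min t T))"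
    by (rule continuous_on_compose2[OF V_cont]) (use T in \<open>auto intro!: continuous_intros\<close>)
  then obtain n2 where n2: "0 < n2" "\<And>n s t. n2 \<le> n \<Longrightarrow> s \<in> {0..T} \<Longrightarrow> t \<in> {0..T} \<Longrightarrow> \<bar>s - t\<bar> \<le> T / real n
      \<Longrightarrow> dist (V (min s T)) (V (min t T)) < d"
    by (rule grid_modulus[OF _ T d]) (rule that)
  show thesis
  proof (rule that[of "max n1 n2"])
    show "0 < max n1 n2" using n1 by simp
    fix n m assume n: "max n1 n2 \<le> n" and m: "m \<le> n" and K1: "K (grid T n m) \<le> 1"
    let ?v = "\<lambda>i. V (grid T n (Suc i)) - V (grid T n i)"
    let ?U = "\<lambda>i. dA n i * (2 * S (grid T n (Suc i)) - dA n i)"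
    let ?L = "\<lambda>s t. (LINT r:{s..t}|lborel. 2 * S r * a r) + (LINT r:{s..t}|stieltjes K. 2 * S r * \<beta> r)"
    have step: "0 \<le> grid T n i" "grid T n i \<le> grid T n (Suc i)" "grid T n (Suc i) \<le> T" if "i < m" for i
      using that m grid_nonneg[OF T0] grid_mono[OF T0] grid_le[OF T0] by auto
    have c2: "continuous_on {0..} (\<lambda>r. 2 * S r)" and c3: "continuous_on {0..} (\<lambda>r. 2 * S r * \<beta> r)"
      using S_cont \<beta>_cont by (auto intro!: continuous_intros)
    have tele: "(\<Sum>i<k. ?L (grid T n i) (grid T n (Suc i))) = ?L 0 (grid T n k)" if "k \<le> m" for k
      using that
    proof (induction k)
      case 0
      have "set_integrable lborel {0..0} (\<lambda>r. 2 * S r * a r)"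
        by (rule integral_bound(1)[OF _ _ _ c2, of 0 0 "2 * C"]) (use T0 S2_bd in auto)
      from set_integral_split[OF this, of 0] integral_K_split[OF c3, of 0 0 0] show ?case by simp
    next
      case (Suc k)
      note st = step[of k]
      have i: "set_integrable lborel {0..grid T n (Suc k)} (\<lambda>r. 2 * S r * a r)"
        by (rule integral_bound(1)[OF _ _ _ c2, of _ _ "2 * C"]) (use st S2_bd Suc.prems in auto)
      show ?case
        using Suc st set_integral_split[OF i, of "grid T n k"] integral_K_split[OF c3, of 0 "grid T n k" "grid T n (Suc k)"] by simp
    qed
    have "\<bar>(\<Sum>i<m. ?U i) - ?L 0 (grid T n m)\<bar> = \<bar>\<Sum>i<m. ?U i - ?L (grid T n i) (grid T n (Suc i))\<bar>"
      unfolding tele[OF order_refl, symmetric] by (simp only: sum_subtractf)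
    also have "\<dots> \<le> (\<Sum>i<m. \<bar>?U i - ?L (grid T n i) (grid T n (Suc i))\<bar>)" by (rule sum_abs)
    also have "\<dots> \<le> (\<Sum>i<m. (3 * d) * ?v i)"
    proof (rule sum_mono)
      fix i assume "i \<in> {..<m}"
      then have i: "i < m" by simp
      have v: "0 \<le> ?v i" using V_mono[OF step[OF i]] by simp
      have gm: "grid T n i \<in> {0..T}" "grid T n (Suc i) \<in> {0..T}" using step[OF i] by auto
      have "?v i \<le> d"
        using n2(2)[of n "grid T n (Suc i)" "grid T n i"] n gm grid_step_abs[OF T0, of n i]
        by (auto simp: dist_real_def min_def)
      moreover have "\<bar>S (grid T n (Suc i)) - S r\<bar> \<le> d" if "r \<in> {grid T n i..grid T n (Suc i)}" for r
        using n1(2)[of n "grid T n (Suc i)" r] n gm that grid_step[of T n i] by (auto simp: dist_real_def)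
      then have "\<bar>?U i - ?L (grid T n i) (grid T n (Suc i))\<bar> \<le> (2 * d + ?v i) * ?v i"
        by (rule step_error[OF step[OF i]])
      ultimately show "\<bar>?U i - ?L (grid T n i) (grid T n (Suc i))\<bar> \<le> (3 * d) * ?v i"
        using v by (smt (verit) mult_right_mono)
    qed
    also have "\<dots> = (3 * d) * V (grid T n m)" unfolding sum_distrib_left[symmetric] V_grid_sum[OF m] ..
    also have "\<dots> \<le> (3 * d) * ?B" using V_grid_le[OF m K1] d by (intro mult_left_mono) auto
    also have "\<dots> \<le> e"
    proof -
      have "3 * (x / 3) = x" for x :: real by simp
      then have "3 * d = e / (?B + 1)" unfolding d_def .
      then have "(3 * d) * ?B = e * (?B / (?B + 1))" by (simp only: times_divide_eq_left times_divide_eq_right)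
      also have "\<dots> \<le> e * 1" using e Bpos by (intro mult_left_mono) auto
      finally show ?thesis by simp
    qed
    finally show "\<bar>(\<Sum>i<m. ?U i) - ?L 0 (grid T n m)\<bar> \<le> e" .
  qed
qed

end

section \<open>Reflected diffusion with a backward equation\<close>

text \<open>\<open>m\<close> is the last index before the first failure, cut off at
  \<open>n\<close>; a failure at \<open>Suc m\<close> can therefore be claimed only if
  \<open>m < n\<close>.\<close>

lemma stop_index:
  fixes good :: "nat \<Rightarrow> bool"
  assumes "good 0"
  obtains m where "m \<le> n" "\<And>i. i \<le> n \<Longrightarrow> (\<forall>j\<le>i. good j) \<longleftrightarrow> i \<le> m" "m < n \<Longrightarrow> \<not> good (Suc m)"
proof -
  have "\<exists>m\<le>n. (\<forall>i\<le>n. (\<forall>j\<le>i. good j) \<longleftrightarrow> i \<le> m) \<and> (m < n \<longrightarrow> \<not> good (Suc m))"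
  proof (induction n)
    case 0 then show ?case using assms by auto
  next
    case (Suc n)
    then obtain m where m: "m \<le> n" "\<And>i. i \<le> n \<Longrightarrow> (\<forall>j\<le>i. good j) \<longleftrightarrow> i \<le> m" "m < n \<Longrightarrow> \<not> good (Suc m)" by auto
    show ?case
    proof (cases "m = n \<and> good (Suc n)")
      case True
      then have all: "\<forall>j\<le>Suc n. good j" using m(2)[of n] by (auto simp: le_Suc_eq)
      show ?thesis
      proof (intro exI[of _ "Suc n"] conjI allI impI)
        fix i assume "i \<le> Suc n" then show "(\<forall>j\<le>i. good j) \<longleftrightarrow> i \<le> Suc n" using all by auto
      qed auto
    next
      case False
      have bad: "\<not> good (Suc m)" using False m(1,3) by (cases "m = n") auto
      show ?thesis
      proof (intro exI[of _ m] conjI allI impI)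
        show "m \<le> Suc n" using m(1) by simp
        fix i assume i: "i \<le> Suc n"
        show "(\<forall>j\<le>i. good j) \<longleftrightarrow> i \<le> m"
        proof (cases "i \<le> n")
          case True then show ?thesis by (rule m(2))
        next
          case False
          then have "Suc m \<le> i" using i m(1) by simp
          then show ?thesis using bad by auto
        qed
      qed (rule bad)
    qed
  qed
  then show thesis using that by blast
qed

lemma sum_stopped:
  fixes x :: "nat \<Rightarrow> real"
  assumes "m \<le> n" shows "(\<Sum>i<n. (if Suc i \<le> m then 1 else 0) * x i) = (\<Sum>i<m. x i)"
proof -
  have "(\<Sum>i<n. (if Suc i \<le> m then 1 else 0) * x i) = (\<Sum>i\<in>{..<n} \<inter> {..<m}. x i)"
    by (subst sum.inter_restrict) (auto intro!: sum.cong)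
  also have "{..<n} \<inter> {..<m} = {..<m}" using assms by auto
  finally show ?thesis .
qed

text \<open>Weights taken at the left endpoint still include the step out of \<open>m\<close>. The
  sum thus ends at the first bad grid point, or at \<open>n\<close> if there is none, one step later
  than in \<open>sum_stopped\<close>.\<close>

lemma sum_stopped_diff:
  fixes f :: "nat \<Rightarrow> real"
  assumes "m \<le> n"
  shows "(\<Sum>i<n. (if i \<le> m then 1 else 0) * (f (Suc i) - f i)) = f (min (Suc m) n) - f 0"
proof -
  have "(\<Sum>i<n. (if i \<le> m then 1 else 0) * (f (Suc i) - f i)) = (\<Sum>i<n. (if Suc i \<le> min (Suc m) n then 1 else 0) * (f (Suc i) - f i))"
    by (intro sum.cong) auto
  also have "\<dots> = (\<Sum>i<min (Suc m) n. f (Suc i) - f i)" by (rule sum_stopped) simp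
  also have "\<dots> = f (min (Suc m) n) - f 0" by (rule sum_lessThan_telescope)
  finally show ?thesis .
qed

text \<open>Jensen's inequality on the unit interval, obtained from the nonnegativity of the
  variance.\<close>

lemma set_integral_square_le:
  fixes f :: "real \<Rightarrow> real"
  assumes f: "set_integrable lborel {0..1} f" and f2: "set_integrable lborel {0..1} (\<lambda>r. (f r)^2)"
  shows "(LINT r:{0..1}|lborel. f r)^2 \<le> (LINT r:{0..1}|lborel. (f r)^2)"
proof -
  let ?m = "LINT r:{0..1}|lborel. f r"
  have c: "set_integrable lborel {0..1} (\<lambda>r::real. ?m^2)" "(LINT r:{0..1::real}|lborel. ?m^2) = ?m^2"
    by (auto simp: set_integrable_def set_integral_const)
  have "0 \<le> (LINT r:{0..1}|lborel. (f r - ?m)^2)"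
    unfolding set_lebesgue_integral_def by (rule Bochner_Integration.integral_nonneg) auto
  also have "(\<lambda>r. (f r - ?m)^2) = (\<lambda>r. ((f r)^2 + ?m^2) - (2 * ?m) * f r)"
    by (auto simp: power2_eq_square algebra_simps)
  also have "(LINT r:{0..1}|lborel. ((f r)^2 + ?m^2) - (2 * ?m) * f r)
      = (LINT r:{0..1}|lborel. (f r)^2) + ?m^2 - (2 * ?m) * ?m"
    using f f2 c by (simp add: set_integral_diff set_integral_add)
  finally show ?thesis by (simp add: power2_eq_square)
qed

lemma set_integral_inner:
  fixes f :: "real \<Rightarrow> 'b::euclidean_space"
  assumes "set_integrable M A f"
  shows "w \<bullet> (LINT r:A|M. f r) = (LINT r:A|M. w \<bullet> f r)"
  using assms unfolding set_lebesgue_integral_def set_integrable_def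
  by (simp add: integral_inner_right[symmetric] del: integral_inner_right)

lemma set_integrable_continuous:
  fixes f :: "real \<Rightarrow> 'b::euclidean_space"
  assumes "continuous_on {0..} f" "0 \<le> s" shows "set_integrable lborel {s..t} f"
  unfolding set_integrable_def
  by (rule borel_integrable_compact) (use assms continuous_on_subset[OF assms(1), of "{s..t}"] in auto)

context brownian
begin

lemma ito_limit_sum:
  assumes "ito_limit N H" "finite A" "\<And>i. i \<in> A \<Longrightarrow> ito_limit (N' i) (H' i)"
  shows "ito_limit (\<lambda>t \<omega>. N t \<omega> + (\<Sum>i\<in>A. N' i t \<omega>)) (\<lambda>s \<omega>. H s \<omega> + (\<Sum>i\<in>A. H' i s \<omega>))"
  using assms(2,3)
proof (induction A rule: finite_induct)
  case empty then show ?case using assms(1) by simp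
next
  case (insert i A)
  have "ito_limit (\<lambda>t \<omega>. N t \<omega> + (\<Sum>i\<in>A. N' i t \<omega>)) (\<lambda>s \<omega>. H s \<omega> + (\<Sum>i\<in>A. H' i s \<omega>))"
    using insert.IH insert.prems by auto
  from ito_limit_add[OF insert.prems[of i] this] show ?case using insert by (simp add: add.left_commute)
qed

end

text \<open>The starting point is fixed, so that the exceptional null sets concern one process only.
  \<open>D\<close>, \<open>bd\<close> and \<open>nrm\<close> stand for the closed domain, its
  boundary and the gradient of \<open>\<phi>\<close>; \<open>L\<close> is the Lipschitz constant of
  \<open>\<psi>\<close> in its second argument. The equations are stated for increments, and
  \<open>v\<close> is Borel on the whole space so that \<open>v (X t)\<close> is adapted.\<close>

locale reflected_bsde = brownian M W for M :: "'a measure" and W :: "real \<Rightarrow> 'a \<Rightarrow> real^'d::finite" +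
  fixes D bd :: "(real^'d) set" and b nrm :: "real^'d \<Rightarrow> real^'d" and \<sigma> :: "real^'d \<Rightarrow> real^'d^'d"
    and \<psi> :: "real^'d \<Rightarrow> real^'d \<Rightarrow> real" and g v :: "real^'d \<Rightarrow> real" and lam \<mu> L :: real and \<zeta> :: "real^'d \<Rightarrow> real^'d"
    and x0 :: "real^'d" and X :: "real \<Rightarrow> 'a \<Rightarrow> real^'d" and K :: "real \<Rightarrow> 'a \<Rightarrow> real"
    and I :: "real \<Rightarrow> 'a \<Rightarrow> real" and J :: "'d \<Rightarrow> real \<Rightarrow> 'a \<Rightarrow> real"
  assumes D: "compact D" "x0 \<in> D" and bd: "closed bd"
    and cont: "continuous_on D b" "continuous_on D nrm" "continuous_on D \<sigma>" "continuous_on D g" "continuous_on D v"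
    and v_meas: "v \<in> borel_measurable borel"
    and \<psi>_cont: "continuous_on (D \<times> UNIV) (\<lambda>(x, z). \<psi> x z)"
    and \<psi>_lip: "\<And>x z z'. x \<in> D \<Longrightarrow> \<bar>\<psi> x z - \<psi> x z'\<bar> \<le> L * norm (z - z')"
    and \<zeta>_meas: "\<zeta> \<in> borel_measurable borel"
    and XF: "\<And>t. 0 \<le> t \<Longrightarrow> X t \<in> borel_measurable (F t)" and KF: "\<And>t. 0 \<le> t \<Longrightarrow> K t \<in> borel_measurable (F t)"
    and I_lim: "ito_limit I (\<lambda>s \<omega>. \<zeta> (X s \<omega>))" and J_lim: "\<And>i. ito_limit (J i) (\<lambda>s \<omega>. row i (\<sigma> (X s \<omega>)))"
    and X_path: "AE \<omega> in M. continuous_on {0..} (\<lambda>t. X t \<omega>) \<and> X 0 \<omega> = x0 \<and> (\<forall>t\<ge>0. X t \<omega> \<in> D)"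
    and K_path: "AE \<omega> in M. continuous_on {0..} (\<lambda>t. K t \<omega>) \<and> mono_on {0..} (\<lambda>t. K t \<omega>) \<and> K 0 \<omega> = 0 \<and>
        (\<forall>t\<ge>0. K t \<omega> = (LINT s:{0..t}|stieltjes (\<lambda>r. K r \<omega>). indicator bd (X s \<omega>)))"
    and sde: "AE \<omega> in M. \<forall>s t. 0 \<le> s \<longrightarrow> s \<le> t \<longrightarrow> X t \<omega> - X s \<omega> = (LINT r:{s..t}|lborel. b (X r \<omega>))
        + (\<chi> i. J i t \<omega> - J i s \<omega>) + (LINT r:{s..t}|stieltjes (\<lambda>r. K r \<omega>). nrm (X r \<omega>))"
    and bsde: "AE \<omega> in M. \<forall>s t. 0 \<le> s \<longrightarrow> s \<le> t \<longrightarrow> v (X t \<omega>) - v (X s \<omega>)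
        = - (LINT r:{s..t}|lborel. \<psi> (X r \<omega>) (\<zeta> (X r \<omega>)) - lam)
          - (LINT r:{s..t}|stieltjes (\<lambda>r. K r \<omega>). g (X r \<omega>) - \<mu>) + (I t \<omega> - I s \<omega>)"
begin

text \<open>Along the paths, \<open>d Sf(X) = af dt + bf dK + Hf dW\<close>, and \<open>Nf\<close> is the stochastic integral. The
  expression \<open>E\<close> of the introduction is \<open>Sf\<close> with \<open>\<alpha> = 1\<close> and \<open>w = - \<nabla>f(x\<^sub>0)\<close>, and linear
  forms of \<open>h\<close> have \<open>\<alpha> = 0\<close>.\<close>

definition "Sf \<alpha> w x = \<alpha> * (v x - v x0) + w \<bullet> (x - x0)"
definition "af \<alpha> w x z = - \<alpha> * (\<psi> x z - lam) + w \<bullet> b x"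
definition "bf \<alpha> w x = - \<alpha> * (g x - \<mu>) + w \<bullet> nrm x"
definition "Hf \<alpha> w x z = \<alpha> *\<^sub>R z + w v* \<sigma> x"
definition "Nf \<alpha> w t \<omega> = \<alpha> * I t \<omega> + (\<Sum>i\<in>UNIV. w $ i * J i t \<omega>)"

lemma Nf_lim: "ito_limit (Nf \<alpha> w) (\<lambda>s \<omega>. Hf \<alpha> w (X s \<omega>) (\<zeta> (X s \<omega>)))"
proof -
  have "w v* \<sigma> x = (\<Sum>i\<in>UNIV. w $ i *\<^sub>R row i (\<sigma> x))" for x
    by (simp add: vec_eq_iff vector_matrix_mult_def row_def mult.commute)
  moreover have fin: "finite (UNIV :: 'd set)" by simp
  moreover have J': "ito_limit (\<lambda>t \<omega>. w $ i * J i t \<omega>) (\<lambda>s \<omega>. w $ i *\<^sub>R row i (\<sigma> (X s \<omega>)))" for i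
    by (rule ito_limit_scale[OF J_lim])
  ultimately show ?thesis
    unfolding Nf_def[abs_def] Hf_def
    using ito_limit_sum[OF ito_limit_scale[OF I_lim, where c = \<alpha>] fin J'] by simp
qed

lemma D_bound:
  fixes f :: "real^'d \<Rightarrow> 'b::real_normed_vector"
  assumes "continuous_on D f"
  obtains C where "0 \<le> C" "\<And>x. x \<in> D \<Longrightarrow> norm (f x) \<le> C"
proof -
  have "bounded (f ` D)" by (intro compact_imp_bounded compact_continuous_image assms D(1))
  then obtain C where C: "\<forall>x\<in>D. norm (f x) \<le> C" by (auto simp: bounded_iff)
  moreover have "0 \<le> C" using C D(2) norm_ge_zero order_trans by blast
  ultimately show thesis using that by blast
qed

lemma Sf_cont: "continuous_on D (Sf \<alpha> w)" and bf_cont: "continuous_on D (bf \<alpha> w)"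
  unfolding Sf_def[abs_def] bf_def[abs_def] by (intro continuous_intros cont)+

lemma \<psi>0_cont: "continuous_on D (\<lambda>x. \<psi> x 0)"
proof -
  have "continuous_on D (\<lambda>x. (\<lambda>(x, z). \<psi> x z) (x, 0))"
    by (rule continuous_on_compose2[OF \<psi>_cont]) (auto intro!: continuous_intros)
  then show ?thesis by simp
qed

lemma L_nonneg: "0 \<le> L"
proof -
  obtain i :: 'd where True by simp
  have "norm (axis i 1 - 0 :: real^'d) = 1" by simp
  then show ?thesis using \<psi>_lip[OF D(2), of "axis i 1" 0] by (smt (verit) mult_cancel_left1 mult.right_neutral abs_ge_zero)
qed

lemma af_bound:
  obtains C where "0 \<le> C" "\<And>x z. x \<in> D \<Longrightarrow> \<bar>af \<alpha> w x z\<bar> \<le> C * (1 + norm z)"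
proof -
  obtain C1 where C1: "0 \<le> C1" "\<And>x. x \<in> D \<Longrightarrow> norm (\<psi> x 0) \<le> C1" by (rule D_bound[OF \<psi>0_cont]) (rule that)
  obtain C2 where C2: "0 \<le> C2" "\<And>x. x \<in> D \<Longrightarrow> norm (b x) \<le> C2" by (rule D_bound[OF cont(1)]) (rule that)
  define C where "C = \<bar>\<alpha>\<bar> * (C1 + L + \<bar>lam\<bar>) + norm w * C2"
  have C0: "0 \<le> C" unfolding C_def using C1 C2 L_nonneg by simp
  show thesis
  proof (rule that[OF C0])
    fix x z assume x: "x \<in> D"
    have "\<bar>\<psi> x z - lam\<bar> \<le> C1 + L * norm z + \<bar>lam\<bar>"
      using C1(2)[OF x] \<psi>_lip[OF x, of z 0] by simp
    also have "\<dots> \<le> (C1 + L + \<bar>lam\<bar>) * (1 + norm z)"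
      using C1 L_nonneg by (simp add: algebra_simps add_increasing2)
    finally have 1: "\<bar>\<alpha>\<bar> * \<bar>\<psi> x z - lam\<bar> \<le> \<bar>\<alpha>\<bar> * ((C1 + L + \<bar>lam\<bar>) * (1 + norm z))" by (rule mult_left_mono) simp
    have "\<bar>w \<bullet> b x\<bar> \<le> norm w * norm (b x)" by (rule Cauchy_Schwarz_ineq2)
    also have "\<dots> \<le> norm w * C2" using C2(2)[OF x] by (intro mult_left_mono) auto
    also have "\<dots> \<le> norm w * C2 * (1 + norm z)" using C2(1) by (simp add: mult_le_cancel_left1 algebra_simps)
    finally have 2: "\<bar>w \<bullet> b x\<bar> \<le> norm w * C2 * (1 + norm z)" .
    have "\<bar>af \<alpha> w x z\<bar> \<le> \<bar>\<alpha>\<bar> * \<bar>\<psi> x z - lam\<bar> + \<bar>w \<bullet> b x\<bar>"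
      unfolding af_def by (rule order_trans[OF abs_triangle_ineq]) (simp add: abs_mult)
    also have "\<dots> \<le> C * (1 + norm z)" using 1 2 unfolding C_def by (simp add: algebra_simps)
    finally show "\<bar>af \<alpha> w x z\<bar> \<le> C * (1 + norm z)" .
  qed
qed

lemma Hf_bound:
  obtains C where "0 \<le> C" "\<And>x z. x \<in> D \<Longrightarrow> (norm (Hf \<alpha> w x z))^2 \<le> C * (1 + (norm z)^2)"
proof -
  have "continuous_on D (\<lambda>x. w v* \<sigma> x)"
    unfolding vector_matrix_mult_def by (intro continuous_intros cont(3))
  then obtain C1 where C1: "0 \<le> C1" "\<And>x. x \<in> D \<Longrightarrow> norm (w v* \<sigma> x) \<le> C1" by (rule D_bound) (rule that)
  show thesis
  proof (rule that[of "2 * \<alpha>^2 + 2 * C1^2"])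
    fix x z assume x: "x \<in> D"
    have "(norm (Hf \<alpha> w x z))^2 \<le> 2 * (norm (\<alpha> *\<^sub>R z))^2 + 2 * (norm (w v* \<sigma> x))^2"
      unfolding Hf_def by (rule norm_add_squared_le)
    also have "\<dots> \<le> 2 * \<alpha>^2 * (norm z)^2 + 2 * C1^2"
      using power_mono[OF C1(2)[OF x], of 2] by (simp add: power_mult_distrib)
    also have "\<dots> \<le> (2 * \<alpha>^2 + 2 * C1^2) * (1 + (norm z)^2)" by (simp add: algebra_simps)
    finally show "(norm (Hf \<alpha> w x z))^2 \<le> (2 * \<alpha>^2 + 2 * C1^2) * (1 + (norm z)^2)" .
  qed simp
qed

text \<open>One event of full probability on which all path arguments become deterministic. The
  horizon is 1 from here on, and the last conjunct is the square integrability of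
  \<open>\<zeta>\<close> along the path up to it.\<close>

definition good_path :: "'a \<Rightarrow> bool" where
  "good_path \<omega> \<longleftrightarrow> continuous_on {0..} (\<lambda>t. X t \<omega>) \<and> X 0 \<omega> = x0 \<and> (\<forall>t\<ge>0. X t \<omega> \<in> D) \<and>
    continuous_on {0..} (\<lambda>t. K t \<omega>) \<and> mono_on {0..} (\<lambda>t. K t \<omega>) \<and> K 0 \<omega> = 0 \<and>
    (\<forall>t\<ge>0. K t \<omega> = (LINT s:{0..t}|stieltjes (\<lambda>r. K r \<omega>). indicator bd (X s \<omega>))) \<and>
    (\<forall>s t. 0 \<le> s \<longrightarrow> s \<le> t \<longrightarrow> X t \<omega> - X s \<omega> = (LINT r:{s..t}|lborel. b (X r \<omega>))
        + (\<chi> i. J i t \<omega> - J i s \<omega>) + (LINT r:{s..t}|stieltjes (\<lambda>r. K r \<omega>). nrm (X r \<omega>))) \<and>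
    (\<forall>s t. 0 \<le> s \<longrightarrow> s \<le> t \<longrightarrow> v (X t \<omega>) - v (X s \<omega>)
        = - (LINT r:{s..t}|lborel. \<psi> (X r \<omega>) (\<zeta> (X r \<omega>)) - lam)
          - (LINT r:{s..t}|stieltjes (\<lambda>r. K r \<omega>). g (X r \<omega>) - \<mu>) + (I t \<omega> - I s \<omega>)) \<and>
    set_integrable lborel {0..1} (\<lambda>r. (norm (\<zeta> (X r \<omega>)))^2)"

lemma AE_good_path: "AE \<omega> in M. good_path \<omega>"
  using X_path K_path sde bsde path_L2_AE[OF ito_limit_path_L2[OF I_lim] zero_le_one]
  unfolding good_path_def by eventually_elim blast

lemma good_path_compose:
  assumes "good_path \<omega>" "continuous_on D f" shows "continuous_on {0..} (\<lambda>t. f (X t \<omega>))"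
  by (rule continuous_on_compose2[OF assms(2)]) (use assms(1) in \<open>auto simp: good_path_def\<close>)

text \<open>\<open>f\<close> is continuous only on \<open>D \<times> UNIV\<close>; cutting it off
  outside this closed set makes it Borel, and at nonnegative times the path does not notice. The
  conditional makes the claim trivial for negative \<open>s\<close>.\<close>

lemma path_measurable:
  fixes f :: "real^'d \<Rightarrow> real^'d \<Rightarrow> real"
  assumes gp: "good_path \<omega>" and t: "t \<le> 1"
    and f: "continuous_on (D \<times> UNIV) (\<lambda>(x, z). f x z)"
  shows "(\<lambda>r. indicat_real {s..t} r *\<^sub>R (if 0 \<le> s then f (X r \<omega>) (\<zeta> (X r \<omega>)) else 0)) \<in> borel_measurable borel"
proof (cases "0 \<le> s")
  case True
  have Xc: "continuous_on {s..t} (\<lambda>r. X r \<omega>)"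
    by (rule continuous_on_subset[of "{0..}"]) (use gp True in \<open>auto simp: good_path_def\<close>)
  have Xm: "(\<lambda>r. X r \<omega>) \<in> borel_measurable (restrict_space borel {s..t})"
    by (rule borel_measurable_continuous_on_restrict[OF Xc])
  have pm: "(\<lambda>r. (X r \<omega>, \<zeta> (X r \<omega>))) \<in> borel_measurable (restrict_space borel {s..t})"
    using Xm measurable_compose[OF Xm \<zeta>_meas] by (rule borel_measurable_Pair)
  have clo: "closed (D \<times> (UNIV :: (real^'d) set))" by (rule closed_Times[OF compact_imp_closed[OF D(1)] closed_UNIV])
  have fm: "(\<lambda>p. indicat_real (D \<times> UNIV) p *\<^sub>R (case p of (x, z) \<Rightarrow> f x z)) \<in> borel_measurable borel"
    by (rule borel_measurable_continuous_on_indicator[OF borel_closed[OF clo] f])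
  have XD: "X r \<omega> \<in> D" if "r \<in> {s..t}" for r using gp True that by (auto simp: good_path_def)
  have "(\<lambda>r. indicat_real (D \<times> UNIV) (X r \<omega>, \<zeta> (X r \<omega>)) *\<^sub>R f (X r \<omega>) (\<zeta> (X r \<omega>))) \<in> borel_measurable (restrict_space borel {s..t})"
    using measurable_compose[OF pm fm] by simp
  then have 1: "(\<lambda>r. indicat_real {s..t} r *\<^sub>R (indicat_real (D \<times> UNIV) (X r \<omega>, \<zeta> (X r \<omega>)) *\<^sub>R f (X r \<omega>) (\<zeta> (X r \<omega>)))) \<in> borel_measurable borel"
    by (subst (asm) borel_measurable_restrict_space_iff) auto
  have eq: "indicat_real {s..t} r *\<^sub>R (indicat_real (D \<times> UNIV) (X r \<omega>, \<zeta> (X r \<omega>)) *\<^sub>R f (X r \<omega>) (\<zeta> (X r \<omega>)))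
      = indicat_real {s..t} r *\<^sub>R (if 0 \<le> s then f (X r \<omega>) (\<zeta> (X r \<omega>)) else 0)" for r
    using XD[of r] True by (auto simp: indicator_def)
  show ?thesis using 1 unfolding eq .
qed simp

lemma path_integrable:
  assumes gp: "good_path \<omega>" and st: "0 \<le> s" "t \<le> 1"
    and f: "continuous_on (D \<times> UNIV) (\<lambda>(x, z). f x z)" and bnd: "\<And>x z. x \<in> D \<Longrightarrow> \<bar>f x z\<bar> \<le> C * (1 + (norm z)^2)"
  shows "set_integrable lborel {s..t} (\<lambda>r. f (X r \<omega>) (\<zeta> (X r \<omega>)))"
proof -
  have i2: "set_integrable lborel {s..t} (\<lambda>r. (norm (\<zeta> (X r \<omega>)))^2)"
    by (rule set_integrable_subset[of _ "{0..1}"]) (use gp st in \<open>auto simp: good_path_def\<close>)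
  have i1: "set_integrable lborel {s..t} (\<lambda>r. 1::real)"
    by (rule set_integrable_continuous) (use st in auto)
  have i: "set_integrable lborel {s..t} (\<lambda>r. C * (1 + (norm (\<zeta> (X r \<omega>)))^2))"
    by (intro set_integrable_mult_right set_integral_add(1) i1 i2)
  have XD: "X r \<omega> \<in> D" if "r \<in> {s..t}" for r using gp st that by (auto simp: good_path_def)
  show ?thesis
    unfolding set_integrable_def
  proof (rule Bochner_Integration.integrable_bound)
    show "integrable lborel (\<lambda>r. indicat_real {s..t} r *\<^sub>R (C * (1 + (norm (\<zeta> (X r \<omega>)))^2)))"
      using i unfolding set_integrable_def .
    show "(\<lambda>r. indicat_real {s..t} r *\<^sub>R f (X r \<omega>) (\<zeta> (X r \<omega>))) \<in> borel_measurable lborel"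
      using path_measurable[OF gp st(2) f, of s] st(1) by simp
    show "AE r in lborel. norm (indicat_real {s..t} r *\<^sub>R f (X r \<omega>) (\<zeta> (X r \<omega>)))
        \<le> norm (indicat_real {s..t} r *\<^sub>R (C * (1 + (norm (\<zeta> (X r \<omega>)))^2)))"
    proof (rule AE_I2)
      fix r
      show "norm (indicat_real {s..t} r *\<^sub>R f (X r \<omega>) (\<zeta> (X r \<omega>)))
        \<le> norm (indicat_real {s..t} r *\<^sub>R (C * (1 + (norm (\<zeta> (X r \<omega>)))^2)))"
      proof (cases "r \<in> {s..t}")
        case True
        then show ?thesis using bnd[OF XD[OF True], of "\<zeta> (X r \<omega>)"] by (simp add: order_trans[OF _ abs_ge_self])
      next
        case False
        then have z: "indicat_real {s..t} r = 0" by (rule indicator_simps(2))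
        show ?thesis unfolding z by simp
      qed
    qed
  qed
qed

lemma one_norm_le: "1 + norm z \<le> 2 * (1 + (norm z)^2)"
proof -
  have "0 \<le> (norm z - 1)^2" by simp
  then have "2 * norm z \<le> 1 + (norm z)^2" by (simp add: power2_diff)
  then show ?thesis by (smt (verit) zero_le_power2)
qed

lemma af_cont: "continuous_on (D \<times> UNIV) (\<lambda>(x, z). af \<alpha> w x z)"
proof -
  have "continuous_on (D \<times> UNIV) (\<lambda>p. b (fst p))"
    by (rule continuous_on_compose2[OF cont(1)]) (auto intro!: continuous_intros)
  moreover have "continuous_on (D \<times> UNIV) (\<lambda>p. \<psi> (fst p) (snd p))" using \<psi>_cont by (simp add: case_prod_beta')
  ultimately show ?thesis unfolding af_def case_prod_beta' by (intro continuous_intros)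
qed

lemma af_integrable:
  assumes gp: "good_path \<omega>" and st: "0 \<le> s" "t \<le> 1"
  shows "set_integrable lborel {s..t} (\<lambda>r. af \<alpha> w (X r \<omega>) (\<zeta> (X r \<omega>)))"
proof -
  obtain C where C: "0 \<le> C" "\<And>x z. x \<in> D \<Longrightarrow> \<bar>af \<alpha> w x z\<bar> \<le> C * (1 + norm z)" by (rule af_bound) (rule that)
  have "\<bar>af \<alpha> w x z\<bar> \<le> (2 * C) * (1 + (norm z)^2)" if "x \<in> D" for x z
    using C(2)[OF that, of z] mult_left_mono[OF one_norm_le C(1), of z] by (simp add: algebra_simps)
  then show ?thesis by (rule path_integrable[OF gp st af_cont])
qed

text \<open>Subtracting \<open>Nf\<close> removes both stochastic integrals from the same linear
  combination of the forward and the backward equation.\<close>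

lemma A_increment_path:
  assumes gp: "good_path \<omega>" and st: "0 \<le> s" "s \<le> t" "t \<le> 1"
  shows "(Sf \<alpha> w (X t \<omega>) - Nf \<alpha> w t \<omega>) - (Sf \<alpha> w (X s \<omega>) - Nf \<alpha> w s \<omega>)
     = (LINT r:{s..t}|lborel. af \<alpha> w (X r \<omega>) (\<zeta> (X r \<omega>))) + (LINT r:{s..t}|stieltjes (\<lambda>r. K r \<omega>). bf \<alpha> w (X r \<omega>))"
proof -
  interpret K: stieltjes_path "\<lambda>r. K r \<omega>"
    using gp by unfold_locales (auto simp: good_path_def)
  have psi: "set_integrable lborel {s..t} (\<lambda>r. \<psi> (X r \<omega>) (\<zeta> (X r \<omega>)) - lam)"
    using af_integrable[OF gp st(1,3), of "-1" 0] by (simp add: af_def)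
  have bi: "set_integrable lborel {s..t} (\<lambda>r. b (X r \<omega>))"
    by (rule set_integrable_continuous[OF good_path_compose[OF gp cont(1)] st(1)])
  have ni: "set_integrable (stieltjes (\<lambda>r. K r \<omega>)) {s..t} (\<lambda>r. nrm (X r \<omega>))"
    by (rule K.integrable_K[OF good_path_compose[OF gp cont(2)] st(1)])
  have gi: "set_integrable (stieltjes (\<lambda>r. K r \<omega>)) {s..t} (\<lambda>r. g (X r \<omega>) - \<mu>)"
    by (rule K.integrable_K[OF good_path_compose[OF gp] st(1)]) (intro continuous_intros cont)
  have X: "X t \<omega> - X s \<omega> = (LINT r:{s..t}|lborel. b (X r \<omega>))
        + (\<chi> i. J i t \<omega> - J i s \<omega>) + (LINT r:{s..t}|stieltjes (\<lambda>r. K r \<omega>). nrm (X r \<omega>))"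
    and v: "v (X t \<omega>) - v (X s \<omega>) = - (LINT r:{s..t}|lborel. \<psi> (X r \<omega>) (\<zeta> (X r \<omega>)) - lam)
          - (LINT r:{s..t}|stieltjes (\<lambda>r. K r \<omega>). g (X r \<omega>) - \<mu>) + (I t \<omega> - I s \<omega>)"
    using gp st(1,2) unfolding good_path_def by blast+
  have J: "w \<bullet> (\<chi> i. J i t \<omega> - J i s \<omega>) = (\<Sum>i\<in>UNIV. w $ i * J i t \<omega>) - (\<Sum>i\<in>UNIV. w $ i * J i s \<omega>)"
    by (simp add: inner_vec_def right_diff_distrib sum_subtractf)
  have wi: "set_integrable lborel {s..t} (\<lambda>r. w \<bullet> b (X r \<omega>))"
    "set_integrable (stieltjes (\<lambda>r. K r \<omega>)) {s..t} (\<lambda>r. w \<bullet> nrm (X r \<omega>))"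
    using bi ni unfolding set_integrable_def by (auto simp: inner_scaleR_right[symmetric] simp del: inner_scaleR_right intro!: integrable_inner_right)
  have "(Sf \<alpha> w (X t \<omega>) - Nf \<alpha> w t \<omega>) - (Sf \<alpha> w (X s \<omega>) - Nf \<alpha> w s \<omega>)
      = \<alpha> * (v (X t \<omega>) - v (X s \<omega>) - (I t \<omega> - I s \<omega>)) + (w \<bullet> (X t \<omega> - X s \<omega>)
        - ((\<Sum>i\<in>UNIV. w $ i * J i t \<omega>) - (\<Sum>i\<in>UNIV. w $ i * J i s \<omega>)))"
    unfolding Sf_def Nf_def by (simp add: algebra_simps inner_diff_right)
  also have "\<dots> = (- \<alpha> * (LINT r:{s..t}|lborel. \<psi> (X r \<omega>) (\<zeta> (X r \<omega>)) - lam) + w \<bullet> (LINT r:{s..t}|lborel. b (X r \<omega>)))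
      + (- \<alpha> * (LINT r:{s..t}|stieltjes (\<lambda>r. K r \<omega>). g (X r \<omega>) - \<mu>) + w \<bullet> (LINT r:{s..t}|stieltjes (\<lambda>r. K r \<omega>). nrm (X r \<omega>)))"
    unfolding v X inner_add_right J by (simp add: algebra_simps)
  also have "- \<alpha> * (LINT r:{s..t}|lborel. \<psi> (X r \<omega>) (\<zeta> (X r \<omega>)) - lam) + w \<bullet> (LINT r:{s..t}|lborel. b (X r \<omega>))
      = (LINT r:{s..t}|lborel. af \<alpha> w (X r \<omega>) (\<zeta> (X r \<omega>)))"
    unfolding set_integral_inner[OF bi] af_def
    by (subst set_integral_add(2)[OF set_integrable_mult_right[OF psi] wi(1)]) (simp only: set_integral_mult_right)
  also have "- \<alpha> * (LINT r:{s..t}|stieltjes (\<lambda>r. K r \<omega>). g (X r \<omega>) - \<mu>) + w \<bullet> (LINT r:{s..t}|stieltjes (\<lambda>r. K r \<omega>). nrm (X r \<omega>))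
      = (LINT r:{s..t}|stieltjes (\<lambda>r. K r \<omega>). bf \<alpha> w (X r \<omega>))"
    unfolding set_integral_inner[OF ni] bf_def
    by (subst set_integral_add(2)[OF set_integrable_mult_right[OF gi] wi(2)]) (simp only: set_integral_mult_right)
  finally show ?thesis .
qed

lemma semimartingale_path_X:
  assumes gp: "good_path \<omega>" and C: "\<And>x. x \<in> D \<Longrightarrow> \<bar>Sf \<alpha> w x\<bar> \<le> C" "\<And>x. x \<in> D \<Longrightarrow> \<bar>bf \<alpha> w x\<bar> \<le> C"
  shows "semimartingale_path (\<lambda>t. K t \<omega>) 1 C (\<lambda>t. Sf \<alpha> w (X t \<omega>)) (\<lambda>t. Sf \<alpha> w (X t \<omega>) - Nf \<alpha> w t \<omega>)
     (\<lambda>r. af \<alpha> w (X r \<omega>) (\<zeta> (X r \<omega>))) (\<lambda>r. bf \<alpha> w (X r \<omega>))"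
proof unfold_locales
  have XD: "X t \<omega> \<in> D" if "0 \<le> t" for t using gp that by (auto simp: good_path_def)
  show "\<bar>Sf \<alpha> w (X t \<omega>)\<bar> \<le> C" "\<bar>bf \<alpha> w (X t \<omega>)\<bar> \<le> C" if "0 \<le> t" for t using C XD[OF that] by auto
  show "continuous_on {0..} (\<lambda>t. Sf \<alpha> w (X t \<omega>))" "continuous_on {0..} (\<lambda>r. bf \<alpha> w (X r \<omega>))"
    by (intro good_path_compose[OF gp] Sf_cont bf_cont)+
  show "set_integrable lborel {0..1} (\<lambda>r. af \<alpha> w (X r \<omega>) (\<zeta> (X r \<omega>)))" by (rule af_integrable[OF gp]) auto
qed (use gp A_increment_path[OF gp] in \<open>auto simp: good_path_def\<close>)

lemma bounded_continuous_process_X: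
  assumes C: "\<And>x. x \<in> D \<Longrightarrow> \<bar>Sf \<alpha> w x\<bar> \<le> C"
  shows "bounded_continuous_process (\<lambda>t \<omega>. Sf \<alpha> w (X t \<omega>)) C"
  unfolding bounded_continuous_process_def
proof (intro conjI allI impI)
  fix t :: real assume "0 \<le> t"
  have "Sf \<alpha> w \<in> borel_measurable borel" unfolding Sf_def[abs_def] using v_meas by measurable
  from measurable_compose[OF XF[OF \<open>0 \<le> t\<close>] this] show "(\<lambda>\<omega>. Sf \<alpha> w (X t \<omega>)) \<in> borel_measurable (F t)" .
next
  show "AE \<omega> in M. continuous_on {0..} (\<lambda>t. Sf \<alpha> w (X t \<omega>)) \<and> (\<forall>t\<ge>0. \<bar>Sf \<alpha> w (X t \<omega>)\<bar> \<le> C)"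
    using AE_good_path
  proof eventually_elim
    case (elim \<omega>)
    then show ?case using good_path_compose[OF elim Sf_cont] C by (auto simp: good_path_def)
  qed
qed

end

section \<open>Compensators along the grid\<close>

context reflected_bsde
begin

abbreviation "Gt \<equiv> grid 1"
abbreviation "dA \<alpha> w n i \<omega> \<equiv> (Sf \<alpha> w (X (Gt n (Suc i)) \<omega>) - Nf \<alpha> w (Gt n (Suc i)) \<omega>) - (Sf \<alpha> w (X (Gt n i) \<omega>) - Nf \<alpha> w (Gt n i) \<omega>)"
abbreviation "dq \<alpha> w n i \<omega> \<equiv> LINT r:{Gt n i..Gt n (Suc i)}|lborel. (norm (Hf \<alpha> w (X r \<omega>) (\<zeta> (X r \<omega>))))^2"
abbreviation "dU \<alpha> w n i \<omega> \<equiv> dA \<alpha> w n i \<omega> * (2 * Sf \<alpha> w (X (Gt n (Suc i)) \<omega>) - dA \<alpha> w n i \<omega>)"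
abbreviation "z2 \<omega> \<equiv> LINT r:{0..1}|lborel. (norm (\<zeta> (X r \<omega>)))^2"
text \<open>The discrete compensator of \<open>l * S + c * S^2\<close> for
  \<open>S = Sf \<alpha> w (X t)\<close>: \<open>dq\<close> is the increment of its bracket and
  \<open>dU\<close> the discrete form of \<open>2 * S * dA\<close>.\<close>

definition "compensator l c \<alpha> w n m \<omega> = l * (\<Sum>i<m. dA \<alpha> w n i \<omega>) + c * (\<Sum>i<m. dq \<alpha> w n i \<omega> + dU \<alpha> w n i \<omega>)"

lemma Sf_bf_bound:
  obtains C where "0 \<le> C" "\<And>x. x \<in> D \<Longrightarrow> \<bar>Sf \<alpha> w x\<bar> \<le> C" "\<And>x. x \<in> D \<Longrightarrow> \<bar>bf \<alpha> w x\<bar> \<le> C"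
proof -
  obtain C1 where C1: "0 \<le> C1" "\<And>x. x \<in> D \<Longrightarrow> norm (Sf \<alpha> w x) \<le> C1" by (rule D_bound[OF Sf_cont]) (rule that)
  obtain C2 where C2: "0 \<le> C2" "\<And>x. x \<in> D \<Longrightarrow> norm (bf \<alpha> w x) \<le> C2" by (rule D_bound[OF bf_cont]) (rule that)
  show thesis
  proof (rule that[of "C1 + C2"])
    show "\<bar>Sf \<alpha> w x\<bar> \<le> C1 + C2" "\<bar>bf \<alpha> w x\<bar> \<le> C1 + C2" if "x \<in> D" for x
      using C1(1) C1(2)[OF that] C2(1) C2(2)[OF that] by simp_all
  qed (use C1 C2 in simp)
qed

lemma Hf_cont: "continuous_on (D \<times> UNIV) (\<lambda>(x, z). (norm (Hf \<alpha> w x z))^2)"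
proof -
  have "continuous_on D (\<lambda>x. w v* \<sigma> x)"
    unfolding vector_matrix_mult_def by (intro continuous_intros cont(3))
  then have "continuous_on (D \<times> UNIV) (\<lambda>p. w v* \<sigma> (fst p))"
    by (rule continuous_on_compose2) (auto intro!: continuous_intros)
  then show ?thesis unfolding Hf_def case_prod_beta' by (intro continuous_intros)
qed

lemma Hf_integrable:
  assumes gp: "good_path \<omega>" and st: "0 \<le> s" "t \<le> 1"
  shows "set_integrable lborel {s..t} (\<lambda>r. (norm (Hf \<alpha> w (X r \<omega>) (\<zeta> (X r \<omega>))))^2)"
proof -
  obtain C where C: "0 \<le> C" "\<And>x z. x \<in> D \<Longrightarrow> (norm (Hf \<alpha> w x z))^2 \<le> C * (1 + (norm z)^2)" by (rule Hf_bound) (rule that)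
  show ?thesis by (rule path_integrable[OF gp st Hf_cont, of _ _ C]) (use C in auto)
qed

lemma z_integrable:
  assumes gp: "good_path \<omega>"
  shows "set_integrable lborel {0..1} (\<lambda>r. norm (\<zeta> (X r \<omega>)))" "set_integrable lborel {0..1} (\<lambda>r. (norm (\<zeta> (X r \<omega>)))^2)"
proof -
  show "set_integrable lborel {0..1} (\<lambda>r. norm (\<zeta> (X r \<omega>)))"
  proof (rule path_integrable[OF gp order_refl order_refl, of "\<lambda>x z. norm z" 2])
    show "continuous_on (D \<times> UNIV) (\<lambda>(x, z :: real^'d). norm z)" unfolding case_prod_beta' by (intro continuous_intros)
    show "\<bar>norm z\<bar> \<le> 2 * (1 + (norm z)^2)" for z :: "real^'d" using one_norm_le[of z] by simp
  qed
  show "set_integrable lborel {0..1} (\<lambda>r. (norm (\<zeta> (X r \<omega>)))^2)" using gp by (simp add: good_path_def)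
qed

lemma dq_sum:
  assumes gp: "good_path \<omega>" and m: "m \<le> n"
  shows "(\<Sum>i<m. dq \<alpha> w n i \<omega>) = (LINT r:{0..Gt n m}|lborel. (norm (Hf \<alpha> w (X r \<omega>) (\<zeta> (X r \<omega>))))^2)"
  by (rule set_integral_grid[OF Hf_integrable[OF gp order_refl order_refl] zero_le_one m])

text \<open>Up to a point with \<open>K \<le> 1\<close> every part of the compensator is at most
  quadratic in the time integral of \<open>norm (\<zeta> (X r \<omega>))\<close>, or linear in the
  integral of its square. By Jensen all is dominated by a multiple of \<open>1 + z2\<close>, with a
  factor free of the path, of \<open>n\<close> and of \<open>m\<close>: the dominating function for
  the final passage to the limit.\<close>

lemma compensator_bound:
  obtains B where "0 \<le> B"
    "\<And>\<omega> n m. good_path \<omega> \<Longrightarrow> m \<le> n \<Longrightarrow> K (Gt n m) \<omega> \<le> 1 \<Longrightarrow> \<bar>compensator l c \<alpha> w n m \<omega>\<bar> \<le> B * (1 + z2 \<omega>)"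
proof -
  obtain C where C: "0 \<le> C" "\<And>x. x \<in> D \<Longrightarrow> \<bar>Sf \<alpha> w x\<bar> \<le> C" "\<And>x. x \<in> D \<Longrightarrow> \<bar>bf \<alpha> w x\<bar> \<le> C"
    by (rule Sf_bf_bound) (rule that)
  obtain Ca where Ca: "0 \<le> Ca" "\<And>x z. x \<in> D \<Longrightarrow> \<bar>af \<alpha> w x z\<bar> \<le> Ca * (1 + norm z)" by (rule af_bound) (rule that)
  obtain CH where CH: "0 \<le> CH" "\<And>x z. x \<in> D \<Longrightarrow> (norm (Hf \<alpha> w x z))^2 \<le> CH * (1 + (norm z)^2)" by (rule Hf_bound) (rule that)
  define E where "E = Ca + C"
  have E: "0 \<le> E" using Ca C unfolding E_def by simp
  show thesis
  proof (rule that[of "\<bar>l\<bar> * (2 * E) + \<bar>c\<bar> * (CH + 6 * E^2)"])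
    show "0 \<le> \<bar>l\<bar> * (2 * E) + \<bar>c\<bar> * (CH + 6 * E^2)" using E CH by simp
    fix \<omega> n m assume gp: "good_path \<omega>" and m: "m \<le> n" and K1: "K (Gt n m) \<omega> \<le> 1"
    interpret SP: semimartingale_path "\<lambda>t. K t \<omega>" 1 C "\<lambda>t. Sf \<alpha> w (X t \<omega>)" "\<lambda>t. Sf \<alpha> w (X t \<omega>) - Nf \<alpha> w t \<omega>"
      "\<lambda>r. af \<alpha> w (X r \<omega>) (\<zeta> (X r \<omega>))" "\<lambda>r. bf \<alpha> w (X r \<omega>)"
      by (rule semimartingale_path_X[OF gp]) (use C in auto)
    have XD: "X t \<omega> \<in> D" if "0 \<le> t" for t using gp that by (auto simp: good_path_def)
    define z1 where "z1 = (LINT r:{0..1}|lborel. norm (\<zeta> (X r \<omega>)))"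
    have z1: "0 \<le> z1" unfolding z1_def set_lebesgue_integral_def by (rule Bochner_Integration.integral_nonneg) auto
    have zz: "z1^2 \<le> z2 \<omega>"
      unfolding z1_def by (rule set_integral_square_le) (use z_integrable[OF gp] in auto)
    define P where "P = (LINT r:{0..1}|lborel. \<bar>af \<alpha> w (X r \<omega>) (\<zeta> (X r \<omega>))\<bar>)"
    have P0: "0 \<le> P" unfolding P_def set_lebesgue_integral_def by (rule Bochner_Integration.integral_nonneg) auto
    have c1: "set_integrable lborel {0..1} (\<lambda>r::real. 1::real)" by (rule set_integrable_continuous) auto
    have "P \<le> (LINT r:{0..1}|lborel. Ca * (1 + norm (\<zeta> (X r \<omega>))))"
      unfolding P_def
      by (rule set_integral_mono[OF set_integrable_abs[OF af_integrable[OF gp order_refl order_refl]]])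
         (use Ca XD z_integrable[OF gp] c1 in \<open>auto intro!: set_integral_add(1) set_integrable_mult_right\<close>)
    also have "\<dots> = Ca * (1 + z1)"
      unfolding z1_def using set_integral_add(2)[OF c1 z_integrable(1)[OF gp]] by (simp add: set_integral_const)
    finally have P: "P + C \<le> E * (1 + z1)" unfolding E_def using mult_nonneg_nonneg[OF C(1) z1] by (simp add: algebra_simps)
    define G where "G = 1 + z2 \<omega>"
    \<comment> \<open>From \<open>(1 + z1)^2 \<le> 2 * (1 + z1^2)\<close> and Jensen's bound
      \<open>z1^2 \<le> z2 \<omega>\<close>.\<close>
    have g1: "(1 + z1)^2 \<le> 2 * G"
      using zz zero_le_power2[of "z1 - 1"] unfolding G_def by (simp add: power2_eq_square algebra_simps)
    have g2: "1 + z1 \<le> 2 * G"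
    proof -
      have "(1 + z1) * 1 \<le> (1 + z1) * (1 + z1)" using z1 by (intro mult_left_mono) auto
      then show ?thesis using g1 by (simp add: power2_eq_square)
    qed
    have lin: "\<bar>\<Sum>i<m. dA \<alpha> w n i \<omega>\<bar> \<le> 2 * E * G"
    proof -
      have "\<bar>\<Sum>i<m. dA \<alpha> w n i \<omega>\<bar> \<le> P + C" using SP.linear_sum_bound[OF m K1] unfolding P_def .
      also have "\<dots> \<le> E * (2 * G)" using P mult_left_mono[OF g2 E] by linarith
      finally show ?thesis by simp
    qed
    have sq: "\<bar>\<Sum>i<m. dU \<alpha> w n i \<omega>\<bar> \<le> 6 * E^2 * G"
    proof -
      have "\<bar>\<Sum>i<m. dU \<alpha> w n i \<omega>\<bar> \<le> (P + C) * (2 * C + (P + C))" using SP.square_sum_bound[OF m K1] unfolding P_def .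
      also have "\<dots> \<le> (E * (1 + z1)) * (3 * (E * (1 + z1)))"
        using P P0 C by (intro mult_mono) auto
      also have "\<dots> = 3 * E^2 * (1 + z1)^2" by (simp add: power2_eq_square)
      also have "\<dots> \<le> 3 * E^2 * (2 * G)" by (rule mult_left_mono[OF g1]) simp
      finally show ?thesis by simp
    qed
    have q: "\<bar>\<Sum>i<m. dq \<alpha> w n i \<omega>\<bar> \<le> CH * G"
    proof -
      have g: "0 \<le> Gt n m" "Gt n m \<le> 1" using grid_nonneg[of 1] grid_le[OF zero_le_one m] by auto
      note HI = Hf_integrable[OF gp order_refl order_refl, of \<alpha> w]
      have nn: "0 \<le> (LINT r:{s..t}|lborel. (norm (Hf \<alpha> w (X r \<omega>) (\<zeta> (X r \<omega>))))^2)" for s t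
        unfolding set_lebesgue_integral_def by (rule Bochner_Integration.integral_nonneg) auto
      have "(LINT r:{0..Gt n m}|lborel. (norm (Hf \<alpha> w (X r \<omega>) (\<zeta> (X r \<omega>))))^2)
         \<le> (LINT r:{0..1}|lborel. (norm (Hf \<alpha> w (X r \<omega>) (\<zeta> (X r \<omega>))))^2)"
        using set_integral_split[OF HI g] nn[of "Gt n m" 1] by simp
      also have "\<dots> \<le> (LINT r:{0..1}|lborel. CH * (1 + (norm (\<zeta> (X r \<omega>)))^2))"
        by (rule set_integral_mono[OF HI])
           (use CH XD z_integrable[OF gp] c1 in \<open>auto intro!: set_integral_add(1) set_integrable_mult_right\<close>)
      also have "\<dots> = CH * G"
        unfolding G_def using set_integral_add(2)[OF c1 z_integrable(2)[OF gp]] by (simp add: set_integral_const)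
      finally show ?thesis unfolding dq_sum[OF gp m] using nn[of 0 "Gt n m"] by simp
    qed
    have "\<bar>compensator l c \<alpha> w n m \<omega>\<bar> \<le> \<bar>l\<bar> * \<bar>\<Sum>i<m. dA \<alpha> w n i \<omega>\<bar> + \<bar>c\<bar> * (\<bar>\<Sum>i<m. dq \<alpha> w n i \<omega>\<bar> + \<bar>\<Sum>i<m. dU \<alpha> w n i \<omega>\<bar>)"
      unfolding compensator_def sum.distrib
      by (rule order_trans[OF abs_triangle_ineq]) (auto simp: abs_mult intro!: add_mono mult_left_mono abs_triangle_ineq)
    also have "\<dots> \<le> \<bar>l\<bar> * (2 * E * G) + \<bar>c\<bar> * (CH * G + 6 * E^2 * G)"
      using lin sq q by (intro add_mono mult_left_mono) auto
    also have "\<dots> = (\<bar>l\<bar> * (2 * E) + \<bar>c\<bar> * (CH + 6 * E^2)) * (1 + z2 \<omega>)" unfolding G_def by (simp add: algebra_simps)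
    finally show "\<bar>compensator l c \<alpha> w n m \<omega>\<bar> \<le> (\<bar>l\<bar> * (2 * E) + \<bar>c\<bar> * (CH + 6 * E^2)) * (1 + z2 \<omega>)" .
  qed
qed

text \<open>The coefficients of \<open>dt\<close> and, in \<open>bdrift\<close>, of
  \<open>dK\<close> that Ito's formula would give for \<open>l * S + c * S^2\<close>.\<close>

definition "drift l c \<alpha> w x z = l * af \<alpha> w x z + c * ((norm (Hf \<alpha> w x z))^2 + 2 * Sf \<alpha> w x * af \<alpha> w x z)"
definition "bdrift l c \<alpha> w x = l * bf \<alpha> w x + c * (2 * Sf \<alpha> w x * bf \<alpha> w x)"

lemma Sf_af_integrable:
  assumes gp: "good_path \<omega>" and st: "0 \<le> s" "t \<le> 1"
  shows "set_integrable lborel {s..t} (\<lambda>r. 2 * Sf \<alpha> w (X r \<omega>) * af \<alpha> w (X r \<omega>) (\<zeta> (X r \<omega>)))"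
proof (cases "s \<le> t")
  case True
  obtain C where C: "0 \<le> C" "\<And>x. x \<in> D \<Longrightarrow> \<bar>Sf \<alpha> w x\<bar> \<le> C" "\<And>x. x \<in> D \<Longrightarrow> \<bar>bf \<alpha> w x\<bar> \<le> C"
    by (rule Sf_bf_bound) (rule that)
  interpret SP: semimartingale_path "\<lambda>t. K t \<omega>" 1 C "\<lambda>t. Sf \<alpha> w (X t \<omega>)" "\<lambda>t. Sf \<alpha> w (X t \<omega>) - Nf \<alpha> w t \<omega>"
    "\<lambda>r. af \<alpha> w (X r \<omega>) (\<zeta> (X r \<omega>))" "\<lambda>r. bf \<alpha> w (X r \<omega>)"
    by (rule semimartingale_path_X[OF gp]) (use C in auto)
  show ?thesis
  proof (rule SP.integral_bound(1)[OF st(1) True st(2), of _ "2 * C"])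
    show "continuous_on {0..} (\<lambda>r. 2 * Sf \<alpha> w (X r \<omega>))" using SP.S_cont by (intro continuous_intros)
    show "\<bar>2 * Sf \<alpha> w (X r \<omega>)\<bar> \<le> 2 * C" if "r \<in> {s..t}" for r using SP.S2_bd[of r] st that by simp
  qed
qed (simp add: set_integrable_def)

lemma drift_integrable:
  assumes gp: "good_path \<omega>" and st: "0 \<le> s" "t \<le> 1"
  shows "set_integrable lborel {s..t} (\<lambda>r. drift l c \<alpha> w (X r \<omega>) (\<zeta> (X r \<omega>)))"
  unfolding drift_def
  by (intro set_integral_add(1) set_integrable_mult_right af_integrable[OF gp st] Hf_integrable[OF gp st] Sf_af_integrable[OF gp st])

lemma bdrift_cont: "continuous_on D (bdrift l c \<alpha> w)"
  unfolding bdrift_def[abs_def] by (intro continuous_intros Sf_cont bf_cont)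

text \<open>The linear part and the energy are integrals exactly; only the sum of the
  \<open>dU\<close> is a Riemann sum. It enters with the factor \<open>c\<close>, hence the accuracy
  \<open>e / (\<bar>c\<bar> + 1)\<close>. The one-sided estimate is all that the barrier argument
  asks for.\<close>

lemma compensator_limit:
  assumes gp: "good_path \<omega>" and e: "0 < e"
  obtains n0 where "0 < n0" "\<And>n m. n0 \<le> n \<Longrightarrow> m \<le> n \<Longrightarrow> K (Gt n m) \<omega> \<le> 1 \<Longrightarrow>
    (LINT r:{0..Gt n m}|lborel. drift l c \<alpha> w (X r \<omega>) (\<zeta> (X r \<omega>)))
      + (LINT r:{0..Gt n m}|stieltjes (\<lambda>r. K r \<omega>). bdrift l c \<alpha> w (X r \<omega>)) - e \<le> compensator l c \<alpha> w n m \<omega>"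
proof -
  obtain C where C: "0 \<le> C" "\<And>x. x \<in> D \<Longrightarrow> \<bar>Sf \<alpha> w x\<bar> \<le> C" "\<And>x. x \<in> D \<Longrightarrow> \<bar>bf \<alpha> w x\<bar> \<le> C"
    by (rule Sf_bf_bound) (rule that)
  interpret SP: semimartingale_path "\<lambda>t. K t \<omega>" 1 C "\<lambda>t. Sf \<alpha> w (X t \<omega>)" "\<lambda>t. Sf \<alpha> w (X t \<omega>) - Nf \<alpha> w t \<omega>"
    "\<lambda>r. af \<alpha> w (X r \<omega>) (\<zeta> (X r \<omega>))" "\<lambda>r. bf \<alpha> w (X r \<omega>)"
    by (rule semimartingale_path_X[OF gp]) (use C in auto)
  have "0 < e / (\<bar>c\<bar> + 1)" using e by simp
  then obtain n0 where n0: "0 < n0" "\<And>n m. n0 \<le> n \<Longrightarrow> m \<le> n \<Longrightarrow> K (grid 1 n m) \<omega> \<le> 1 \<Longrightarrow>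
     \<bar>(\<Sum>i<m. dU \<alpha> w n i \<omega>)
       - ((LINT r:{0..grid 1 n m}|lborel. 2 * Sf \<alpha> w (X r \<omega>) * af \<alpha> w (X r \<omega>) (\<zeta> (X r \<omega>)))
         + (LINT r:{0..grid 1 n m}|stieltjes (\<lambda>r. K r \<omega>). 2 * Sf \<alpha> w (X r \<omega>) * bf \<alpha> w (X r \<omega>)))\<bar> \<le> e / (\<bar>c\<bar> + 1)"
    by (rule SP.square_sum_limit) (rule that)
  show thesis
  proof (rule that[OF n0(1)])
    fix n m assume n: "n0 \<le> n" and m: "m \<le> n" and K1: "K (Gt n m) \<omega> \<le> 1"
    let ?t = "Gt n m"
    have t: "0 \<le> ?t" "?t \<le> 1" using grid_nonneg[of 1] grid_le[OF zero_le_one m] by auto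
    let ?a = "LINT r:{0..?t}|lborel. af \<alpha> w (X r \<omega>) (\<zeta> (X r \<omega>))"
    let ?b = "LINT r:{0..?t}|stieltjes (\<lambda>r. K r \<omega>). bf \<alpha> w (X r \<omega>)"
    let ?q = "LINT r:{0..?t}|lborel. (norm (Hf \<alpha> w (X r \<omega>) (\<zeta> (X r \<omega>))))^2"
    let ?A = "LINT r:{0..?t}|lborel. 2 * Sf \<alpha> w (X r \<omega>) * af \<alpha> w (X r \<omega>) (\<zeta> (X r \<omega>))"
    let ?B = "LINT r:{0..?t}|stieltjes (\<lambda>r. K r \<omega>). 2 * Sf \<alpha> w (X r \<omega>) * bf \<alpha> w (X r \<omega>)"
    have d1: "(LINT r:{0..?t}|lborel. drift l c \<alpha> w (X r \<omega>) (\<zeta> (X r \<omega>))) = l * ?a + c * (?q + ?A)"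
      unfolding drift_def
      using af_integrable[OF gp order_refl t(2), of \<alpha> w] Hf_integrable[OF gp order_refl t(2), of \<alpha> w]
        Sf_af_integrable[OF gp order_refl t(2), of \<alpha> w]
      by (simp only: set_integral_add set_integrable_mult_right set_integral_mult_right simp_thms)
    have i1: "set_integrable (stieltjes (\<lambda>r. K r \<omega>)) {0..?t} (\<lambda>r. bf \<alpha> w (X r \<omega>))"
      by (rule SP.integrable_K[OF good_path_compose[OF gp bf_cont] order_refl])
    have "continuous_on D (\<lambda>x. 2 * Sf \<alpha> w x * bf \<alpha> w x)" by (intro continuous_intros Sf_cont bf_cont)
    then have i2: "set_integrable (stieltjes (\<lambda>r. K r \<omega>)) {0..?t} (\<lambda>r. 2 * Sf \<alpha> w (X r \<omega>) * bf \<alpha> w (X r \<omega>))"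
      by (rule SP.integrable_K[OF good_path_compose[OF gp] order_refl])
    have d2: "(LINT r:{0..?t}|stieltjes (\<lambda>r. K r \<omega>). bdrift l c \<alpha> w (X r \<omega>)) = l * ?b + c * ?B"
      unfolding bdrift_def using i1 i2
      by (simp only: set_integral_add set_integrable_mult_right set_integral_mult_right simp_thms)
    have lin: "(\<Sum>i<m. dA \<alpha> w n i \<omega>) = ?a + ?b" by (rule SP.linear_sum[OF m])
    have "\<bar>c * ((\<Sum>i<m. dU \<alpha> w n i \<omega>) - (?A + ?B))\<bar> \<le> \<bar>c\<bar> * (e / (\<bar>c\<bar> + 1))"
      unfolding abs_mult by (rule mult_left_mono[OF n0(2)[OF n m K1]]) simp
    also have "\<dots> \<le> e" using e by (simp add: field_simps)
    finally have "- e \<le> c * ((\<Sum>i<m. dU \<alpha> w n i \<omega>) - (?A + ?B))" by linarith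
    then show "(LINT r:{0..?t}|lborel. drift l c \<alpha> w (X r \<omega>) (\<zeta> (X r \<omega>)))
      + (LINT r:{0..?t}|stieltjes (\<lambda>r. K r \<omega>). bdrift l c \<alpha> w (X r \<omega>)) - e \<le> compensator l c \<alpha> w n m \<omega>"
      unfolding compensator_def sum.distrib dq_sum[OF gp m] lin d1 d2 by (simp add: algebra_simps)
  qed
qed

end

section \<open>The barrier argument\<close>

context reflected_bsde
begin

text \<open>Only grid points are inspected, so no hitting time of the continuous path occurs. The
  bound on \<open>K\<close> keeps the compensators dominated.\<close>

definition "stay r n i \<omega> \<longleftrightarrow> norm (X (Gt n i) \<omega> - x0) \<le> r \<and> K (Gt n i) \<omega> \<le> 1"
definition "wt r n i \<omega> = (if \<forall>j\<in>{..i}. stay r n j \<omega> then 1 else 0 :: real)"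

lemma stopping_weights_wt: "stopping_weights 1 (wt r)"
  unfolding stopping_weights_def
proof (intro allI conjI ballI)
  fix n i
  have st: "Measurable.pred (F (Gt n i)) (stay r n j)" if "j \<in> {..i}" for j
  proof -
    have "X (Gt n j) \<in> borel_measurable (F (Gt n i))" "K (Gt n j) \<in> borel_measurable (F (Gt n i))"
      using that by (auto intro!: measurable_F_mono[OF XF] measurable_F_mono[OF KF] grid_nonneg grid_mono)
    then show ?thesis unfolding stay_def[abs_def] by measurable
  qed
  have "Measurable.pred (F (Gt n i)) (\<lambda>\<omega>. \<forall>j\<in>{..i}. stay r n j \<omega>)"
    by (rule pred_intros_finite(3)) (use st in auto)
  then show "wt r n i \<in> borel_measurable (F (Gt n i))"
    unfolding wt_def[abs_def] by measurable
  fix \<omega>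
  show "0 \<le> wt r n i \<omega>" "wt r n i \<omega> \<le> 1" "wt r n (Suc i) \<omega> \<le> wt r n i \<omega>"
    by (auto simp: wt_def)
qed

lemma wt_index:
  assumes gp: "good_path \<omega>" and r: "0 \<le> r"
  obtains m where "m \<le> n" "\<forall>i\<le>n. wt r n i \<omega> = (if i \<le> m then 1 else 0)"
    "\<And>j. j \<le> m \<Longrightarrow> stay r n j \<omega>" "m < n \<Longrightarrow> \<not> stay r n (Suc m) \<omega>"
proof -
  have "stay r n 0 \<omega>" using gp r by (simp add: stay_def good_path_def)
  then obtain m where m: "m \<le> n" "\<And>i. i \<le> n \<Longrightarrow> (\<forall>j\<le>i. stay r n j \<omega>) \<longleftrightarrow> i \<le> m" "m < n \<Longrightarrow> \<not> stay r n (Suc m) \<omega>"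
    by (rule stop_index[of "\<lambda>j. stay r n j \<omega>" n]) (rule that)
  show thesis
  proof (rule that[OF m(1) _ _ m(3)])
    show "\<forall>i\<le>n. wt r n i \<omega> = (if i \<le> m then 1 else 0)"
    proof (intro allI impI)
      fix i assume "i \<le> n"
      then show "wt r n i \<omega> = (if i \<le> m then 1 else 0)" using m(2)[of i] unfolding wt_def by auto
    qed
    show "stay r n j \<omega>" if "j \<le> m" for j using m(2)[OF m(1)] that by blast
  qed
qed

text \<open>The errors of the discrete Ito formulas for \<open>Sf\<close> and its square.\<close>

definition "R1 r \<alpha> w n \<omega> = (\<Sum>i<n. wt r n i \<omega> * (Sf \<alpha> w (X (Gt n (Suc i)) \<omega>) - Sf \<alpha> w (X (Gt n i) \<omega>)) - wt r n (Suc i) \<omega> * dA \<alpha> w n i \<omega>)"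
definition "R2 r \<alpha> w n \<omega> = (\<Sum>i<n. wt r n i \<omega> * ((Sf \<alpha> w (X (Gt n (Suc i)) \<omega>))^2 - (Sf \<alpha> w (X (Gt n i) \<omega>))^2)
    - wt r n (Suc i) \<omega> * (dq \<alpha> w n i \<omega> + dU \<alpha> w n i \<omega>))"

lemma R_limits:
  shows "integrable M (R1 r \<alpha> w n)" "(\<lambda>n. expectation (R1 r \<alpha> w n)) \<longlonglongrightarrow> 0"
    and "integrable M (R2 r \<alpha> w n)" "(\<lambda>n. expectation (R2 r \<alpha> w n)) \<longlonglongrightarrow> 0"
proof -
  obtain C where C: "0 \<le> C" "\<And>x. x \<in> D \<Longrightarrow> \<bar>Sf \<alpha> w x\<bar> \<le> C" "\<And>x. x \<in> D \<Longrightarrow> \<bar>bf \<alpha> w x\<bar> \<le> C"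
    by (rule Sf_bf_bound) (rule that)
  have S: "bounded_continuous_process (\<lambda>t \<omega>. Sf \<alpha> w (X t \<omega>)) C"
    by (rule bounded_continuous_process_X[OF C(2)])
  note 1 = discrete_ito_linear[OF S Nf_lim zero_less_one stopping_weights_wt]
  note 2 = discrete_ito_square[OF S Nf_lim zero_less_one stopping_weights_wt]
  show "integrable M (R1 r \<alpha> w n)" unfolding R1_def[abs_def] by (rule 1(1))
  show "(\<lambda>n. expectation (R1 r \<alpha> w n)) \<longlonglongrightarrow> 0" unfolding R1_def by (rule 1(2))
  show "integrable M (R2 r \<alpha> w n)" unfolding R2_def[abs_def] by (rule 2(1))
  show "(\<lambda>n. expectation (R2 r \<alpha> w n)) \<longlonglongrightarrow> 0" unfolding R2_def by (rule 2(2))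
qed

text \<open>On a path the weights are the indicator of \<open>i \<le> m\<close>. The increments of
  \<open>Sf\<close> and of its square then telescope to the first bad grid point, while the
  compensator ends at \<open>m\<close>; the initial value is zero because the path starts in
  \<open>x0\<close>.\<close>

lemma R_stopped:
  assumes m: "m \<le> n" and wt: "\<forall>i\<le>n. wt r n i \<omega> = (if i \<le> m then 1 else 0)"
    and gp: "good_path \<omega>"
  shows "l * R1 r \<alpha> w n \<omega> + c * R2 r \<alpha> w n \<omega>
     = l * Sf \<alpha> w (X (Gt n (min (Suc m) n)) \<omega>) + c * (Sf \<alpha> w (X (Gt n (min (Suc m) n)) \<omega>))^2
       - compensator l c \<alpha> w n m \<omega>"
proof -
  have S0: "Sf \<alpha> w (X (Gt n 0) \<omega>) = 0" using gp by (simp add: Sf_def good_path_def)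
  have split: "(\<Sum>i<n. wt r n i \<omega> * (f (Suc i) - f i) - wt r n (Suc i) \<omega> * x i) = f (min (Suc m) n) - f 0 - (\<Sum>i<m. x i)"
    for f x :: "nat \<Rightarrow> real"
  proof -
    have "(\<Sum>i<n. wt r n i \<omega> * (f (Suc i) - f i) - wt r n (Suc i) \<omega> * x i)
        = (\<Sum>i<n. (if i \<le> m then 1 else 0) * (f (Suc i) - f i)) - (\<Sum>i<n. (if Suc i \<le> m then 1 else 0) * x i)"
      unfolding sum_subtractf[symmetric] by (intro sum.cong refl) (simp add: wt)
    then show ?thesis unfolding sum_stopped[OF m] sum_stopped_diff[OF m] .
  qed
  have eq1: "R1 r \<alpha> w n \<omega> = Sf \<alpha> w (X (Gt n (min (Suc m) n)) \<omega>) - 0 - (\<Sum>i<m. dA \<alpha> w n i \<omega>)"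
    unfolding R1_def split[of "\<lambda>i. Sf \<alpha> w (X (Gt n i) \<omega>)"] S0 ..
  have eq2: "R2 r \<alpha> w n \<omega> = (Sf \<alpha> w (X (Gt n (min (Suc m) n)) \<omega>))^2 - 0 - (\<Sum>i<m. dq \<alpha> w n i \<omega> + dU \<alpha> w n i \<omega>)"
    unfolding R2_def split[of "\<lambda>i. (Sf \<alpha> w (X (Gt n i) \<omega>))^2"] S0 by simp
  have "l * (x - 0 - y) + c * (x' - 0 - y') = l * x + c * x' - (l * y + c * y')" for x y x' y' :: real
    by (simp add: algebra_simps)
  then show ?thesis unfolding compensator_def eq1 eq2 .
qed

text \<open>The error \<open>Q\<close> of the discrete formulas is a nonpositive value of the
  barrier minus a compensator that grows at least like \<open>\<delta>\<close> times the elapsed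
  time \<open>Len\<close>, up to small errors. Since \<open>Q\<close> has mean tending to zero, the
  expectation of \<open>Len\<close> tends to zero as well. But on each path \<open>Len\<close> stays
  away from zero, because \<open>X\<close> and \<open>K\<close> need some time to leave.\<close>

lemma no_strict_barrier:
  fixes Ix :: "'k set" and l c \<alpha> :: "'k \<Rightarrow> real" and w :: "'k \<Rightarrow> real^'d"
  assumes fin: "finite Ix" and r: "0 < r" and \<delta>: "0 < \<delta>"
    and neg: "\<And>x. x \<in> D \<Longrightarrow> norm (x - x0) \<le> r \<Longrightarrow> (\<Sum>k\<in>Ix. l k * Sf (\<alpha> k) (w k) x + c k * (Sf (\<alpha> k) (w k) x)^2) \<le> 0"
    and pos: "\<And>x z. x \<in> D \<Longrightarrow> norm (x - x0) \<le> r \<Longrightarrow> \<delta> \<le> (\<Sum>k\<in>Ix. drift (l k) (c k) (\<alpha> k) (w k) x z)"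
    and bpos: "\<And>x. x \<in> D \<Longrightarrow> x \<in> bd \<Longrightarrow> norm (x - x0) \<le> r \<Longrightarrow> 0 \<le> (\<Sum>k\<in>Ix. bdrift (l k) (c k) (\<alpha> k) (w k) x)"
  shows False
proof -
  \<comment> \<open>Stopping at half the radius leaves room: on a fine grid the first bad point and
    all times between grid points are still within \<open>r\<close>.\<close>
  define r2 where "r2 = r / 2"
  have r2: "0 < r2" "0 \<le> r2" unfolding r2_def using r by auto
  define P where "P x = (\<Sum>k\<in>Ix. l k * Sf (\<alpha> k) (w k) x + c k * (Sf (\<alpha> k) (w k) x)^2)" for x
  define Q where "Q n \<omega> = (\<Sum>k\<in>Ix. l k * R1 r2 (\<alpha> k) (w k) n \<omega> + c k * R2 r2 (\<alpha> k) (w k) n \<omega>)" for n \<omega>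
  \<comment> \<open>The share of steps with two good endpoints, which is the grid time at which the
    compensator ends. Written through the weights it is visibly measurable.\<close>
  define Len where "Len n \<omega> = (\<Sum>i<n. wt r2 n (Suc i) \<omega>) / real n" for n \<omega>
  define comp where "comp n m \<omega> = (\<Sum>k\<in>Ix. compensator (l k) (c k) (\<alpha> k) (w k) n m \<omega>)" for n m \<omega>
  note sw = stopping_weights_D[OF stopping_weights_wt[of r2]]
  have Qi: "integrable M (Q n)" for n
    unfolding Q_def[abs_def] by (intro Bochner_Integration.integrable_sum Bochner_Integration.integrable_add integrable_mult_right R_limits)
  have Qlim: "(\<lambda>n. expectation (Q n)) \<longlonglongrightarrow> 0"
  proof -
    have "expectation (Q n) = (\<Sum>k\<in>Ix. l k * expectation (R1 r2 (\<alpha> k) (w k) n) + c k * expectation (R2 r2 (\<alpha> k) (w k) n))" for n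
    proof -
      have "expectation (Q n) = (\<Sum>k\<in>Ix. expectation (\<lambda>\<omega>. l k * R1 r2 (\<alpha> k) (w k) n \<omega> + c k * R2 r2 (\<alpha> k) (w k) n \<omega>))"
        unfolding Q_def[abs_def]
        by (intro Bochner_Integration.integral_sum Bochner_Integration.integrable_add integrable_mult_right R_limits)
      also have "\<dots> = (\<Sum>k\<in>Ix. l k * expectation (R1 r2 (\<alpha> k) (w k) n) + c k * expectation (R2 r2 (\<alpha> k) (w k) n))"
        by (intro sum.cong refl) (simp add: R_limits)
      finally show ?thesis .
    qed
    moreover have "(\<lambda>n. \<Sum>k\<in>Ix. l k * expectation (R1 r2 (\<alpha> k) (w k) n) + c k * expectation (R2 r2 (\<alpha> k) (w k) n)) \<longlonglongrightarrow> (\<Sum>k\<in>Ix. l k * 0 + c k * 0)"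
      by (intro tendsto_sum tendsto_add tendsto_mult tendsto_const R_limits)
    ultimately show ?thesis by simp
  qed
  have Qstop: "Q n \<omega> = P (X (Gt n (min (Suc m) n)) \<omega>) - comp n m \<omega>"
    if "good_path \<omega>" "m \<le> n" "\<forall>i\<le>n. wt r2 n i \<omega> = (if i \<le> m then 1 else 0)" for n m \<omega>
    unfolding Q_def P_def comp_def sum_subtractf[symmetric] using R_stopped[OF that(2,3,1)] by (intro sum.cong refl) auto
  have Lenstop: "Len n \<omega> = Gt n m" if "m \<le> n" "\<forall>i\<le>n. wt r2 n i \<omega> = (if i \<le> m then 1 else 0)" for n m \<omega>
  proof -
    have "(\<Sum>i<n. wt r2 n (Suc i) \<omega>) = (\<Sum>i<n. (if Suc i \<le> m then 1 else 0) * 1)"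
      by (intro sum.cong refl) (simp add: that(2))
    also have "\<dots> = real m" using sum_stopped[OF that(1), of "\<lambda>_. 1"] by simp
    finally show ?thesis unfolding Len_def grid_def by simp
  qed
  have Len01: "0 \<le> Len n \<omega>" "Len n \<omega> \<le> 1" if "\<omega> \<in> space M" for n \<omega>
  proof -
    show "0 \<le> Len n \<omega>" unfolding Len_def using sw(3)[OF that] by (intro divide_nonneg_nonneg sum_nonneg) auto
    have "(\<Sum>i<n. wt r2 n (Suc i) \<omega>) \<le> (\<Sum>i<n. 1)" using sw(4)[OF that] by (intro sum_mono) auto
    then show "Len n \<omega> \<le> 1" unfolding Len_def by (cases "n = 0") (auto simp: divide_le_eq)
  qed
  have Leni: "integrable M (Len n)" for n
  proof (rule integrable_const_bound)
    show "AE \<omega> in M. norm (Len n \<omega>) \<le> 1" using Len01 by (intro AE_I2) auto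
    show "Len n \<in> borel_measurable M" unfolding Len_def[abs_def] using sw(2)
      by (intro borel_measurable_divide borel_measurable_sum borel_measurable_const)
  qed
  have "\<exists>B. \<forall>k\<in>Ix. 0 \<le> B k \<and> (\<forall>\<omega> n m. good_path \<omega> \<longrightarrow> m \<le> n \<longrightarrow> K (Gt n m) \<omega> \<le> 1 \<longrightarrow> \<bar>compensator (l k) (c k) (\<alpha> k) (w k) n m \<omega>\<bar> \<le> B k * (1 + z2 \<omega>))"
  proof (rule bchoice, rule ballI)
    fix k
    obtain B where "0 \<le> B" "\<And>\<omega> n m. good_path \<omega> \<Longrightarrow> m \<le> n \<Longrightarrow> K (Gt n m) \<omega> \<le> 1 \<Longrightarrow> \<bar>compensator (l k) (c k) (\<alpha> k) (w k) n m \<omega>\<bar> \<le> B * (1 + z2 \<omega>)"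
      by (rule compensator_bound) (rule that)
    then show "\<exists>B. 0 \<le> B \<and> (\<forall>\<omega> n m. good_path \<omega> \<longrightarrow> m \<le> n \<longrightarrow> K (Gt n m) \<omega> \<le> 1 \<longrightarrow> \<bar>compensator (l k) (c k) (\<alpha> k) (w k) n m \<omega>\<bar> \<le> B * (1 + z2 \<omega>))"
      by blast
  qed
  then obtain B where B: "\<And>k \<omega> n m. k \<in> Ix \<Longrightarrow> good_path \<omega> \<Longrightarrow> m \<le> n \<Longrightarrow> K (Gt n m) \<omega> \<le> 1 \<Longrightarrow> \<bar>compensator (l k) (c k) (\<alpha> k) (w k) n m \<omega>\<bar> \<le> B k * (1 + z2 \<omega>)"
    by blast
  have "continuous_on D P" unfolding P_def[abs_def] by (intro continuous_intros Sf_cont)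
  then obtain CP where CP: "0 \<le> CP" "\<And>x. x \<in> D \<Longrightarrow> norm (P x) \<le> CP" by (rule D_bound) (rule that)
  have Qbound: "\<bar>Q n \<omega>\<bar> \<le> CP + (\<Sum>k\<in>Ix. B k) * (1 + z2 \<omega>)" if gp: "good_path \<omega>" for n \<omega>
  proof -
    obtain m where m: "m \<le> n" "\<forall>i\<le>n. wt r2 n i \<omega> = (if i \<le> m then 1 else 0)" "\<And>j. j \<le> m \<Longrightarrow> stay r2 n j \<omega>"
      by (rule wt_index[OF gp r2(2), of n]) (rule that)
    have K1: "K (Gt n m) \<omega> \<le> 1" using m(3)[of m] unfolding stay_def by simp
    have XD: "X (Gt n (min (Suc m) n)) \<omega> \<in> D" using gp grid_nonneg[OF zero_le_one] unfolding good_path_def by blast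
    have "\<bar>comp n m \<omega>\<bar> \<le> (\<Sum>k\<in>Ix. \<bar>compensator (l k) (c k) (\<alpha> k) (w k) n m \<omega>\<bar>)" unfolding comp_def by (rule sum_abs)
    also have "\<dots> \<le> (\<Sum>k\<in>Ix. B k * (1 + z2 \<omega>))" by (intro sum_mono B gp m(1) K1)
    also have "\<dots> = (\<Sum>k\<in>Ix. B k) * (1 + z2 \<omega>)" by (rule sum_distrib_right[symmetric])
    finally show ?thesis unfolding Qstop[OF gp m(1,2)] using CP(2)[OF XD] by simp
  qed
  \<comment> \<open>The pathwise estimate: \<open>P\<close> is nonpositive at the first bad point,
    and the compensator is at least \<open>\<delta> * Len n \<omega>\<close> minus the error of the
    Riemann sums.\<close>
  have main: "\<exists>n0. \<forall>n\<ge>n0. Q n \<omega> + \<delta> * Len n \<omega> \<le> e" if gp: "good_path \<omega>" and e: "0 < e" for \<omega> e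
  proof -
    have Xc: "continuous_on {0..} (\<lambda>t. X t \<omega>)" using gp by (simp add: good_path_def)
    interpret K: stieltjes_path "\<lambda>r. K r \<omega>"
      using gp by unfold_locales (auto simp: good_path_def)
    obtain n1 where n1: "0 < n1" "\<And>n s t. n1 \<le> n \<Longrightarrow> s \<in> {0..1} \<Longrightarrow> t \<in> {0..1} \<Longrightarrow> \<bar>s - t\<bar> \<le> 1 / real n \<Longrightarrow> dist (X s \<omega>) (X t \<omega>) < r2"
      by (rule grid_modulus[OF Xc zero_less_one r2(1)]) (rule that)
    \<comment> \<open>One share of the error for each index in \<open>Ix\<close>; the added 1 covers
      the empty set.\<close>
    define e' where "e' = e / (real (card Ix) + 1)"
    have e': "0 < e'" unfolding e'_def using e by (simp add: add_nonneg_pos)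
    have "\<exists>N. \<forall>k\<in>Ix. \<forall>n m. N k \<le> n \<longrightarrow> m \<le> n \<longrightarrow> K (Gt n m) \<omega> \<le> 1 \<longrightarrow>
      (LINT r:{0..Gt n m}|lborel. drift (l k) (c k) (\<alpha> k) (w k) (X r \<omega>) (\<zeta> (X r \<omega>)))
      + (LINT r:{0..Gt n m}|stieltjes (\<lambda>r. K r \<omega>). bdrift (l k) (c k) (\<alpha> k) (w k) (X r \<omega>)) - e' \<le> compensator (l k) (c k) (\<alpha> k) (w k) n m \<omega>"
    proof (rule bchoice, rule ballI)
      fix k
      obtain N where "\<And>n m. N \<le> n \<Longrightarrow> m \<le> n \<Longrightarrow> K (Gt n m) \<omega> \<le> 1 \<Longrightarrow>
       (LINT r:{0..Gt n m}|lborel. drift (l k) (c k) (\<alpha> k) (w k) (X r \<omega>) (\<zeta> (X r \<omega>)))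
       + (LINT r:{0..Gt n m}|stieltjes (\<lambda>r. K r \<omega>). bdrift (l k) (c k) (\<alpha> k) (w k) (X r \<omega>)) - e' \<le> compensator (l k) (c k) (\<alpha> k) (w k) n m \<omega>"
        by (rule compensator_limit[OF gp e']) (rule that)
      then show "\<exists>N. \<forall>n m. N \<le> n \<longrightarrow> m \<le> n \<longrightarrow> K (Gt n m) \<omega> \<le> 1 \<longrightarrow>
       (LINT r:{0..Gt n m}|lborel. drift (l k) (c k) (\<alpha> k) (w k) (X r \<omega>) (\<zeta> (X r \<omega>)))
       + (LINT r:{0..Gt n m}|stieltjes (\<lambda>r. K r \<omega>). bdrift (l k) (c k) (\<alpha> k) (w k) (X r \<omega>)) - e' \<le> compensator (l k) (c k) (\<alpha> k) (w k) n m \<omega>"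
        by blast
    qed
    then obtain N where N: "\<And>k n m. k \<in> Ix \<Longrightarrow> N k \<le> n \<Longrightarrow> m \<le> n \<Longrightarrow> K (Gt n m) \<omega> \<le> 1 \<Longrightarrow>
      (LINT r:{0..Gt n m}|lborel. drift (l k) (c k) (\<alpha> k) (w k) (X r \<omega>) (\<zeta> (X r \<omega>)))
      + (LINT r:{0..Gt n m}|stieltjes (\<lambda>r. K r \<omega>). bdrift (l k) (c k) (\<alpha> k) (w k) (X r \<omega>)) - e' \<le> compensator (l k) (c k) (\<alpha> k) (w k) n m \<omega>"
      by blast
    show ?thesis
    proof (intro exI[of _ "n1 + (\<Sum>k\<in>Ix. N k)"] allI impI)
      fix n assume n: "n1 + (\<Sum>k\<in>Ix. N k) \<le> n"
      have nN: "N k \<le> n" if "k \<in> Ix" for k using member_le_sum[of k Ix N] fin that n by simp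
      have nn1: "n1 \<le> n" "0 < n" using n n1(1) by auto
      obtain m where m: "m \<le> n" "\<forall>i\<le>n. wt r2 n i \<omega> = (if i \<le> m then 1 else 0)" "\<And>j. j \<le> m \<Longrightarrow> stay r2 n j \<omega>"
        by (rule wt_index[OF gp r2(2), of n]) (rule that)
      have K1: "K (Gt n m) \<omega> \<le> 1" using m(3)[of m] unfolding stay_def by simp
      have t: "0 \<le> Gt n m" "Gt n m \<le> 1" using grid_nonneg[of 1] grid_le[OF zero_le_one m(1)] by auto
      have XD: "X s \<omega> \<in> D" if "0 \<le> s" for s using gp that by (auto simp: good_path_def)
      have near: "norm (X s \<omega> - x0) \<le> r" if s: "s \<in> {0..1}" and j: "j \<le> m" "\<bar>s - Gt n j\<bar> \<le> 1 / real n" for s j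
      proof -
        have "Gt n j \<in> {0..1}" by (rule grid_mem) (use j m in auto)
        then have "dist (X s \<omega>) (X (Gt n j) \<omega>) < r2" using n1(2)[OF nn1(1) s] j by blast
        moreover have "norm (X (Gt n j) \<omega> - x0) \<le> r2" using m(3)[OF j(1)] unfolding stay_def by simp
        ultimately show ?thesis
          using norm_triangle_ineq[of "X s \<omega> - X (Gt n j) \<omega>" "X (Gt n j) \<omega> - x0"] unfolding r2_def dist_norm by simp
      qed
      have nearp: "norm (X (Gt n (min (Suc m) n)) \<omega> - x0) \<le> r"
      proof (rule near[of _ m])
        show "Gt n (min (Suc m) n) \<in> {0..1}" by (rule grid_mem) auto
        show "\<bar>Gt n (min (Suc m) n) - Gt n m\<bar> \<le> 1 / real n"
          using grid_step_abs[of 1 n m] m(1) by (cases "m = n") (auto simp: min_def)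
      qed simp
      have nears: "norm (X s \<omega> - x0) \<le> r" if s: "s \<in> {0..Gt n m}" for s
      proof -
        \<comment> \<open>The last grid point not after \<open>s\<close>; it is at distance at most
          one step and does not exceed \<open>m\<close>.\<close>
        define j where "j = nat \<lfloor>s * real n\<rfloor>"
        have sn: "0 \<le> s * real n" using s by simp
        have "s * real n \<le> real m" using s nn1(2) by (simp add: grid_def le_divide_eq)
        then have jm: "j \<le> m" unfolding j_def using sn by (simp add: nat_le_iff floor_le_iff)
        have "real j \<le> s * real n" "s * real n \<le> real j + 1"
          unfolding j_def using sn by linarith+
        then have "\<bar>s * real n - real j\<bar> \<le> 1" by simp
        then have "\<bar>s * real n - real j\<bar> / real n \<le> 1 / real n" by (rule divide_right_mono) simp
        moreover have "s - Gt n j = (s * real n - real j) / real n"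
          using nn1(2) by (simp add: grid_def field_simps)
        then have "\<bar>s * real n - real j\<bar> / real n = \<bar>s - Gt n j\<bar>" by (simp add: abs_divide)
        ultimately show ?thesis using near[OF _ jm, of s] s t by auto
      qed
      have c: "continuous_on D (\<lambda>x. \<Sum>k\<in>Ix. bdrift (l k) (c k) (\<alpha> k) (w k) x)" by (intro continuous_intros bdrift_cont)
      have bint: "(\<Sum>k\<in>Ix. LINT r:{0..Gt n m}|stieltjes (\<lambda>r. K r \<omega>). bdrift (l k) (c k) (\<alpha> k) (w k) (X r \<omega>))
          = (LINT r:{0..Gt n m}|stieltjes (\<lambda>r. K r \<omega>). \<Sum>k\<in>Ix. bdrift (l k) (c k) (\<alpha> k) (w k) (X r \<omega>))"
        unfolding set_lebesgue_integral_def scaleR_sum_right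
        by (rule Bochner_Integration.integral_sum[symmetric])
           (use K.integrable_K[OF good_path_compose[OF gp bdrift_cont] order_refl] in \<open>simp add: set_integrable_def\<close>)
      \<comment> \<open>The measure \<open>dK\<close> is carried by the times at the boundary, so
        the sign of the integrand is needed only there.\<close>
      have "0 \<le> (LINT r:{0..Gt n m}|stieltjes (\<lambda>r. K r \<omega>). \<Sum>k\<in>Ix. bdrift (l k) (c k) (\<alpha> k) (w k) (X r \<omega>))"
      proof (rule K.integral_K_nonneg[OF good_path_compose[OF gp c] t(1), of "\<lambda>r. X r \<omega> \<in> bd"])
        show "K 0 \<omega> = 0" using gp by (simp add: good_path_def)
        have "K (Gt n m) \<omega> = (LINT s:{0..Gt n m}|stieltjes (\<lambda>r. K r \<omega>). indicator bd (X s \<omega>))"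
          using gp t(1) unfolding good_path_def by blast
        moreover have "indicator bd (X s \<omega>) = indicat_real {r. X r \<omega> \<in> bd} s" for s by (simp add: indicator_def)
        ultimately show "K (Gt n m) \<omega> = (LINT r:{0..Gt n m}|stieltjes (\<lambda>r. K r \<omega>). indicat_real {r. X r \<omega> \<in> bd} r)" by simp
        show "0 \<le> (\<Sum>k\<in>Ix. bdrift (l k) (c k) (\<alpha> k) (w k) (X s \<omega>))" if "s \<in> {0..Gt n m}" "X s \<omega> \<in> bd" for s
          by (rule bpos) (use XD nears that in auto)
        have "closed ({0..Gt n m} \<inter> (\<lambda>r. X r \<omega>) -` bd)"
          by (rule continuous_closed_preimage[OF continuous_on_subset[OF Xc] _ bd]) auto
        then show "{r. X r \<omega> \<in> bd} \<inter> {0..Gt n m} \<in> sets borel"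
          by (simp add: vimage_def Int_commute)
      qed
      then have bK: "0 \<le> (\<Sum>k\<in>Ix. LINT r:{0..Gt n m}|stieltjes (\<lambda>r. K r \<omega>). bdrift (l k) (c k) (\<alpha> k) (w k) (X r \<omega>))"
        unfolding bint .
      have di: "set_integrable lborel {0..Gt n m} (\<lambda>r. \<Sum>k\<in>Ix. drift (l k) (c k) (\<alpha> k) (w k) (X r \<omega>) (\<zeta> (X r \<omega>)))"
        unfolding set_integrable_def scaleR_sum_right
        using drift_integrable[OF gp order_refl t(2)] by (intro Bochner_Integration.integrable_sum) (simp add: set_integrable_def)
      have dint: "(\<Sum>k\<in>Ix. LINT r:{0..Gt n m}|lborel. drift (l k) (c k) (\<alpha> k) (w k) (X r \<omega>) (\<zeta> (X r \<omega>)))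
          = (LINT r:{0..Gt n m}|lborel. \<Sum>k\<in>Ix. drift (l k) (c k) (\<alpha> k) (w k) (X r \<omega>) (\<zeta> (X r \<omega>)))"
        unfolding set_lebesgue_integral_def scaleR_sum_right
        by (rule Bochner_Integration.integral_sum[symmetric])
           (use drift_integrable[OF gp order_refl t(2)] in \<open>simp add: set_integrable_def\<close>)
      have "(LINT r:{0..Gt n m}|lborel. \<delta>) \<le> (LINT r:{0..Gt n m}|lborel. \<Sum>k\<in>Ix. drift (l k) (c k) (\<alpha> k) (w k) (X r \<omega>) (\<zeta> (X r \<omega>)))"
      proof (rule set_integral_mono[OF _ di])
        show "set_integrable lborel {0..Gt n m} (\<lambda>r. \<delta>)" by (rule set_integrable_continuous) auto
        show "\<delta> \<le> (\<Sum>k\<in>Ix. drift (l k) (c k) (\<alpha> k) (w k) (X s \<omega>) (\<zeta> (X s \<omega>)))" if "s \<in> {0..Gt n m}" for s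
          by (rule pos) (use XD nears that in auto)
      qed
      then have dK: "\<delta> * Gt n m \<le> (\<Sum>k\<in>Ix. LINT r:{0..Gt n m}|lborel. drift (l k) (c k) (\<alpha> k) (w k) (X r \<omega>) (\<zeta> (X r \<omega>)))"
        unfolding dint using t by (simp add: set_integral_const mult.commute)
      have "(\<Sum>k\<in>Ix. (LINT r:{0..Gt n m}|lborel. drift (l k) (c k) (\<alpha> k) (w k) (X r \<omega>) (\<zeta> (X r \<omega>)))
        + (LINT r:{0..Gt n m}|stieltjes (\<lambda>r. K r \<omega>). bdrift (l k) (c k) (\<alpha> k) (w k) (X r \<omega>)) - e') \<le> comp n m \<omega>"
        unfolding comp_def by (intro sum_mono N nN m(1) K1)
      then have "\<delta> * Gt n m - real (card Ix) * e' \<le> comp n m \<omega>"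
        using bK dK by (simp add: sum.distrib sum_subtractf)
      moreover have "real (card Ix) * e' \<le> e"
        unfolding e'_def using e by (simp add: field_simps)
      moreover have "P (X (Gt n (min (Suc m) n)) \<omega>) \<le> 0"
        unfolding P_def by (rule neg[OF XD nearp]) (rule grid_nonneg[OF zero_le_one])
      ultimately show "Q n \<omega> + \<delta> * Len n \<omega> \<le> e"
        unfolding Qstop[OF gp m(1,2)] Lenstop[OF m(1,2)] by simp
    qed
  qed
  \<comment> \<open>The lower bound may depend on the path. Up to time \<open>h\<close> neither the
    ball of radius \<open>r2\<close> nor the level 1 of \<open>K\<close> is left, so the first bad
    grid point comes after \<open>h\<close>, and the preceding one after \<open>h / 2\<close> once
    the steps are short.\<close>
  have lower: "\<exists>t0>0. \<exists>n0. \<forall>n\<ge>n0. t0 \<le> Len n \<omega>" if gp: "good_path \<omega>" for \<omega>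
  proof -
    have Xc: "continuous_on {0..} (\<lambda>t. X t \<omega>)" and Kc: "continuous_on {0..} (\<lambda>t. K t \<omega>)"
      and X0: "X 0 \<omega> = x0" and K0: "K 0 \<omega> = 0" using gp by (auto simp: good_path_def)
    obtain n1 where n1: "0 < n1" "\<And>n s t. n1 \<le> n \<Longrightarrow> s \<in> {0..1} \<Longrightarrow> t \<in> {0..1} \<Longrightarrow> \<bar>s - t\<bar> \<le> 1 / real n \<Longrightarrow> dist (X s \<omega>) (X t \<omega>) < r2"
      by (rule grid_modulus[OF Xc zero_less_one r2(1)]) (rule that)
    obtain n2 where n2: "0 < n2" "\<And>n s t. n2 \<le> n \<Longrightarrow> s \<in> {0..1} \<Longrightarrow> t \<in> {0..1} \<Longrightarrow> \<bar>s - t\<bar> \<le> 1 / real n \<Longrightarrow> dist (K s \<omega>) (K t \<omega>) < 1"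
      by (rule grid_modulus[OF Kc zero_less_one zero_less_one]) (rule that)
    define h where "h = 1 / real (n1 + n2)"
    have h: "0 < h" "h \<le> 1" unfolding h_def using n1(1) by auto
    have st: "stay r2 n j \<omega>" if "Gt n j \<le> h" for n j
    proof -
      have g: "Gt n j \<in> {0..1}" using that h grid_nonneg[of 1 n j] by auto
      have "dist (X (Gt n j) \<omega>) (X 0 \<omega>) < r2"
        by (rule n1(2)[of "n1 + n2"]) (use g that in \<open>auto simp: h_def\<close>)
      moreover have "dist (K (Gt n j) \<omega>) (K 0 \<omega>) < 1"
        by (rule n2(2)[of "n1 + n2"]) (use g that in \<open>auto simp: h_def\<close>)
      ultimately show ?thesis unfolding stay_def X0 K0 by (simp add: dist_norm)
    qed
    show ?thesis
    proof (intro exI[of _ "h / 2"] conjI exI[of _ "2 * (n1 + n2)"] allI impI)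
      show "0 < h / 2" using h by simp
      fix n assume n: "2 * (n1 + n2) \<le> n"
      have np: "0 < n" using n n1(1) by simp
      obtain m where m: "m \<le> n" "\<forall>i\<le>n. wt r2 n i \<omega> = (if i \<le> m then 1 else 0)" "m < n \<Longrightarrow> \<not> stay r2 n (Suc m) \<omega>"
        by (rule wt_index[OF gp r2(2), of n]) (rule that)
      have "1 / real n \<le> 1 / real (2 * (n1 + n2))"
        using n n1(1) by (intro divide_left_mono) auto
      moreover have "h / 2 = 1 / real (2 * (n1 + n2))" unfolding h_def by simp
      ultimately have hn: "1 / real n \<le> h / 2" by (simp only:)
      have "h / 2 \<le> Gt n m"
      proof (cases "m < n")
        case True
        then have "h < Gt n (Suc m)" using m(3) st[of n "Suc m"] by (meson not_le)
        then show ?thesis using hn grid_step[of 1 n m] by simp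
      next
        case False
        then have "m = n" using m(1) by simp
        then show ?thesis using h grid_end[OF np, of 1] by simp
      qed
      then show "h / 2 \<le> Len n \<omega>" unfolding Lenstop[OF m(1,2)] .
    qed
  qed
  have one: "(\<lambda>_. 1::real) \<in> borel_measurable M" "\<forall>\<omega>\<in>space M. \<bar>1::real\<bar> \<le> 1" by auto
  have z2i: "integrable M z2"
    using path_L2_integrals(2)[OF ito_limit_path_L2[OF I_lim] order_refl order_refl one] by simp
  \<comment> \<open>Only an upper bound of the limit is known on the paths, so dominated convergence
    is applied to the positive part.\<close>
  have "(\<lambda>n. expectation (\<lambda>\<omega>. max 0 (Q n \<omega> + \<delta> * Len n \<omega>))) \<longlonglongrightarrow> expectation (\<lambda>\<omega>. 0)"
  proof (rule integral_dominated_convergence)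
    show "(\<lambda>\<omega>. max 0 (Q n \<omega> + \<delta> * Len n \<omega>)) \<in> borel_measurable M" for n
      using borel_measurable_integrable[OF Qi] borel_measurable_integrable[OF Leni] by measurable
    show "integrable M (\<lambda>\<omega>. CP + (\<Sum>k\<in>Ix. B k) * (1 + z2 \<omega>) + \<delta>)" using z2i by simp
    show "AE \<omega> in M. norm (max 0 (Q n \<omega> + \<delta> * Len n \<omega>)) \<le> CP + (\<Sum>k\<in>Ix. B k) * (1 + z2 \<omega>) + \<delta>" for n
      using AE_good_path AE_space
    proof eventually_elim
      case (elim \<omega>)
      have "\<delta> * Len n \<omega> \<le> \<delta> * 1" using Len01(2)[OF elim(2)] \<delta> by (intro mult_left_mono) auto
      then have "\<delta> * Len n \<omega> \<le> \<delta>" by (simp only: mult_1_right)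
      then have "Q n \<omega> + \<delta> * Len n \<omega> \<le> CP + (\<Sum>k\<in>Ix. B k) * (1 + z2 \<omega>) + \<delta>" "0 \<le> CP + (\<Sum>k\<in>Ix. B k) * (1 + z2 \<omega>) + \<delta>"
        using Qbound[OF elim(1), of n] \<delta> by linarith+
      then show ?case by simp
    qed
    show "AE \<omega> in M. (\<lambda>n. max 0 (Q n \<omega> + \<delta> * Len n \<omega>)) \<longlonglongrightarrow> 0"
      using AE_good_path
    proof eventually_elim
      case (elim \<omega>)
      show ?case
      proof (rule LIMSEQ_I)
        fix e :: real assume "0 < e"
        then obtain n0 where n0: "\<forall>n\<ge>n0. Q n \<omega> + \<delta> * Len n \<omega> \<le> e / 2" using main[OF elim, of "e / 2"] by auto
        show "\<exists>no. \<forall>n\<ge>no. norm (max 0 (Q n \<omega> + \<delta> * Len n \<omega>) - 0) < e"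
        proof (intro exI[of _ n0] allI impI)
          fix n assume "n0 \<le> n"
          then have "Q n \<omega> + \<delta> * Len n \<omega> \<le> e / 2" using n0 by blast
          then show "norm (max 0 (Q n \<omega> + \<delta> * Len n \<omega>) - 0) < e" using \<open>0 < e\<close> by simp
        qed
      qed
    qed
  qed simp
  then have maxlim: "(\<lambda>n. expectation (\<lambda>\<omega>. max 0 (Q n \<omega> + \<delta> * Len n \<omega>))) \<longlonglongrightarrow> 0" by simp
  \<comment> \<open>The expectation of \<open>\<delta> * Len\<close> is squeezed between 0 and the
    expected positive part minus the expectation of \<open>Q\<close>, both of which tend to
    zero.\<close>
  have "(\<lambda>n. \<delta> * expectation (Len n)) \<longlonglongrightarrow> 0"
  proof (rule tendsto_sandwich[OF always_eventually always_eventually tendsto_const])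
    show "\<forall>n. 0 \<le> \<delta> * expectation (Len n)"
    proof
      fix n show "0 \<le> \<delta> * expectation (Len n)"
        using \<delta> Len01(1) by (intro mult_nonneg_nonneg Bochner_Integration.integral_nonneg) auto
    qed
    show "\<forall>n. \<delta> * expectation (Len n) \<le> expectation (\<lambda>\<omega>. max 0 (Q n \<omega> + \<delta> * Len n \<omega>)) - expectation (Q n)"
    proof
      fix n
      have "expectation (\<lambda>\<omega>. Q n \<omega> + \<delta> * Len n \<omega>) \<le> expectation (\<lambda>\<omega>. max 0 (Q n \<omega> + \<delta> * Len n \<omega>))"
        using Qi Leni by (intro integral_mono integrable_max) auto
      then show "\<delta> * expectation (Len n) \<le> expectation (\<lambda>\<omega>. max 0 (Q n \<omega> + \<delta> * Len n \<omega>)) - expectation (Q n)"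
        using Qi Leni by simp
    qed
    show "(\<lambda>n. expectation (\<lambda>\<omega>. max 0 (Q n \<omega> + \<delta> * Len n \<omega>)) - expectation (Q n)) \<longlonglongrightarrow> 0"
      using tendsto_diff[OF maxlim Qlim] by simp
  qed
  then have "(\<lambda>n. (1 / \<delta>) * (\<delta> * expectation (Len n))) \<longlonglongrightarrow> (1 / \<delta>) * 0" by (rule tendsto_mult_left)
  then have EL: "(\<lambda>n. expectation (Len n)) \<longlonglongrightarrow> 0" using \<delta> by simp
  have "expectation (\<lambda>\<omega>. norm (Len n \<omega>)) = expectation (Len n)" for n
    using Len01(1) by (intro Bochner_Integration.integral_cong) auto
  \<comment> \<open>Convergence in mean gives almost sure convergence along a subsequence, which
    contradicts the pathwise bound \<open>lower\<close>.\<close>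
  then have "\<exists>q::nat\<Rightarrow>nat. strict_mono q \<and> (AE \<omega> in M. (\<lambda>n. Len (q n) \<omega>) \<longlonglongrightarrow> 0)"
    using EL by (intro tendsto_L1_AE_subseq Leni) simp
  then obtain q :: "nat \<Rightarrow> nat" where q: "strict_mono q" "AE \<omega> in M. (\<lambda>n. Len (q n) \<omega>) \<longlonglongrightarrow> 0" by blast
  have "AE \<omega> in M. False"
    using AE_good_path q(2)
  proof eventually_elim
    case (elim \<omega>)
    obtain t0 n0 where t0: "0 < t0" "\<forall>n\<ge>n0. t0 \<le> Len n \<omega>" using lower[OF elim(1)] by blast
    have "t0 \<le> 0"
    proof (rule LIMSEQ_le_const[OF elim(2)])
      show "\<exists>N. \<forall>n\<ge>N. t0 \<le> Len (q n) \<omega>"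
        using t0(2) seq_suble[OF q(1)] by (meson order_trans)
    qed
    then show False using t0(1) by simp
  qed
  then show False by (simp only: AE_False)
qed

end

section \<open>Second-order superjets\<close>

lemma continuous_on_pos_near:
  fixes f :: "'b::real_normed_vector \<Rightarrow> real"
  assumes "continuous_on D f" "x0 \<in> D" "a < f x0"
  obtains r where "0 < r" "\<And>x. x \<in> D \<Longrightarrow> norm (x - x0) \<le> r \<Longrightarrow> a < f x"
proof -
  obtain d where d: "0 < d" "\<And>x. x \<in> D \<Longrightarrow> dist x x0 < d \<Longrightarrow> dist (f x) (f x0) < f x0 - a"
    using assms unfolding continuous_on_iff by (metis diff_gt_0_iff_gt)
  show thesis
  proof (rule that[of "d / 2"])
    show "a < f x" if "x \<in> D" "norm (x - x0) \<le> d / 2" for x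
      using d(2)[OF that(1)] that(2) d(1) by (simp add: dist_norm dist_real_def)
  qed (use d in simp)
qed

lemma continuous_on_abs_near:
  fixes f :: "'b::real_normed_vector \<Rightarrow> real"
  assumes "continuous_on D f" "x0 \<in> D" "f x0 = 0" "0 < a"
  obtains r where "0 < r" "\<And>x. x \<in> D \<Longrightarrow> norm (x - x0) \<le> r \<Longrightarrow> \<bar>f x\<bar> < a"
proof -
  have "continuous_on D (\<lambda>x. - \<bar>f x\<bar>)" by (intro continuous_intros assms(1))
  then obtain r where "0 < r" "\<And>x. x \<in> D \<Longrightarrow> norm (x - x0) \<le> r \<Longrightarrow> - a < - \<bar>f x\<bar>"
    by (rule continuous_on_pos_near[OF _ assms(2), of _ "- a"]) (use assms(3,4) in simp, rule that)
  then show thesis using that by fastforce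
qed

text \<open>Completing the square. The factor \<open>3 / 2\<close> is the upper bound of
  \<open>1 + 2 * C * E\<close> near the starting point.\<close>

lemma quadratic_lower_bound:
  fixes C L y :: real
  assumes "0 < C" shows "- (9 / 16 * L^2 / C) \<le> C * y^2 - 3 / 2 * L * y"
proof -
  have "0 \<le> (C * y - 3 / 4 * L)^2 / C" using assms by simp
  also have "\<dots> = C * y^2 - 3 / 2 * L * y + 9 / 16 * L^2 / C"
    using assms by (simp add: power2_eq_square field_simps)
  finally show ?thesis by simp
qed

text \<open>Here \<open>h\<close> is the squared distance to the starting point. With
  \<open>d = E - q\<close>, which is at most \<open>- (\<epsilon> * h)\<close>, the term
  \<open>C * E^2\<close> is at most \<open>2 * C * d^2 + 2 * C * q^2\<close>. The first part is
  absorbed by half of \<open>- d\<close> as \<open>d\<close> is small, the second is of order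
  \<open>h^2\<close> and is absorbed by \<open>\<epsilon> * h / 2\<close>.\<close>

lemma barrier_nonpos:
  fixes E q C h :: real
  assumes C: "0 < C" and E: "E \<le> q - \<epsilon> * h" and \<epsilon>: "0 < \<epsilon>" and h: "0 \<le> h" and q: "\<bar>q\<bar> \<le> \<Gamma> * h" and \<Gamma>: "0 \<le> \<Gamma>"
    and small: "\<bar>E - q\<bar> \<le> 1 / (4 * C)" and hs: "4 * C * \<Gamma>^2 * h \<le> \<epsilon>"
  shows "E + C * E^2 - q \<le> 0"
proof -
  define d where "d = E - q"
  have d: "d \<le> - (\<epsilon> * h)" unfolding d_def using E by simp
  have "0 \<le> \<epsilon> * h" using \<epsilon> h by simp
  then have d0: "d \<le> 0" using d by linarith
  have "E^2 \<le> 2 * d^2 + 2 * q^2"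
    using norm_add_squared_le[of d q] unfolding d_def by simp
  then have "C * E^2 \<le> C * (2 * d^2 + 2 * q^2)" using C by (intro mult_left_mono) auto
  moreover have "2 * C * d^2 \<le> - d / 2"
  proof -
    have "- d \<le> 1 / (4 * C)" using small d0 unfolding d_def by simp
    then have "(- d) * (- d) \<le> (- d) * (1 / (4 * C))" using d0 by (intro mult_left_mono) auto
    then have "2 * C * ((- d) * (- d)) \<le> 2 * C * ((- d) * (1 / (4 * C)))" by (rule mult_left_mono) (use C in simp)
    also have "\<dots> = - d / 2" using C by simp
    finally show ?thesis by (simp add: power2_eq_square)
  qed
  moreover have "2 * C * q^2 \<le> \<epsilon> * h / 2"
  proof -
    have "q^2 \<le> (\<Gamma> * h)^2" using power_mono[OF q, of 2] by simp
    then have "2 * C * q^2 \<le> 2 * C * (\<Gamma> * h)^2" using C by (intro mult_left_mono) auto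
    also have "\<dots> = (4 * C * \<Gamma>^2 * h) * h / 2" by (simp add: power2_eq_square)
    also have "\<dots> \<le> \<epsilon> * h / 2" using hs h by (intro divide_right_mono mult_right_mono) auto
    finally show ?thesis .
  qed
  ultimately have "d + C * E^2 \<le> d - d / 2 + \<epsilon> * h / 2" by (simp add: algebra_simps)
  also have "\<dots> \<le> 0" using d by simp
  finally show ?thesis unfolding d_def by simp
qed

context reflected_bsde
begin

text \<open>Adding \<open>C E\<^sup>2\<close> with \<open>C\<close> large to the linear expression \<open>E\<close> makes the compensator dominate the
  term of order \<open>|Z - p \<sigma>|\<close> coming from the generator \<open>\<psi>\<close>.\<close>

lemma superjet:
  fixes A :: "'k set" and cc :: "'k \<Rightarrow> real" and u :: "'k \<Rightarrow> real^'d" and p :: "real^'d"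
  assumes fin: "finite A" and \<epsilon>: "0 < \<epsilon>" and \<rho>: "0 < \<rho>"
    and touch: "\<And>x. x \<in> D \<Longrightarrow> norm (x - x0) \<le> \<rho> \<Longrightarrow>
      v x - v x0 \<le> p \<bullet> (x - x0) + (\<Sum>k\<in>A. cc k * (u k \<bullet> (x - x0))^2) - \<epsilon> * (norm (x - x0))^2"
    and int: "0 < lam - \<psi> x0 (p v* \<sigma> x0) - b x0 \<bullet> p - (\<Sum>k\<in>A. cc k * (norm (u k v* \<sigma> x0))^2)"
    and bdr: "x0 \<in> bd \<Longrightarrow> 0 < \<mu> - g x0 - nrm x0 \<bullet> p"
  shows False
proof -
  define F0 where "F0 = lam - \<psi> x0 (p v* \<sigma> x0) - b x0 \<bullet> p - (\<Sum>k\<in>A. cc k * (norm (u k v* \<sigma> x0))^2)"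
  have F0: "0 < F0" using int unfolding F0_def .
  \<comment> \<open>Large enough that the loss \<open>9 / 16 * L^2 / C\<close> from completing the
    square is at most \<open>F0 / 4\<close>; the added 1 keeps it positive when \<open>L\<close> is
    zero.\<close>
  define C where "C = 1 + 9 * L^2 / (4 * F0)"
  have C: "0 < C" "9 / 16 * L^2 / C \<le> F0 / 4"
  proof -
    show "0 < C" unfolding C_def using F0 by (simp add: add_pos_nonneg)
    have "9 / 16 * L^2 = (9 * L^2 / (4 * F0)) * (F0 / 4)" using F0 by simp
    also have "\<dots> \<le> C * (F0 / 4)" unfolding C_def using F0 by (intro mult_right_mono) auto
    finally show "9 / 16 * L^2 / C \<le> F0 / 4" using \<open>0 < C\<close> by (simp add: divide_le_eq mult_ac)
  qed
  define E where "E = Sf 1 (- p)"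
  define q where "q x = (\<Sum>k\<in>A. cc k * (u k \<bullet> (x - x0))^2)" for x
  have E_eq: "E x = v x - v x0 - p \<bullet> (x - x0)" for x unfolding E_def Sf_def by simp
  have E0: "E x0 = 0" and q0: "q x0 = 0" unfolding E_eq q_def by simp_all
  have Ec: "continuous_on D E" unfolding E_def by (rule Sf_cont)
  have qc: "continuous_on D q" unfolding q_def[abs_def] by (intro continuous_intros)
  define \<Gamma> where "\<Gamma> = (\<Sum>k\<in>A. \<bar>cc k\<bar> * (norm (u k))^2)"
  have \<Gamma>: "0 \<le> \<Gamma>" unfolding \<Gamma>_def by (intro sum_nonneg) auto
  have qb: "\<bar>q x\<bar> \<le> \<Gamma> * (norm (x - x0))^2" for x
  proof -
    have "\<bar>q x\<bar> \<le> (\<Sum>k\<in>A. \<bar>cc k * (u k \<bullet> (x - x0))^2\<bar>)" unfolding q_def by (rule sum_abs)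
    also have "\<dots> \<le> (\<Sum>k\<in>A. (\<bar>cc k\<bar> * (norm (u k))^2) * (norm (x - x0))^2)"
    proof (rule sum_mono)
      fix k
      have "(u k \<bullet> (x - x0))^2 \<le> (norm (u k) * norm (x - x0))^2"
        using power_mono[OF Cauchy_Schwarz_ineq2[of "u k" "x - x0"], of 2] by simp
      then have "\<bar>cc k\<bar> * (u k \<bullet> (x - x0))^2 \<le> \<bar>cc k\<bar> * (norm (u k) * norm (x - x0))^2" by (rule mult_left_mono) simp
      then show "\<bar>cc k * (u k \<bullet> (x - x0))^2\<bar> \<le> (\<bar>cc k\<bar> * (norm (u k))^2) * (norm (x - x0))^2"
        by (simp add: abs_mult power_mult_distrib mult.assoc)
    qed
    finally show ?thesis unfolding \<Gamma>_def sum_distrib_right .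
  qed
  have Eqc: "continuous_on D (\<lambda>x. E x - q x)" by (intro continuous_intros Ec qc)
  have C4: "0 < 1 / (4 * C)" using C by simp
  obtain r1 where r1: "0 < r1" "\<And>x. x \<in> D \<Longrightarrow> norm (x - x0) \<le> r1 \<Longrightarrow> \<bar>E x - q x\<bar> < 1 / (4 * C)"
    by (rule continuous_on_abs_near[OF Eqc D(2) _ C4]) (use E0 q0 in simp, rule that)
  have C5: "0 < 1 / (4 * C)" using C by simp
  obtain r2 where r2: "0 < r2" "\<And>x. x \<in> D \<Longrightarrow> norm (x - x0) \<le> r2 \<Longrightarrow> \<bar>E x\<bar> < 1 / (4 * C)"
    by (rule continuous_on_abs_near[OF Ec D(2) E0 C5]) (rule that)
  have \<sigma>c: "continuous_on D (\<lambda>x. w v* \<sigma> x)" for w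
    unfolding vector_matrix_mult_def by (intro continuous_intros cont(3))
  have \<psi>c: "continuous_on D (\<lambda>x. \<psi> x (p v* \<sigma> x))"
  proof -
    have "continuous_on D (\<lambda>x. (\<lambda>(x, z). \<psi> x z) (x, p v* \<sigma> x))"
      by (rule continuous_on_compose2[OF \<psi>_cont]) (auto intro!: continuous_intros \<sigma>c)
    then show ?thesis by simp
  qed
  \<comment> \<open>The drift of the barrier at \<open>z = p v* \<sigma> x\<close>, where the
    bracket of \<open>E\<close> vanishes. It equals \<open>F0\<close> at the starting point and
    stays above \<open>F0 / 2\<close> nearby.\<close>
  define f0 where "f0 x = (1 + 2 * C * E x) * (lam - \<psi> x (p v* \<sigma> x) - p \<bullet> b x)
     - (\<Sum>k\<in>A. cc k * ((norm (u k v* \<sigma> x))^2 + 2 * (u k \<bullet> (x - x0)) * (u k \<bullet> b x)))" for x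
  have f0c: "continuous_on D f0" unfolding f0_def[abs_def] by (intro continuous_intros Ec \<psi>c \<sigma>c cont)
  have f00: "f0 x0 = F0" unfolding f0_def F0_def E0 by (simp add: inner_commute)
  obtain r3 where r3: "0 < r3" "\<And>x. x \<in> D \<Longrightarrow> norm (x - x0) \<le> r3 \<Longrightarrow> F0 / 2 < f0 x"
    by (rule continuous_on_pos_near[OF f0c D(2), of "F0 / 2"]) (use f00 F0 in simp, rule that)
  \<comment> \<open>The coefficient of \<open>dK\<close> in the barrier; at the starting point it is
    the boundary expression assumed positive there.\<close>
  define f1 where "f1 x = (1 + 2 * C * E x) * (\<mu> - g x - p \<bullet> nrm x)
     - (\<Sum>k\<in>A. cc k * (2 * (u k \<bullet> (x - x0)) * (u k \<bullet> nrm x)))" for x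
  have f1c: "continuous_on D f1" unfolding f1_def[abs_def] by (intro continuous_intros Ec cont)
  have f10: "f1 x0 = \<mu> - g x0 - nrm x0 \<bullet> p" unfolding f1_def E0 by (simp add: inner_commute)
  \<comment> \<open>Away from the boundary a ball that avoids the closed set \<open>bd\<close>
    satisfies the claim vacuously.\<close>
  obtain r4 where r4: "0 < r4" "\<And>x. x \<in> D \<Longrightarrow> x \<in> bd \<Longrightarrow> norm (x - x0) \<le> r4 \<Longrightarrow> 0 \<le> f1 x"
  proof (cases "x0 \<in> bd")
    case True
    obtain r where "0 < r" "\<And>x. x \<in> D \<Longrightarrow> norm (x - x0) \<le> r \<Longrightarrow> 0 < f1 x"
      by (rule continuous_on_pos_near[OF f1c D(2), of 0]) (use bdr[OF True] f10 in simp, rule that)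
    then show thesis using that[of r] less_imp_le by blast
  next
    case False
    have "open (- bd)" using bd by (simp add: open_Compl)
    then obtain r where "0 < r" "ball x0 r \<subseteq> - bd" using False open_contains_ball by blast
    then show thesis by (intro that[of "r / 2"]) (auto simp: subset_iff dist_norm norm_minus_commute)
  qed
  \<comment> \<open>The radius within which
    \<open>4 * C * \<Gamma>^2 * h^2 \<le> \<epsilon>\<close>, the smallness demanded by
    \<open>barrier_nonpos\<close>; the added 1 covers \<open>\<Gamma> = 0\<close>.\<close>
  define r5 where "r5 = sqrt (\<epsilon> / (4 * C * \<Gamma>^2 + 1))"
  have pos5: "0 < 4 * C * \<Gamma>^2 + 1" using C(1) by (simp add: add_nonneg_pos)
  have r5: "0 < r5" unfolding r5_def using \<epsilon> pos5 by simp
  have r5': "4 * C * \<Gamma>^2 * h^2 \<le> \<epsilon>" if "0 \<le> h" "h \<le> r5" for h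
  proof -
    have "h^2 \<le> r5^2" using that by (intro power_mono)
    also have "r5^2 = \<epsilon> / (4 * C * \<Gamma>^2 + 1)" unfolding r5_def using \<epsilon> pos5 by simp
    finally have "(4 * C * \<Gamma>^2 + 1) * h^2 \<le> \<epsilon>" using pos5 by (simp add: le_divide_eq mult.commute)
    then have "4 * C * \<Gamma>^2 * h^2 + h^2 \<le> \<epsilon>" by (simp only: distrib_right mult_1_left)
    then show ?thesis using zero_le_power2[of h] by linarith
  qed
  define r where "r = min \<rho> (min r1 (min r2 (min r3 (min r4 r5))))"
  have r: "0 < r" "r \<le> \<rho>" "r \<le> r1" "r \<le> r2" "r \<le> r3" "r \<le> r4" "r \<le> r5"
    unfolding r_def using \<rho> r1(1) r2(1) r3(1) r4(1) r5 by simp_all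
  \<comment> \<open>\<open>None\<close> stands for \<open>E + C * E^2\<close>, and
    \<open>Some k\<close> for the square of a linear form with coefficient \<open>- cc k\<close> and
    no linear part; together they form \<open>E + C * E^2 - q\<close>.\<close>
  define Ix where "Ix = insert None (Some ` A)"
  define l where "l = case_option 1 (\<lambda>_::'k. 0::real)"
  define c where "c = case_option C (\<lambda>k. - cc k)"
  define \<alpha> where "\<alpha> = case_option 1 (\<lambda>_::'k. 0::real)"
  define w where "w = case_option (- p) u"
  have Isum: "(\<Sum>k\<in>Ix. f k) = f None + (\<Sum>k\<in>A. f (Some k))" for f :: "'k option \<Rightarrow> real"
    unfolding Ix_def using fin by (simp add: sum.reindex)
  show False
  proof (rule no_strict_barrier[of Ix r "F0 / 4" l \<alpha> w c])
    show "finite Ix" unfolding Ix_def using fin by simp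
    show "0 < r" by (rule r)
    show "0 < F0 / 4" using F0 by simp
    fix x assume x: "x \<in> D" "norm (x - x0) \<le> r"
    have "E x + C * (E x)^2 - q x \<le> 0"
    proof (rule barrier_nonpos[OF C(1) _ \<epsilon> _ qb \<Gamma>])
      show "E x \<le> q x - \<epsilon> * (norm (x - x0))^2"
        using touch[OF x(1)] x(2) r(2) unfolding E_eq q_def by simp
      show "\<bar>E x - q x\<bar> \<le> 1 / (4 * C)" using r1(2)[OF x(1)] x(2) r(3) by simp
      show "4 * C * \<Gamma>^2 * (norm (x - x0))^2 \<le> \<epsilon>" by (rule r5') (use x(2) r(7) in auto)
    qed simp
    then show "(\<Sum>k\<in>Ix. l k * Sf (\<alpha> k) (w k) x + c k * (Sf (\<alpha> k) (w k) x)^2) \<le> 0"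
      unfolding Isum l_def c_def \<alpha>_def w_def q_def E_def by (simp add: Sf_def sum_negf)
  next
    fix x z assume x: "x \<in> D" "norm (x - x0) \<le> r"
    let ?y = "norm (z - p v* \<sigma> x)"
    \<comment> \<open>So \<open>1 + 2 * C * E x\<close> lies between \<open>1 / 2\<close> and
      \<open>3 / 2\<close>: it preserves the direction of the Lipschitz estimate and enlarges it by
      at most \<open>3 / 2\<close>.\<close>
    have CE: "\<bar>2 * C * E x\<bar> \<le> 1 / 2"
    proof -
      have "\<bar>E x\<bar> \<le> 1 / (4 * C)" using r2(2)[OF x(1)] x(2) r(4) by simp
      then have "(2 * C) * \<bar>E x\<bar> \<le> (2 * C) * (1 / (4 * C))" using C by (intro mult_left_mono) auto
      then show ?thesis using C by (simp add: abs_mult)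
    qed
    have "\<psi> x z - \<psi> x (p v* \<sigma> x) \<le> L * ?y" using \<psi>_lip[OF x(1), of z "p v* \<sigma> x"] by simp
    then have "(1 + 2 * C * E x) * (\<psi> x z - \<psi> x (p v* \<sigma> x)) \<le> (1 + 2 * C * E x) * (L * ?y)"
      using CE by (intro mult_left_mono) auto
    also have "\<dots> \<le> (3 / 2) * (L * ?y)" using CE L_nonneg by (intro mult_right_mono) auto
    finally have psi: "(1 + 2 * C * E x) * (\<psi> x z - \<psi> x (p v* \<sigma> x)) \<le> 3 / 2 * L * ?y" by simp
    have m: "(- p) v* \<sigma> x = - (p v* \<sigma> x)"
      by (simp add: vec_eq_iff vector_matrix_mult_def sum_negf)
    have dN: "drift 1 C 1 (- p) x z = (1 + 2 * C * E x) * (lam - \<psi> x z - p \<bullet> b x) + C * ?y^2"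
      unfolding drift_def E_def[symmetric] by (simp add: af_def Hf_def m algebra_simps)
    have dS: "drift 0 (- cc k) 0 (u k) x z = - (cc k * ((norm (u k v* \<sigma> x))^2 + 2 * (u k \<bullet> (x - x0)) * (u k \<bullet> b x)))" for k
      unfolding drift_def by (simp add: af_def Hf_def Sf_def)
    have "(\<Sum>k\<in>Ix. drift (l k) (c k) (\<alpha> k) (w k) x z)
      = (1 + 2 * C * E x) * (lam - \<psi> x z - p \<bullet> b x) + C * ?y^2
        - (\<Sum>k\<in>A. cc k * ((norm (u k v* \<sigma> x))^2 + 2 * (u k \<bullet> (x - x0)) * (u k \<bullet> b x)))"
      unfolding Isum l_def c_def \<alpha>_def w_def by (simp add: dN dS sum_negf)
    also have "\<dots> = f0 x - (1 + 2 * C * E x) * (\<psi> x z - \<psi> x (p v* \<sigma> x)) + C * ?y^2"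
      unfolding f0_def by (simp add: algebra_simps)
    finally have "f0 x - 3 / 2 * L * ?y + C * ?y^2 \<le> (\<Sum>k\<in>Ix. drift (l k) (c k) (\<alpha> k) (w k) x z)"
      using psi by linarith
    moreover have "F0 / 2 < f0 x" using r3(2)[OF x(1)] x(2) r(5) by simp
    ultimately show "F0 / 4 \<le> (\<Sum>k\<in>Ix. drift (l k) (c k) (\<alpha> k) (w k) x z)"
      using quadratic_lower_bound[OF C(1), of L ?y] C(2) by linarith
  next
    fix x assume x: "x \<in> D" "x \<in> bd" "norm (x - x0) \<le> r"
    have bN: "bdrift 1 C 1 (- p) x = (1 + 2 * C * E x) * (\<mu> - g x - p \<bullet> nrm x)"
      unfolding bdrift_def E_def[symmetric] by (simp add: bf_def algebra_simps)
    have bS: "bdrift 0 (- cc k) 0 (u k) x = - (cc k * (2 * (u k \<bullet> (x - x0)) * (u k \<bullet> nrm x)))" for k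
      unfolding bdrift_def by (simp add: bf_def Sf_def)
    have "(\<Sum>k\<in>Ix. bdrift (l k) (c k) (\<alpha> k) (w k) x) = f1 x"
      unfolding Isum l_def c_def \<alpha>_def w_def f1_def by (simp add: bN bS sum_negf)
    then show "0 \<le> (\<Sum>k\<in>Ix. bdrift (l k) (c k) (\<alpha> k) (w k) x)" using r4(2)[OF x(1,2)] x(3) r(6) by simp
  qed
qed

end

section \<open>Test functions\<close>

lemma has_derivative_grad:
  fixes f :: "real^'d::finite \<Rightarrow> real"
  assumes "f differentiable (at x)"
  shows "(f has_derivative (\<lambda>h. grad f x \<bullet> h)) (at x)"
proof -
  have der: "(f has_derivative frechet_derivative f (at x)) (at x)"
    using assms frechet_derivative_works by blast
  interpret linear "frechet_derivative f (at x)" by (rule has_derivative_linear[OF der])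
  have "frechet_derivative f (at x) h = grad f x \<bullet> h" for h
  proof -
    have "h = (\<Sum>i\<in>UNIV. h $ i *\<^sub>R axis i 1)" by (rule basis_expansion[of h, symmetric, unfolded scalar_mult_eq_scaleR])
    then have "frechet_derivative f (at x) h = frechet_derivative f (at x) (\<Sum>i\<in>UNIV. h $ i *\<^sub>R axis i 1)"
      by (rule arg_cong)
    then show ?thesis unfolding grad_def partial_def inner_vec_def by (simp add: sum scale mult.commute)
  qed
  then show ?thesis using der by (metis (no_types, lifting) ext)
qed

lemma C_k_2_D:
  fixes f :: "real^'d::finite \<Rightarrow> real"
  assumes "C_k 2 UNIV f"
  shows "f differentiable (at x)" "partial j f differentiable (at x)" "continuous_on UNIV (partial i (partial j f))"
proof -
  have d: "length is < 2 \<Longrightarrow> partials is f differentiable_on UNIV" for "is"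
    using assms unfolding C_k_def by simp
  show "f differentiable (at x)" using d[of "[]"] by (simp add: differentiable_on_def)
  show "partial j f differentiable (at x)" using d[of "[j]"] by (simp add: differentiable_on_def)
  have c: "length is \<le> 2 \<Longrightarrow> \<exists>h. continuous_on UNIV h \<and> (\<forall>x. h x = partials is f x)" for "is"
    using assms unfolding C_k_def by simp
  obtain h where "continuous_on UNIV h" "\<forall>x. h x = partials [i, j] f x" using c[of "[i, j]"] by auto
  moreover then have "h = partial i (partial j f)" by auto
  ultimately show "continuous_on UNIV (partial i (partial j f))" by simp
qed

text \<open>\<open>frechet_derivative\<close> carries no information where there is no derivative,
  so the sign passes through a partial derivative only at points of differentiability. The class
  provides these for the two orders that occur.\<close>

lemma C_k_2_uminus:
  fixes f :: "real^'d::finite \<Rightarrow> real"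
  assumes f: "C_k 2 UNIV f"
  shows "C_k 2 UNIV (\<lambda>x. - f x)" "grad (\<lambda>x. - f x) x = - grad f x" "hessian (\<lambda>x. - f x) x = - hessian f x"
proof -
  have neg: "partial i (\<lambda>x. - h x) x = - partial i h x" if "h differentiable (at x)" for h :: "real^'d \<Rightarrow> real" and i x
  proof -
    have "((\<lambda>x. - h x) has_derivative (\<lambda>y. - frechet_derivative h (at x) y)) (at x)"
      using that unfolding frechet_derivative_works by (rule has_derivative_minus)
    then show ?thesis unfolding partial_def by (metis frechet_derivative_at)
  qed
  have p1: "partial i (\<lambda>x. - f x) = (\<lambda>x. - partial i f x)" for i
    by (rule ext) (rule neg[OF C_k_2_D(1)[OF f]])
  have p2: "partial i (\<lambda>x. - partial j f x) = (\<lambda>x. - partial i (partial j f) x)" for i j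
    by (rule ext) (rule neg[OF C_k_2_D(2)[OF f]])
  have ps: "partials is (\<lambda>x. - f x) = (\<lambda>x. - partials is f x)" if l: "length is \<le> 2" for "is"
  proof -
    consider "is = []" | i where "is = [i]" | i j where "is = [i, j]"
      using l by (auto simp: numeral_2_eq_2 le_Suc_eq length_Suc_conv)
    then show ?thesis by cases (auto simp: p1 p2)
  qed
  show "C_k 2 UNIV (\<lambda>x. - f x)"
    unfolding C_k_def interior_UNIV
  proof (intro conjI allI impI)
    show "continuous_on UNIV (\<lambda>x. - f x)" using f unfolding C_k_def by (intro continuous_on_minus) blast
    show "partials is (\<lambda>x. - f x) differentiable_on UNIV" if "length is < 2" for "is"
      using f that unfolding C_k_def ps[OF less_imp_le[OF that]] by (simp add: differentiable_on_def)
    show "\<exists>h. continuous_on UNIV h \<and> (\<forall>x\<in>UNIV. h x = partials is (\<lambda>x. - f x) x)" if l: "length is \<le> 2" for "is"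
    proof -
      obtain h where "continuous_on UNIV h" "\<forall>x\<in>UNIV. h x = partials is f x"
        using f l unfolding C_k_def interior_UNIV by (elim conjE allE[of _ "is"]) auto
      then show ?thesis unfolding ps[OF l] by (intro exI[of _ "\<lambda>x. - h x"]) (auto intro: continuous_on_minus)
    qed
  qed
  show "grad (\<lambda>x. - f x) x = - grad f x" by (simp add: grad_def p1 vec_eq_iff)
  have "partials [i, j] (\<lambda>x. - f x) x = - partials [i, j] f x" for i j by (subst ps) simp_all
  then show "hessian (\<lambda>x. - f x) x = - hessian f x" unfolding hessian_def vec_eq_iff by simp
qed

text \<open>Along the segment from \<open>x0\<close> to \<open>x\<close> the remainder in Lagrange
  form involves the Hessian at an intermediate point, and continuity of the second derivatives
  replaces it by the Hessian at \<open>x0\<close>.\<close>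

lemma taylor_second_order:
  fixes f :: "real^'d::finite \<Rightarrow> real"
  assumes f: "C_k 2 UNIV f" and \<epsilon>: "0 < \<epsilon>"
  obtains \<rho> where "0 < \<rho>" "\<And>x. norm (x - x0) \<le> \<rho> \<Longrightarrow>
    \<bar>f x - f x0 - grad f x0 \<bullet> (x - x0)
      - (\<Sum>i\<in>UNIV. \<Sum>j\<in>UNIV. hessian f x0 $ i $ j * (x - x0) $ i * (x - x0) $ j) / 2\<bar> \<le> \<epsilon> * (norm (x - x0))^2"
proof -
  define N where "N = real CARD('d) * real CARD('d)"
  have N: "0 < N" unfolding N_def by simp
  \<comment> \<open>The error is distributed evenly over the \<open>N\<close> entries of the
    Hessian.\<close>
  define \<eta> where "\<eta> = \<epsilon> / N"
  have \<eta>: "0 < \<eta>" unfolding \<eta>_def using \<epsilon> N by simp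
  let ?H = "\<lambda>i j. partial i (partial j f)"
  have "\<exists>d. \<forall>i j. 0 < d i j \<and> (\<forall>x. dist x x0 < d i j \<longrightarrow> dist (?H i j x) (?H i j x0) < \<eta>)"
  proof -
    have "\<exists>d>0. \<forall>x. dist x x0 < d \<longrightarrow> dist (?H i j x) (?H i j x0) < \<eta>" for i j
      using C_k_2_D(3)[OF f, of i j] \<eta> unfolding continuous_on_iff by simp
    then show ?thesis by metis
  qed
  then obtain d where d: "\<And>i j. 0 < d i j" "\<And>i j x. dist x x0 < d i j \<Longrightarrow> dist (?H i j x) (?H i j x0) < \<eta>" by blast
  define d0 where "d0 = Min (range (\<lambda>(i, j). d i j))"
  have d0: "0 < d0" unfolding d0_def using d(1) by (subst Min_gr_iff) auto
  have d0_le: "d0 \<le> d i j" for i j unfolding d0_def by (rule Min_le) (auto intro: rev_image_eqI[of "(i, j)"])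
  show thesis
  proof (rule that[of "d0 / 2"])
    show "0 < d0 / 2" using d0 by simp
    fix x assume x: "norm (x - x0) \<le> d0 / 2"
    define h where "h = x - x0"
    let ?p = "\<lambda>t::real. x0 + t *\<^sub>R h"
    \<comment> \<open>The function along the segment and its first two derivatives, in the indexed
      form that \<open>Maclaurin\<close> expects.\<close>
    define D where "D m = (if m = 0 then (\<lambda>t. f (?p t)) else if m = 1 then (\<lambda>t. grad f (?p t) \<bullet> h)
        else (\<lambda>t. \<Sum>i\<in>UNIV. \<Sum>j\<in>UNIV. ?H i j (?p t) * h $ i * h $ j))" for m :: nat
    have pd: "(?p has_derivative (\<lambda>s. s *\<^sub>R h)) (at t)" for t
      by (auto intro!: derivative_eq_intros)
    have chain: "DERIV (\<lambda>t. g (?p t)) t :> grad g (?p t) \<bullet> h" if "\<And>y. g differentiable (at y)" for g :: "real^'d \<Rightarrow> real" and t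
    proof -
      have "((\<lambda>t. g (?p t)) has_derivative (\<lambda>s. grad g (?p t) \<bullet> (s *\<^sub>R h))) (at t)"
        by (rule has_derivative_compose[OF pd has_derivative_grad[OF that]])
      moreover have "(\<lambda>s. grad g (?p t) \<bullet> (s *\<^sub>R h)) = (*) (grad g (?p t) \<bullet> h)" by (auto simp: mult.commute)
      ultimately show ?thesis by (simp add: has_field_derivative_def)
    qed
    have D0: "DERIV (D 0) t :> D 1 t" for t
      unfolding D_def using chain[of f t] C_k_2_D(1)[OF f] by simp
    have D1: "DERIV (D 1) t :> D 2 t" for t
    proof -
      have "((\<lambda>t. \<Sum>j\<in>UNIV. partial j f (?p t) * h $ j) has_real_derivative
          (\<Sum>j\<in>UNIV. (grad (partial j f) (?p t) \<bullet> h) * h $ j)) (at t)"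
        by (intro DERIV_sum DERIV_cmult_right chain C_k_2_D(2)[OF f])
      moreover have "(\<Sum>j\<in>UNIV. (grad (partial j f) (?p t) \<bullet> h) * h $ j) = D 2 t"
        unfolding D_def grad_def inner_vec_def
        by (subst sum.swap) (simp add: sum_distrib_right)
      moreover have "(\<lambda>t. \<Sum>j\<in>UNIV. partial j f (?p t) * h $ j) = D 1"
        unfolding D_def grad_def inner_vec_def by simp
      ultimately show ?thesis by simp
    qed
    have "\<exists>t>0. t < 1 \<and> D 0 1 = (\<Sum>m<2. D m 0 / fact m * 1 ^ m) + D 2 t / fact 2 * 1 ^ 2"
    proof (rule Maclaurin)
      show "\<forall>m t. m < 2 \<and> 0 \<le> t \<and> t \<le> 1 \<longrightarrow> DERIV (D m) t :> D (Suc m) t"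
      proof (intro allI impI)
        fix m :: nat and t :: real assume "m < 2 \<and> 0 \<le> t \<and> t \<le> 1"
        then consider "m = 0" | "m = 1" by linarith
        then show "DERIV (D m) t :> D (Suc m) t"
        proof cases
          case 1 then show ?thesis using D0[of t] by simp
        next
          case 2 then show ?thesis using D1[of t] by (simp add: numeral_2_eq_2)
        qed
      qed
    qed auto
    then obtain t where t: "0 < t" "t < 1" "D 0 1 = D 0 0 + D 1 0 + D 2 t / 2"
      by (auto simp: numeral_2_eq_2)
    have hH: "hessian f x0 $ i $ j = ?H i j x0" for i j by (simp add: hessian_def)
    have eq: "f x - f x0 - grad f x0 \<bullet> h - (\<Sum>i\<in>UNIV. \<Sum>j\<in>UNIV. hessian f x0 $ i $ j * h $ i * h $ j) / 2
        = (\<Sum>i\<in>UNIV. \<Sum>j\<in>UNIV. (?H i j (?p t) - ?H i j x0) * h $ i * h $ j) / 2"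
    proof -
      have "f x = D 0 1" unfolding D_def h_def by simp
      then have "f x = f x0 + grad f x0 \<bullet> h + (\<Sum>i\<in>UNIV. \<Sum>j\<in>UNIV. ?H i j (?p t) * h $ i * h $ j) / 2"
        using t(3) unfolding D_def by simp
      then show ?thesis unfolding hH by (simp add: left_diff_distrib sum_subtractf diff_divide_distrib)
    qed
    have near: "dist (?p t) x0 < d i j" for i j
    proof -
      have "dist (?p t) x0 = t * norm h" using t by (simp add: dist_norm)
      also have "\<dots> \<le> 1 * norm h" using t by (intro mult_right_mono) auto
      also have "\<dots> < d0" using x d0 unfolding h_def by simp
      finally show ?thesis using d0_le[of i j] by linarith
    qed
    have "\<bar>\<Sum>i\<in>UNIV. \<Sum>j\<in>UNIV. (?H i j (?p t) - ?H i j x0) * h $ i * h $ j\<bar> \<le> (\<Sum>i\<in>(UNIV::'d set). \<Sum>j\<in>(UNIV::'d set). \<eta> * (norm h)^2)"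
    proof (rule order_trans[OF sum_abs], rule sum_mono, rule order_trans[OF sum_abs], rule sum_mono)
      fix i j :: 'd
      have "\<bar>?H i j (?p t) - ?H i j x0\<bar> \<le> \<eta>" using d(2)[OF near, of i j] by (simp add: dist_real_def)
      then have "\<bar>?H i j (?p t) - ?H i j x0\<bar> * \<bar>h $ i\<bar> * \<bar>h $ j\<bar> \<le> \<eta> * norm h * norm h"
        by (intro mult_mono component_le_norm_cart mult_nonneg_nonneg) (use \<eta> in auto)
      then show "\<bar>(?H i j (?p t) - ?H i j x0) * h $ i * h $ j\<bar> \<le> \<eta> * (norm h)^2"
        by (simp add: abs_mult power2_eq_square)
    qed
    also have "\<dots> = \<epsilon> * (norm h)^2" unfolding \<eta>_def using N by (simp add: N_def)
    finally have "\<bar>(\<Sum>i\<in>UNIV. \<Sum>j\<in>UNIV. (?H i j (?p t) - ?H i j x0) * h $ i * h $ j) / 2\<bar> \<le> \<epsilon> * (norm h)^2 / 2"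
      by simp
    also have "\<dots> \<le> \<epsilon> * (norm h)^2" using \<epsilon> by simp
    finally show "\<bar>f x - f x0 - grad f x0 \<bullet> (x - x0)
      - (\<Sum>i\<in>UNIV. \<Sum>j\<in>UNIV. hessian f x0 $ i $ j * (x - x0) $ i * (x - x0) $ j) / 2\<bar> \<le> \<epsilon> * (norm (x - x0))^2"
      unfolding h_def[symmetric] eq .
  qed
qed

text \<open>By polarization a quadratic form is a linear combination of squares of linear forms.\<close>

lemma polarization:
  fixes Q :: "'d::finite \<Rightarrow> 'd \<Rightarrow> real" and B :: "real^'d \<Rightarrow> real^'d \<Rightarrow> real"
  assumes B: "\<And>x y. B (x + y) (x + y) = B x x + 2 * B x y + B y y" "\<And>x y. B (x - y) (x - y) = B x x - 2 * B x y + B y y"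
  shows "(\<Sum>(i, j, s)\<in>UNIV. (if s then Q i j / 8 else - (Q i j / 8)) *
      B (if s then axis i 1 + axis j 1 else axis i 1 - axis j 1) (if s then axis i 1 + axis j 1 else axis i 1 - axis j 1))
    = (\<Sum>i\<in>UNIV. \<Sum>j\<in>UNIV. Q i j * B (axis i 1) (axis j 1)) / 2"
proof -
  have "(\<Sum>(i, j, s)\<in>UNIV. (if s then Q i j / 8 else - (Q i j / 8)) *
      B (if s then axis i 1 + axis j 1 else axis i 1 - axis j 1) (if s then axis i 1 + axis j 1 else axis i 1 - axis j 1))
    = (\<Sum>i\<in>UNIV. \<Sum>j\<in>UNIV. \<Sum>s\<in>UNIV. (if s then Q i j / 8 else - (Q i j / 8)) *
      B (if s then axis i 1 + axis j 1 else axis i 1 - axis j 1) (if s then axis i 1 + axis j 1 else axis i 1 - axis j 1))"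
    by (simp only: UNIV_Times_UNIV[symmetric] sum.cartesian_product split_beta fst_conv snd_conv)
  \<comment> \<open>For \<open>B (a + b) (a + b) - B (a - b) (a - b) = 4 * B a b\<close>, and
    \<open>4 / 8\<close> is the factor one half of the Taylor expansion.\<close>
  also have "\<dots> = (\<Sum>i\<in>UNIV. \<Sum>j\<in>UNIV. Q i j * B (axis i 1) (axis j 1) / 2)"
    by (intro sum.cong refl) (simp add: UNIV_bool B algebra_simps)
  finally show ?thesis by (simp only: sum_divide_distrib)
qed

lemma vector_matrix_axis: "axis i 1 v* (A :: real^'d^'d::finite) = row i A"
  by (simp add: vec_eq_iff vector_matrix_mult_def row_def axis_def if_distrib if_distribR cong: if_cong)

lemma trace_generator:
  fixes A H :: "real^'d^'d::finite"
  shows "trace (A ** transpose A ** H) = (\<Sum>i\<in>UNIV. \<Sum>j\<in>UNIV. H $ i $ j * (row i A \<bullet> row j A))"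
proof -
  have "trace (A ** transpose A ** H) = (\<Sum>i\<in>UNIV. \<Sum>k\<in>UNIV. (row i A \<bullet> row k A) * H $ k $ i)"
    unfolding trace_def matrix_matrix_mult_def transpose_def row_def inner_vec_def by simp
  also have "\<dots> = (\<Sum>k\<in>UNIV. \<Sum>i\<in>UNIV. (row i A \<bullet> row k A) * H $ k $ i)" by (rule sum.swap)
  finally show ?thesis by (simp add: inner_commute mult.commute)
qed

context reflected_bsde
begin

text \<open>A strictly violated inequality leaves room to enlarge the Hessian of \<open>f\<close> a
  little. The enlarged second-order polynomial lies above \<open>v\<close> with a quadratic margin,
  and polarization brings it into the form required by \<open>superjet\<close>.\<close>

lemma test_function:
  assumes f: "C_k 2 UNIV f" and max: "local_max_on D (\<lambda>y. v y - f y) x0"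
    and int: "0 < pde_interior b \<sigma> \<psi> lam f x0"
    and bdr: "x0 \<in> bd \<Longrightarrow> 0 < \<mu> - g x0 - nrm x0 \<bullet> grad f x0"
  shows False
proof -
  define p where "p = grad f x0"
  define R where "R = (\<Sum>i\<in>UNIV. (norm (row i (\<sigma> x0)))^2)"
  have R: "0 \<le> R" unfolding R_def by (intro sum_nonneg) auto
  define F0 where "F0 = pde_interior b \<sigma> \<psi> lam f x0"
  \<comment> \<open>Adding \<open>4 * \<epsilon>\<close> to the diagonal of the Hessian costs
    \<open>2 * \<epsilon> * R\<close> in the interior inequality, with this choice at most half of
    \<open>F0\<close>.\<close>
  define \<epsilon> where "\<epsilon> = F0 / (4 * (R + 1))"
  have \<epsilon>: "0 < \<epsilon>" unfolding \<epsilon>_def F0_def using int R by simp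
  have \<epsilon>R: "2 * \<epsilon> * R < F0"
  proof -
    have "2 * \<epsilon> * R \<le> 2 * \<epsilon> * (R + 1)" using \<epsilon> by simp
    also have "\<dots> = F0 / 2" unfolding \<epsilon>_def using R by (simp add: field_simps)
    finally show ?thesis using int unfolding F0_def by simp
  qed
  \<comment> \<open>Half of the diagonal term yields \<open>2 * \<epsilon>\<close> times the squared
    distance: one \<open>\<epsilon>\<close> covers the Taylor remainder, the other is the margin of
    \<open>superjet\<close>.\<close>
  define Q where "Q i j = hessian f x0 $ i $ j + (if i = j then 4 * \<epsilon> else 0)" for i j
  define cc where "cc = (\<lambda>(i, j, s). if s then Q i j / 8 else - (Q i j / 8))"
  define u where "u = (\<lambda>(i, j, s). if s then axis i 1 + axis j 1 else axis i 1 - axis j 1 :: real^'d)"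
  obtain \<rho>1 where \<rho>1: "0 < \<rho>1" "\<And>x. norm (x - x0) \<le> \<rho>1 \<Longrightarrow>
    \<bar>f x - f x0 - grad f x0 \<bullet> (x - x0)
      - (\<Sum>i\<in>UNIV. \<Sum>j\<in>UNIV. hessian f x0 $ i $ j * (x - x0) $ i * (x - x0) $ j) / 2\<bar> \<le> \<epsilon> * (norm (x - x0))^2"
    by (rule taylor_second_order[OF f \<epsilon>]) (rule that)
  obtain e where e: "0 < e" "\<And>y. y \<in> D \<Longrightarrow> y \<in> ball x0 e \<Longrightarrow> v y - f y \<le> v x0 - f x0"
    using max unfolding local_max_on_def by blast
  have diag: "(\<Sum>i\<in>UNIV. \<Sum>j\<in>UNIV. (if i = j then 4 * \<epsilon> else 0) * m i j) = 4 * \<epsilon> * (\<Sum>i\<in>UNIV. m i i)" for m :: "'d \<Rightarrow> 'd \<Rightarrow> real"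
  proof -
    have "(\<Sum>i\<in>UNIV. \<Sum>j\<in>UNIV. (if i = j then 4 * \<epsilon> else 0) * m i j) = (\<Sum>i\<in>UNIV. 4 * \<epsilon> * m i i)"
    proof (intro sum.cong refl)
      fix i :: 'd
      have "(if i = j then 4 * \<epsilon> else 0) * m i j = (if j = i then 4 * \<epsilon> * m i i else 0)" for j by simp
      then show "(\<Sum>j\<in>UNIV. (if i = j then 4 * \<epsilon> else 0) * m i j) = 4 * \<epsilon> * m i i" by (simp only: sum.delta finite) simp
    qed
    then show ?thesis by (simp only: sum_distrib_left)
  qed
  have q1: "(\<Sum>k\<in>UNIV. cc k * (u k \<bullet> h)^2)
      = (\<Sum>i\<in>UNIV. \<Sum>j\<in>UNIV. hessian f x0 $ i $ j * h $ i * h $ j) / 2 + 2 * \<epsilon> * (norm h)^2" for h :: "real^'d"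
  proof -
    \<comment> \<open>Polarization for the bilinear form
      \<open>(x \<bullet> h) * (y \<bullet> h)\<close>; the trace term below uses the inner product
      of \<open>x v* \<sigma> x0\<close> and \<open>y v* \<sigma> x0\<close> with the same
      coefficients.\<close>
    have "(\<Sum>k\<in>UNIV. cc k * (u k \<bullet> h)^2) = (\<Sum>(i, j, s)\<in>UNIV. (if s then Q i j / 8 else - (Q i j / 8)) *
      (\<lambda>x y. (x \<bullet> h) * (y \<bullet> h)) (if s then axis i 1 + axis j 1 else axis i 1 - axis j 1) (if s then axis i 1 + axis j 1 else axis i 1 - axis j 1))"
      unfolding cc_def u_def by (intro sum.cong refl) (auto simp: power2_eq_square)
    also have "\<dots> = (\<Sum>i\<in>UNIV. \<Sum>j\<in>UNIV. Q i j * (h $ i * h $ j)) / 2"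
      by (subst polarization) (auto simp: inner_axis' inner_add_left inner_diff_left algebra_simps)
    also have "(\<Sum>i\<in>UNIV. \<Sum>j\<in>UNIV. Q i j * (h $ i * h $ j))
        = (\<Sum>i\<in>UNIV. \<Sum>j\<in>UNIV. hessian f x0 $ i $ j * h $ i * h $ j) + 4 * \<epsilon> * (\<Sum>i\<in>UNIV. h $ i * h $ i)"
      unfolding diag[of "\<lambda>i j. h $ i * h $ j", symmetric] sum.distrib[symmetric] Q_def by (intro sum.cong refl) (simp add: distrib_right mult.assoc)
    also have "(\<Sum>i\<in>UNIV. h $ i * h $ i) = (norm h)^2" by (simp add: power2_norm_eq_inner inner_vec_def)
    finally show ?thesis by simp
  qed
  have q2: "(\<Sum>k\<in>UNIV. cc k * (norm (u k v* \<sigma> x0))^2) = trace (\<sigma> x0 ** transpose (\<sigma> x0) ** hessian f x0) / 2 + 2 * \<epsilon> * R"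
  proof -
    have add: "(x + y) v* \<sigma> x0 = x v* \<sigma> x0 + y v* \<sigma> x0" "(x - y) v* \<sigma> x0 = x v* \<sigma> x0 - y v* \<sigma> x0" for x y :: "real^'d"
      by (simp_all add: vec_eq_iff vector_matrix_mult_def distrib_right left_diff_distrib sum.distrib sum_subtractf)
    have "(\<Sum>k\<in>UNIV. cc k * (norm (u k v* \<sigma> x0))^2) = (\<Sum>(i, j, s)\<in>UNIV. (if s then Q i j / 8 else - (Q i j / 8)) *
      (\<lambda>x y. (x v* \<sigma> x0) \<bullet> (y v* \<sigma> x0)) (if s then axis i 1 + axis j 1 else axis i 1 - axis j 1) (if s then axis i 1 + axis j 1 else axis i 1 - axis j 1))"
      unfolding cc_def u_def by (intro sum.cong refl) (auto simp: power2_norm_eq_inner)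
    also have "\<dots> = (\<Sum>i\<in>UNIV. \<Sum>j\<in>UNIV. Q i j * (row i (\<sigma> x0) \<bullet> row j (\<sigma> x0))) / 2"
      by (subst polarization) (auto simp: vector_matrix_axis add inner_add inner_diff inner_commute)
    also have "(\<Sum>i\<in>UNIV. \<Sum>j\<in>UNIV. Q i j * (row i (\<sigma> x0) \<bullet> row j (\<sigma> x0)))
        = (\<Sum>i\<in>UNIV. \<Sum>j\<in>UNIV. hessian f x0 $ i $ j * (row i (\<sigma> x0) \<bullet> row j (\<sigma> x0))) + 4 * \<epsilon> * (\<Sum>i\<in>UNIV. row i (\<sigma> x0) \<bullet> row i (\<sigma> x0))"
      unfolding diag[of "\<lambda>i j. row i (\<sigma> x0) \<bullet> row j (\<sigma> x0)", symmetric] sum.distrib[symmetric] Q_def by (intro sum.cong refl) (simp add: distrib_right)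
    finally show ?thesis unfolding trace_generator R_def by (simp add: power2_norm_eq_inner)
  qed
  show False
  proof (rule superjet[of UNIV \<epsilon> "min \<rho>1 (e / 2)" p cc u])
    show "0 < min \<rho>1 (e / 2)" using \<rho>1(1) e(1) by simp
    show "v x - v x0 \<le> p \<bullet> (x - x0) + (\<Sum>k\<in>UNIV. cc k * (u k \<bullet> (x - x0))^2) - \<epsilon> * (norm (x - x0))^2"
      if x: "x \<in> D" "norm (x - x0) \<le> min \<rho>1 (e / 2)" for x
    proof -
      have "x \<in> ball x0 e" using x(2) e(1) by (simp add: dist_norm norm_minus_commute)
      then have "v x - v x0 \<le> f x - f x0" using e(2)[OF x(1)] by simp
      also have "f x - f x0 \<le> p \<bullet> (x - x0)
          + (\<Sum>i\<in>UNIV. \<Sum>j\<in>UNIV. hessian f x0 $ i $ j * (x - x0) $ i * (x - x0) $ j) / 2 + \<epsilon> * (norm (x - x0))^2"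
        using \<rho>1(2)[of x] x(2) unfolding p_def by linarith
      finally show ?thesis unfolding q1 by simp
    qed
    have "F0 - 2 * \<epsilon> * R = lam - \<psi> x0 (p v* \<sigma> x0) - b x0 \<bullet> p - (\<Sum>k\<in>UNIV. cc k * (norm (u k v* \<sigma> x0))^2)"
      unfolding q2 F0_def pde_interior_def generator_def p_def by simp
    then show "0 < lam - \<psi> x0 (p v* \<sigma> x0) - b x0 \<bullet> p - (\<Sum>k\<in>UNIV. cc k * (norm (u k v* \<sigma> x0))^2)"
      using \<epsilon>R by simp
    show "0 < \<mu> - g x0 - nrm x0 \<bullet> p" if "x0 \<in> bd" using bdr[OF that] unfolding p_def .
  qed (use \<epsilon> in simp_all)
qed

end

section \<open>The viscosity property\<close>

lemma set_integral_point:
  assumes "AE r in N. r \<noteq> a"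
  shows "(LINT r:{a..a::real}|N. f r) = (0 :: 'b::euclidean_space)"
  unfolding set_lebesgue_integral_def
  by (rule integral_eq_zero_AE) (use assms in eventually_elim, simp)

lemma continuous_on_norm_le:
  fixes f :: "'b::real_normed_vector \<Rightarrow> 'c::real_normed_vector"
  assumes le: "\<And>x y. x \<in> S \<Longrightarrow> y \<in> S \<Longrightarrow> norm (f x - f y) \<le> C * norm (x - y)"
  shows "continuous_on S f"
proof (rule lipschitz_on_continuous_on[OF lipschitz_onI])
  show "dist (f x) (f y) \<le> \<bar>C\<bar> * dist x y" if "x \<in> S" "y \<in> S" for x y
    using order_trans[OF le[OF that] mult_right_mono[OF abs_ge_self norm_ge_zero]] by (simp add: dist_norm)
qed simp

lemma vector_matrix_mult_uminus: "(- x) v* (A :: real^'d^'d::finite) = - (x v* A)"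
  by (simp add: vec_eq_iff vector_matrix_mult_def sum_negf)

text \<open>The inner sign in \<open>- \<psi> x (- z)\<close> undoes the one that the gradient
  acquires, and the outer sign makes the whole expression odd in the test function and the
  data.\<close>

lemma pde_interior_uminus:
  assumes f: "C_k 2 UNIV f"
  shows "pde_interior b \<sigma> (\<lambda>x z. - \<psi> x (- z)) (- lam) (\<lambda>y. - f y) x = - pde_interior b \<sigma> \<psi> lam f x"
  unfolding pde_interior_def generator_def C_k_2_uminus(2,3)[OF f] trace_generator vector_matrix_mult_uminus
  by (simp add: sum_negf)

section \<open>From the given equations to the setting of the barrier argument\<close>

context brownian
begin

text \<open>Elementary integrals vanish at time 0, so the distance at time 0 is a constant sequence
  that tends to zero.\<close>

lemma ito_limit_zero:
  assumes "ito_limit N H" shows "AE \<omega> in M. N 0 \<omega> = 0"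
proof -
  obtain S J E where 1: "\<And>k. elementary (S k) (J k) (E k)"
    "\<And>T. 0 \<le> T \<Longrightarrow> L2_lim (lborel \<Otimes>\<^sub>M M) (\<lambda>k. time_cut T (E k)) (time_cut T H)"
    "\<And>T. 0 \<le> T \<Longrightarrow> L2_lim M (\<lambda>k. J k T) (N T)" by (rule ito_limitE[OF assms]) (rule that)
  note lim = 1(3)[OF order_refl]
  have "(\<integral>\<^sup>+ \<omega>. ennreal ((norm (J k 0 \<omega> - N 0 \<omega>))^2) \<partial>M) = (\<integral>\<^sup>+ \<omega>. ennreal ((N 0 \<omega>)^2) \<partial>M)" for k
    by (rule nn_integral_cong) (simp add: elementary_zero[OF 1(1)])
  then have "(\<integral>\<^sup>+ \<omega>. ennreal ((N 0 \<omega>)^2) \<partial>M) = 0"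
    using L2_limD(4)[OF lim] by (simp add: LIMSEQ_const_iff)
  then show ?thesis
    using L2_limD(2)[OF lim] by (simp add: nn_integral_0_iff_AE)
qed

text \<open>At time 0 the integrals run over a single point, which neither Lebesgue measure nor the
  continuous \<open>K\<close> charges; this gives the initial values. Subtracting the equations at
  \<open>s\<close> and \<open>t\<close> gives the increments.\<close>

lemma reflected_path_increments:
  assumes bn: "continuous_on D b" "continuous_on D nrm" and J: "\<And>i. ito_limit (J i) (H i)"
    and path: "AE \<omega> in M. continuous_on {0..} (\<lambda>t. X t \<omega>) \<and> continuous_on {0..} (\<lambda>t. K t \<omega>) \<and> mono_on {0..} (\<lambda>t. K t \<omega>) \<and>
        (\<forall>t\<ge>0. X t \<omega> \<in> D \<and> 0 \<le> K t \<omega> \<and>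
           X t \<omega> = x0 + (LINT s:{0..t}|lborel. b (X s \<omega>)) + (\<chi> i. J i t \<omega>)
             + (LINT s:{0..t}|stieltjes (\<lambda>r. K r \<omega>). nrm (X s \<omega>)) \<and>
           K t \<omega> = (LINT s:{0..t}|stieltjes (\<lambda>r. K r \<omega>). indicator bd (X s \<omega>)))"
  shows "AE \<omega> in M. continuous_on {0..} (\<lambda>t. X t \<omega>) \<and> X 0 \<omega> = x0 \<and> (\<forall>t\<ge>0. X t \<omega> \<in> D)"
    and "AE \<omega> in M. continuous_on {0..} (\<lambda>t. K t \<omega>) \<and> mono_on {0..} (\<lambda>t. K t \<omega>) \<and> K 0 \<omega> = 0 \<and>
        (\<forall>t\<ge>0. K t \<omega> = (LINT s:{0..t}|stieltjes (\<lambda>r. K r \<omega>). indicator bd (X s \<omega>)))"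
    and "AE \<omega> in M. \<forall>s t. 0 \<le> s \<longrightarrow> s \<le> t \<longrightarrow> X t \<omega> - X s \<omega> = (LINT r:{s..t}|lborel. b (X r \<omega>))
        + (\<chi> i. J i t \<omega> - J i s \<omega>) + (LINT r:{s..t}|stieltjes (\<lambda>r. K r \<omega>). nrm (X r \<omega>))"
proof -
  have J0: "AE \<omega> in M. \<forall>i. J i 0 \<omega> = 0"
    unfolding AE_all_countable using ito_limit_zero[OF J] by blast
  have all: "AE \<omega> in M. (X 0 \<omega> = x0 \<and> K 0 \<omega> = 0) \<and> (\<forall>s t. 0 \<le> s \<longrightarrow> s \<le> t \<longrightarrow> X t \<omega> - X s \<omega> = (LINT r:{s..t}|lborel. b (X r \<omega>))
        + (\<chi> i. J i t \<omega> - J i s \<omega>) + (LINT r:{s..t}|stieltjes (\<lambda>r. K r \<omega>). nrm (X r \<omega>)))"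
    using path J0
  proof eventually_elim
    fix \<omega>
    assume p: "continuous_on {0..} (\<lambda>t. X t \<omega>) \<and> continuous_on {0..} (\<lambda>t. K t \<omega>) \<and> mono_on {0..} (\<lambda>t. K t \<omega>) \<and>
        (\<forall>t\<ge>0. X t \<omega> \<in> D \<and> 0 \<le> K t \<omega> \<and>
           X t \<omega> = x0 + (LINT s:{0..t}|lborel. b (X s \<omega>)) + (\<chi> i. J i t \<omega>)
             + (LINT s:{0..t}|stieltjes (\<lambda>r. K r \<omega>). nrm (X s \<omega>)) \<and>
           K t \<omega> = (LINT s:{0..t}|stieltjes (\<lambda>r. K r \<omega>). indicator bd (X s \<omega>)))"
      and J0: "\<forall>i. J i 0 \<omega> = 0"
    interpret stieltjes_path "\<lambda>t. K t \<omega>" using p by unfold_locales auto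
    have XD: "X t \<omega> \<in> D" if "0 \<le> t" for t using p that by blast
    have X: "X t \<omega> = x0 + (LINT s:{0..t}|lborel. b (X s \<omega>)) + (\<chi> i. J i t \<omega>)
             + (LINT s:{0..t}|stieltjes (\<lambda>r. K r \<omega>). nrm (X s \<omega>))" if "0 \<le> t" for t using p that by blast
    have K: "K t \<omega> = (LINT s:{0..t}|stieltjes (\<lambda>r. K r \<omega>). indicator bd (X s \<omega>))" if "0 \<le> t" for t using p that by blast
    have Xc: "continuous_on {0..} (\<lambda>t. X t \<omega>)" using p by blast
    have bX: "continuous_on {0..} (\<lambda>s. b (X s \<omega>))" "continuous_on {0..} (\<lambda>s. nrm (X s \<omega>))"
      by (rule continuous_on_compose2[OF bn(1) Xc]; use XD in auto)
         (rule continuous_on_compose2[OF bn(2) Xc]; use XD in auto)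
    have "X 0 \<omega> = x0"
      using X[OF order_refl] set_integral_point[OF AE_K[OF order_refl], of "\<lambda>s. nrm (X s \<omega>)"]
        set_integral_point[OF AE_lborel_singleton, of 0 "\<lambda>s. b (X s \<omega>)"] J0
      by (simp add: vec_eq_iff)
    moreover have "K 0 \<omega> = 0"
      using K[OF order_refl] set_integral_point[OF AE_K[OF order_refl], of "\<lambda>s. indicat_real bd (X s \<omega>)"] by simp
    moreover have "X t \<omega> - X s \<omega> = (LINT r:{s..t}|lborel. b (X r \<omega>))
        + (\<chi> i. J i t \<omega> - J i s \<omega>) + (LINT r:{s..t}|stieltjes (\<lambda>r. K r \<omega>). nrm (X r \<omega>))" if st: "0 \<le> s" "s \<le> t" for s t
    proof -
      have "set_integrable lborel {0..t} (\<lambda>s. b (X s \<omega>))"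
        by (rule set_integrable_continuous[OF bX(1)]) simp
      then have "(LINT r:{0..t}|lborel. b (X r \<omega>)) = (LINT r:{0..s}|lborel. b (X r \<omega>)) + (LINT r:{s..t}|lborel. b (X r \<omega>))"
        by (rule set_integral_Icc_split[OF AE_lborel_singleton]) (use st in auto)
      moreover have "(\<chi> i. J i t \<omega>) = (\<chi> i. J i s \<omega>) + (\<chi> i. J i t \<omega> - J i s \<omega>)" by (simp add: vec_eq_iff)
      moreover have "0 \<le> t" using st by simp
      ultimately show ?thesis
        using X[OF st(1)] X[of t] integral_K_split[OF bX(2) order_refl st] by simp
    qed
    ultimately show "(X 0 \<omega> = x0 \<and> K 0 \<omega> = 0) \<and> (\<forall>s t. 0 \<le> s \<longrightarrow> s \<le> t \<longrightarrow> X t \<omega> - X s \<omega> = (LINT r:{s..t}|lborel. b (X r \<omega>))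
        + (\<chi> i. J i t \<omega> - J i s \<omega>) + (LINT r:{s..t}|stieltjes (\<lambda>r. K r \<omega>). nrm (X r \<omega>)))" by blast
  qed
  show "AE \<omega> in M. continuous_on {0..} (\<lambda>t. X t \<omega>) \<and> X 0 \<omega> = x0 \<and> (\<forall>t\<ge>0. X t \<omega> \<in> D)"
    using path all by eventually_elim blast
  show "AE \<omega> in M. continuous_on {0..} (\<lambda>t. K t \<omega>) \<and> mono_on {0..} (\<lambda>t. K t \<omega>) \<and> K 0 \<omega> = 0 \<and>
        (\<forall>t\<ge>0. K t \<omega> = (LINT s:{0..t}|stieltjes (\<lambda>r. K r \<omega>). indicator bd (X s \<omega>)))"
    using path all by eventually_elim blast
  show "AE \<omega> in M. \<forall>s t. 0 \<le> s \<longrightarrow> s \<le> t \<longrightarrow> X t \<omega> - X s \<omega> = (LINT r:{s..t}|lborel. b (X r \<omega>))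
        + (\<chi> i. J i t \<omega> - J i s \<omega>) + (LINT r:{s..t}|stieltjes (\<lambda>r. K r \<omega>). nrm (X r \<omega>))"
    using all by eventually_elim blast
qed

lemma subsolution_test:
  assumes G: "bounded G" "x0 \<in> closure G"
    and cont: "continuous_on (closure G) b" "continuous_on (closure G) (grad \<phi>)" "continuous_on (closure G) \<sigma>"
      "continuous_on (closure G) g" "continuous_on (closure G) v"
    and \<psi>: "\<forall>x\<in>closure G. \<forall>x'\<in>closure G. \<forall>z z'. \<bar>\<psi> x z - \<psi> x' z'\<bar> \<le> L' * norm (x - x') + L * norm (z - z')"
    and \<zeta>: "\<zeta> \<in> borel_measurable borel"
    and sde: "reflected_sde_solution M F W b \<sigma> \<phi> G x0 X K"
    and I: "ito_limit I (\<lambda>s \<omega>. \<zeta> (X s \<omega>))"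
    and eq: "AE \<omega> in M. \<forall>t T. 0 \<le> t \<and> t \<le> T \<longrightarrow> v (X t \<omega>) = v (X T \<omega>)
        + (LINT s:{t..T}|lborel. \<psi> (X s \<omega>) (\<zeta> (X s \<omega>)) - lam)
        + (LINT s:{t..T}|stieltjes (\<lambda>r. K r \<omega>). g (X s \<omega>) - \<mu>) - (I T \<omega> - I t \<omega>)"
    and f: "C_k 2 UNIV f" "local_max_on (closure G) (\<lambda>y. v y - f y) x0"
    and int: "0 < pde_interior b \<sigma> \<psi> lam f x0" and bdr: "x0 \<in> frontier G \<Longrightarrow> 0 < pde_boundary \<phi> g \<mu> f x0"
  shows False
proof -
  obtain J where J: "\<forall>i. ito_integral M F W (\<lambda>s \<omega>. row i (\<sigma> (X s \<omega>))) (J i)"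
    and path: "AE \<omega> in M. continuous_on {0..} (\<lambda>t. X t \<omega>) \<and> continuous_on {0..} (\<lambda>t. K t \<omega>) \<and> mono_on {0..} (\<lambda>t. K t \<omega>) \<and>
        (\<forall>t\<ge>0. X t \<omega> \<in> closure G \<and> 0 \<le> K t \<omega> \<and>
           X t \<omega> = x0 + (LINT s:{0..t}|lborel. b (X s \<omega>)) + (\<chi> i. J i t \<omega>)
             + (LINT s:{0..t}|stieltjes (\<lambda>r. K r \<omega>). grad \<phi> (X s \<omega>)) \<and>
           K t \<omega> = (LINT s:{0..t}|stieltjes (\<lambda>r. K r \<omega>). indicator (frontier G) (X s \<omega>)))"
    using sde unfolding reflected_sde_solution_def by (elim conjE exE)
  have J_lim: "ito_limit (J i) (\<lambda>s \<omega>. row i (\<sigma> (X s \<omega>)))" for i using J by (intro ito_limit_ito_integral) blast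
  note inc = reflected_path_increments[OF cont(1,2) J_lim path]
  \<comment> \<open>\<open>v\<close> is controlled only on the closed domain; its extension by zero
    is Borel on the whole space and agrees with \<open>v\<close> along the paths.\<close>
  define v' where "v' x = indicator (closure G) x *\<^sub>R v x" for x
  have v': "v' x = v x" if "x \<in> closure G" for x using that by (simp add: v'_def)
  interpret R: reflected_bsde M W "closure G" "frontier G" b "grad \<phi>" \<sigma> \<psi> g v' lam \<mu> L \<zeta> x0 X K I J
  proof unfold_locales
    show "compact (closure G)" using G(1) by (simp add: compact_closure)
    show "continuous_on (closure G) v'" using cont(5) v' by (simp cong: continuous_on_cong)
    show "v' \<in> borel_measurable borel"
      unfolding v'_def by (rule borel_measurable_continuous_on_indicator[OF _ cont(5)]) simp
    show "\<bar>\<psi> x z - \<psi> x z'\<bar> \<le> L * norm (z - z')" if "x \<in> closure G" for x z z'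
      using \<psi>[rule_format, OF that that, of z z'] by simp
    show "continuous_on (closure G \<times> UNIV) (\<lambda>(x, z). \<psi> x z)"
    proof (rule continuous_on_norm_le)
      fix p q assume pq: "p \<in> closure G \<times> (UNIV :: (real^'d) set)" "q \<in> closure G \<times> (UNIV :: (real^'d) set)"
      have "\<bar>\<psi> (fst p) (snd p) - \<psi> (fst q) (snd q)\<bar> \<le> L' * norm (fst p - fst q) + L * norm (snd p - snd q)"
        using \<psi> pq by auto
      also have "\<dots> \<le> \<bar>L'\<bar> * norm (p - q) + \<bar>L\<bar> * norm (p - q)"
        using norm_fst_le[of "fst p - fst q" "snd p - snd q"] norm_snd_le[of "snd p - snd q" "fst p - fst q"]
        by (intro add_mono mult_mono) (auto simp: minus_prod_def)
      finally show "norm ((\<lambda>(x, z). \<psi> x z) p - (\<lambda>(x, z). \<psi> x z) q) \<le> (\<bar>L'\<bar> + \<bar>L\<bar>) * norm (p - q)"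
        by (simp add: case_prod_beta' distrib_right)
    qed
    show "X t \<in> borel_measurable (F t)" "K t \<in> borel_measurable (F t)" if "0 \<le> t" for t
      using sde that unfolding reflected_sde_solution_def adapted_def by blast+
    show "AE \<omega> in M. \<forall>s t. 0 \<le> s \<longrightarrow> s \<le> t \<longrightarrow> v' (X t \<omega>) - v' (X s \<omega>)
        = - (LINT r:{s..t}|lborel. \<psi> (X r \<omega>) (\<zeta> (X r \<omega>)) - lam)
          - (LINT r:{s..t}|stieltjes (\<lambda>r. K r \<omega>). g (X r \<omega>) - \<mu>) + (I t \<omega> - I s \<omega>)"
      using eq inc(1)
    proof eventually_elim
      case (elim \<omega>)
      have XD: "X t \<omega> \<in> closure G" if "0 \<le> t" for t using elim(2) that by blast
      show ?case
      proof (intro allI impI)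
        fix s t :: real assume st: "0 \<le> s" "s \<le> t"
        show "v' (X t \<omega>) - v' (X s \<omega>) = - (LINT r:{s..t}|lborel. \<psi> (X r \<omega>) (\<zeta> (X r \<omega>)) - lam)
          - (LINT r:{s..t}|stieltjes (\<lambda>r. K r \<omega>). g (X r \<omega>) - \<mu>) + (I t \<omega> - I s \<omega>)"
          using elim(1)[rule_format, of s t] st v'[OF XD[of s]] v'[OF XD[of t]] by simp
      qed
    qed
  qed (use G cont \<zeta> I J_lim inc in simp_all)
  show False
  proof (rule R.test_function[OF f(1) _ int])
    show "local_max_on (closure G) (\<lambda>y. v' y - f y) x0"
      using f(2) v' unfolding local_max_on_def by auto
    show "0 < \<mu> - g x0 - grad \<phi> x0 \<bullet> grad f x0" if "x0 \<in> frontier G"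
      using bdr[OF that] unfolding pde_boundary_def normal_deriv_def by simp
  qed
qed

text \<open>The forward equation is left as it is. Replacing \<open>v\<close>,
  \<open>\<zeta>\<close>, \<open>I\<close>, \<open>g\<close>, \<open>lam\<close> and
  \<open>\<mu>\<close> by their negatives and \<open>\<psi> x z\<close> by
  \<open>- \<psi> x (- z)\<close> preserves the backward equation and the Lipschitz constants, and
  turns a minimum of \<open>v - f\<close> into a maximum of \<open>- v - (- f)\<close>.\<close>

lemma supersolution_test:
  assumes G: "bounded G" "x0 \<in> closure G"
    and cont: "continuous_on (closure G) b" "continuous_on (closure G) (grad \<phi>)" "continuous_on (closure G) \<sigma>"
      "continuous_on (closure G) g" "continuous_on (closure G) v"
    and \<psi>: "\<forall>x\<in>closure G. \<forall>x'\<in>closure G. \<forall>z z'. \<bar>\<psi> x z - \<psi> x' z'\<bar> \<le> L' * norm (x - x') + L * norm (z - z')"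
    and \<zeta>: "\<zeta> \<in> borel_measurable borel"
    and sde: "reflected_sde_solution M F W b \<sigma> \<phi> G x0 X K"
    and I: "ito_limit I (\<lambda>s \<omega>. \<zeta> (X s \<omega>))"
    and eq: "AE \<omega> in M. \<forall>t T. 0 \<le> t \<and> t \<le> T \<longrightarrow> v (X t \<omega>) = v (X T \<omega>)
        + (LINT s:{t..T}|lborel. \<psi> (X s \<omega>) (\<zeta> (X s \<omega>)) - lam)
        + (LINT s:{t..T}|stieltjes (\<lambda>r. K r \<omega>). g (X s \<omega>) - \<mu>) - (I T \<omega> - I t \<omega>)"
    and f: "C_k 2 UNIV f" "local_min_on (closure G) (\<lambda>y. v y - f y) x0"
    and int: "pde_interior b \<sigma> \<psi> lam f x0 < 0" and bdr: "x0 \<in> frontier G \<Longrightarrow> pde_boundary \<phi> g \<mu> f x0 < 0"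
  shows False
proof (rule subsolution_test[OF G cont(1-3) _ _ _ _ sde])
  show "continuous_on (closure G) (\<lambda>x. - g x)" "continuous_on (closure G) (\<lambda>x. - v x)"
    by (intro continuous_on_minus cont(4,5))+
  show "\<forall>x\<in>closure G. \<forall>x'\<in>closure G. \<forall>z z'. \<bar>- \<psi> x (- z) - - \<psi> x' (- z')\<bar> \<le> L' * norm (x - x') + L * norm (z - z')"
  proof (intro ballI allI)
    fix x x' z z' assume "x \<in> closure G" "x' \<in> closure G"
    then have "\<bar>\<psi> x (- z) - \<psi> x' (- z')\<bar> \<le> L' * norm (x - x') + L * norm (- z - - z')" using \<psi> by blast
    moreover have e: "norm (- z - - z') = norm (z - z')" by (simp add: norm_minus_commute)
    ultimately show "\<bar>- \<psi> x (- z) - - \<psi> x' (- z')\<bar> \<le> L' * norm (x - x') + L * norm (z - z')" unfolding e by linarith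
  qed
  show "(\<lambda>x. - \<zeta> x) \<in> borel_measurable borel" using \<zeta> by measurable
  show "ito_limit (\<lambda>t \<omega>. - I t \<omega>) (\<lambda>s \<omega>. - \<zeta> (X s \<omega>))" using ito_limit_scale[OF I, of "- 1"] by simp
  show "AE \<omega> in M. \<forall>t T. 0 \<le> t \<and> t \<le> T \<longrightarrow> - v (X t \<omega>) = - v (X T \<omega>)
        + (LINT s:{t..T}|lborel. - \<psi> (X s \<omega>) (- (- \<zeta> (X s \<omega>))) - - lam)
        + (LINT s:{t..T}|stieltjes (\<lambda>r. K r \<omega>). - g (X s \<omega>) - - \<mu>) - (- I T \<omega> - - I t \<omega>)"
    using eq
  proof eventually_elim
    case (elim \<omega>)
    have neg: "(LINT s:A|N. - h s - - c) = - (LINT s:A|N. h s - c)" for A :: "real set" and N and h :: "real \<Rightarrow> real" and c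
      unfolding set_lebesgue_integral_def Bochner_Integration.integral_minus[symmetric]
      by (rule Bochner_Integration.integral_cong[OF refl]) (auto simp: algebra_simps)
    show ?case
    proof (intro allI impI)
      fix t T :: real assume "0 \<le> t \<and> t \<le> T"
      from elim[rule_format, OF this]
      show "- v (X t \<omega>) = - v (X T \<omega>) + (LINT s:{t..T}|lborel. - \<psi> (X s \<omega>) (- (- \<zeta> (X s \<omega>))) - - lam)
        + (LINT s:{t..T}|stieltjes (\<lambda>r. K r \<omega>). - g (X s \<omega>) - - \<mu>) - (- I T \<omega> - - I t \<omega>)"
        unfolding neg minus_minus by simp
    qed
  qed
  show "C_k 2 UNIV (\<lambda>x. - f x)" by (rule C_k_2_uminus(1)[OF f(1)])
  show "local_max_on (closure G) (\<lambda>y. - v y - - f y) x0"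
  proof -
    have "- v y - - f y \<le> - v x0 - - f x0 \<longleftrightarrow> v x0 - f x0 \<le> v y - f y" for y by linarith
    then show ?thesis using f(2) unfolding local_max_on_def local_min_on_def by simp
  qed
  show "0 < pde_interior b \<sigma> (\<lambda>x z. - \<psi> x (- z)) (- lam) (\<lambda>x. - f x) x0"
    using int unfolding pde_interior_uminus[OF f(1)] by simp
  show "0 < pde_boundary \<phi> (\<lambda>x. - g x) (- \<mu>) (\<lambda>x. - f x) x0" if "x0 \<in> frontier G"
    using bdr[OF that] unfolding pde_boundary_def normal_deriv_def C_k_2_uminus(2)[OF f(1)] by simp
qed

end

theorem theorem5p1:
  fixes M :: "'a measure"
    and W :: "real \<Rightarrow> 'a \<Rightarrow> real^'d::finite"
    and \<phi> :: "real^'d \<Rightarrow> real" and G :: "(real^'d) set"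
    and b :: "real^'d \<Rightarrow> real^'d" and \<sigma> :: "real^'d \<Rightarrow> real^'d^'d"
    and \<psi> :: "real^'d \<Rightarrow> real^'d \<Rightarrow> real" and g :: "real^'d \<Rightarrow> real"
    and X :: "real^'d \<Rightarrow> real \<Rightarrow> 'a \<Rightarrow> real^'d" and K :: "real^'d \<Rightarrow> real \<Rightarrow> 'a \<Rightarrow> real"
    and K\<^sub>b K\<^sub>\<sigma> K\<^sub>\<psi>\<^sub>x K\<^sub>\<psi>\<^sub>z lam \<mu> :: real
    and v :: "real^'d \<Rightarrow> real" and \<zeta> :: "real^'d \<Rightarrow> real^'d"
  defines "F \<equiv> augmented_filtration M W"
  assumes "prob_space M" and "brownian_motion M W"
    and "C_k_bounded 2 UNIV \<phi>" and "C_k_lip 2 UNIV \<phi>"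
    and "G = {x. \<phi> x > 0}" and "frontier G = {x. \<phi> x = 0}"
    and "\<forall>x\<in>frontier G. norm (grad \<phi> x) = 1"
    and "bounded G" and "convex G"
    and "\<forall>x y. norm (b x - b y) \<le> K\<^sub>b * norm (x - y)"
    and "\<forall>x y. norm (\<sigma> x - \<sigma> y) \<le> K\<^sub>\<sigma> * norm (x - y)"
    and "\<forall>x\<in>closure G. \<forall>x'\<in>closure G. \<forall>z z'.
           \<bar>\<psi> x z - \<psi> x' z'\<bar> \<le> K\<^sub>\<psi>\<^sub>x * norm (x - x') + K\<^sub>\<psi>\<^sub>z * norm (z - z')"
    and "dissipativity (closure G) b \<sigma> + K\<^sub>\<psi>\<^sub>z * K\<^sub>\<sigma> < 0"
    and "C_k_lip 2 (closure G) g"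
    and "\<forall>x\<in>closure G. reflected_sde_solution M F W b \<sigma> \<phi> G x (X x) (K x)"
    and "ebsde_solution M F W (closure G) X K \<psi> g lam \<mu> v \<zeta>
       \<or> (\<exists>C. \<forall>x\<in>closure G. \<forall>z. \<bar>\<psi> x z\<bar> \<le> C) \<and>
         (\<exists>\<nu>. invariant_measure M (closure G) X \<nu> \<and> (LINT x|\<nu>. generator b \<sigma> \<phi> x) < 0) \<and>
         ebsde_solution M F W (closure G) X K \<psi> g lam \<mu> v \<zeta>"
  shows "viscosity_solution G \<phi> b \<sigma> \<psi> g lam \<mu> v"
proof -
  interpret prob_space M by fact
  interpret brownian M W by unfold_locales fact
  have \<phi>: "C_k 2 UNIV \<phi>" using assms(4) by (simp add: C_k_bounded_def)
  \<comment> \<open>Openness separates \<open>G\<close> from its boundary, so that the boundary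
    premise of the test lemmas is vacuous at points of \<open>G\<close>.\<close>
  have "open G"
    unfolding assms(6) using \<phi> by (intro open_Collect_less continuous_on_const) (simp add: C_k_def)
  then have disj: "x \<notin> frontier G" if "x \<in> G" for x
    using that by (simp add: frontier_def interior_open)
  \<comment> \<open>The first partial derivatives are themselves differentiable, hence
    continuous.\<close>
  have "continuous_on UNIV (partial i \<phi>)" for i
    by (intro continuous_at_imp_continuous_on ballI differentiable_imp_continuous_within C_k_2_D(2)[OF \<phi>])
  then have "continuous_on UNIV (grad \<phi>)"
    unfolding grad_def by (intro continuous_on_vec_lambda)
  then have cont: "continuous_on (closure G) b" "continuous_on (closure G) (grad \<phi>)"
      "continuous_on (closure G) \<sigma>" "continuous_on (closure G) g"
    using assms(15)[unfolded C_k_lip_def C_k_def] continuous_on_subset[OF _ subset_UNIV]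
    by (blast intro: continuous_on_norm_le[of _ b "K\<^sub>b", OF assms(11)[rule_format]]
        continuous_on_norm_le[of _ \<sigma> "K\<^sub>\<sigma>", OF assms(12)[rule_format]])+
  have "ebsde_solution M F W (closure G) X K \<psi> g lam \<mu> v \<zeta>" using assms(17) by blast
  then obtain I L where L: "L-lipschitz_on (closure G) v" and \<zeta>: "\<zeta> \<in> borel_measurable borel"
    and I: "\<forall>x\<in>closure G. ito_integral M F W (\<lambda>t \<omega>. \<zeta> (X x t \<omega>)) (I x)"
    and eq: "AE \<omega> in M. \<forall>x\<in>closure G. \<forall>t T. 0 \<le> t \<and> t \<le> T \<longrightarrow>
           v (X x t \<omega>) = v (X x T \<omega>)
             + (LINT s:{t..T}|lborel. \<psi> (X x s \<omega>) (\<zeta> (X x s \<omega>)) - lam)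
             + (LINT s:{t..T}|stieltjes (\<lambda>r. K x r \<omega>). g (X x s \<omega>) - \<mu>)
             - (I x T \<omega> - I x t \<omega>)"
    unfolding ebsde_solution_def by (elim conjE exE)
  have v: "continuous_on (closure G) v" by (rule lipschitz_on_continuous_on[OF L])
  have I_lim: "ito_limit (I x) (\<lambda>t \<omega>. \<zeta> (X x t \<omega>))" if "x \<in> closure G" for x
    using I that unfolding F_def by (intro ito_limit_ito_integral) blast
  have sde: "reflected_sde_solution M (augmented_filtration M W) W b \<sigma> \<phi> G x (X x) (K x)" if "x \<in> closure G" for x
    using assms(16) that unfolding F_def by blast
  have eq': "AE \<omega> in M. \<forall>t T. 0 \<le> t \<and> t \<le> T \<longrightarrow> v (X x t \<omega>) = v (X x T \<omega>)
             + (LINT s:{t..T}|lborel. \<psi> (X x s \<omega>) (\<zeta> (X x s \<omega>)) - lam)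
             + (LINT s:{t..T}|stieltjes (\<lambda>r. K x r \<omega>). g (X x s \<omega>) - \<mu>)
             - (I x T \<omega> - I x t \<omega>)" if "x \<in> closure G" for x
    using eq by eventually_elim (use that in blast)
  have D: "x \<in> closure G" if "local_max_on (closure G) h x \<or> local_min_on (closure G) h x" for h x
    using that by (auto simp: local_max_on_def local_min_on_def)
  have "viscosity_subsolution G \<phi> b \<sigma> \<psi> g lam \<mu> v"
    unfolding viscosity_subsolution_def
  proof (intro conjI allI impI v)
    fix f x assume f: "C_k 2 UNIV f \<and> local_max_on (closure G) (\<lambda>y. v y - f y) x"
    then have x: "x \<in> closure G" using D by blast
    note test = subsolution_test[OF assms(9) x cont v assms(13) \<zeta> sde[OF x] I_lim[OF x] eq'[OF x] conjunct1[OF f] conjunct2[OF f]]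
    show "pde_interior b \<sigma> \<psi> lam f x \<le> 0" if "x \<in> G"
      by (rule ccontr, rule test) (use disj[OF that] in auto)
    \<comment> \<open>The negation makes the interior and the boundary expression strictly positive
      at once, as the barrier needs.\<close>
    show "min (pde_interior b \<sigma> \<psi> lam f x) (pde_boundary \<phi> g \<mu> f x) \<le> 0" if "x \<in> frontier G"
      by (rule ccontr, rule test) (auto simp: min_def not_le split: if_splits)
  qed
  moreover have "viscosity_supersolution G \<phi> b \<sigma> \<psi> g lam \<mu> v"
    unfolding viscosity_supersolution_def
  proof (intro conjI allI impI v)
    fix f x assume f: "C_k 2 UNIV f \<and> local_min_on (closure G) (\<lambda>y. v y - f y) x"
    then have x: "x \<in> closure G" using D by blast
    note test = supersolution_test[OF assms(9) x cont v assms(13) \<zeta> sde[OF x] I_lim[OF x] eq'[OF x] conjunct1[OF f] conjunct2[OF f]]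
    show "0 \<le> pde_interior b \<sigma> \<psi> lam f x" if "x \<in> G"
      by (rule ccontr, rule test) (use disj[OF that] in auto)
    show "0 \<le> max (pde_interior b \<sigma> \<psi> lam f x) (pde_boundary \<phi> g \<mu> f x)" if "x \<in> frontier G"
      by (rule ccontr, rule test) (auto simp: max_def not_le split: if_splits)
  qed
  ultimately show ?thesis by (simp add: viscosity_solution_def)
qed

end
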